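(* Let $(M^{2m+1},H(M),J)$, $m\ge 1$, be a strictly pseudoconvex CR manifold, let $\ell\in\{-m,-m+2,\dots,m-2,m\}$, let $\theta$ be an adapted pseudo-Hermitian structure with a ${\rm spin}^{\mathbb C}$ structure of weight $\ell$, and let $\tilde\theta=e^{2f}\theta$ with $f\in C^\infty(M)$, equipped with the corresponding ${\rm spin}^{\mathbb C}$ structure of weight $\ell$. Denote by $\phi\mapsto\tilde\phi$ the natural unitary isomorphism $\Sigma(H(M))\cong\widetilde\Sigma(H(M))$ of the spinor bundles of $\theta$ and $\tilde\theta$, extended as ${\rm id}\otimes\widetilde{\ }$ to $H(M)^*\otimes\Sigma(H(M))$. Let $\mathcal P_\ell$ and $\widetilde{\mathcal P}_\ell$ be the twistor operators on spinors of $\Theta$-eigenvalue $\mu_q=\ell$ with respect to $\theta$ and $\tilde\theta$. Then for every $\phi\in\Gamma(\Sigma^{\ell}(H(M)))$ $$\widetilde{\mathcal P}_\ell\big(e^{f}\tilde\phi\big)=e^{f}\,\widetilde{\mathcal P_\ell\phi}.$$ That is, the twistor operator $\mathcal P_\ell$ is CR-covariant.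
   Context: CR and pseudo-Hermitian setting. $M$ is a connected orientable smooth manifold of dimension $2m+1$; $H(M)\subset TM$ is a corank-1 subbundle, $J$ a bundle endomorphism of $H(M)$ with $J^2=-1$. With $\{X,Y\}=-[X,Y]\bmod H(M)$, $(H(M),J)$ is strictly pseudoconvex if $\{JX,Y\}+\{X,JY\}=0$, $\{X,JX\}\ne0$ for $X\neq 0$, and the Nijenhuis tensor $[X,Y]-[JX,JY]+J([JX,Y]+[X,JY])$ vanishes on $H(M)$. $H(M)\otimes\mathbb C=T_{10}\oplus T_{01}$ are the $\pm i$-eigenbundles of $J$. For $X\in H(M)$, $X_{10}=\frac12(X-iJX)$ and $X_{01}=\frac12(X+iJX)$. An adapted pseudo-Hermitian structure is a 1-form $\theta$ with kernel $H(M)$ such that $g_\theta(X,Y)=\frac12 d\theta(X,JY)$ is positive definite on $H(M)$; its Reeb field $T$ satisfies $\theta(T)=1$, $\iota_Td\theta=0$. The Webster--Tanaka connection $\nabla^{W}$ is the connection on $TM$ for which $T$, $g_\theta$ and $J$ are parallel, with torsion ${\rm Tor}(X,Y)=d\theta(X,Y)T$ and ${\rm Tor}(T,X)=-\frac12([T,X]+J[T,JX])$ for $X,Y\in H(M)$. ${\rm Spin}^{\mathbb C}$ structures. $\mathcal K=\Lambda^{m+1,0}(M)$ is the canonical line bundle ($(p,0)$-forms are complex $p$-forms $\eta$ with $\iota_Z\eta=0$ for $Z\in T_{01}$). Fix a complex line bundle $\mathcal E(1)$ with $\mathcal E(1)^{m+2}=\mathcal K^{-1}$ and let $\mathcal E(p)=\mathcal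 E(1)^p$. A ${\rm spin}^{\mathbb C}$ structure for $\theta$ is a reduction $P\to {\rm SO}(H(M))$ of the $g_\theta$-orthonormal frame bundle of $H(M)$ to ${\rm Spin}^{\mathbb C}(2m)$; it has weight $\ell$ if its determinant line bundle is $L=\mathcal E(\ell)$. $\nabla^W$ induces connections on $\mathcal K$, $\mathcal E(p)$ and $L$; together with $\nabla^W$ on $H(M)$ this lifts to $P$ and gives the Webster--Tanaka spinor derivative $\nabla^\Sigma$ on the associated spinor bundle $\Sigma(H(M))$ (rank $2^m$), extended $\mathbb C$-linearly to derivatives in directions of $H(M)\otimes\mathbb C$. Clifford multiplication satisfies $X\cdot X\cdot\phi=-g_\theta(X,X)\phi$, $X\in H(M)$, and is extended $\mathbb C$-linearly. The element $\Theta=\frac{i}{2}d\theta=i\sum_{\alpha=1}^m e_\alpha\cdot Je_\alpha$ (for any orthonormal frame $e_1,Je_1,\dots,e_m,Je_m$ of $H(M)$) of the complex Clifford bundle acts on $\Sigma(H(M))$ with eigenvalues $\mu_q=m-2q$, $q=0,\dots,m$; $\Sigma^{\mu_q}(H(M))$ denotes the eigenbundle. With $E_\alpha=(e_\alpha)_{10}$ put $D_-\phi=2\sum_\alpha \overline{E_\alpha}\cdot\nabla^\Sigma_{E_\alpha}\phi$ and $D_+\phi=2\sum_\alpha E_\alpha\cdot\nabla^\Sigma_{\overline{E_\alpha}}\phi$. Twistor operator. For $\mu_q=\ell$ (i.e. $q=\frac{m-\ell}2$) set $a_q=\frac1{2(q+1)}$, $b_q=\frac1{2(m-q+1)}$.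 For $\phi\in\Gamma(\Sigma^{\ell})$, $\mathcal P_\ell\phi\in\Gamma(H(M)^*\otimes\Sigma(H(M)))$ is given by $$(\mathcal P_\ell\phi)(X)=\nabla^\Sigma_X\phi+a_q\,X_{01}\cdot D_+\phi+b_q\,X_{10}\cdot D_-\phi,\qquad X\in H(M).$$ $\widetilde{\mathcal P}_\ell$ is the same expression formed with all objects (connection, Clifford multiplication, $D_\pm$) of $\tilde\theta$. Conformal change. For $\tilde\theta=e^{2f}\theta$, orthonormal frames $(s_i)$ for $g_\theta$ are identified with the orthonormal frames $(e^{-f}s_i)$ for $g_{\tilde\theta}$; the ${\rm U}(1)$-frame bundles of $L$ for $\theta$ and $\tilde\theta$ are naturally identified by positive rescaling; the ${\rm spin}^{\mathbb C}$ structure of $\tilde\theta$ is the unique one whose spinor frames are identified with those of $\theta$. This induces the unitary isomorphism $\phi\mapsto\tilde\phi$, under which $X\cdot\phi$ is sent to $e^{-f}X\,\tilde\cdot\,\tilde\phi$ for $X\in H(M)$; it preserves the $\Theta$-eigenbundles. *)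

theory Defs
  imports "HOL-Analysis.Analysis"
begin

section \<open>Smooth manifolds\<close>

text \<open>\<^term>\<open>Ck_on k U f\<close> is meant for open \<^term>\<open>U\<close> in a finite-dimensional space, where
  being of class C^k means that all iterated directional derivatives up to order k exist and are
  continuous. A Lie group given as a set of matrices (or of complex numbers) is embedded, so that
  maps into it are smooth iff they are smooth as maps into the ambient vector space.\<close>

primrec Ck_on :: "nat \<Rightarrow> 'b::real_normed_vector set \<Rightarrow> ('b \<Rightarrow> 'c::real_normed_vector) \<Rightarrow> bool" where
  "Ck_on 0 U f \<longleftrightarrow> continuous_on U f"
| "Ck_on (Suc k) U f \<longleftrightarrow> f differentiable_on U \<and>
     (\<forall>v. Ck_on k U (\<lambda>x. frechet_derivative f (at x) v))"

definition Cinf_on :: "'b::real_normed_vector set \<Rightarrow> ('b \<Rightarrow> 'c::real_normed_vector) \<Rightarrow> bool" where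
  "Cinf_on U f \<longleftrightarrow> (\<forall>k. Ck_on k U f)"

type_synonym ('a, 'n) chart = "'a set \<times> ('a \<Rightarrow> real ^ 'n)"

definition smooth_atlas :: "('a::topological_space, 'n::finite) chart set \<Rightarrow> bool" where
  "smooth_atlas A \<longleftrightarrow>
     (\<Union>(U, \<psi>)\<in>A. U) = UNIV \<and>
     (\<forall>(U, \<psi>)\<in>A. open U \<and> open (\<psi> ` U) \<and> homeomorphism U (\<psi> ` U) \<psi> (inv_into U \<psi>)) \<and>
     (\<forall>(U, \<psi>)\<in>A. \<forall>(V, \<xi>)\<in>A. Cinf_on (\<psi> ` (U \<inter> V)) (\<xi> \<circ> inv_into U \<psi>))"

definition orientable :: "('a::topological_space, 'n::finite) chart set \<Rightarrow> bool" where
  "orientable A \<longleftrightarrow> (\<exists>B. smooth_atlas B \<and> smooth_atlas (A \<union> B) \<and>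
     (\<forall>(U, \<psi>)\<in>B. \<forall>(V, \<xi>)\<in>B. \<forall>x\<in>U \<inter> V.
        0 < det (matrix (frechet_derivative (\<xi> \<circ> inv_into U \<psi>) (at (\<psi> x))))))"

definition smooth_fun ::
  "('a::topological_space, 'n::finite) chart set \<Rightarrow> 'a set \<Rightarrow> ('a \<Rightarrow> 'c::real_normed_vector) \<Rightarrow> bool" where
  "smooth_fun A U f \<longleftrightarrow> open U \<and> (\<forall>(V, \<psi>)\<in>A. Cinf_on (\<psi> ` (U \<inter> V)) (f \<circ> inv_into V \<psi>))"

definition smooth_near ::
  "('a::topological_space, 'n::finite) chart set \<Rightarrow> 'a \<Rightarrow> ('a \<Rightarrow> 'c::real_normed_vector) \<Rightarrow> bool" where
  "smooth_near A x f \<longleftrightarrow> (\<exists>U. x \<in> U \<and> smooth_fun A U f)"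

text \<open>Tangent vectors at x are the derivations at x of the real functions that are smooth near x.
  Locality follows from the Leibniz rule, since locally constant functions need not be globally
  smooth here. The value 0 on all other functions is a convention making tangent vectors
  extensional.\<close>

type_synonym 'a tvec = "('a \<Rightarrow> real) \<Rightarrow> real"
type_synonym 'a vfield = "'a \<Rightarrow> 'a tvec"

definition tangent_space ::
  "('a::topological_space, 'n::finite) chart set \<Rightarrow> 'a \<Rightarrow> 'a tvec set" where
  "tangent_space A x = {v.
     (\<forall>h k a b. smooth_near A x h \<longrightarrow> smooth_near A x k \<longrightarrow>
        v (\<lambda>y. a * h y + b * k y) = a * v h + b * v k \<and>
        v (\<lambda>y. h y * k y) = h x * v k + k x * v h) \<and>
     (\<forall>h. \<not> smooth_near A x h \<longrightarrow> v h = 0)}"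

definition tv_sum :: "'i set \<Rightarrow> ('i \<Rightarrow> real) \<Rightarrow> ('i \<Rightarrow> 'a tvec) \<Rightarrow> 'a tvec" where
  "tv_sum I c e = (\<lambda>h. \<Sum>i\<in>I. c i * e i h)"

definition tv_lin :: "real \<Rightarrow> 'a tvec \<Rightarrow> real \<Rightarrow> 'a tvec \<Rightarrow> 'a tvec" where
  "tv_lin a u b w = (\<lambda>h. a * u h + b * w h)"

definition cder :: "'a tvec \<Rightarrow> ('a \<Rightarrow> complex) \<Rightarrow> complex" where
  "cder v h = Complex (v (\<lambda>y. Re (h y))) (v (\<lambda>y. Im (h y)))"

definition vder :: "'a tvec \<Rightarrow> ('a \<Rightarrow> complex ^ 's) \<Rightarrow> complex ^ 's" where
  "vder v h = (\<chi> i. cder v (\<lambda>y. h y $ i))"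

definition vf_on ::
  "('a::topological_space, 'n::finite) chart set \<Rightarrow> 'a set \<Rightarrow> 'a vfield \<Rightarrow> bool" where
  "vf_on A U X \<longleftrightarrow> open U \<and> (\<forall>x\<in>U. X x \<in> tangent_space A x) \<and>
     (\<forall>W (h :: 'a \<Rightarrow> real). W \<subseteq> U \<longrightarrow> smooth_fun A W h \<longrightarrow> smooth_fun A W (\<lambda>y. X y h))"

definition vf_near ::
  "('a::topological_space, 'n::finite) chart set \<Rightarrow> 'a \<Rightarrow> 'a vfield \<Rightarrow> bool" where
  "vf_near A x X \<longleftrightarrow> (\<exists>U. x \<in> U \<and> vf_on A U X)"

definition bracket ::
  "('a::topological_space, 'n::finite) chart set \<Rightarrow> 'a vfield \<Rightarrow> 'a vfield \<Rightarrow> 'a vfield" where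
  "bracket A X Y x = (\<lambda>h. if smooth_near A x h
      then X x (\<lambda>y. Y y h) - Y x (\<lambda>y. X y h) else 0)"

definition one_form ::
  "('a::topological_space, 'n::finite) chart set \<Rightarrow> ('a \<Rightarrow> 'a tvec \<Rightarrow> real) \<Rightarrow> bool" where
  "one_form A \<theta> \<longleftrightarrow>
     (\<forall>x. \<forall>u\<in>tangent_space A x. \<forall>w\<in>tangent_space A x. \<forall>a b.
        \<theta> x (tv_lin a u b w) = a * \<theta> x u + b * \<theta> x w) \<and>
     (\<forall>U X. vf_on A U X \<longrightarrow> smooth_fun A U (\<lambda>y. \<theta> y (X y)))"

text \<open>Pointwise values of the exterior derivative, with the convention
  d\<theta>(X,Y) = X\<theta>(Y) - Y\<theta>(X) - \<theta>([X,Y]) without a factor 1/2; by tensoriality the local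
  extensions X, Y of v, w do not matter.\<close>

definition ext_d ::
  "('a::topological_space, 'n::finite) chart set \<Rightarrow> ('a \<Rightarrow> 'a tvec \<Rightarrow> real) \<Rightarrow>
     'a \<Rightarrow> 'a tvec \<Rightarrow> 'a tvec \<Rightarrow> real" where
  "ext_d A \<theta> x v w = (THE c. \<forall>X Y. vf_near A x X \<longrightarrow> vf_near A x Y \<longrightarrow> X x = v \<longrightarrow> Y x = w \<longrightarrow>
      c = X x (\<lambda>y. \<theta> y (Y y)) - Y x (\<lambda>y. \<theta> y (X y)) - \<theta> x (bracket A X Y x))"


section \<open>Strictly pseudoconvex CR manifolds\<close>

text \<open>The manifold is the whole type \<^typ>\<open>'a\<close>; \<^term>\<open>crdim\<close> is m, \<^term>\<open>levi\<close> is H(M) and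
  \<^term>\<open>cplx\<close> is J.\<close>

record ('a, 'n) cr_structure =
  charts :: "('a, 'n) chart set"
  crdim :: nat
  levi :: "'a \<Rightarrow> 'a tvec set"
  cplx :: "'a \<Rightarrow> 'a tvec \<Rightarrow> 'a tvec"

definition hvf_on :: "('a::topological_space, 'n::finite) cr_structure \<Rightarrow> 'a set \<Rightarrow> 'a vfield \<Rightarrow> bool" where
  "hvf_on C U X \<longleftrightarrow> vf_on (charts C) U X \<and> (\<forall>x\<in>U. X x \<in> levi C x)"

definition hvf_near :: "('a::topological_space, 'n::finite) cr_structure \<Rightarrow> 'a \<Rightarrow> 'a vfield \<Rightarrow> bool" where
  "hvf_near C x X \<longleftrightarrow> (\<exists>U. x \<in> U \<and> hvf_on C U X)"

definition cplx_vf :: "('a, 'n) cr_structure \<Rightarrow> 'a vfield \<Rightarrow> 'a vfield" where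
  "cplx_vf C X = (\<lambda>y. cplx C y (X y))"

text \<open>As the manifold has dimension 2m+1, rank 2m is corank 1.\<close>

definition corank1_subbundle :: "('a::topological_space, 'n::finite) cr_structure \<Rightarrow> bool" where
  "corank1_subbundle C \<longleftrightarrow> CARD('n) = 2 * crdim C + 1 \<and>
     (\<forall>x. \<exists>U e. x \<in> U \<and> (\<forall>a<2 * crdim C. vf_on (charts C) U (e a)) \<and> open U \<and>
        (\<forall>y\<in>U. levi C y = {tv_sum {..<2 * crdim C} c (\<lambda>a. e a y) | c. True} \<and>
           (\<forall>c. tv_sum {..<2 * crdim C} c (\<lambda>a. e a y) = (\<lambda>_. 0) \<longrightarrow> (\<forall>a<2 * crdim C. c a = 0))))"

definition almost_complex :: "('a::topological_space, 'n::finite) cr_structure \<Rightarrow> bool" where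
  "almost_complex C \<longleftrightarrow>
     (\<forall>x. \<forall>v\<in>levi C x. cplx C x v \<in> levi C x \<and> cplx C x (cplx C x v) = tv_lin (-1) v 0 v) \<and>
     (\<forall>x. \<forall>v\<in>levi C x. \<forall>w\<in>levi C x. \<forall>a b.
        cplx C x (tv_lin a v b w) = tv_lin a (cplx C x v) b (cplx C x w)) \<and>
     (\<forall>U X. hvf_on C U X \<longrightarrow> hvf_on C U (cplx_vf C X))"

definition cr_manifold :: "('a::{t2_space, second_countable_topology}, 'n::finite) cr_structure \<Rightarrow> bool" where
  "cr_manifold C \<longleftrightarrow> smooth_atlas (charts C) \<and> orientable (charts C) \<and> connected (UNIV :: 'a set) \<and>
     corank1_subbundle C \<and> almost_complex C"

definition strictly_pseudoconvex_cr ::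
  "('a::{t2_space, second_countable_topology}, 'n::finite) cr_structure \<Rightarrow> bool" where
  "strictly_pseudoconvex_cr C \<longleftrightarrow> cr_manifold C \<and>
     (let J = cplx_vf C; br = bracket (charts C) in
      \<forall>U X Y. hvf_on C U X \<longrightarrow> hvf_on C U Y \<longrightarrow> (\<forall>x\<in>U.
        tv_lin 1 (br (J X) Y x) 1 (br X (J Y) x) \<in> levi C x \<and>
        (X x \<noteq> (\<lambda>_. 0) \<longrightarrow> br X (J X) x \<notin> levi C x) \<and>
        tv_lin 1 (tv_lin 1 (br X Y x) (-1) (br (J X) (J Y) x))
               1 (cplx C x (tv_lin 1 (br (J X) Y x) 1 (br X (J Y) x))) = (\<lambda>_. 0)))"

text \<open>Complex tangent vectors U + iW are pairs (U, W) of real ones; \<^term>\<open>cext\<close> is the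
  C-linear extension of a map with values in complex vectors.\<close>

type_synonym 'a ctvec = "'a tvec \<times> 'a tvec"

definition part10 :: "('a, 'n) cr_structure \<Rightarrow> 'a \<Rightarrow> 'a tvec \<Rightarrow> 'a ctvec" where
  "part10 C x v = (\<lambda>h. v h / 2, \<lambda>h. - (cplx C x v h / 2))"

definition part01 :: "('a, 'n) cr_structure \<Rightarrow> 'a \<Rightarrow> 'a tvec \<Rightarrow> 'a ctvec" where
  "part01 C x v = (\<lambda>h. v h / 2, \<lambda>h. cplx C x v h / 2)"

definition cext :: "('a tvec \<Rightarrow> complex ^ 's) \<Rightarrow> 'a ctvec \<Rightarrow> complex ^ 's" where
  "cext G Z = G (fst Z) + \<i> *s G (snd Z)"


section \<open>Pseudo-Hermitian structures and the Webster--Tanaka connection\<close>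

text \<open>The Reeb field \<^term>\<open>reeb\<close> and the connection \<^term>\<open>webster\<close> are uniquely determined by
  \<^term>\<open>theta\<close> through \<open>pseudo_hermitian\<close> below; they are carried along as fields.
  \<^term>\<open>webster h x v Y\<close> is the derivative of the vector field Y in direction v at x.\<close>

record 'a pherm =
  theta :: "'a \<Rightarrow> 'a tvec \<Rightarrow> real"
  reeb :: "'a vfield"
  webster :: "'a \<Rightarrow> 'a tvec \<Rightarrow> 'a vfield \<Rightarrow> 'a tvec"

definition dtheta ::
  "('a::topological_space, 'n::finite) cr_structure \<Rightarrow> 'a pherm \<Rightarrow> 'a \<Rightarrow> 'a tvec \<Rightarrow> 'a tvec \<Rightarrow> real" where
  "dtheta C h = ext_d (charts C) (theta h)"

definition gtheta ::
  "('a::topological_space, 'n::finite) cr_structure \<Rightarrow> 'a pherm \<Rightarrow> 'a \<Rightarrow> 'a tvec \<Rightarrow> 'a tvec \<Rightarrow> real" where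
  "gtheta C h x v w = 1/2 * dtheta C h x v (cplx C x w)"

definition adapted_form ::
  "('a::topological_space, 'n::finite) cr_structure \<Rightarrow> 'a pherm \<Rightarrow> bool" where
  "adapted_form C h \<longleftrightarrow> one_form (charts C) (theta h) \<and>
     (\<forall>x. {v \<in> tangent_space (charts C) x. theta h x v = 0} = levi C x) \<and>
     (\<forall>x. \<forall>v\<in>levi C x. v \<noteq> (\<lambda>_. 0) \<longrightarrow> 0 < gtheta C h x v v)"

definition reeb_field ::
  "('a::topological_space, 'n::finite) cr_structure \<Rightarrow> 'a pherm \<Rightarrow> bool" where
  "reeb_field C h \<longleftrightarrow> vf_on (charts C) UNIV (reeb h) \<and>
     (\<forall>x. theta h x (reeb h x) = 1 \<and>
        (\<forall>w\<in>tangent_space (charts C) x. dtheta C h x (reeb h x) w = 0))"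

definition connection_on_TM ::
  "('a::topological_space, 'n::finite) chart set \<Rightarrow> ('a \<Rightarrow> 'a tvec \<Rightarrow> 'a vfield \<Rightarrow> 'a tvec) \<Rightarrow> bool" where
  "connection_on_TM A D \<longleftrightarrow>
     (\<forall>x Y Z u w a b (k :: 'a \<Rightarrow> real). vf_near A x Y \<longrightarrow> vf_near A x Z \<longrightarrow> smooth_near A x k \<longrightarrow>
        u \<in> tangent_space A x \<longrightarrow> w \<in> tangent_space A x \<longrightarrow>
        D x u Y \<in> tangent_space A x \<and>
        D x (tv_lin a u b w) Y = tv_lin a (D x u Y) b (D x w Y) \<and>
        D x u (\<lambda>y. tv_lin 1 (Y y) 1 (Z y)) = tv_lin 1 (D x u Y) 1 (D x u Z) \<and>
        D x u (\<lambda>y j. k y * Y y j) = tv_lin (u k) (Y x) (k x) (D x u Y)) \<and>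
     (\<forall>U X Y. vf_on A U X \<longrightarrow> vf_on A U Y \<longrightarrow> vf_on A U (\<lambda>y. D y (X y) Y))"

text \<open>Parallelity of J and of the metric, which live on H(M), includes that the connection
  preserves H(M).\<close>

definition webster_tanaka ::
  "('a::topological_space, 'n::finite) cr_structure \<Rightarrow> 'a pherm \<Rightarrow> bool" where
  "webster_tanaka C h \<longleftrightarrow>
     (let A = charts C; D = webster h; T = reeb h; g = gtheta C h; J = cplx_vf C; br = bracket A in
      connection_on_TM A D \<and>
      (\<forall>x. \<forall>v\<in>tangent_space A x. D x v T = (\<lambda>_. 0) \<and>
         (\<forall>Y. hvf_near C x Y \<longrightarrow> D x v Y \<in> levi C x \<and> D x v (J Y) = cplx C x (D x v Y)) \<and>
         (\<forall>Y Z. hvf_near C x Y \<longrightarrow> hvf_near C x Z \<longrightarrow>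
            v (\<lambda>y. g y (Y y) (Z y)) = g x (D x v Y) (Z x) + g x (Y x) (D x v Z))) \<and>
      (\<forall>x X Y. hvf_near C x X \<longrightarrow> hvf_near C x Y \<longrightarrow>
         tv_lin 1 (tv_lin 1 (D x (X x) Y) (-1) (D x (Y x) X)) (-1) (br X Y x)
           = (\<lambda>k. dtheta C h x (X x) (Y x) * T x k)) \<and>
      (\<forall>x X. hvf_near C x X \<longrightarrow>
         tv_lin 1 (tv_lin 1 (D x (T x) X) (-1) (D x (X x) T)) (-1) (br T X x)
           = tv_lin (-1/2) (br T X x) (-1/2) (cplx C x (br T (J X) x))))"

definition pseudo_hermitian ::
  "('a::topological_space, 'n::finite) cr_structure \<Rightarrow> 'a pherm \<Rightarrow> bool" where
  "pseudo_hermitian C h \<longleftrightarrow> adapted_form C h \<and> reeb_field C h \<and> webster_tanaka C h"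

text \<open>\<^term>\<open>e 0\<close>, ..., \<^term>\<open>e (m-1)\<close> such that the e and Je form an orthonormal basis of H(M)
  at x.\<close>

definition unitary_frame ::
  "('a::topological_space, 'n::finite) cr_structure \<Rightarrow> 'a pherm \<Rightarrow> 'a \<Rightarrow> (nat \<Rightarrow> 'a tvec) \<Rightarrow> bool" where
  "unitary_frame C h x e \<longleftrightarrow> (\<forall>a<crdim C. e a \<in> levi C x) \<and>
     (\<forall>a<crdim C. \<forall>b<crdim C. gtheta C h x (e a) (e b) = (if a = b then 1 else 0) \<and>
        gtheta C h x (e a) (cplx C x (e b)) = 0)"

definition some_unitary_frame ::
  "('a::topological_space, 'n::finite) cr_structure \<Rightarrow> 'a pherm \<Rightarrow> 'a \<Rightarrow> nat \<Rightarrow> 'a tvec" where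
  "some_unitary_frame C h x = (SOME e. unitary_frame C h x e)"

text \<open>Orthonormal frames of H(M) at x that are positively oriented: up to a positive factor the sum
  is (d\<theta>)^m evaluated on the frame, and it is positive on (e_1, Je_1, ..., e_m, Je_m).\<close>

definition so_frame ::
  "('a::topological_space, 'n::finite) cr_structure \<Rightarrow> 'a pherm \<Rightarrow> 'a \<Rightarrow> (nat \<Rightarrow> 'a tvec) \<Rightarrow> bool" where
  "so_frame C h x s \<longleftrightarrow> (\<forall>a<2 * crdim C. s a \<in> levi C x) \<and>
     (\<forall>a<2 * crdim C. \<forall>b<2 * crdim C. gtheta C h x (s a) (s b) = (if a = b then 1 else 0)) \<and>
     0 < (\<Sum>p | p permutes {..<2 * crdim C}.
            of_int (sign p) * (\<Prod>i<crdim C. dtheta C h x (s (p (2 * i))) (s (p (2 * i + 1)))))"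


section \<open>Principal bundles\<close>

text \<open>A principal bundle with total space \<^typ>\<open>'p\<close>, whose smooth structure is given by an atlas
  \<^term>\<open>Sec\<close> of local sections with smooth transition functions.\<close>

definition principal_bundle ::
  "('a::topological_space, 'n::finite) chart set \<Rightarrow> 'g::real_normed_vector set \<Rightarrow>
   ('g \<Rightarrow> 'g \<Rightarrow> 'g) \<Rightarrow> 'g \<Rightarrow> ('p \<Rightarrow> 'a) \<Rightarrow> ('p \<Rightarrow> 'g \<Rightarrow> 'p) \<Rightarrow> ('a set \<times> ('a \<Rightarrow> 'p)) set \<Rightarrow> bool" where
  "principal_bundle A G mul one pr act Sec \<longleftrightarrow>
     (\<forall>p. act p one = p) \<and>
     (\<forall>p. \<forall>g\<in>G. \<forall>g'\<in>G. act (act p g) g' = act p (mul g g')) \<and>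
     (\<forall>p. \<forall>g\<in>G. pr (act p g) = pr p) \<and>
     (\<forall>p p'. pr p = pr p' \<longrightarrow> (\<exists>!g. g \<in> G \<and> p' = act p g)) \<and>
     (\<forall>x. \<exists>(U, s)\<in>Sec. x \<in> U) \<and>
     (\<forall>(U, s)\<in>Sec. open U \<and> (\<forall>x\<in>U. pr (s x) = x)) \<and>
     (\<forall>(U, s)\<in>Sec. \<forall>(V, t)\<in>Sec. \<exists>g. smooth_fun A (U \<inter> V) g \<and>
        (\<forall>x\<in>U \<inter> V. g x \<in> G \<and> t x = act (s x) (g x)))"

definition local_section ::
  "('a::topological_space, 'n::finite) chart set \<Rightarrow> 'g::real_normed_vector set \<Rightarrow>
   ('p \<Rightarrow> 'a) \<Rightarrow> ('p \<Rightarrow> 'g \<Rightarrow> 'p) \<Rightarrow> ('a set \<times> ('a \<Rightarrow> 'p)) set \<Rightarrow> 'a set \<Rightarrow> ('a \<Rightarrow> 'p) \<Rightarrow> bool" where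
  "local_section A G pr act Sec U t \<longleftrightarrow> open U \<and> (\<forall>x\<in>U. pr (t x) = x) \<and>
     (\<forall>(V, s)\<in>Sec. \<exists>g. smooth_fun A (U \<inter> V) g \<and>
        (\<forall>x\<in>U \<inter> V. g x \<in> G \<and> t x = act (s x) (g x)))"


section \<open>The canonical bundle and the line bundles E(p)\<close>

text \<open>Complex-valued real-multilinear forms are the same as complex-multilinear forms on the
  complexified tangent space. As T01 consists of the X + iJX, the last condition says that
  contraction with T01 vanishes.\<close>

definition tuple_at :: "('a::topological_space, 'n::finite) cr_structure \<Rightarrow> 'a \<Rightarrow> 'a tvec list \<Rightarrow> bool" where
  "tuple_at C x V \<longleftrightarrow> length V = crdim C + 1 \<and> set V \<subseteq> tangent_space (charts C) x"

definition canonical_form ::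
  "('a::topological_space, 'n::finite) cr_structure \<Rightarrow> 'a \<Rightarrow> ('a tvec list \<Rightarrow> complex) \<Rightarrow> bool" where
  "canonical_form C x \<omega> \<longleftrightarrow> (\<forall>V. tuple_at C x V \<longrightarrow>
     (\<forall>i<crdim C + 1. \<forall>u\<in>tangent_space (charts C) x. \<forall>w\<in>tangent_space (charts C) x. \<forall>a b.
        \<omega> (V[i := tv_lin a u b w]) = of_real a * \<omega> (V[i := u]) + of_real b * \<omega> (V[i := w])) \<and>
     (\<forall>i<crdim C + 1. \<forall>j<i. V ! i = V ! j \<longrightarrow> \<omega> V = 0) \<and>
     (\<forall>X\<in>levi C x. \<omega> (V[0 := X]) + \<i> * \<omega> (V[0 := cplx C x X]) = 0))"

text \<open>The line bundle E(1) is given by its principal bundle of nonzero vectors, with structure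
  group the nonzero complex numbers. The isomorphism of E(1)^(m+2) with the dual of the canonical
  bundle is given by \<^term>\<open>kappa\<close>: it sends a nonzero vector q to the nonzero canonical form which
  is dual to q^(m+2). An element of E(p) at x is given by its coordinates u(q) with
  respect to the frames q^p, i.e. by a function with u(q w) = w^(-p) u(q).\<close>

record ('a, 'q) density =
  qproj :: "'q \<Rightarrow> 'a"
  qact :: "'q \<Rightarrow> complex \<Rightarrow> 'q"
  qsec :: "('a set \<times> ('a \<Rightarrow> 'q)) set"
  kappa :: "'q \<Rightarrow> 'a tvec list \<Rightarrow> complex"

definition density_section ::
  "('a::topological_space, 'n::finite) cr_structure \<Rightarrow> ('a, 'q) density \<Rightarrow> 'a set \<Rightarrow> ('a \<Rightarrow> 'q) \<Rightarrow> bool" where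
  "density_section C E U q \<longleftrightarrow>
     local_section (charts C) {z::complex. z \<noteq> 0} (qproj E) (qact E) (qsec E) U q"

definition density_bundle ::
  "('a::topological_space, 'n::finite) cr_structure \<Rightarrow> ('a, 'q) density \<Rightarrow> bool" where
  "density_bundle C E \<longleftrightarrow>
     principal_bundle (charts C) {z::complex. z \<noteq> 0} (*) 1 (qproj E) (qact E) (qsec E) \<and>
     (\<forall>q. canonical_form C (qproj E q) (kappa E q) \<and>
        (\<exists>V. tuple_at C (qproj E q) V \<and> kappa E q V \<noteq> 0)) \<and>
     (\<forall>q z V. z \<noteq> 0 \<longrightarrow> tuple_at C (qproj E q) V \<longrightarrow>
        kappa E (qact E q z) V = z powi (- (int (crdim C) + 2)) * kappa E q V) \<and>
     (\<forall>U q Vs. density_section C E U q \<longrightarrow> length Vs = crdim C + 1 \<longrightarrow>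
        (\<forall>X\<in>set Vs. vf_on (charts C) U X) \<longrightarrow>
        smooth_fun (charts C) U (\<lambda>y. kappa E (q y) (map (\<lambda>X. X y) Vs)))"

text \<open>The norm of a canonical form, and the induced norm of an element u of E(p), expressed
  by means of any nonzero vector q of E(1) at x.\<close>

definition canonical_norm ::
  "('a::topological_space, 'n::finite) cr_structure \<Rightarrow> 'a pherm \<Rightarrow> 'a \<Rightarrow> ('a tvec list \<Rightarrow> complex) \<Rightarrow> real" where
  "canonical_norm C h x \<omega> = cmod (\<omega> (reeb h x # map (some_unitary_frame C h x) [0..<crdim C]))"

definition density_norm ::
  "('a::topological_space, 'n::finite) cr_structure \<Rightarrow> 'a pherm \<Rightarrow> ('a, 'q) density \<Rightarrow> int \<Rightarrow>
     ('q \<Rightarrow> complex) \<Rightarrow> 'q \<Rightarrow> real" where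
  "density_norm C h E p u q = cmod (u q) *
     (canonical_norm C h (qproj E q) (kappa E q) powr (- 1 / real (crdim C + 2))) powi p"

text \<open>The connection form of the canonical bundle with respect to a local frame \<eta>, i.e. the c with
  (Webster--Tanaka derivative of \<eta> in direction v) = c \<eta>.\<close>

definition canonical_conn ::
  "('a::topological_space, 'n::finite) cr_structure \<Rightarrow> 'a pherm \<Rightarrow> ('a \<Rightarrow> 'a tvec list \<Rightarrow> complex) \<Rightarrow>
     'a \<Rightarrow> 'a tvec \<Rightarrow> complex" where
  "canonical_conn C h \<eta> x v = (THE c. \<forall>Vs. length Vs = crdim C + 1 \<longrightarrow>
     (\<forall>X\<in>set Vs. vf_near (charts C) x X) \<longrightarrow>
       cder v (\<lambda>y. \<eta> y (map (\<lambda>X. X y) Vs))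
       - (\<Sum>i<crdim C + 1. \<eta> x ((map (\<lambda>X. X x) Vs)[i := webster h x v (Vs ! i)]))
       = c * \<eta> x (map (\<lambda>X. X x) Vs))"

text \<open>The logarithmic derivative (derivative of u in direction v)/u of a local nonvanishing section
  u of E(p), computed in a local frame q^p. The frame q of E(1) has connection
  form -1/(m+2) times that of the frame \<kappa>(q). The result does not depend on the
  choice of q.\<close>

definition density_logder ::
  "('a::topological_space, 'n::finite) cr_structure \<Rightarrow> 'a pherm \<Rightarrow> ('a, 'q) density \<Rightarrow> int \<Rightarrow>
     ('a \<Rightarrow> 'q \<Rightarrow> complex) \<Rightarrow> 'a \<Rightarrow> 'a tvec \<Rightarrow> complex" where
  "density_logder C h E p u x v =
     (let q = (SOME q. \<exists>U. x \<in> U \<and> density_section C E U q)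
      in cder v (\<lambda>y. u y (q y)) / u x (q x)
         + of_int p * (- canonical_conn C h (\<lambda>y. kappa E (q y)) x v / of_nat (crdim C + 2)))"


section \<open>Spin-c structures\<close>

text \<open>The spinor module of the complex Clifford algebra of rank 2m, given by skew-Hermitian Clifford
  matrices; it is unique up to unitary equivalence and identifies this algebra with all
  complex matrices of size 2^m, so that the group Spin-c(2m) is a group of such matrices.\<close>

definition spinor_module :: "nat \<Rightarrow> (nat \<Rightarrow> complex ^ 's ^ 's::finite) \<Rightarrow> bool" where
  "spinor_module m \<gamma> \<longleftrightarrow> CARD('s) = 2 ^ m \<and>
     (\<forall>a<2*m. \<forall>b<2*m. \<gamma> a ** \<gamma> b + \<gamma> b ** \<gamma> a = (if a = b then mat (-2) else 0)) \<and>
     (\<forall>a<2*m. \<forall>i j. cnj (\<gamma> a $ j $ i) = - (\<gamma> a $ i $ j))"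

definition cliff :: "nat \<Rightarrow> (nat \<Rightarrow> complex ^ 's ^ 's::finite) \<Rightarrow> (nat \<Rightarrow> real) \<Rightarrow> complex ^ 's ^ 's" where
  "cliff m \<gamma> v = (\<Sum>a<2*m. v a *\<^sub>R \<gamma> a)"

inductive_set spin_group :: "nat \<Rightarrow> (nat \<Rightarrow> complex ^ 's ^ 's::finite) \<Rightarrow> (complex ^ 's ^ 's) set"
  for m \<gamma> where
  one: "mat 1 \<in> spin_group m \<gamma>"
| step: "g \<in> spin_group m \<gamma> \<Longrightarrow> (\<Sum>a<2*m. (v a)\<^sup>2) = 1 \<Longrightarrow> (\<Sum>a<2*m. (w a)\<^sup>2) = 1 \<Longrightarrow>
     g ** cliff m \<gamma> v ** cliff m \<gamma> w \<in> spin_group m \<gamma>"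

definition spinc_group :: "nat \<Rightarrow> (nat \<Rightarrow> complex ^ 's ^ 's::finite) \<Rightarrow> (complex ^ 's ^ 's) set" where
  "spinc_group m \<gamma> = {mat z ** g | z g. cmod z = 1 \<and> g \<in> spin_group m \<gamma>}"

definition spinc_det :: "nat \<Rightarrow> (nat \<Rightarrow> complex ^ 's ^ 's::finite) \<Rightarrow> complex ^ 's ^ 's \<Rightarrow> complex" where
  "spinc_det m \<gamma> g = (THE w. \<exists>z k. cmod z = 1 \<and> k \<in> spin_group m \<gamma> \<and> g = mat z ** k \<and> w = z\<^sup>2)"

text \<open>R is the image of g in SO(2m), as the matrix of conjugation by g.\<close>

definition spinc_rot ::
  "nat \<Rightarrow> (nat \<Rightarrow> complex ^ 's ^ 's::finite) \<Rightarrow> complex ^ 's ^ 's \<Rightarrow> (nat \<Rightarrow> nat \<Rightarrow> real) \<Rightarrow> bool" where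
  "spinc_rot m \<gamma> g R \<longleftrightarrow> (\<forall>a<2*m. g ** \<gamma> a = (\<Sum>b<2*m. R b a *\<^sub>R \<gamma> b) ** g)"

text \<open>\<^term>\<open>pframe\<close> is the map to the orthonormal frames of H(M), and \<^term>\<open>pdet\<close> the map to the
  frames of unit length of the determinant bundle L = E(l), the image of p being given
  by the coordinate function \<^term>\<open>pdet S p\<close> on the nonzero vectors of E(1) at the same point.\<close>

record ('a, 'p, 'q, 's) spinc =
  pproj :: "'p \<Rightarrow> 'a"
  pact :: "'p \<Rightarrow> complex ^ 's ^ 's \<Rightarrow> 'p"
  psec :: "('a set \<times> ('a \<Rightarrow> 'p)) set"
  pframe :: "'p \<Rightarrow> nat \<Rightarrow> 'a tvec"
  pdet :: "'p \<Rightarrow> 'q \<Rightarrow> complex"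

definition spinor_frame ::
  "('a::topological_space, 'n::finite) cr_structure \<Rightarrow> (nat \<Rightarrow> complex ^ 's ^ 's::finite) \<Rightarrow>
   ('a, 'p, 'q, 's) spinc \<Rightarrow> 'a set \<Rightarrow> ('a \<Rightarrow> 'p) \<Rightarrow> bool" where
  "spinor_frame C \<gamma> S U s \<longleftrightarrow>
     local_section (charts C) (spinc_group (crdim C) \<gamma>) (pproj S) (pact S) (psec S) U s"

definition spinc_structure ::
  "('a::topological_space, 'n::finite) cr_structure \<Rightarrow> (nat \<Rightarrow> complex ^ 's ^ 's::finite) \<Rightarrow>
   ('a, 'q) density \<Rightarrow> int \<Rightarrow> 'a pherm \<Rightarrow> ('a, 'p, 'q, 's) spinc \<Rightarrow> bool" where
  "spinc_structure C \<gamma> E l h S \<longleftrightarrow>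
     (let m = crdim C; G = spinc_group m \<gamma> in
      principal_bundle (charts C) G (**) (mat 1) (pproj S) (pact S) (psec S) \<and>
      (\<forall>p. so_frame C h (pproj S p) (pframe S p)) \<and>
      (\<forall>p. \<forall>g\<in>G. \<forall>R. spinc_rot m \<gamma> g R \<longrightarrow>
         (\<forall>a<2*m. pframe S (pact S p g) a = tv_sum {..<2*m} (\<lambda>b. R b a) (pframe S p))) \<and>
      (\<forall>U s. spinor_frame C \<gamma> S U s \<longrightarrow> (\<forall>a<2*m. vf_on (charts C) U (\<lambda>y. pframe S (s y) a))) \<and>
      (\<forall>p q. qproj E q = pproj S p \<longrightarrow> density_norm C h E l (pdet S p) q = 1) \<and>
      (\<forall>p q w. qproj E q = pproj S p \<longrightarrow> w \<noteq> 0 \<longrightarrow>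
         pdet S p (qact E q w) = w powi (- l) * pdet S p q) \<and>
      (\<forall>p q. \<forall>g\<in>G. qproj E q = pproj S p \<longrightarrow>
         pdet S (pact S p g) q = spinc_det m \<gamma> g * pdet S p q) \<and>
      (\<forall>U s q. spinor_frame C \<gamma> S U s \<longrightarrow> density_section C E U q \<longrightarrow>
         smooth_fun (charts C) U (\<lambda>y. pdet S (s y) (q y))))"


section \<open>Spinors and the twistor operator\<close>

text \<open>The spinor bundle is the bundle associated to P by the spinor module. A section is given by
  the equivariant function \<phi> on P for which its value at x is the class [p, \<phi>(p)] for any p over x.
  All operators below act on such functions, and their value at p is the coordinate
  vector of the result in the spinor frame p.\<close>

definition spinor_field ::
  "('a::topological_space, 'n::finite) cr_structure \<Rightarrow> (nat \<Rightarrow> complex ^ 's ^ 's::finite) \<Rightarrow>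
   ('a, 'p, 'q, 's) spinc \<Rightarrow> ('p \<Rightarrow> complex ^ 's) \<Rightarrow> bool" where
  "spinor_field C \<gamma> S \<phi> \<longleftrightarrow>
     (\<forall>p. \<forall>g\<in>spinc_group (crdim C) \<gamma>. g *v \<phi> (pact S p g) = \<phi> p) \<and>
     (\<forall>U s. spinor_frame C \<gamma> S U s \<longrightarrow> smooth_fun (charts C) U (\<lambda>y. \<phi> (s y)))"

definition clifford_mult ::
  "('a::topological_space, 'n::finite) cr_structure \<Rightarrow> (nat \<Rightarrow> complex ^ 's ^ 's::finite) \<Rightarrow>
   'a pherm \<Rightarrow> ('a, 'p, 'q, 's) spinc \<Rightarrow> 'p \<Rightarrow> complex ^ 's \<Rightarrow> 'a tvec \<Rightarrow> complex ^ 's" where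
  "clifford_mult C \<gamma> h S p \<psi> X =
     cliff (crdim C) \<gamma> (\<lambda>a. gtheta C h (pproj S p) X (pframe S p a)) *v \<psi>"

text \<open>Covariant derivative of a spinor field in direction v at the point under p. With respect to a
  local section s of P through p, the lift to Spin-c of the pair consisting of the connection form of
  s as an orthonormal frame and the connection form A of the frame det(s) of L acts on
  spinors by 1/2 (sum over a<b of g(D_v s_a, s_b) \<gamma>_a \<gamma>_b) + A(v)/2, because
  Spin-c(2m) covers SO(2m) x U(1) by squaring the U(1) factor. The result does not
  depend on the choice of s.\<close>

definition spinor_deriv ::
  "('a::topological_space, 'n::finite) cr_structure \<Rightarrow> (nat \<Rightarrow> complex ^ 's ^ 's::finite) \<Rightarrow>
   ('a, 'q) density \<Rightarrow> int \<Rightarrow> 'a pherm \<Rightarrow> ('a, 'p, 'q, 's) spinc \<Rightarrow>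
   ('p \<Rightarrow> complex ^ 's) \<Rightarrow> 'p \<Rightarrow> 'a tvec \<Rightarrow> complex ^ 's" where
  "spinor_deriv C \<gamma> E l h S \<phi> p v =
     (let m = crdim C; x = pproj S p;
          s = (SOME s. \<exists>U. x \<in> U \<and> s x = p \<and> spinor_frame C \<gamma> S U s)
      in vder v (\<lambda>y. \<phi> (s y))
         + (1/2) *\<^sub>R (\<Sum>b<2*m. \<Sum>a<b.
             gtheta C h x (webster h x v (\<lambda>y. pframe S (s y) a)) (pframe S p b)
               *\<^sub>R ((\<gamma> a ** \<gamma> b) *v \<phi> p))
         + (density_logder C h E l (\<lambda>y. pdet S (s y)) x v / 2) *s \<phi> p)"

definition Theta_act ::
  "('a::topological_space, 'n::finite) cr_structure \<Rightarrow> (nat \<Rightarrow> complex ^ 's ^ 's::finite) \<Rightarrow>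
   'a pherm \<Rightarrow> ('a, 'p, 'q, 's) spinc \<Rightarrow> 'p \<Rightarrow> complex ^ 's \<Rightarrow> complex ^ 's" where
  "Theta_act C \<gamma> h S p \<psi> =
     (let x = pproj S p; e = some_unitary_frame C h x; cl = clifford_mult C \<gamma> h S p
      in \<i> *s (\<Sum>\<alpha><crdim C. cl (cl \<psi> (cplx C x (e \<alpha>))) (e \<alpha>)))"

definition Dminus ::
  "('a::topological_space, 'n::finite) cr_structure \<Rightarrow> (nat \<Rightarrow> complex ^ 's ^ 's::finite) \<Rightarrow>
   ('a, 'q) density \<Rightarrow> int \<Rightarrow> 'a pherm \<Rightarrow> ('a, 'p, 'q, 's) spinc \<Rightarrow>
   ('p \<Rightarrow> complex ^ 's) \<Rightarrow> 'p \<Rightarrow> complex ^ 's" where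
  "Dminus C \<gamma> E l h S \<phi> p =
     (let x = pproj S p; e = some_unitary_frame C h x
      in 2 *\<^sub>R (\<Sum>\<alpha><crdim C.
           cext (clifford_mult C \<gamma> h S p
                  (cext (spinor_deriv C \<gamma> E l h S \<phi> p) (part10 C x (e \<alpha>)))) (part01 C x (e \<alpha>))))"

definition Dplus ::
  "('a::topological_space, 'n::finite) cr_structure \<Rightarrow> (nat \<Rightarrow> complex ^ 's ^ 's::finite) \<Rightarrow>
   ('a, 'q) density \<Rightarrow> int \<Rightarrow> 'a pherm \<Rightarrow> ('a, 'p, 'q, 's) spinc \<Rightarrow>
   ('p \<Rightarrow> complex ^ 's) \<Rightarrow> 'p \<Rightarrow> complex ^ 's" where
  "Dplus C \<gamma> E l h S \<phi> p =
     (let x = pproj S p; e = some_unitary_frame C h x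
      in 2 *\<^sub>R (\<Sum>\<alpha><crdim C.
           cext (clifford_mult C \<gamma> h S p
                  (cext (spinor_deriv C \<gamma> E l h S \<phi> p) (part01 C x (e \<alpha>)))) (part10 C x (e \<alpha>))))"

definition twistor ::
  "('a::topological_space, 'n::finite) cr_structure \<Rightarrow> (nat \<Rightarrow> complex ^ 's ^ 's::finite) \<Rightarrow>
   ('a, 'q) density \<Rightarrow> int \<Rightarrow> 'a pherm \<Rightarrow> ('a, 'p, 'q, 's) spinc \<Rightarrow>
   ('p \<Rightarrow> complex ^ 's) \<Rightarrow> 'p \<Rightarrow> 'a tvec \<Rightarrow> complex ^ 's" where
  "twistor C \<gamma> E l h S \<phi> p X =
     (let x = pproj S p; m = real (crdim C); q = (m - of_int l) / 2;
          a = 1 / (2 * (q + 1)); b = 1 / (2 * (m - q + 1))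
      in spinor_deriv C \<gamma> E l h S \<phi> p X
         + a *\<^sub>R cext (clifford_mult C \<gamma> h S p (Dplus C \<gamma> E l h S \<phi> p)) (part01 C x X)
         + b *\<^sub>R cext (clifford_mult C \<gamma> h S p (Dminus C \<gamma> E l h S \<phi> p)) (part10 C x X))"


section \<open>Conformal change\<close>

definition conformal_change ::
  "('a::topological_space, 'n::finite) cr_structure \<Rightarrow> ('a \<Rightarrow> real) \<Rightarrow> 'a pherm \<Rightarrow> 'a pherm \<Rightarrow> bool" where
  "conformal_change C f h h' \<longleftrightarrow>
     (\<forall>x. \<forall>v\<in>tangent_space (charts C) x. theta h' x v = exp (2 * f x) * theta h x v)"

text \<open>The spinor frames of S and S' are identified: both are reductions of the same principal bundle
  P, over the rescaling of orthonormal frames of H(M) and of unit frames of L. Hence the isomorphism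
  of spinor bundles, which identifies the classes of (p, \<psi>) with respect to S and
  S', sends a section to the one given by the same equivariant function on P; what changes from S to
  S' is the action of vectors and the covariant derivative. The positive factor is determined
  by the requirement in \<^term>\<open>spinc_structure\<close> that determinants have unit length.\<close>

definition corresponding_spinc ::
  "('a::topological_space, 'n::finite) cr_structure \<Rightarrow> ('a, 'q) density \<Rightarrow> ('a \<Rightarrow> real) \<Rightarrow>
   ('a, 'p, 'q, 's::finite) spinc \<Rightarrow> ('a, 'p, 'q, 's) spinc \<Rightarrow> bool" where
  "corresponding_spinc C E f S S' \<longleftrightarrow>
     pproj S' = pproj S \<and> pact S' = pact S \<and> psec S' = psec S \<and>
     (\<forall>p. \<forall>a<2 * crdim C. pframe S' p a = (\<lambda>k. exp (- f (pproj S p)) * pframe S p a k)) \<and>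
     (\<forall>p. \<exists>r>0. \<forall>q. qproj E q = pproj S p \<longrightarrow> pdet S' p q = of_real r * pdet S p q)"

end

theory Submission
  imports Defs "HOL-Library.Function_Algebras"
begin

text \<open>Write \<open>u = e\<^sup>f\<close>, \<open>\<delta> = df\<close> on \<open>H(M)\<close>, and \<open>G\<close> for the \<open>g\<^sub>\<theta>\<close>-gradient of \<open>f\<close> in \<open>H(M)\<close>. The Reeb fields are
  related by \<open>u\<^sup>2 T' = T + W\<close> with \<open>W = - J G\<close>, and a Koszul argument gives for \<open>X, Y\<close> in \<open>H(M)\<close>
  \<open>\<nabla>'\<^sub>X Y - \<nabla>\<^sub>X Y = \<delta>(X) Y + \<delta>(Y) X - \<delta>(JX) JY - \<delta>(JY) JX - g(X,Y) G - g(JX,Y) J G\<close>.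
  Its complex trace determines the change of the connections of the canonical bundle and of \<open>L = E(l)\<close>,
  and the latter cancels the action of \<open>\<delta>(JX) J\<close> on spinors of \<open>\<Theta>\<close>-eigenvalue \<open>l\<close>. What is left is
  \<open>\<nabla>'\<^sub>X (u \<phi>) = u (\<nabla>\<^sub>X \<phi> - 1/2 (X \<cdot> G + JX \<cdot> J G) \<cdot> \<phi>)\<close>. Since \<open>G - i J G\<close> and \<open>G + i J G\<close> shift the
  eigenvalue of \<open>\<Theta>\<close> by -2 and +2, the zeroth order terms of the Dirac operators are multiples of
  \<open>(G \<mp> i J G) \<cdot> \<phi>\<close> by exactly the inverses of the coefficients of the twistor operator.\<close>

section \<open>Calculus of smooth functions\<close>

text \<open>Several objects are given by a choice or by a unique description. The descriptions
  behind d\<theta> and behind the connection form of the canonical bundle call for existence and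
  uniqueness, hence for tensoriality, which rests on smooth coefficients in local frames, and for
  the fact that canonical forms at a point form a line. The unitary frames in the norm of canonical
  forms and in \<Theta>, D_+ and D_- are chosen separately for the two metrics, so norms and traces
  must be shown not to depend on them. The local section of P and the local frame of E(1), in
  contrast, are selected by conditions that do not mention \<theta>; both structures use literally
  the same ones, and the two derivatives are compared directly. The weight e^f has this origin:
  reordering G \<cdot> X into X \<cdot> G in the spin action leaves the scalar -df(X), and the
  derivative of e^f cancels it. The remaining term -1/2 (X \<cdot> G + JX \<cdot> JG) splits into
  two halves, one of which is compensated by D_+ and the other by D_-.\<close>

lemma Ck_on_cong:
  assumes "open U" "\<And>x. x \<in> U \<Longrightarrow> f x = g x"
  shows "Ck_on k U f \<longleftrightarrow> Ck_on k U g"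
  using assms(2)
proof (induction k arbitrary: f g)
  case 0
  then show ?case by (auto intro: continuous_on_cong[THEN iffD1])
next
  case (Suc k)
  have eq: "frechet_derivative f (at x) = frechet_derivative g (at x)"
    if "x \<in> U" "f differentiable_on U \<or> g differentiable_on U" for x
  proof -
    have *: "(f has_derivative D) (at x) \<longleftrightarrow> (g has_derivative D) (at x)" for D
      using has_derivative_transform_within_open[OF _ \<open>open U\<close> \<open>x \<in> U\<close>] Suc.prems by (metis (full_types))
    show ?thesis unfolding frechet_derivative_def * ..
  qed
  have d: "f differentiable_on U \<longleftrightarrow> g differentiable_on U"
    using Suc.prems by (auto simp: differentiable_on_def intro: differentiable_transform_within[OF _ zero_less_one])
  have "Ck_on k U (\<lambda>x. frechet_derivative f (at x) v) \<longleftrightarrow> Ck_on k U (\<lambda>x. frechet_derivative g (at x) v)"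
    if "f differentiable_on U \<or> g differentiable_on U" for v
    by (rule Suc.IH) (use eq that in auto)
  then show ?case using d by auto
qed

lemma Ck_on_SucI:
  assumes "open U" "\<And>x. x \<in> U \<Longrightarrow> (f has_derivative f' x) (at x)"
    and "\<And>v. Ck_on k U (\<lambda>x. f' x v)"
  shows "Ck_on (Suc k) U f"
proof -
  have "Ck_on k U (\<lambda>x. frechet_derivative f (at x) v) = Ck_on k U (\<lambda>x. f' x v)" for v
    by (rule Ck_on_cong[OF assms(1)]) (use assms(2) frechet_derivative_at in metis)
  moreover have "f differentiable_on U"
    using assms(2) by (auto simp: differentiable_on_def differentiable_def intro: has_derivative_at_withinI)
  ultimately show ?thesis using assms(3) by simp
qed

lemma Ck_on_SucD:
  assumes "open U" "Ck_on (Suc k) U f" "x \<in> U"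
  shows "(f has_derivative frechet_derivative f (at x)) (at x)"
  using assms by (metis Ck_on.simps(2) differentiable_on_eq_differentiable_at frechet_derivative_works)

lemma Ck_on_Suc_imp: "Ck_on (Suc k) U f \<Longrightarrow> Ck_on k U f"
  by (induction k arbitrary: f) (auto intro: differentiable_imp_continuous_on)

lemma Ck_on_subset:
  assumes "Ck_on k U f" "V \<subseteq> U"
  shows "Ck_on k V f"
  using assms
  by (induction k arbitrary: f) (auto intro: continuous_on_subset differentiable_on_subset)

lemma Ck_on_const: "open U \<Longrightarrow> Ck_on k U (\<lambda>x. c)"
proof (induction k arbitrary: c)
  case (Suc k)
  then show ?case by (intro Ck_on_SucI[where f' = "\<lambda>_ _. 0"]) auto
qed simp

lemma Ck_on_linear:
  assumes "bounded_linear L" "open U" "Ck_on k U f"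
  shows "Ck_on k U (\<lambda>x. L (f x))"
  using assms(3)
proof (induction k arbitrary: f)
  case 0
  then show ?case
    by (simp add: bounded_linear.continuous_on[OF assms(1)])
next
  case (Suc k)
  show ?case
  proof (rule Ck_on_SucI[OF assms(2)])
    show "((\<lambda>x. L (f x)) has_derivative (\<lambda>v. L (frechet_derivative f (at x) v))) (at x)"
      if "x \<in> U" for x
      using Ck_on_SucD[OF assms(2) Suc.prems that] by (rule bounded_linear.has_derivative[OF assms(1)])
  qed (use Suc in auto)
qed

lemma Ck_on_add:
  assumes "open U" "Ck_on k U f" "Ck_on k U g"
  shows "Ck_on k U (\<lambda>x. f x + g x)"
  using assms(2,3)
proof (induction k arbitrary: f g)
  case 0
  then show ?case by (auto intro: continuous_on_add)
next
  case (Suc k)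
  show ?case
  proof (rule Ck_on_SucI[OF assms(1)])
    show "((\<lambda>x. f x + g x) has_derivative
        (\<lambda>v. frechet_derivative f (at x) v + frechet_derivative g (at x) v)) (at x)"
      if "x \<in> U" for x
      using Ck_on_SucD[OF assms(1) Suc.prems(1) that] Ck_on_SucD[OF assms(1) Suc.prems(2) that]
      by (rule has_derivative_add)
  qed (use Suc in auto)
qed

lemma Ck_on_bilinear:
  assumes "bounded_bilinear B" "open U" "Ck_on k U f" "Ck_on k U g"
  shows "Ck_on k U (\<lambda>x. B (f x) (g x))"
  using assms(3,4)
proof (induction k arbitrary: f g)
  case 0
  then show ?case by (simp add: bounded_bilinear.continuous_on[OF assms(1)])
next
  case (Suc k)
  show ?case
  proof (rule Ck_on_SucI[OF assms(2)])
    show "((\<lambda>x. B (f x) (g x)) has_derivative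
        (\<lambda>v. B (f x) (frechet_derivative g (at x) v) + B (frechet_derivative f (at x) v) (g x))) (at x)"
      if "x \<in> U" for x
      using Ck_on_SucD[OF assms(2) Suc.prems(1) that] Ck_on_SucD[OF assms(2) Suc.prems(2) that]
      by (rule bounded_bilinear.FDERIV[OF assms(1)])
    show "Ck_on k U (\<lambda>x. B (f x) (frechet_derivative g (at x) v) + B (frechet_derivative f (at x) v) (g x))"
      for v
      using Suc.prems Ck_on_Suc_imp[OF Suc.prems(1)] Ck_on_Suc_imp[OF Suc.prems(2)]
      by (intro Ck_on_add[OF assms(2)] Suc.IH) auto
  qed
qed

text \<open>The whole sequence of successive derivatives \<open>F j\<close> is carried along, so
  that the chain rule reduces the claim for \<open>F j\<close> at order \<open>Suc k\<close> to
  order \<open>k\<close>, where \<open>F (Suc j)\<close> appears as well. It serves both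
  \<open>exp\<close> and \<open>inverse\<close>.\<close>

lemma Ck_on_compose_real:
  fixes f :: "'b::real_normed_vector \<Rightarrow> real"
  assumes "\<And>j t. t \<in> I \<Longrightarrow> (F j has_real_derivative F (Suc j) t) (at t)"
    and "open U" "\<And>x. x \<in> U \<Longrightarrow> f x \<in> I" "Ck_on k U f"
  shows "Ck_on k U (\<lambda>x. F j (f x))"
  using assms(4)
proof (induction k arbitrary: j)
  case 0
  have "continuous_on I (F j)"
    using assms(1) by (meson DERIV_isCont continuous_at_imp_continuous_on)
  then show ?case using 0 assms(3) by (auto intro: continuous_on_compose2)
next
  case (Suc k)
  show ?case
  proof (rule Ck_on_SucI[OF assms(2)])
    show "((\<lambda>x. F j (f x)) has_derivative (\<lambda>v. F (Suc j) (f x) * frechet_derivative f (at x) v)) (at x)"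
      if "x \<in> U" for x
    proof -
      have "(F j has_derivative (\<lambda>t. F (Suc j) (f x) * t)) (at (f x))"
        using assms(1)[OF assms(3)[OF that]] by (simp add: has_field_derivative_def)
      from diff_chain_at[OF Ck_on_SucD[OF assms(2) Suc.prems that] this]
      show ?thesis by (simp add: o_def)
    qed
    show "Ck_on k U (\<lambda>x. F (Suc j) (f x) * frechet_derivative f (at x) v)" for v
      using Suc.prems Suc.IH Ck_on_Suc_imp[OF Suc.prems]
      by (intro Ck_on_bilinear[OF bounded_bilinear_mult assms(2)]) auto
  qed
qed

lemma Ck_on_exp:
  fixes f :: "'b::real_normed_vector \<Rightarrow> real"
  assumes "open U" "Ck_on k U f" shows "Ck_on k U (\<lambda>x. exp (f x))"
  using Ck_on_compose_real[of UNIV "\<lambda>_. exp" U f k 0] assms by (auto intro: DERIV_exp)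

lemma Ck_on_inverse:
  fixes f :: "'b::real_normed_vector \<Rightarrow> real"
  assumes "open U" "Ck_on k U f" "\<And>x. x \<in> U \<Longrightarrow> f x \<noteq> 0" shows "Ck_on k U (\<lambda>x. inverse (f x))"
proof -
  \<comment> \<open>The j-th derivative of 1/t is (-1)^j j! / t^(j+1).\<close>
  define F where "F j t = (- 1) ^ j * fact j * inverse t ^ Suc j" for j and t :: real
  have "(F j has_real_derivative F (Suc j) t) (at t)" if "t \<in> - {0}" for j t
  proof -
    have "(inverse has_real_derivative - (inverse t ^ Suc (Suc 0))) (at t)"
      using DERIV_inverse[of t UNIV] that by (simp add: numeral_2_eq_2)
    from DERIV_cmult[OF DERIV_power[OF this, of "Suc j"], of "(- 1) ^ j * fact j"]
    show ?thesis
      unfolding F_def by (simp add: algebra_simps)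
  qed
  from Ck_on_compose_real[of "-{0}" F U f k 0, OF this assms(1) _ assms(2)] assms(3)
  show ?thesis by (simp add: F_def)
qed

section \<open>Smooth functions, derivations, vector fields and brackets on a manifold\<close>

locale smooth_mfd =
  fixes A :: "('a::t2_space, 'n::finite) chart set"
  assumes A: "smooth_atlas A"
begin

lemma chart_inv:
  assumes "(V, \<psi>) \<in> A" "y \<in> \<psi> ` (U \<inter> V)"
  shows "inv_into V \<psi> y \<in> U \<inter> V" "\<psi> (inv_into V \<psi> y) = y"
proof -
  have "homeomorphism V (\<psi> ` V) \<psi> (inv_into V \<psi>)"
    using A assms(1) unfolding smooth_atlas_def by auto
  then show "inv_into V \<psi> y \<in> U \<inter> V" "\<psi> (inv_into V \<psi> y) = y"
    using assms(2) unfolding homeomorphism_def by auto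
qed

lemma open_chart_image:
  assumes "(V, \<psi>) \<in> A" "open U"
  shows "open (\<psi> ` (U \<inter> V))"
proof -
  have "open V" "open (\<psi> ` V)" "homeomorphism V (\<psi> ` V) \<psi> (inv_into V \<psi>)"
    using A assms(1) unfolding smooth_atlas_def by auto
  moreover have "openin (top_of_set V) (U \<inter> V)"
    using assms(2) by (metis Int_commute openin_open)
  ultimately show ?thesis
    by (meson homeomorphism_imp_open_map openin_open_eq)
qed

lemma smooth_fun_subset:
  "smooth_fun A U f \<Longrightarrow> open W \<Longrightarrow> W \<subseteq> U \<Longrightarrow> smooth_fun A W f"
  unfolding smooth_fun_def Cinf_on_def
  by (fastforce intro: Ck_on_subset)

lemma smooth_fun_cong:
  assumes "\<And>x. x \<in> U \<Longrightarrow> f x = g x" "smooth_fun A U f"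
  shows "smooth_fun A U g"
  unfolding smooth_fun_def Cinf_on_def
proof (intro conjI, safe)
  show U: "open U" using assms(2) by (simp add: smooth_fun_def)
  fix V \<psi> k assume V: "(V, \<psi>) \<in> A"
  have "Ck_on k (\<psi> ` (U \<inter> V)) (f \<circ> inv_into V \<psi>)"
    using assms(2) V unfolding smooth_fun_def Cinf_on_def by auto
  then show "Ck_on k (\<psi> ` (U \<inter> V)) (g \<circ> inv_into V \<psi>)"
    using Ck_on_cong[OF open_chart_image[OF V U], of "f \<circ> inv_into V \<psi>" "g \<circ> inv_into V \<psi>"]
      assms(1) chart_inv[OF V] by auto
qed

lemma smooth_funI:
  assumes "open U"
    and "\<And>V \<psi> k. (V, \<psi>) \<in> A \<Longrightarrow> open (\<psi> ` (U \<inter> V)) \<Longrightarrow> Ck_on k (\<psi> ` (U \<inter> V)) (\<lambda>y. f (inv_into V \<psi> y))"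
  shows "smooth_fun A U f"
  unfolding smooth_fun_def Cinf_on_def o_def using assms open_chart_image by fast

lemma smooth_funD: "smooth_fun A U f \<Longrightarrow> (V, \<psi>) \<in> A \<Longrightarrow> Ck_on k (\<psi> ` (U \<inter> V)) (\<lambda>y. f (inv_into V \<psi> y))"
  unfolding smooth_fun_def Cinf_on_def o_def by fast

lemma smooth_fun_open: "smooth_fun A U f \<Longrightarrow> open U"
  by (simp add: smooth_fun_def)

lemma smooth_fun_const: "open U \<Longrightarrow> smooth_fun A U (\<lambda>x. c)"
  by (rule smooth_funI) (simp_all add: Ck_on_const)

lemma smooth_fun_linear:
  assumes "bounded_linear L" "smooth_fun A U f"
  shows "smooth_fun A U (\<lambda>x. L (f x))"
  by (rule smooth_funI, rule smooth_fun_open[OF assms(2)], rule Ck_on_linear[OF assms(1)])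
    (simp_all add: smooth_funD[OF assms(2)])

lemma smooth_fun_bilinear:
  assumes "bounded_bilinear B" "smooth_fun A U f" "smooth_fun A U g"
  shows "smooth_fun A U (\<lambda>x. B (f x) (g x))"
  by (rule smooth_funI, rule smooth_fun_open[OF assms(2)], rule Ck_on_bilinear[OF assms(1)])
    (simp_all add: smooth_funD[OF assms(2)] smooth_funD[OF assms(3)])

lemma smooth_fun_add:
  assumes "smooth_fun A U f" "smooth_fun A U g"
  shows "smooth_fun A U (\<lambda>x. f x + g x)"
  by (rule smooth_funI, rule smooth_fun_open[OF assms(1)], rule Ck_on_add)
    (simp_all add: smooth_funD[OF assms(1)] smooth_funD[OF assms(2)])

lemma smooth_fun_exp:
  fixes f :: "'a \<Rightarrow> real"
  assumes "smooth_fun A U f"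
  shows "smooth_fun A U (\<lambda>x. exp (f x))"
  by (rule smooth_funI, rule smooth_fun_open[OF assms(1)], rule Ck_on_exp)
    (simp_all add: smooth_funD[OF assms(1)])

lemma smooth_fun_inverse:
  fixes f :: "'a \<Rightarrow> real"
  assumes "smooth_fun A U f" "\<And>x. x \<in> U \<Longrightarrow> f x \<noteq> 0"
  shows "smooth_fun A U (\<lambda>x. inverse (f x))"
  unfolding smooth_fun_def Cinf_on_def
proof (intro conjI, safe)
  show U: "open U" using assms by (simp add: smooth_fun_def)
  fix V \<psi> k assume V: "(V, \<psi>) \<in> A"
  show "Ck_on k (\<psi> ` (U \<inter> V)) ((\<lambda>x. inverse (f x)) \<circ> inv_into V \<psi>)"
    unfolding o_def
  proof (rule Ck_on_inverse[OF open_chart_image[OF V U]])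
    show "Ck_on k (\<psi> ` (U \<inter> V)) (\<lambda>x. f (inv_into V \<psi> x))"
      using assms(1) V unfolding smooth_fun_def Cinf_on_def o_def by auto
    show "f (inv_into V \<psi> x) \<noteq> 0" if "x \<in> \<psi> ` (U \<inter> V)" for x
      using assms(2) chart_inv(1)[OF V that] by auto
  qed
qed

lemma smooth_fun_mult:
  fixes f g :: "'a \<Rightarrow> 'c::real_normed_algebra"
  shows "smooth_fun A U f \<Longrightarrow> smooth_fun A U g \<Longrightarrow> smooth_fun A U (\<lambda>x. f x * g x)"
  by (rule smooth_fun_bilinear[OF bounded_bilinear_mult])

lemma smooth_fun_sum:
  assumes "open U" "\<And>i. i \<in> I \<Longrightarrow> smooth_fun A U (f i)"
  shows "smooth_fun A U (\<lambda>x. \<Sum>i\<in>I. f i x)"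
proof (cases "finite I")
  case True
  then show ?thesis using assms(2)
    by (induction I) (simp_all add: smooth_fun_add smooth_fun_const assms(1))
qed (simp add: smooth_fun_const assms(1))

lemma smooth_fun_prod:
  fixes f :: "'i \<Rightarrow> 'a \<Rightarrow> 'c::{real_normed_algebra,comm_ring_1}"
  assumes "open U" "\<And>i. i \<in> I \<Longrightarrow> smooth_fun A U (f i)"
  shows "smooth_fun A U (\<lambda>x. \<Prod>i\<in>I. f i x)"
proof (cases "finite I")
  case True
  then show ?thesis using assms(2)
    by (induction I) (simp_all add: smooth_fun_mult smooth_fun_const assms(1))
qed (simp add: smooth_fun_const assms(1))

text \<open>The Leibniz expansion is a polynomial in the entries. This is what makes the
  coefficients obtained from Cramer's rule smooth.\<close>

lemma smooth_fun_det:
  fixes M :: "'a \<Rightarrow> real ^ 'k ^ 'k::finite"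
  assumes "open U" "\<And>i j. smooth_fun A U (\<lambda>x. M x $ i $ j)"
  shows "smooth_fun A U (\<lambda>x. det (M x))"
  unfolding det_def
  by (intro smooth_fun_sum smooth_fun_mult smooth_fun_const smooth_fun_prod assms)

lemma smooth_fun_continuous:
  assumes f: "smooth_fun A U f"
  shows "continuous_on U f"
proof -
  have U: "open U" using f by (rule smooth_fun_open)
  have "isCont f x" if x: "x \<in> U" for x
  proof -
    obtain V \<psi> where V: "(V, \<psi>) \<in> A" "x \<in> V" using A unfolding smooth_atlas_def by force
    have "open V" "homeomorphism V (\<psi> ` V) \<psi> (inv_into V \<psi>)"
      using A V(1) unfolding smooth_atlas_def by auto
    then have \<psi>: "continuous_on V \<psi>" "\<And>y. y \<in> V \<Longrightarrow> inv_into V \<psi> (\<psi> y) = y"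
      by (auto simp: homeomorphism_def)
    have "Ck_on 0 (\<psi> ` (U \<inter> V)) (f \<circ> inv_into V \<psi>)"
      using f V(1) unfolding smooth_fun_def Cinf_on_def by blast
    then have "continuous_on (\<psi> ` (U \<inter> V)) (f \<circ> inv_into V \<psi>)" by simp
    then have "continuous_on (U \<inter> V) (\<lambda>y. (f \<circ> inv_into V \<psi>) (\<psi> y))"
      by (rule continuous_on_compose2) (auto intro: continuous_on_subset[OF \<psi>(1)])
    then have "continuous_on (U \<inter> V) f"
      by (rule continuous_on_eq) (use \<psi>(2) in auto)
    then show "isCont f x"
      using U \<open>open V\<close> x V(2) continuous_on_eq_continuous_at open_Int by blast
  qed
  then show ?thesis by (simp add: continuous_at_imp_continuous_on)
qed

subsection \<open>Tangent vectors as derivations\<close>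

lemma smooth_near_cong_on:
  assumes "open W" "x \<in> W" "\<And>y. y \<in> W \<Longrightarrow> f y = g y"
  shows "smooth_near A x f \<longleftrightarrow> smooth_near A x g"
proof -
  have "smooth_near A x g" if "\<And>y. y \<in> W \<Longrightarrow> f y = g y" "smooth_near A x f"
    for f g :: "'a \<Rightarrow> 'c::real_normed_vector"
  proof -
    obtain U where "x \<in> U" "smooth_fun A U f" using \<open>smooth_near A x f\<close> unfolding smooth_near_def by blast
    then have "smooth_fun A (U \<inter> W) f"
      using smooth_fun_subset[of U f "U \<inter> W"] smooth_fun_open[of U f] assms(1) by auto
    then have "smooth_fun A (U \<inter> W) g"
      by (rule smooth_fun_cong[rotated]) (use that in auto)
    then show ?thesis using \<open>x \<in> U\<close> assms(2) unfolding smooth_near_def by blast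
  qed
  then show ?thesis using assms(3) by metis
qed

lemma smooth_nearI: "smooth_fun A U f \<Longrightarrow> x \<in> U \<Longrightarrow> smooth_near A x f"
  unfolding smooth_near_def by blast

lemma smooth_near2E:
  assumes "smooth_near A x f" "smooth_near A x g"
  obtains U where "x \<in> U" "open U" "smooth_fun A U f" "smooth_fun A U g"
proof -
  obtain U V where "x \<in> U" "smooth_fun A U f" "x \<in> V" "smooth_fun A V g"
    using assms unfolding smooth_near_def by blast
  then show ?thesis
    using that[of "U \<inter> V"] smooth_fun_subset[of U f "U \<inter> V"] smooth_fun_subset[of V g "U \<inter> V"]
    by (auto simp: smooth_fun_def)
qed

lemma smooth_near_const: "smooth_near A x (\<lambda>y. c)"
  by (rule smooth_nearI[of UNIV]) (auto intro: smooth_fun_const)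

lemma smooth_near_add: "smooth_near A x f \<Longrightarrow> smooth_near A x g \<Longrightarrow> smooth_near A x (\<lambda>y. f y + g y)"
  by (erule (1) smooth_near2E, rule smooth_nearI, rule smooth_fun_add)

lemma smooth_near_mult:
  fixes f g :: "'a \<Rightarrow> 'c::real_normed_algebra"
  shows "smooth_near A x f \<Longrightarrow> smooth_near A x g \<Longrightarrow> smooth_near A x (\<lambda>y. f y * g y)"
  by (erule (1) smooth_near2E, rule smooth_nearI, rule smooth_fun_mult)

lemma smooth_near_linear:
  "bounded_linear L \<Longrightarrow> smooth_near A x f \<Longrightarrow> smooth_near A x (\<lambda>y. L (f y))"
  unfolding smooth_near_def using smooth_fun_linear[of L] by fast

lemma smooth_near_sum:
  assumes "\<And>i. i \<in> I \<Longrightarrow> smooth_near A x (f i)"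
  shows "smooth_near A x (\<lambda>y. \<Sum>i\<in>I. f i y)"
  using assms by (induction I rule: infinite_finite_induct) (simp_all add: smooth_near_add smooth_near_const)

lemma smooth_near_inverse:
  fixes f :: "'a \<Rightarrow> real"
  assumes "smooth_near A x f" "f x \<noteq> 0"
  shows "smooth_near A x (\<lambda>y. inverse (f y))"
proof -
  obtain U where U: "x \<in> U" "smooth_fun A U f" using assms unfolding smooth_near_def by blast
  define W where "W = {y\<in>U. f y \<noteq> 0}"
  have "W = U \<inter> f -` (- {0})" by (auto simp: W_def)
  then have "open W"
    using smooth_fun_continuous[OF U(2)] U(2)
    by (metis continuous_on_open_vimage open_Compl closed_singleton smooth_fun_def Int_commute)
  then have "smooth_fun A W (\<lambda>y. inverse (f y))"
    by (intro smooth_fun_inverse smooth_fun_subset[OF U(2)]) (auto simp: W_def)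
  then show ?thesis by (rule smooth_nearI) (use U assms(2) in \<open>simp add: W_def\<close>)
qed

context
  fixes x :: 'a and v :: "'a tvec"
  assumes v: "v \<in> tangent_space A x"
begin

lemma tv_smooth_lin:
  "smooth_near A x h \<Longrightarrow> smooth_near A x k \<Longrightarrow> v (\<lambda>y. a * h y + b * k y) = a * v h + b * v k"
  using v unfolding tangent_space_def by blast

lemma tv_mult:
  "smooth_near A x h \<Longrightarrow> smooth_near A x k \<Longrightarrow> v (\<lambda>y. h y * k y) = h x * v k + k x * v h"
  using v unfolding tangent_space_def by blast

lemma tv_nonsmooth: "\<not> smooth_near A x h \<Longrightarrow> v h = 0"
  using v unfolding tangent_space_def by blast

lemma tv_add: "smooth_near A x h \<Longrightarrow> smooth_near A x k \<Longrightarrow> v (\<lambda>y. h y + k y) = v h + v k"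
  using tv_smooth_lin[of h k 1 1] by simp

lemma tv_scale: "smooth_near A x h \<Longrightarrow> v (\<lambda>y. a * h y) = a * v h"
  using tv_smooth_lin[of h h a 0] by simp

text \<open>The Leibniz rule for 1 = 1 * 1 gives v(1) = 2 v(1).\<close>

lemma tv_const: "v (\<lambda>y. c) = 0"
proof -
  have "v (\<lambda>y. 1 * 1) = 1 * v (\<lambda>y. 1) + 1 * v (\<lambda>y. 1)"
    by (rule tv_mult) (rule smooth_near_const)+
  then have "v (\<lambda>y. 1) = v (\<lambda>y. 1) + v (\<lambda>y. 1)" by (simp only: mult_1_left)
  then have "v (\<lambda>y. 1) = 0" by linarith
  then show ?thesis using tv_scale[OF smooth_near_const[of _ 1], of c] by simp
qed

lemma tv_sum_fun:
  assumes "\<And>i. i \<in> I \<Longrightarrow> smooth_near A x (h i)"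
  shows "v (\<lambda>y. \<Sum>i\<in>I. c i * h i y) = (\<Sum>i\<in>I. c i * v (h i))"
  using assms
proof (induction I rule: infinite_finite_induct)
  case (insert i I)
  then have "v (\<lambda>y. c i * h i y + 1 * (\<Sum>i\<in>I. c i * h i y)) = c i * v (h i) + 1 * v (\<lambda>y. \<Sum>i\<in>I. c i * h i y)"
    by (intro tv_smooth_lin smooth_near_sum smooth_near_mult smooth_near_const) auto
  then show ?case using insert by simp
qed (simp_all add: tv_const)

end

lemma smooth_near_indicator:
  assumes "open W" "x \<in> W"
  shows "smooth_near A x (\<lambda>y. if y \<in> W then 1 else 0 :: real)"
  using smooth_near_cong_on[OF assms, of "\<lambda>y. if y \<in> W then 1 else 0" "\<lambda>y. 1::real"] smooth_near_const by auto

text \<open>The indicator of \<open>W\<close> takes the place of a bump function: it is smooth near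
  x, and it is idempotent with value 1 at x, so the Leibniz rule makes v vanish on it.
  Multiplication by it therefore changes neither v(h) nor v(k), and the two products are the same
  function.\<close>

lemma tv_cong_on:
  assumes v: "v \<in> tangent_space A x" and W: "open W" "x \<in> W" and eq: "\<And>y. y \<in> W \<Longrightarrow> h y = k y"
  shows "v h = v k"
proof (cases "smooth_near A x h")
  case True
  then have k: "smooth_near A x k" using smooth_near_cong_on[OF W, of h k] eq by simp
  let ?i = "\<lambda>y. if y \<in> W then 1 else 0 :: real"
  have i: "smooth_near A x ?i" by (rule smooth_near_indicator[OF W])
  have "v (\<lambda>y. ?i y * ?i y) = 2 * v ?i" using tv_mult[OF v i i] W by simp
  moreover have "(\<lambda>y. ?i y * ?i y) = ?i" by auto
  ultimately have "v ?i = 0" by simp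
  then have "v (\<lambda>y. ?i y * h y) = v h" "v (\<lambda>y. ?i y * k y) = v k"
    using tv_mult[OF v i True] tv_mult[OF v i k] W by simp_all
  moreover have "(\<lambda>y. ?i y * h y) = (\<lambda>y. ?i y * k y)" using eq by auto
  ultimately show ?thesis by simp
next
  case False
  then show ?thesis using smooth_near_cong_on[OF W, of h k] eq tv_nonsmooth[OF v] by simp
qed

text \<open>Differentiate \<open>h y * inverse (h y) = 1\<close>, an identity on a whole
  neighbourhood of x.\<close>

lemma tv_inverse:
  assumes v: "v \<in> tangent_space A x" and h: "smooth_near A x h" "h x \<noteq> 0"
  shows "v (\<lambda>y. inverse (h y)) = - v h / (h x)\<^sup>2"
proof -
  have i: "smooth_near A x (\<lambda>y. inverse (h y))" by (rule smooth_near_inverse[OF h])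
  obtain U where U: "x \<in> U" "smooth_fun A U h" using h(1) unfolding smooth_near_def by blast
  have "open (U \<inter> h -` (- {0}))"
    using smooth_fun_continuous[OF U(2)] U(2)
    by (metis continuous_on_open_vimage open_Compl closed_singleton smooth_fun_def Int_commute)
  then have "v (\<lambda>y. h y * inverse (h y)) = v (\<lambda>y. 1)"
    by (rule tv_cong_on[OF v]) (use U h in auto)
  then show ?thesis
    using tv_mult[OF v h(1) i] tv_const[OF v, of 1] h(2) by (simp add: field_simps power2_eq_square)
qed

lemma tangent_lin:
  "u \<in> tangent_space A x \<Longrightarrow> w \<in> tangent_space A x \<Longrightarrow> tv_lin a u b w \<in> tangent_space A x"
  unfolding tangent_space_def tv_lin_def by (simp add: algebra_simps)

lemma tangent_zero: "(\<lambda>_. 0) \<in> tangent_space A x"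
  unfolding tangent_space_def by simp

lemma tangent_sum:
  assumes "\<And>i. i \<in> I \<Longrightarrow> e i \<in> tangent_space A x"
  shows "tv_sum I c e \<in> tangent_space A x"
  using assms
proof (induction I rule: infinite_finite_induct)
  case (insert i I)
  then have "tv_lin (c i) (e i) 1 (tv_sum I c e) \<in> tangent_space A x" by (intro tangent_lin) auto
  then show ?case using insert by (simp add: tv_lin_def tv_sum_def)
qed (simp_all add: tv_sum_def tangent_zero)

lemma vf_on_subset: "vf_on A U X \<Longrightarrow> open W \<Longrightarrow> W \<subseteq> U \<Longrightarrow> vf_on A W X"
  unfolding vf_on_def by (meson subset_iff subset_trans)

lemma vf_on_lin:
  assumes "vf_on A U X" "vf_on A U Y" "smooth_fun A U a" "smooth_fun A U b"
  shows "vf_on A U (\<lambda>y k. a y * X y k + b y * Y y k)"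
  unfolding vf_on_def
proof (intro conjI ballI allI impI)
  show "open U" using assms(1) by (simp add: vf_on_def)
  show "(\<lambda>k. a y * X y k + b y * Y y k) \<in> tangent_space A y" if "y \<in> U" for y
    using tangent_lin[of "X y" y "Y y"] assms(1,2) that unfolding vf_on_def tv_lin_def by blast
  fix W and h :: "'a \<Rightarrow> real" assume W: "W \<subseteq> U" "smooth_fun A W h"
  have "open W" using W(2) by (simp add: smooth_fun_def)
  then show "smooth_fun A W (\<lambda>y. a y * X y h + b y * Y y h)"
    using assms W unfolding vf_on_def
    by (intro smooth_fun_add smooth_fun_mult) (auto intro: smooth_fun_subset[where U=U])
qed

lemma vf_on_zero: "open U \<Longrightarrow> vf_on A U (\<lambda>y k. 0)"
  unfolding vf_on_def by (simp add: tangent_zero smooth_fun_const smooth_fun_open)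

lemma vf_on_sum:
  assumes "open U" "\<And>i. i \<in> I \<Longrightarrow> vf_on A U (X i)" "\<And>i. i \<in> I \<Longrightarrow> smooth_fun A U (z i)"
  shows "vf_on A U (\<lambda>y k. \<Sum>i\<in>I. z i y * X i y k)"
  using assms(2,3)
proof (induction I rule: infinite_finite_induct)
  case (insert i I)
  then show ?case
    using vf_on_lin[of U "X i" "\<lambda>y k. \<Sum>i\<in>I. z i y * X i y k" "z i" "\<lambda>_. 1"]
    by (simp add: smooth_fun_const assms(1))
qed (simp_all add: vf_on_zero assms(1))

lemma vf_on_cong:
  assumes "\<And>y. y \<in> U \<Longrightarrow> X y = Y y" "vf_on A U X"
  shows "vf_on A U Y"
  unfolding vf_on_def
proof (intro conjI ballI allI impI)
  show "open U" "\<And>x. x \<in> U \<Longrightarrow> Y x \<in> tangent_space A x"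
    using assms unfolding vf_on_def by auto
  fix W and h :: "'a \<Rightarrow> real" assume W: "W \<subseteq> U" "smooth_fun A W h"
  then have "smooth_fun A W (\<lambda>y. X y h)" using assms(2) unfolding vf_on_def by blast
  then show "smooth_fun A W (\<lambda>y. Y y h)" by (rule smooth_fun_cong[rotated]) (use W assms in auto)
qed

lemma vf_near_tangent: "vf_near A x X \<Longrightarrow> X x \<in> tangent_space A x"
  unfolding vf_near_def vf_on_def by blast

lemma vf_near_smooth: "vf_near A x X \<Longrightarrow> smooth_near A x h \<Longrightarrow> smooth_near A x (\<lambda>y. X y h)" for h :: "'a \<Rightarrow> real"
proof -
  assume "vf_near A x X" "smooth_near A x h"
  then obtain U V where U: "x \<in> U" "vf_on A U X" and V: "x \<in> V" "smooth_fun A V h"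
    unfolding vf_near_def smooth_near_def by blast
  have "smooth_fun A (U \<inter> V) h"
    using U V by (intro smooth_fun_subset[OF V(2)]) (auto simp: vf_on_def smooth_fun_def)
  then have "smooth_fun A (U \<inter> V) (\<lambda>y. X y h)" using U unfolding vf_on_def by blast
  then show ?thesis using U V by (auto intro: smooth_nearI)
qed

lemma vf_near2E:
  assumes "vf_near A x X" "vf_near A x Y"
  obtains U where "x \<in> U" "open U" "vf_on A U X" "vf_on A U Y"
proof -
  obtain U V where "x \<in> U" "vf_on A U X" "x \<in> V" "vf_on A V Y"
    using assms unfolding vf_near_def by blast
  then show ?thesis
    using that[of "U \<inter> V"] vf_on_subset[of U X "U \<inter> V"] vf_on_subset[of V Y "U \<inter> V"]
    by (auto simp: vf_on_def)
qed

lemma vf_near_lin: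
  assumes "vf_near A x X" "vf_near A x Y" "smooth_near A x a" "smooth_near A x b"
  shows "vf_near A x (\<lambda>y k. a y * X y k + b y * Y y k)"
proof -
  obtain U where U: "x \<in> U" "open U" "vf_on A U X" "vf_on A U Y"
    using vf_near2E assms by metis
  obtain V where V: "x \<in> V" "open V" "smooth_fun A V a" "smooth_fun A V b"
    using smooth_near2E assms by metis
  have "vf_on A (U \<inter> V) (\<lambda>y k. a y * X y k + b y * Y y k)"
    by (rule vf_on_lin[OF vf_on_subset[OF U(3)] vf_on_subset[OF U(4)] smooth_fun_subset[OF V(3)]
        smooth_fun_subset[OF V(4)]]) (use U V in auto)
  then show ?thesis using U V unfolding vf_near_def by blast
qed

lemma vf_near_scale: "vf_near A x X \<Longrightarrow> smooth_near A x a \<Longrightarrow> vf_near A x (\<lambda>y k. a y * X y k)"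
  using vf_near_lin[of x X X a "\<lambda>_. 0"] by (simp add: smooth_near_const)

lemma vf_near_add: "vf_near A x X \<Longrightarrow> vf_near A x Y \<Longrightarrow> vf_near A x (\<lambda>y k. X y k + Y y k)"
  using vf_near_lin[of x X Y "\<lambda>_. 1" "\<lambda>_. 1"] by (simp add: smooth_near_const)

lemma vf_near_zero: "vf_near A x (\<lambda>y k. 0)"
  unfolding vf_near_def using vf_on_zero[of UNIV] by auto

lemma vf_near_cong_on:
  assumes "vf_near A x X" "open W" "x \<in> W" "\<And>y. y \<in> W \<Longrightarrow> X y = Y y"
  shows "vf_near A x Y"
proof -
  obtain U where "x \<in> U" "vf_on A U X" using assms(1) unfolding vf_near_def by blast
  then have "vf_on A (U \<inter> W) Y"
    using assms vf_on_subset[of U X "U \<inter> W"] by (intro vf_on_cong[of "U \<inter> W" X Y]) (auto simp: vf_on_def[of A U])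
  then show ?thesis using \<open>x \<in> U\<close> assms(3) unfolding vf_near_def by auto
qed

text \<open>Locality comes for free: multiply by the indicator function of a neighbourhood, which is
  smooth near its points.\<close>

lemma homogeneous_local:
  fixes F :: "'a vfield \<Rightarrow> 'v::real_vector"
  assumes scale: "\<And>k X. smooth_near A x k \<Longrightarrow> vf_near A x X \<Longrightarrow> F (\<lambda>y j. k y * X y j) = k x *\<^sub>R F X"
    and "vf_near A x X" "open W" "x \<in> W" "\<And>y. y \<in> W \<Longrightarrow> X y = Y y"
  shows "F X = F Y"
proof -
  let ?i = "\<lambda>y. if y \<in> W then 1 else 0 :: real"
  have i: "smooth_near A x ?i" by (rule smooth_near_indicator) fact+
  have "vf_near A x Y" using vf_near_cong_on assms by blast
  then have "F (\<lambda>y j. ?i y * X y j) = F X" "F (\<lambda>y j. ?i y * Y y j) = F Y"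
    using scale[OF i] assms(2,4) by simp_all
  moreover have "(\<lambda>y j. ?i y * X y j) = (\<lambda>y j. ?i y * Y y j)" using assms(5) by auto
  ultimately show ?thesis by simp
qed

lemma homogeneous_sum:
  fixes F :: "'a vfield \<Rightarrow> 'v::real_vector"
  assumes scale: "\<And>k X. smooth_near A x k \<Longrightarrow> vf_near A x X \<Longrightarrow> F (\<lambda>y j. k y * X y j) = k x *\<^sub>R F X"
    and add: "\<And>X Y. vf_near A x X \<Longrightarrow> vf_near A x Y \<Longrightarrow> F (\<lambda>y j. X y j + Y y j) = F X + F Y"
    and "\<And>i. i \<in> I \<Longrightarrow> vf_near A x (X i)" "\<And>i. i \<in> I \<Longrightarrow> smooth_near A x (z i)"
  shows "vf_near A x (\<lambda>y j. \<Sum>i\<in>I. z i y * X i y j)"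
    and "F (\<lambda>y j. \<Sum>i\<in>I. z i y * X i y j) = (\<Sum>i\<in>I. z i x *\<^sub>R F (X i))"
proof -
  have "vf_near A x (\<lambda>y j. \<Sum>i\<in>I. z i y * X i y j) \<and>
      F (\<lambda>y j. \<Sum>i\<in>I. z i y * X i y j) = (\<Sum>i\<in>I. z i x *\<^sub>R F (X i))"
    using assms(3,4)
  proof (induction I rule: infinite_finite_induct)
    case (insert i I)
    then show ?case
      using vf_near_add[OF vf_near_scale[of x "X i" "z i"], of "\<lambda>y j. \<Sum>i\<in>I. z i y * X i y j"]
        add[OF vf_near_scale[of x "X i" "z i"], of "\<lambda>y j. \<Sum>i\<in>I. z i y * X i y j"] scale
      by simp
  qed (use scale[OF smooth_near_const[of _ 0] vf_near_zero] in \<open>auto simp: vf_near_zero\<close>)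
  then show "vf_near A x (\<lambda>y j. \<Sum>i\<in>I. z i y * X i y j)"
    and "F (\<lambda>y j. \<Sum>i\<in>I. z i y * X i y j) = (\<Sum>i\<in>I. z i x *\<^sub>R F (X i))" by auto
qed

subsection \<open>Brackets\<close>

lemma bracket_apply: "smooth_near A x h \<Longrightarrow> bracket A X Y x h = X x (\<lambda>y. Y y h) - Y x (\<lambda>y. X y h)"
  by (simp add: bracket_def)

text \<open>The first order terms X(h) Y(k) + X(k) Y(h) of the second formula are symmetric in X and
  Y. They cancel in the commutator, which is why the bracket is again a derivation.\<close>

lemma vf_product:
  assumes X: "vf_near A x X" and Y: "vf_near A x Y" and "smooth_near A x h" "smooth_near A x k"
  shows "X x (\<lambda>y. Y y (\<lambda>z. a * h z + b * k z)) = a * X x (\<lambda>y. Y y h) + b * X x (\<lambda>y. Y y k)" (is ?lin)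
    and "X x (\<lambda>y. Y y (\<lambda>z. h z * k z)) =
      h x * X x (\<lambda>y. Y y k) + X x h * Y x k + k x * X x (\<lambda>y. Y y h) + X x k * Y x h" (is ?mul)
proof -
  obtain U where U: "x \<in> U" "open U" "smooth_fun A U h" "smooth_fun A U k"
    using smooth_near2E assms by metis
  obtain V where V: "x \<in> V" "open V" "vf_on A V Y" using Y unfolding vf_near_def vf_on_def by auto
  have W: "open (U \<inter> V)" "x \<in> U \<inter> V" using U V by auto
  have Xx: "X x \<in> tangent_space A x" using vf_near_tangent[OF X] .
  have sm: "smooth_near A y h" "smooth_near A y k" "Y y \<in> tangent_space A y" if "y \<in> U \<inter> V" for y
    using that U V by (auto intro: smooth_nearI simp: vf_on_def)
  have s: "smooth_near A x (\<lambda>y. Y y h)" "smooth_near A x (\<lambda>y. Y y k)"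
    using vf_near_smooth[OF Y] assms by auto
  have "X x (\<lambda>y. Y y (\<lambda>z. a * h z + b * k z)) = X x (\<lambda>y. a * Y y h + b * Y y k)"
    by (rule tv_cong_on[OF Xx W]) (use tv_smooth_lin sm in blast)
  then show ?lin using tv_smooth_lin[OF Xx s] by simp
  have "X x (\<lambda>y. Y y (\<lambda>z. h z * k z)) = X x (\<lambda>y. h y * Y y k + k y * Y y h)"
    by (rule tv_cong_on[OF Xx W]) (use tv_mult sm in blast)
  also have "\<dots> = X x (\<lambda>y. h y * Y y k) + X x (\<lambda>y. k y * Y y h)"
    by (intro tv_add[OF Xx] smooth_near_mult assms s)
  also have "\<dots> = h x * X x (\<lambda>y. Y y k) + Y x k * X x h + (k x * X x (\<lambda>y. Y y h) + Y x h * X x k)"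
    by (simp add: tv_mult[OF Xx] assms s)
  finally show ?mul by simp
qed

lemma bracket_tangent:
  assumes "vf_near A x X" "vf_near A x Y"
  shows "bracket A X Y x \<in> tangent_space A x"
  unfolding tangent_space_def
proof (intro CollectI conjI allI impI)
  fix h k :: "'a \<Rightarrow> real" and a b assume hk: "smooth_near A x h" "smooth_near A x k"
  have s: "smooth_near A x (\<lambda>y. a * h y + b * k y)" "smooth_near A x (\<lambda>y. h y * k y)"
    using hk by (intro smooth_near_add smooth_near_mult smooth_near_const; simp)+
  show "bracket A X Y x (\<lambda>y. a * h y + b * k y) = a * bracket A X Y x h + b * bracket A X Y x k"
    using vf_product(1)[OF assms hk] vf_product(1)[OF assms(2,1) hk] hk s
    by (simp add: bracket_apply algebra_simps)
  show "bracket A X Y x (\<lambda>y. h y * k y) = h x * bracket A X Y x k + k x * bracket A X Y x h"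
    using vf_product(2)[OF assms hk] vf_product(2)[OF assms(2,1) hk] hk s
    by (simp add: bracket_apply algebra_simps)
qed (simp add: bracket_def)

lemma bracket_vf_on:
  assumes "vf_on A U X" "vf_on A U Y"
  shows "vf_on A U (bracket A X Y)"
  unfolding vf_on_def
proof (intro conjI ballI allI impI)
  show "open U" using assms by (simp add: vf_on_def)
  show "bracket A X Y x \<in> tangent_space A x" if "x \<in> U" for x
    by (rule bracket_tangent) (use assms that in \<open>auto simp: vf_near_def\<close>)
  fix W and h :: "'a \<Rightarrow> real" assume W: "W \<subseteq> U" "smooth_fun A W h"
  have XY: "smooth_fun A W (\<lambda>y. X y h')" "smooth_fun A W (\<lambda>y. Y y h')" if "smooth_fun A W h'" for h'
    using assms W that unfolding vf_on_def by auto
  have "smooth_fun A W (\<lambda>y. X y (\<lambda>z. Y z h) + - 1 * Y y (\<lambda>z. X z h))"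
    by (intro smooth_fun_add smooth_fun_mult smooth_fun_const XY W) (use W in \<open>simp add: smooth_fun_def\<close>)
  then show "smooth_fun A W (\<lambda>y. bracket A X Y y h)"
    by (rule smooth_fun_cong[rotated]) (use W in \<open>simp add: bracket_apply smooth_nearI\<close>)
qed

lemma bracket_antisym: "bracket A Y X x = tv_lin (-1) (bracket A X Y x) 0 (bracket A X Y x)"
  by (auto simp: bracket_def tv_lin_def)

lemma bracket_add_left:
  assumes "vf_near A x X" "vf_near A x X'" "vf_near A x Y"
  shows "bracket A (\<lambda>y j. X y j + X' y j) Y x = tv_lin 1 (bracket A X Y x) 1 (bracket A X' Y x)"
proof
  fix h
  show "bracket A (\<lambda>y j. X y j + X' y j) Y x h = tv_lin 1 (bracket A X Y x) 1 (bracket A X' Y x) h"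
  proof (cases "smooth_near A x h")
    case True
    have "Y x (\<lambda>y. X y h + X' y h) = Y x (\<lambda>y. X y h) + Y x (\<lambda>y. X' y h)"
      by (rule tv_add[OF vf_near_tangent[OF assms(3)] vf_near_smooth[OF assms(1) True]
            vf_near_smooth[OF assms(2) True]])
    then show ?thesis using True by (simp add: bracket_apply tv_lin_def)
  qed (simp add: bracket_def tv_lin_def)
qed

lemma bracket_scale_left:
  assumes "vf_near A x X" "smooth_near A x k" "vf_near A x Y"
  shows "bracket A (\<lambda>y j. k y * X y j) Y x = tv_lin (k x) (bracket A X Y x) (- Y x k) (X x)"
proof
  fix h
  show "bracket A (\<lambda>y j. k y * X y j) Y x h = tv_lin (k x) (bracket A X Y x) (- Y x k) (X x) h"
  proof (cases "smooth_near A x h")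
    case True
    have "Y x (\<lambda>y. k y * X y h) = k x * Y x (\<lambda>y. X y h) + X x h * Y x k"
      by (rule tv_mult[OF vf_near_tangent[OF assms(3)] assms(2) vf_near_smooth[OF assms(1) True]])
    then show ?thesis using True by (simp add: bracket_apply tv_lin_def algebra_simps)
  next
    case False
    then show ?thesis using tv_nonsmooth[OF vf_near_tangent[OF assms(1)]] by (simp add: bracket_def tv_lin_def)
  qed
qed

end

text \<open>Steinitz exchange for families of tangent vectors, obtained from the vector space of all
  real functions on the test functions. As that theory speaks of sets, an independent family has to
  be shown injective.\<close>

lemma tv_exchange:
  fixes u :: "'i \<Rightarrow> 'a tvec" and w :: "'k \<Rightarrow> 'a tvec"
  assumes "finite I" "finite K" and span: "\<And>i. i \<in> I \<Longrightarrow> \<exists>c. u i = tv_sum K c w"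
    and indep: "\<And>c. tv_sum I c u = (\<lambda>_. 0) \<Longrightarrow> \<forall>i\<in>I. c i = 0"
  shows "card I \<le> card K"
proof -
  interpret V: vector_space "\<lambda>r (v :: 'a tvec) k. r * v k"
    by unfold_locales (auto simp: fun_eq_iff algebra_simps)
  have sum_eq: "tv_sum J c e = (\<Sum>i\<in>J. (\<lambda>k. c i * e i k))" for J :: "'j set" and c and e :: "'j \<Rightarrow> 'a tvec"
    by (induction J rule: infinite_finite_induct) (auto simp: tv_sum_def fun_eq_iff)
  have inj: "inj_on u I"
  proof (rule inj_onI, rule ccontr)
    fix i j assume ij: "i \<in> I" "j \<in> I" "u i = u j" "i \<noteq> j"
    \<comment> \<open>A repeated vector yields the nontrivial relation u_i - u_j = 0.\<close>
    define c where "c = (\<lambda>k. if k = i then 1 else if k = j then -1 else 0 :: real)"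
    have "(\<Sum>k\<in>I. c k * u k h) = (\<Sum>k\<in>{i, j}. c k * u k h)" for h
      by (rule sum.mono_neutral_right) (use ij assms(1) in \<open>auto simp: c_def\<close>)
    then have "tv_sum I c u = (\<lambda>_. 0)" using ij by (auto simp: tv_sum_def c_def)
    then show False using indep ij by (force simp: c_def)
  qed
  have "V.independent (u ` I)"
    unfolding V.dependent_finite[OF finite_imageI[OF assms(1)]]
  proof safe
    fix f i assume f: "(\<Sum>v\<in>u ` I. (\<lambda>k. f v * v k)) = 0" "f (u i) \<noteq> 0" "i \<in> I"
    have "tv_sum I (f \<circ> u) u = (\<lambda>_. 0)"
      unfolding sum_eq using f(1) by (simp add: sum.reindex[OF inj] zero_fun_def)
    from indep[OF this] f show False by auto
  qed
  moreover have "u ` I \<subseteq> V.span (w ` K)"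
  proof safe
    fix i assume "i \<in> I"
    from span[OF this] obtain c where c: "u i = tv_sum K c w" by blast
    show "u i \<in> V.span (w ` K)"
      unfolding c sum_eq by (intro V.span_sum V.span_scale V.span_base) auto
  qed
  ultimately have "card (u ` I) \<le> card (w ` K)"
    using V.independent_span_bound[of "w ` K" "u ` I"] assms(2) by auto
  then show ?thesis using card_image[OF inj] card_image_le[OF assms(2), of w] by simp
qed

text \<open>Linearity of \<open>L\<close> is asked on \<open>V\<close> only: forms, metrics and
  connections are unconstrained outside the tangent space or outside H(M).\<close>

lemma tv_linear_sum:
  fixes L :: "'a tvec \<Rightarrow> 'v::real_vector"
  assumes lin: "\<And>a b v w. v \<in> V \<Longrightarrow> w \<in> V \<Longrightarrow> L (tv_lin a v b w) = a *\<^sub>R L v + b *\<^sub>R L w"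
    and closed: "\<And>a b v w. v \<in> V \<Longrightarrow> w \<in> V \<Longrightarrow> tv_lin a v b w \<in> V" and zero: "(\<lambda>_. 0) \<in> V"
    and e: "\<And>i. i \<in> I \<Longrightarrow> e i \<in> V"
  shows "tv_sum I c e \<in> V" and "L (tv_sum I c e) = (\<Sum>i\<in>I. c i *\<^sub>R L (e i))"
proof -
  have "tv_sum I c e \<in> V \<and> L (tv_sum I c e) = (\<Sum>i\<in>I. c i *\<^sub>R L (e i))"
    using e
  proof (induction I rule: infinite_finite_induct)
    case (insert i I)
    have "tv_sum (insert i I) c e = tv_lin (c i) (e i) 1 (tv_sum I c e)"
      using insert.hyps by (simp add: tv_sum_def tv_lin_def)
    then show ?case using insert lin closed by simp
  qed (use lin[OF zero zero, of 0 0] zero in \<open>simp_all add: tv_sum_def tv_lin_def\<close>)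
  then show "tv_sum I c e \<in> V" "L (tv_sum I c e) = (\<Sum>i\<in>I. c i *\<^sub>R L (e i))" by blast+
qed

context smooth_mfd
begin

text \<open>A substitute for coordinates adapted to given vectors. By independence, the new vector
  minus its part along the old ones is a nonzero derivation, so some function detects it; corrected
  and normalised, this function completes the dual system.\<close>

lemma dual_functions:
  assumes "finite I" "\<And>i. i \<in> I \<Longrightarrow> e i \<in> tangent_space A x"
    and "\<And>c. tv_sum I c e = (\<lambda>_. 0) \<Longrightarrow> \<forall>i\<in>I. c i = 0"
  shows "\<exists>h. (\<forall>i\<in>I. smooth_near A x (h i)) \<and> (\<forall>i\<in>I. \<forall>j\<in>I. e i (h j) = (if i = j then 1 else 0))"
  using assms
proof (induction I)
  case (insert n I)
  have e: "e i \<in> tangent_space A x" if "i \<in> insert n I" for i using insert.prems(1) that by blast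
  have "\<exists>h. (\<forall>i\<in>I. smooth_near A x (h i)) \<and> (\<forall>i\<in>I. \<forall>j\<in>I. e i (h j) = (if i = j then 1 else 0))"
  proof (rule insert.IH)
    fix c assume c: "tv_sum I c e = (\<lambda>_. 0)"
    have "(\<Sum>i\<in>I. (c(n := 0)) i * e i k) = (\<Sum>i\<in>I. c i * e i k)" for k
      by (rule sum.cong) (use insert.hyps in auto)
    then have "tv_sum (insert n I) (c(n := 0)) e = (\<lambda>_. 0)"
      using c insert.hyps by (simp add: tv_sum_def fun_eq_iff)
    then show "\<forall>i\<in>I. c i = 0" using insert.prems(2)[of "c(n := 0)"] insert.hyps(2) by (auto simp: fun_upd_def split: if_splits)
  qed (use e in blast)
  then obtain h where h: "\<And>i. i \<in> I \<Longrightarrow> smooth_near A x (h i)"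
    "\<And>i j. i \<in> I \<Longrightarrow> j \<in> I \<Longrightarrow> e i (h j) = (if i = j then 1 else 0)" by blast
  \<comment> \<open>The coefficients of e_n minus its part along the old vectors. The relation is
    not zero because the coefficient of e_n is 1.\<close>
  define c where "c = (\<lambda>i. if i = n then 1 else - e n (h i))"
  have cs: "tv_sum (insert n I) c e = (\<lambda>k. e n k - (\<Sum>i\<in>I. e n (h i) * e i k))"
  proof
    fix k
    have "(\<Sum>i\<in>I. c i * e i k) = (\<Sum>i\<in>I. - (e n (h i) * e i k))"
      by (rule sum.cong) (use insert.hyps in \<open>auto simp: c_def\<close>)
    then show "tv_sum (insert n I) c e k = e n k - (\<Sum>i\<in>I. e n (h i) * e i k)"
      using insert.hyps by (simp add: tv_sum_def c_def sum_negf)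
  qed
  have "tv_sum (insert n I) c e \<noteq> (\<lambda>_. 0)" using insert.prems(2)[of c] by (auto simp: c_def)
  then obtain k where k: "tv_sum (insert n I) c e k \<noteq> 0" by blast
  have "tv_sum (insert n I) c e \<in> tangent_space A x" by (rule tangent_sum) (use e in blast)
  \<comment> \<open>Tangent vectors are 0 on functions that are not smooth near x, so a function
    with nonzero value is smooth.\<close>
  then have ks: "smooth_near A x k" using tv_nonsmooth k by blast
  \<comment> \<open>Subtracting the derivatives of \<open>k\<close> along the old vectors makes it
    constant to first order along them, and leaves a nonzero derivative along e_n.\<close>
  define k' where "k' = (\<lambda>y. 1 * k y + (-1) * (\<Sum>i\<in>I. e i k * h i y))"
  have sh: "smooth_near A x (\<lambda>y. \<Sum>i\<in>I. e i k * h i y)"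
    by (rule smooth_near_sum) (intro smooth_near_mult smooth_near_const h)
  have k's: "smooth_near A x k'"
    unfolding k'_def by (intro smooth_near_add smooth_near_mult smooth_near_const ks sh)
  have ek': "e j k' = e j k - (\<Sum>i\<in>I. e i k * e j (h i))" if "j \<in> insert n I" for j
    unfolding k'_def using tv_smooth_lin[OF e[OF that] ks sh, of 1 "-1"] tv_sum_fun[OF e[OF that], of I h "\<lambda>i. e i k"] h(1)
    by simp
  have z: "e j k' = 0" if "j \<in> I" for j
  proof -
    have "(\<Sum>i\<in>I. e i k * e j (h i)) = (\<Sum>i\<in>I. if i = j then e i k else 0)"
      by (rule sum.cong) (use h(2)[OF that] in auto)
    then show ?thesis using ek'[of j] that insert.hyps by simp
  qed
  have nz: "e n k' \<noteq> 0"
    using ek'[of n] k unfolding cs by (simp add: mult.commute)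
  define hn where "hn = (\<lambda>y. (1 / e n k') * k' y)"
  have hns: "smooth_near A x hn"
    unfolding hn_def by (intro smooth_near_mult smooth_near_const k's)
  have hn1: "e j hn = (if j = n then 1 else 0)" if "j \<in> insert n I" for j
    unfolding hn_def using tv_scale[OF e[OF that] k's, of "1 / e n k'"] z nz that by auto
  \<comment> \<open>The old dual functions are corrected to have derivative 0 along e_n; their
    derivatives along the old vectors do not change, since \<open>hn\<close> has none.\<close>
  define h' where "h' = (\<lambda>i. if i = n then hn else (\<lambda>y. 1 * h i y + (- e n (h i)) * hn y))"
  have h'e: "e j (h' i) = e j (h i) - e n (h i) * e j hn" if "j \<in> insert n I" "i \<in> I" for i j
    unfolding h'_def using tv_smooth_lin[OF e[OF that(1)] h(1)[OF that(2)] hns, of 1 "- e n (h i)"]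
      that(2) insert.hyps by auto
  have "smooth_near A x (h' i)" if "i \<in> insert n I" for i
  proof (cases "i = n")
    case False
    then have "i \<in> I" using that by blast
    have "smooth_near A x (\<lambda>y. 1 * h i y + (- e n (h i)) * hn y)"
      by (intro smooth_near_add smooth_near_mult smooth_near_const h(1) hns \<open>i \<in> I\<close>)
    then show ?thesis using False by (simp only: h'_def if_False)
  qed (simp add: h'_def hns)
  moreover have "e i (h' j) = (if i = j then 1 else 0)" if "i \<in> insert n I" "j \<in> insert n I" for i j
  proof (cases "j = n")
    case True
    then show ?thesis using hn1[OF that(1)] by (simp add: h'_def)
  next
    case False
    then have j: "j \<in> I" using that by blast
    show ?thesis
      using h'e[OF that(1) j] hn1[OF that(1)] h(2)[OF _ j] that j insert.hyps by auto
  qed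
  ultimately show ?case by blast
qed auto

end

section \<open>CR manifolds\<close>

locale cr =
  fixes C :: "('a::{t2_space, second_countable_topology}, 'n::finite) cr_structure"
  assumes spc: "strictly_pseudoconvex_cr C"
begin

abbreviation "\<A> \<equiv> charts C"
abbreviation "m \<equiv> crdim C"
abbreviation "TM \<equiv> tangent_space (charts C)"
abbreviation "H \<equiv> levi C"
abbreviation "J \<equiv> cplx C"

lemma crm: "cr_manifold C"
  using spc by (simp add: strictly_pseudoconvex_cr_def)

sublocale smooth_mfd "charts C"
  by unfold_locales (use crm in \<open>simp add: cr_manifold_def\<close>)

lemma card_n: "CARD('n) = 2 * m + 1"
  using crm by (simp add: cr_manifold_def corank1_subbundle_def)

lemma levi_frame:
  "\<exists>U e. x \<in> U \<and> open U \<and> (\<forall>a<2*m. hvf_on C U (e a)) \<and>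
    (\<forall>y\<in>U. H y = {tv_sum {..<2*m} c (\<lambda>a. e a y) | c. True}) \<and>
    (\<forall>y\<in>U. \<forall>c. tv_sum {..<2*m} c (\<lambda>a. e a y) = (\<lambda>_. 0) \<longrightarrow> (\<forall>a<2*m. c a = 0))"
proof -
  have "corank1_subbundle C" using crm by (simp add: cr_manifold_def)
  then have "\<exists>U e. x \<in> U \<and> (\<forall>a<2 * m. vf_on \<A> U (e a)) \<and> open U \<and>
      (\<forall>y\<in>U. H y = {tv_sum {..<2 * m} c (\<lambda>a. e a y) | c. True} \<and>
        (\<forall>c. tv_sum {..<2 * m} c (\<lambda>a. e a y) = (\<lambda>_. 0) \<longrightarrow> (\<forall>a<2 * m. c a = 0)))"
    unfolding corank1_subbundle_def by (elim conjE, erule_tac x = x in allE)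
  then obtain U e where U: "x \<in> U" "open U" "\<forall>a<2 * m. vf_on \<A> U (e a)"
    and *: "\<forall>y\<in>U. H y = {tv_sum {..<2 * m} c (\<lambda>a. e a y) | c. True} \<and>
        (\<forall>c. tv_sum {..<2 * m} c (\<lambda>a. e a y) = (\<lambda>_. 0) \<longrightarrow> (\<forall>a<2 * m. c a = 0))"
    by (elim exE conjE)
  have "e a y \<in> H y" if "a < 2 * m" "y \<in> U" for a y
  proof -
    have "e a y = tv_sum {..<2*m} (\<lambda>b. if b = a then 1 else 0) (\<lambda>a. e a y)"
    proof
      fix k
      have "(\<Sum>b<2*m. (if b = a then 1 else 0) * e b y k) = (\<Sum>b<2*m. if b = a then e b y k else 0)"
        by (rule sum.cong) auto
      then show "e a y k = tv_sum {..<2*m} (\<lambda>b. if b = a then 1 else 0) (\<lambda>a. e a y) k"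
        using that by (simp add: tv_sum_def)
    qed
    then show ?thesis using * that by blast
  qed
  then have "hvf_on C U (e a)" if "a < 2 * m" for a using U(3) that by (simp add: hvf_on_def)
  then show ?thesis using U(1,2) * by (intro exI[of _ U] exI[of _ e] conjI) auto
qed

lemma levi_tangent: "v \<in> H x \<Longrightarrow> v \<in> TM x"
proof -
  assume v: "v \<in> H x"
  obtain U e where U': "x \<in> U" "open U" "\<forall>a<2*m. hvf_on C U (e a)"
    "\<forall>y\<in>U. H y = {tv_sum {..<2*m} c (\<lambda>a. e a y) | c. True}"
    "\<forall>y\<in>U. \<forall>c. tv_sum {..<2*m} c (\<lambda>a. e a y) = (\<lambda>_. 0) \<longrightarrow> (\<forall>a<2*m. c a = 0)"
    using levi_frame[of x] by (elim exE conjE)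
  note U = U'[rule_format]
  then obtain c where "v = tv_sum {..<2*m} c (\<lambda>a. e a x)" using v by blast
  then show ?thesis using tangent_sum[of "{..<2*m}" "\<lambda>a. e a x" x c] U by (auto simp: hvf_on_def vf_on_def)
qed

lemma levi_lin: "v \<in> H x \<Longrightarrow> w \<in> H x \<Longrightarrow> tv_lin a v b w \<in> H x"
proof -
  assume vw: "v \<in> H x" "w \<in> H x"
  obtain U e where U': "x \<in> U" "open U" "\<forall>a<2*m. hvf_on C U (e a)"
    "\<forall>y\<in>U. H y = {tv_sum {..<2*m} c (\<lambda>a. e a y) | c. True}"
    "\<forall>y\<in>U. \<forall>c. tv_sum {..<2*m} c (\<lambda>a. e a y) = (\<lambda>_. 0) \<longrightarrow> (\<forall>a<2*m. c a = 0)"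
    using levi_frame[of x] by (elim exE conjE)
  note U = U'[rule_format]
  then obtain c d where "v = tv_sum {..<2*m} c (\<lambda>a. e a x)" "w = tv_sum {..<2*m} d (\<lambda>a. e a x)"
    using vw by blast
  then have "tv_lin a v b w = tv_sum {..<2*m} (\<lambda>i. a * c i + b * d i) (\<lambda>a. e a x)"
    by (simp add: tv_lin_def tv_sum_def fun_eq_iff sum_distrib_left sum.distrib algebra_simps)
  then show ?thesis using U by blast
qed

lemma levi_zero: "(\<lambda>_. 0) \<in> H x"
proof -
  obtain U e where U': "x \<in> U" "open U" "\<forall>a<2*m. hvf_on C U (e a)"
    "\<forall>y\<in>U. H y = {tv_sum {..<2*m} c (\<lambda>a. e a y) | c. True}"
    "\<forall>y\<in>U. \<forall>c. tv_sum {..<2*m} c (\<lambda>a. e a y) = (\<lambda>_. 0) \<longrightarrow> (\<forall>a<2*m. c a = 0)"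
    using levi_frame[of x] by (elim exE conjE)
  note U = U'[rule_format]
  moreover have "(\<lambda>_. 0) = tv_sum {..<2*m} (\<lambda>_. 0) (\<lambda>a. e a x)" by (simp add: tv_sum_def)
  ultimately show ?thesis by blast
qed

lemma levi_sum: "(\<And>i. i \<in> I \<Longrightarrow> e i \<in> H x) \<Longrightarrow> tv_sum I c e \<in> H x"
  by (rule tv_linear_sum(1)[where L = "\<lambda>_. 0 :: real", OF _ levi_lin levi_zero]) auto

text \<open>Together with the next bound this says that H(M) has dimension 2m at each point, once
  for independent and once for spanning families.\<close>

lemma levi_independent_bound:
  assumes "finite I" "\<And>i. i \<in> I \<Longrightarrow> u i \<in> H x"
    and "\<And>c. tv_sum I c u = (\<lambda>_. 0) \<Longrightarrow> \<forall>i\<in>I. c i = 0"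
  shows "card I \<le> 2 * m"
proof -
  obtain U e where U': "x \<in> U" "open U" "\<forall>a<2*m. hvf_on C U (e a)"
    "\<forall>y\<in>U. H y = {tv_sum {..<2*m} c (\<lambda>a. e a y) | c. True}"
    "\<forall>y\<in>U. \<forall>c. tv_sum {..<2*m} c (\<lambda>a. e a y) = (\<lambda>_. 0) \<longrightarrow> (\<forall>a<2*m. c a = 0)"
    using levi_frame[of x] by (elim exE conjE)
  note U = U'[rule_format]
  have "card I \<le> card {..<2*m}"
    by (rule tv_exchange[where u = u and w = "\<lambda>a. e a x"]) (use assms U in auto)
  then show ?thesis by simp
qed

lemma levi_spanning_bound:
  assumes "finite K" "\<And>v. v \<in> H x \<Longrightarrow> \<exists>c. v = tv_sum K c w"
  shows "2 * m \<le> card K"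
proof -
  obtain U e where U': "x \<in> U" "open U" "\<forall>a<2*m. hvf_on C U (e a)"
    "\<forall>y\<in>U. H y = {tv_sum {..<2*m} c (\<lambda>a. e a y) | c. True}"
    "\<forall>y\<in>U. \<forall>c. tv_sum {..<2*m} c (\<lambda>a. e a y) = (\<lambda>_. 0) \<longrightarrow> (\<forall>a<2*m. c a = 0)"
    using levi_frame[of x] by (elim exE conjE)
  note U = U'[rule_format]
  have "card {..<2*m} \<le> card K"
    by (rule tv_exchange[where u = "\<lambda>a. e a x" and w = w])
      (use U assms in \<open>auto simp: hvf_on_def\<close>)
  then show ?thesis by simp
qed

lemma J_levi: "v \<in> H x \<Longrightarrow> J x v \<in> H x"
  and JJ: "v \<in> H x \<Longrightarrow> J x (J x v) = tv_lin (-1) v 0 v"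
  and J_lin: "v \<in> H x \<Longrightarrow> w \<in> H x \<Longrightarrow> J x (tv_lin a v b w) = tv_lin a (J x v) b (J x w)"
  and J_vf: "hvf_on C U X \<Longrightarrow> hvf_on C U (cplx_vf C X)"
  using crm unfolding cr_manifold_def almost_complex_def by blast+

lemma hvf_near_vf: "hvf_near C x X \<Longrightarrow> vf_near \<A> x X"
  unfolding hvf_near_def hvf_on_def vf_near_def by blast

lemma hvf_near_levi: "hvf_near C x X \<Longrightarrow> X x \<in> H x"
  unfolding hvf_near_def hvf_on_def by blast

lemma hvf_near_J: "hvf_near C x X \<Longrightarrow> hvf_near C x (cplx_vf C X)"
  unfolding hvf_near_def using J_vf by blast

lemma hvf_on_subset: "hvf_on C U X \<Longrightarrow> open W \<Longrightarrow> W \<subseteq> U \<Longrightarrow> hvf_on C W X"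
  unfolding hvf_on_def using vf_on_subset by blast

lemma hvf_near2E:
  assumes "hvf_near C x X" "hvf_near C x Y"
  obtains U where "x \<in> U" "open U" "hvf_on C U X" "hvf_on C U Y"
proof -
  obtain U V where "x \<in> U" "hvf_on C U X" "x \<in> V" "hvf_on C V Y"
    using assms unfolding hvf_near_def by blast
  then show ?thesis
    using that[of "U \<inter> V"] hvf_on_subset[of U X "U \<inter> V"] hvf_on_subset[of V Y "U \<inter> V"]
    by (auto simp: hvf_on_def vf_on_def)
qed

lemma levi_extend:
  assumes "v \<in> H x"
  obtains X where "hvf_near C x X" "X x = v"
proof -
  obtain U e where U': "x \<in> U" "open U" "\<forall>a<2*m. hvf_on C U (e a)"
    "\<forall>y\<in>U. H y = {tv_sum {..<2*m} c (\<lambda>a. e a y) | c. True}"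
    "\<forall>y\<in>U. \<forall>c. tv_sum {..<2*m} c (\<lambda>a. e a y) = (\<lambda>_. 0) \<longrightarrow> (\<forall>a<2*m. c a = 0)"
    using levi_frame[of x] by (elim exE conjE)
  note U = U'[rule_format]
  obtain c where c: "v = tv_sum {..<2*m} c (\<lambda>a. e a x)" using assms U by blast
  let ?X = "\<lambda>y k. \<Sum>a<2*m. c a * e a y k"
  have "vf_on \<A> U ?X"
    by (rule vf_on_sum[of U "{..<2*m}" e "\<lambda>a y. c a"])
      (use U in \<open>auto simp: hvf_on_def smooth_fun_const\<close>)
  moreover have "?X y \<in> H y" if "y \<in> U" for y
    using levi_sum[of "{..<2*m}" "\<lambda>a. e a y" y c] U(3) that by (auto simp: hvf_on_def tv_sum_def)
  ultimately have "hvf_near C x ?X" using U unfolding hvf_near_def hvf_on_def by blast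
  then show ?thesis using that[of ?X] c by (simp add: tv_sum_def)
qed

end

lemma sum_lessThan_add: "(\<Sum>a<n + k. f a) = (\<Sum>a<n. f a) + (\<Sum>a<k. f (n + a :: nat))"
  for f :: "nat \<Rightarrow> 'b::comm_monoid_add"
  by (induction k) (auto simp: add.assoc)

section \<open>Pseudo-Hermitian structures: local frames, tensoriality, the Levi metric\<close>

locale pherm = cr C for C :: "('a::{t2_space, second_countable_topology}, 'n::finite) cr_structure" +
  fixes h :: "'a pherm"
  assumes ph: "pseudo_hermitian C h"
begin

abbreviation "\<theta> \<equiv> theta h"
abbreviation "T \<equiv> reeb h"
abbreviation "d\<theta> \<equiv> dtheta C h"
abbreviation "g \<equiv> gtheta C h"
abbreviation "D \<equiv> webster h"

lemma theta_one_form: "one_form \<A> \<theta>"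
  using ph by (simp add: pseudo_hermitian_def adapted_form_def)

lemma theta_lin: "u \<in> TM x \<Longrightarrow> w \<in> TM x \<Longrightarrow> \<theta> x (tv_lin a u b w) = a * \<theta> x u + b * \<theta> x w"
  using theta_one_form unfolding one_form_def by blast

lemma theta_lin': "u \<in> TM x \<Longrightarrow> w \<in> TM x \<Longrightarrow> \<theta> x (\<lambda>k. a * u k + b * w k) = a * \<theta> x u + b * \<theta> x w"
  using theta_lin[of u x w a b] by (simp add: tv_lin_def)

lemma theta_scale: "u \<in> TM x \<Longrightarrow> \<theta> x (\<lambda>k. a * u k) = a * \<theta> x u"
  using theta_lin'[of u x u a 0] by simp

lemma theta_add: "u \<in> TM x \<Longrightarrow> w \<in> TM x \<Longrightarrow> \<theta> x (\<lambda>k. u k + w k) = \<theta> x u + \<theta> x w"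
  using theta_lin'[of u x w 1 1] by simp

lemma theta_smooth: "vf_on \<A> U X \<Longrightarrow> smooth_fun \<A> U (\<lambda>y. \<theta> y (X y))"
  using theta_one_form unfolding one_form_def by blast

lemma theta_smooth_near: "vf_near \<A> x X \<Longrightarrow> smooth_near \<A> x (\<lambda>y. \<theta> y (X y))"
  unfolding vf_near_def smooth_near_def using theta_smooth by blast

lemma levi_iff: "v \<in> H x \<longleftrightarrow> v \<in> TM x \<and> \<theta> x v = 0"
  using ph unfolding pseudo_hermitian_def adapted_form_def by blast

lemma g_pos: "v \<in> H x \<Longrightarrow> v \<noteq> (\<lambda>_. 0) \<Longrightarrow> 0 < g x v v"
  using ph unfolding pseudo_hermitian_def adapted_form_def by blast

lemma reeb_vf: "vf_on \<A> UNIV T" and theta_reeb: "\<theta> x (T x) = 1"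
  and dtheta_reeb: "w \<in> TM x \<Longrightarrow> d\<theta> x (T x) w = 0"
  using ph unfolding pseudo_hermitian_def reeb_field_def by blast+

lemma reeb_near: "vf_near \<A> x T"
  unfolding vf_near_def using reeb_vf by blast

lemma reeb_tangent: "T x \<in> TM x"
  using vf_near_tangent[OF reeb_near] .

lemma tangent_split:
  assumes "v \<in> TM x"
  shows "(\<lambda>k. v k - \<theta> x v * T x k) \<in> H x"
proof -
  have "(\<lambda>k. v k - \<theta> x v * T x k) = tv_lin 1 v (- \<theta> x v) (T x)" by (simp add: tv_lin_def)
  then show ?thesis
    unfolding levi_iff using tangent_lin[OF assms reeb_tangent, of 1 "- \<theta> x v"]
      theta_lin[OF assms reeb_tangent, of 1 "- \<theta> x v"] by (simp add: theta_reeb)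
qed

text \<open>A frame of H(M) is completed by the Reeb field. The point is the smoothness of
  coefficients: applying a field to functions dual to the frame at x gives a linear system whose
  matrix is the identity at x, so near x Cramer's rule expresses the coefficients by smooth
  functions.\<close>

lemma local_frame:
  "\<exists>U fr. x \<in> U \<and> open U \<and> (\<forall>a<2*m. hvf_on C U (fr a)) \<and> fr (2*m) = T \<and>
    (\<forall>y\<in>U. \<forall>c. tv_sum {..2*m} c (\<lambda>a. fr a y) = (\<lambda>_. 0) \<longrightarrow> (\<forall>a\<le>2*m. c a = 0)) \<and>
    (\<forall>W X. vf_on \<A> W X \<longrightarrow> W \<subseteq> U \<longrightarrow> (\<exists>z. (\<forall>a\<le>2*m. smooth_fun \<A> W (z a)) \<and>
        (\<forall>y\<in>W. X y = (\<lambda>k. \<Sum>a\<le>2*m. z a y * fr a y k))))"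
proof -
  obtain U0 e where U0': "x \<in> U0" "open U0" "\<forall>a<2*m. hvf_on C U0 (e a)"
    "\<forall>y\<in>U0. H y = {tv_sum {..<2*m} c (\<lambda>a. e a y) | c. True}"
    "\<forall>y\<in>U0. \<forall>c. tv_sum {..<2*m} c (\<lambda>a. e a y) = (\<lambda>_. 0) \<longrightarrow> (\<forall>a<2*m. c a = 0)"
    using levi_frame[of x] by (elim exE conjE)
  note U0 = U0'[rule_format]
  define fr where "fr = (\<lambda>a. if a < 2 * m then e a else T)"
  have fr_vf: "vf_on \<A> U0 (fr a)" for a
    using U0(2,3) vf_on_subset[OF reeb_vf U0(2)] by (auto simp: fr_def hvf_on_def)
  have fr_tan: "fr a y \<in> TM y" if "y \<in> U0" for a y
    using fr_vf that by (auto simp: vf_on_def)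
  have sum_fr: "tv_sum {..2*m} c (\<lambda>a. fr a y) = (\<lambda>k. tv_sum {..<2*m} c (\<lambda>a. e a y) k + c (2*m) * T y k)" for c y
    by (simp add: tv_sum_def fr_def fun_eq_iff lessThan_Suc_atMost[symmetric])
  have e_levi: "tv_sum {..<2*m} c (\<lambda>a. e a y) \<in> H y" if "y \<in> U0" for c y
    using U0(4)[OF that] by blast
  have indep: "c a = 0" if "y \<in> U0" "tv_sum {..2*m} c (\<lambda>a. fr a y) = (\<lambda>_. 0)" "a \<le> 2 * m" for y c a
  proof -
    \<comment> \<open>Applying \<theta> removes the part in H(M) and isolates the coefficient of the
      Reeb field.\<close>
    have "\<theta> y (tv_lin 1 (tv_sum {..<2*m} c (\<lambda>a. e a y)) (c (2*m)) (T y)) = c (2*m)"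
      using theta_lin[OF levi_tangent[OF e_levi[OF that(1)]] reeb_tangent] e_levi[OF that(1), of c]
      by (simp add: levi_iff theta_reeb)
    moreover have "tv_lin 1 (tv_sum {..<2*m} c (\<lambda>a. e a y)) (c (2*m)) (T y) = (\<lambda>_. 0)"
      using that(2) unfolding sum_fr by (simp add: tv_lin_def)
    moreover have "\<theta> y (\<lambda>_. 0) = 0" using theta_scale[OF reeb_tangent, of y 0] by simp
    ultimately have c: "c (2*m) = 0" by simp
    then have "tv_sum {..<2*m} c (\<lambda>a. e a y) = (\<lambda>_. 0)" using that(2) unfolding sum_fr by simp
    then show ?thesis using U0(5)[OF that(1)] that(3) c by (cases "a = 2*m") auto
  qed
  have "\<exists>hf. (\<forall>i\<in>{..2*m}. smooth_near \<A> x (hf i)) \<and>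
      (\<forall>i\<in>{..2*m}. \<forall>j\<in>{..2*m}. fr i x (hf j) = (if i = j then 1 else 0))"
    by (rule dual_functions) (use fr_tan U0(1) indep in auto)
  then obtain hf where hf: "\<And>i. i \<le> 2*m \<Longrightarrow> smooth_near \<A> x (hf i)"
    "\<And>i j. i \<le> 2*m \<Longrightarrow> j \<le> 2*m \<Longrightarrow> fr i x (hf j) = (if i = j then 1 else 0)"
    by auto
  from hf(1) have "\<forall>i. \<exists>V. i \<le> 2*m \<longrightarrow> x \<in> V \<and> smooth_fun \<A> V (hf i)" unfolding smooth_near_def by blast
  then obtain V where V: "\<And>i. i \<le> 2*m \<Longrightarrow> x \<in> V i" "\<And>i. i \<le> 2*m \<Longrightarrow> smooth_fun \<A> (V i) (hf i)" by metis
  define U1 where "U1 = U0 \<inter> (\<Inter>i\<in>{..2*m}. V i)"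
  have U1: "open U1" "x \<in> U1" "U1 \<subseteq> U0"
  proof -
    have "open (\<Inter>i\<in>{..2*m}. V i)" by (rule open_INT) (use smooth_fun_open[OF V(2)] in auto)
    then show "open U1" unfolding U1_def using U0(2) by (rule open_Int[rotated])
  qed (use U0(1) V(1) in \<open>auto simp: U1_def\<close>)
  have hf1: "smooth_fun \<A> U1 (hf i)" if "i \<le> 2*m" for i
    by (rule smooth_fun_subset[OF V(2)[OF that] U1(1)]) (use that in \<open>auto simp: U1_def\<close>)
  \<comment> \<open>Matrices are indexed by a finite type, and \<open>'n\<close> has exactly the
    2m+1 elements that enumerate the frame.\<close>
  have "card (UNIV :: 'n set) = card {..2*m}" using card_n by simp
  then obtain \<beta> :: "'n \<Rightarrow> nat" where \<beta>: "bij_betw \<beta> UNIV {..2*m}"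
    using finite_same_card_bij[OF finite_class.finite_UNIV finite_atMost] by fastforce
  have \<beta>le: "\<beta> i \<le> 2*m" for i using \<beta> by (auto dest: bij_betwE)
  have \<beta>inj: "\<beta> i = \<beta> j \<longleftrightarrow> i = j" for i j using \<beta> by (auto simp: bij_betw_def inj_def)
  define M where "M y = (\<chi> j i. fr (\<beta> i) y (hf (\<beta> j)))" for y
  have "M x = mat 1"
    unfolding M_def mat_def vec_eq_iff using hf(2) \<beta>le \<beta>inj by auto
  then have detx: "det (M x) = 1" by simp
  have Ms: "smooth_fun \<A> U1 (\<lambda>y. M y $ j $ i)" for i j
    using vf_on_subset[OF fr_vf U1(1,3)] hf1[OF \<beta>le] by (simp add: M_def vf_on_def)
  then have ds: "smooth_fun \<A> U1 (\<lambda>y. det (M y))" by (rule smooth_fun_det[OF U1(1)])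
  define U where "U = U1 \<inter> (\<lambda>y. det (M y)) -` (- {0})"
  have U: "open U" "x \<in> U" "U \<subseteq> U1"
    using smooth_fun_continuous[OF ds] U1(1,2) detx unfolding U_def
    by (auto intro: continuous_open_preimage)
  show ?thesis
  proof (intro exI[of _ U] exI[of _ fr] conjI allI ballI impI)
    show "x \<in> U" "open U" using U by auto
    show "hvf_on C U (fr a)" if "a < 2 * m" for a
      using hvf_on_subset[OF U0(3)[OF that] U(1)] U(3) U1(3) that by (auto simp: fr_def)
    show "fr (2 * m) = T" by (simp add: fr_def)
    show "c a = 0" if "y \<in> U" "tv_sum {..2*m} c (\<lambda>a. fr a y) = (\<lambda>_. 0)" "a \<le> 2 * m" for y c a
      using indep[OF _ that(2,3)] that(1) U(3) U1(3) by auto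
    fix W X assume X: "vf_on \<A> W X" and WU: "W \<subseteq> U"
    have W: "open W" using X by (simp add: vf_on_def)
    have W1: "W \<subseteq> U1" using WU U(3) by blast
    \<comment> \<open>Cramer's rule: column \<open>a\<close> of the system matrix is replaced by the
      right hand side.\<close>
    define B where "B a y = (\<chi> i j. if j = a then X y (hf (\<beta> i)) else M y $ i $ j)" for a y
    define z where "z i y = det (B (inv_into UNIV \<beta> i) y) * inverse (det (M y))" for i y
    have Bs: "smooth_fun \<A> W (\<lambda>y. B a y $ k $ j)" for a k j
    proof (cases "j = a")
      case True
      have "smooth_fun \<A> W (\<lambda>y. X y (hf (\<beta> k)))"
        using X smooth_fun_subset[OF hf1[OF \<beta>le] W W1] unfolding vf_on_def by blast
      then show ?thesis using True by (simp add: B_def)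
    next
      case False
      then show ?thesis using smooth_fun_subset[OF Ms W W1] by (simp add: B_def)
    qed
    have ds': "smooth_fun \<A> W (\<lambda>y. inverse (det (M y)))"
      by (rule smooth_fun_inverse[OF smooth_fun_subset[OF ds W W1]]) (use WU in \<open>auto simp: U_def\<close>)
    have "smooth_fun \<A> W (z i)" for i
      unfolding z_def by (rule smooth_fun_mult[OF smooth_fun_det[OF W Bs] ds'])
    moreover have "X y = (\<lambda>k. \<Sum>a\<le>2*m. z a y * fr a y k)" if y: "y \<in> W" for y
    proof -
      have yU: "y \<in> U0" "y \<in> U1" "det (M y) \<noteq> 0" using y WU U1(3) by (auto simp: U_def)
      have Xt: "X y \<in> TM y" using X y by (simp add: vf_on_def)
      obtain c0 where c0: "(\<lambda>k. X y k - \<theta> y (X y) * T y k) = tv_sum {..<2*m} c0 (\<lambda>a. e a y)"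
        using tangent_split[OF Xt] U0(4)[OF yU(1)] by auto
      define c where "c = c0(2*m := \<theta> y (X y))"
      have c: "X y k = (\<Sum>a\<le>2*m. c a * fr a y k)" for k
      proof -
        have "(\<Sum>a\<le>2*m. c a * fr a y k) = (\<Sum>a<2*m. c0 a * e a y k) + \<theta> y (X y) * T y k"
          by (simp add: c_def fr_def lessThan_Suc_atMost[symmetric])
        then show ?thesis using fun_cong[OF c0, of k] by (simp add: tv_sum_def)
      qed
      have "M y *v (\<chi> i. c (\<beta> i)) = (\<chi> i. X y (hf (\<beta> i)))"
        using c sum.reindex_bij_betw[OF \<beta>, of "\<lambda>a. c a * fr a y (hf _)"]
        by (simp add: vec_eq_iff matrix_vector_mult_def M_def mult.commute)
      then have "(\<chi> i. c (\<beta> i)) = (\<chi> k. det (\<chi> i j. if j = k then (\<chi> i. X y (hf (\<beta> i))) $ i else M y $ i $ j) / det (M y))"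
        using cramer[OF yU(3)] by blast
      then have cz: "c (\<beta> i) = z (\<beta> i) y" for i
        using inv_into_f_f[of \<beta> UNIV i] \<beta>
        by (simp add: vec_eq_iff z_def B_def divide_inverse bij_betw_def cong: if_cong)
      have "c a = z a y" if "a \<le> 2*m" for a
      proof -
        have "a \<in> \<beta> ` UNIV" using \<beta> that by (simp add: bij_betw_def)
        then show ?thesis using cz by auto
      qed
      then show ?thesis using c by (auto simp: fun_eq_iff)
    qed
    ultimately show "\<exists>z. (\<forall>a\<le>2*m. smooth_fun \<A> W (z a)) \<and> (\<forall>y\<in>W. X y = (\<lambda>k. \<Sum>a\<le>2*m. z a y * fr a y k))"
      by blast
  qed
qed

text \<open>The local coefficients of a field with respect to a frame are smooth, so that an additive
  and \<open>C\<^sup>\<infinity>\<close>-homogeneous map on fields only sees the value of the field at the point.\<close>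

lemma tensorial:
  fixes F :: "'a vfield \<Rightarrow> 'v::real_vector"
  assumes scale: "\<And>k X. smooth_near \<A> x k \<Longrightarrow> vf_near \<A> x X \<Longrightarrow> F (\<lambda>y j. k y * X y j) = k x *\<^sub>R F X"
    and add: "\<And>X Y. vf_near \<A> x X \<Longrightarrow> vf_near \<A> x Y \<Longrightarrow> F (\<lambda>y j. X y j + Y y j) = F X + F Y"
    and XY: "vf_near \<A> x X" "vf_near \<A> x Y" "X x = Y x"
  shows "F X = F Y"
proof -
  obtain U fr where U': "x \<in> U" "open U" "\<forall>a<2*m. hvf_on C U (fr a)" "fr (2*m) = T"
    "\<forall>y\<in>U. \<forall>c. tv_sum {..2*m} c (\<lambda>a. fr a y) = (\<lambda>_. 0) \<longrightarrow> (\<forall>a\<le>2*m. c a = 0)"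
    "\<forall>W X. vf_on \<A> W X \<longrightarrow> W \<subseteq> U \<longrightarrow> (\<exists>z. (\<forall>a\<le>2*m. smooth_fun \<A> W (z a)) \<and>
        (\<forall>y\<in>W. X y = (\<lambda>k. \<Sum>a\<le>2*m. z a y * fr a y k)))"
    using local_frame[of x] by (elim exE conjE)
  note U = U'[rule_format]
  have fr: "vf_near \<A> x (fr a)" if "a \<le> 2*m" for a
    using U(1) U(3)[of a] U(4) reeb_near that unfolding hvf_on_def vf_near_def by (cases "a = 2*m") auto
  have coeffs: "\<exists>c. X x = tv_sum {..2*m} c (\<lambda>a. fr a x) \<and> F X = (\<Sum>a\<le>2*m. c a *\<^sub>R F (fr a))"
    if X: "vf_near \<A> x X" for X
  proof -
    obtain V where V: "x \<in> V" "vf_on \<A> V X" using X unfolding vf_near_def by blast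
    let ?W = "U \<inter> V"
    have W: "x \<in> ?W" "open ?W" using U V by (auto simp: vf_on_def)
    obtain z where z: "\<And>a. a \<le> 2*m \<Longrightarrow> smooth_fun \<A> ?W (z a)"
      "\<And>y. y \<in> ?W \<Longrightarrow> X y = (\<lambda>k. \<Sum>a\<le>2*m. z a y * fr a y k)"
      using U(6)[OF vf_on_subset[OF V(2) W(2)]] by auto
    have zn: "smooth_near \<A> x (z a)" if "a \<in> {..2*m}" for a using z(1)[of a] W(1) that by (auto intro: smooth_nearI)
    have "F X = F (\<lambda>y k. \<Sum>a\<in>{..2*m}. z a y * fr a y k)"
      by (rule homogeneous_local[where F = F and x = x, OF scale X W(2,1)]) (use z(2) in auto)
    also have "\<dots> = (\<Sum>a\<in>{..2*m}. z a x *\<^sub>R F (fr a))"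
      by (rule homogeneous_sum(2)[where F = F and x = x, OF scale add _ zn]) (use fr in auto)
    finally show ?thesis using z(2)[OF W(1)] by (auto simp: tv_sum_def)
  qed
  obtain c d where c: "X x = tv_sum {..2*m} c (\<lambda>a. fr a x)" "F X = (\<Sum>a\<le>2*m. c a *\<^sub>R F (fr a))"
    and d: "Y x = tv_sum {..2*m} d (\<lambda>a. fr a x)" "F Y = (\<Sum>a\<le>2*m. d a *\<^sub>R F (fr a))"
    using coeffs[OF XY(1)] coeffs[OF XY(2)] by blast
  have "tv_sum {..2*m} (\<lambda>a. c a - d a) (\<lambda>a. fr a x) = (\<lambda>_. 0)"
    using c(1) d(1) XY(3) by (simp add: tv_sum_def fun_eq_iff left_diff_distrib sum_subtractf)
  from U(5)[OF U(1) this] have "c a = d a" if "a \<le> 2*m" for a using that by simp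
  then show ?thesis using c(2) d(2) by simp
qed

lemma tangent_extend:
  assumes "v \<in> TM x"
  obtains X where "vf_near \<A> x X" "X x = v"
proof -
  obtain X where X: "hvf_near C x X" "X x = (\<lambda>k. v k - \<theta> x v * T x k)"
    using levi_extend[OF tangent_split[OF assms]] .
  have "vf_near \<A> x (\<lambda>y k. X y k + \<theta> x v * T y k)"
    by (intro vf_near_add vf_near_scale reeb_near smooth_near_const hvf_near_vf X)
  then show ?thesis using that X(2) by auto
qed

subsection \<open>The exterior derivative of the contact form\<close>

text \<open>Cartan's formula on vector fields; \<open>dtheta_fields\<close> identifies it with the
  point value described in \<open>ext_d\<close>.\<close>

definition ext_expr :: "'a \<Rightarrow> 'a vfield \<Rightarrow> 'a vfield \<Rightarrow> real" where
  "ext_expr x X Y = X x (\<lambda>y. \<theta> y (Y y)) - Y x (\<lambda>y. \<theta> y (X y)) - \<theta> x (bracket \<A> X Y x)"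

lemma ext_expr_antisym: "vf_near \<A> x X \<Longrightarrow> vf_near \<A> x Y \<Longrightarrow> ext_expr x Y X = - ext_expr x X Y"
  unfolding ext_expr_def bracket_antisym[of Y X] using bracket_tangent[of x X Y]
  by (simp add: theta_lin)

text \<open>The term Y(k) \<theta>(X) arises twice, from the Leibniz rule for Y(k \<theta>(X)) and
  from the bracket [kX, Y] = k [X, Y] - Y(k) X, with opposite signs.\<close>

lemma ext_expr_scale:
  assumes "smooth_near \<A> x k" "vf_near \<A> x X" "vf_near \<A> x Y"
  shows "ext_expr x (\<lambda>y j. k y * X y j) Y = k x *\<^sub>R ext_expr x X Y"
proof -
  obtain U where U: "x \<in> U" "vf_on \<A> U X" using assms(2) unfolding vf_near_def by blast
  have "Y x (\<lambda>y. \<theta> y (\<lambda>j. k y * X y j)) = Y x (\<lambda>y. k y * \<theta> y (X y))"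
    by (rule tv_cong_on[OF vf_near_tangent[OF assms(3)], of U])
      (use U in \<open>auto simp: vf_on_def theta_scale\<close>)
  also have "\<dots> = k x * Y x (\<lambda>y. \<theta> y (X y)) + \<theta> x (X x) * Y x k"
    by (rule tv_mult[OF vf_near_tangent[OF assms(3)] assms(1) theta_smooth_near[OF assms(2)]])
  finally show ?thesis
    using theta_lin[OF bracket_tangent[OF assms(2,3)] vf_near_tangent[OF assms(2)]]
    by (simp add: ext_expr_def bracket_scale_left[OF assms(2,1,3)] algebra_simps)
qed

lemma ext_expr_add:
  assumes "vf_near \<A> x X" "vf_near \<A> x X'" "vf_near \<A> x Y"
  shows "ext_expr x (\<lambda>y j. X y j + X' y j) Y = ext_expr x X Y + ext_expr x X' Y"
proof -
  obtain U where U: "x \<in> U" "open U" "vf_on \<A> U X" "vf_on \<A> U X'" using vf_near2E[OF assms(1,2)] .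
  have "Y x (\<lambda>y. \<theta> y (\<lambda>j. X y j + X' y j)) = Y x (\<lambda>y. \<theta> y (X y) + \<theta> y (X' y))"
    by (rule tv_cong_on[OF vf_near_tangent[OF assms(3)], of U])
      (use U in \<open>auto simp: vf_on_def theta_add\<close>)
  also have "\<dots> = Y x (\<lambda>y. \<theta> y (X y)) + Y x (\<lambda>y. \<theta> y (X' y))"
    by (rule tv_add[OF vf_near_tangent[OF assms(3)] theta_smooth_near[OF assms(1)] theta_smooth_near[OF assms(2)]])
  finally show ?thesis
    using theta_lin[OF bracket_tangent[OF assms(1,3)] bracket_tangent[OF assms(2,3)]]
    by (simp add: ext_expr_def bracket_add_left[OF assms] algebra_simps)
qed

text \<open>Antisymmetry reduces the second argument to the first.\<close>

lemma ext_expr_tensorial: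
  assumes "vf_near \<A> x X" "vf_near \<A> x X'" "X x = X' x" "vf_near \<A> x Y" "vf_near \<A> x Y'" "Y x = Y' x"
  shows "ext_expr x X Y = ext_expr x X' Y'"
proof -
  have *: "ext_expr x X Y = ext_expr x X' Y" if "vf_near \<A> x X" "vf_near \<A> x X'" "X x = X' x" "vf_near \<A> x Y"
    for X X' Y
    by (rule tensorial[where F = "\<lambda>X. ext_expr x X Y"]) (use that ext_expr_scale ext_expr_add in auto)
  have "ext_expr x X Y = ext_expr x X' Y" using * assms by blast
  also have "\<dots> = - ext_expr x Y X'" using ext_expr_antisym assms by metis
  also have "\<dots> = - ext_expr x Y' X'" using * assms by metis
  also have "\<dots> = ext_expr x X' Y'" using ext_expr_antisym assms by metis
  finally show ?thesis .
qed

lemma dtheta_fields: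
  assumes "vf_near \<A> x X" "vf_near \<A> x Y"
  shows "d\<theta> x (X x) (Y x) = ext_expr x X Y"
  unfolding dtheta_def ext_d_def
proof (rule the_equality)
  show "\<forall>X' Y'. vf_near \<A> x X' \<longrightarrow> vf_near \<A> x Y' \<longrightarrow> X' x = X x \<longrightarrow> Y' x = Y x \<longrightarrow>
     ext_expr x X Y = X' x (\<lambda>y. \<theta> y (Y' y)) - Y' x (\<lambda>y. \<theta> y (X' y)) - \<theta> x (bracket \<A> X' Y' x)"
    unfolding ext_expr_def[symmetric] using ext_expr_tensorial assms by metis
next
  fix c assume "\<forall>X' Y'. vf_near \<A> x X' \<longrightarrow> vf_near \<A> x Y' \<longrightarrow> X' x = X x \<longrightarrow> Y' x = Y x \<longrightarrow>
     c = X' x (\<lambda>y. \<theta> y (Y' y)) - Y' x (\<lambda>y. \<theta> y (X' y)) - \<theta> x (bracket \<A> X' Y' x)"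
  then show "c = ext_expr x X Y" unfolding ext_expr_def using assms by blast
qed

lemma dtheta_antisym: "v \<in> TM x \<Longrightarrow> w \<in> TM x \<Longrightarrow> d\<theta> x w v = - d\<theta> x v w"
  by (metis tangent_extend dtheta_fields ext_expr_antisym)

lemma dtheta_lin_left:
  assumes "u \<in> TM x" "v \<in> TM x" "w \<in> TM x"
  shows "d\<theta> x (tv_lin a u b v) w = a * d\<theta> x u w + b * d\<theta> x v w"
proof -
  obtain X where X: "vf_near \<A> x X" "X x = u" using tangent_extend[OF assms(1)] .
  obtain Y where Y: "vf_near \<A> x Y" "Y x = v" using tangent_extend[OF assms(2)] .
  obtain Z where Z: "vf_near \<A> x Z" "Z x = w" using tangent_extend[OF assms(3)] .
  have s: "vf_near \<A> x (\<lambda>y k. a * X y k)" "vf_near \<A> x (\<lambda>y k. b * Y y k)"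
    by (intro vf_near_scale smooth_near_const X Y)+
  have "d\<theta> x (tv_lin a u b v) w = ext_expr x (\<lambda>y k. a * X y k + b * Y y k) Z"
    using dtheta_fields[OF vf_near_add[OF s] Z(1)] X Y Z by (simp add: tv_lin_def)
  also have "\<dots> = a * ext_expr x X Z + b * ext_expr x Y Z"
    using ext_expr_add[OF s Z(1)] ext_expr_scale[OF smooth_near_const X(1) Z(1)]
      ext_expr_scale[OF smooth_near_const Y(1) Z(1)] by simp
  finally show ?thesis using dtheta_fields X Y Z by metis
qed

lemma dtheta_lin_right:
  "u \<in> TM x \<Longrightarrow> v \<in> TM x \<Longrightarrow> w \<in> TM x \<Longrightarrow> d\<theta> x w (tv_lin a u b v) = a * d\<theta> x w u + b * d\<theta> x w v"
  using dtheta_lin_left[of u x v w a b] dtheta_antisym[of u x w] dtheta_antisym[of v x w]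
    dtheta_antisym[of "tv_lin a u b v" x w] tangent_lin[of u x v a b] by simp

text \<open>\<theta>(X) and \<theta>(Y) vanish on a neighbourhood, so only the bracket term of
  Cartan's formula survives.\<close>

lemma dtheta_horizontal:
  assumes "hvf_near C x X" "hvf_near C x Y"
  shows "d\<theta> x (X x) (Y x) = - \<theta> x (bracket \<A> X Y x)"
proof -
  obtain U where U: "x \<in> U" "open U" "hvf_on C U X" "hvf_on C U Y" using hvf_near2E[OF assms] .
  have "X x (\<lambda>y. \<theta> y (Y y)) = X x (\<lambda>_. 0)" "Y x (\<lambda>y. \<theta> y (X y)) = Y x (\<lambda>_. 0)"
    by (rule tv_cong_on[OF vf_near_tangent[OF hvf_near_vf] U(2,1)]; use assms U in \<open>auto simp: hvf_on_def levi_iff\<close>)+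
  then show ?thesis
    using dtheta_fields[OF hvf_near_vf hvf_near_vf, OF assms] tv_const[OF vf_near_tangent[OF hvf_near_vf], OF assms(1)]
      tv_const[OF vf_near_tangent[OF hvf_near_vf], OF assms(2)] by (simp add: ext_expr_def)
qed

text \<open>This is the condition {JX,Y} + {X,JY} = 0 on the Levi bracket, read through \<theta>.
  Symmetry and J-invariance of the Levi metric follow from it.\<close>

lemma dtheta_J:
  assumes "v \<in> H x" "w \<in> H x"
  shows "d\<theta> x (J x v) w + d\<theta> x v (J x w) = 0"
proof -
  obtain X where X: "hvf_near C x X" "X x = v" using levi_extend[OF assms(1)] .
  obtain Y where Y: "hvf_near C x Y" "Y x = w" using levi_extend[OF assms(2)] .
  obtain U where U: "x \<in> U" "open U" "hvf_on C U X" "hvf_on C U Y" using hvf_near2E[OF X(1) Y(1)] .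
  note JX = hvf_near_J[OF X(1)] and JY = hvf_near_J[OF Y(1)]
  have "tv_lin 1 (bracket \<A> (cplx_vf C X) Y x) 1 (bracket \<A> X (cplx_vf C Y) x) \<in> H x"
    using spc U unfolding strictly_pseudoconvex_cr_def Let_def by blast
  then have "\<theta> x (bracket \<A> (cplx_vf C X) Y x) + \<theta> x (bracket \<A> X (cplx_vf C Y) x) = 0"
    using theta_lin[OF bracket_tangent bracket_tangent, OF hvf_near_vf[OF JX] hvf_near_vf[OF Y(1)]
        hvf_near_vf[OF X(1)] hvf_near_vf[OF JY], of 1 1] by (simp add: levi_iff)
  then show ?thesis
    using dtheta_horizontal[OF JX Y(1)] dtheta_horizontal[OF X(1) JY] X Y by (simp add: cplx_vf_def)
qed

subsection \<open>The Levi metric\<close>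

lemma g_lin_left: "u \<in> H x \<Longrightarrow> v \<in> H x \<Longrightarrow> w \<in> H x \<Longrightarrow> g x (tv_lin a u b v) w = a * g x u w + b * g x v w"
  by (simp add: gtheta_def dtheta_lin_left levi_tangent J_levi)

lemma dtheta_g: "v \<in> H x \<Longrightarrow> w \<in> H x \<Longrightarrow> d\<theta> x v w = 2 * g x (J x v) w"
  using dtheta_J[of v x "J x w"] dtheta_lin_right[of w x w v "-1" 0] JJ[of w x] J_levi levi_tangent
  by (simp add: gtheta_def)

lemma g_sym: "v \<in> H x \<Longrightarrow> w \<in> H x \<Longrightarrow> g x w v = g x v w"
  using dtheta_J[of v x w] dtheta_antisym[of w x "J x v"] J_levi levi_tangent by (simp add: gtheta_def)

lemma g_lin_right: "u \<in> H x \<Longrightarrow> v \<in> H x \<Longrightarrow> w \<in> H x \<Longrightarrow> g x w (tv_lin a u b v) = a * g x w u + b * g x w v"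
  using g_lin_left[of u x v w a b] g_sym levi_lin by simp

lemma g_JJ: "v \<in> H x \<Longrightarrow> w \<in> H x \<Longrightarrow> g x (J x v) (J x w) = g x v w"
  using dtheta_g[of v x "J x w"] J_levi[of w x] by (simp add: gtheta_def)

lemma g_J_skew: "v \<in> H x \<Longrightarrow> w \<in> H x \<Longrightarrow> g x v (J x w) = - g x (J x v) w"
  using g_JJ[of v x "J x w"] JJ[of w x] g_lin_right[of w x w "J x v" "-1" 0] J_levi by simp

lemma g_J_self: "v \<in> H x \<Longrightarrow> g x v (J x v) = 0"
  using g_J_skew[of v x v] g_sym[of v x "J x v"] J_levi by simp

lemma g_sum_left:
  assumes "\<And>i. i \<in> I \<Longrightarrow> e i \<in> H x" "w \<in> H x"
  shows "g x (tv_sum I c e) w = (\<Sum>i\<in>I. c i * g x (e i) w)"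
  using tv_linear_sum(2)[where L = "\<lambda>v. g x v w" and V = "H x" and c = c, OF _ levi_lin levi_zero assms(1)]
  by (simp add: g_lin_left assms(2))

lemma g_zero_iff: "v \<in> H x \<Longrightarrow> g x v v = 0 \<longleftrightarrow> v = (\<lambda>_. 0)"
  using g_pos[of v x] g_sum_left[of "{}" _ x v] by (force simp: tv_sum_def)

text \<open>The metric is defined through point values of d\<theta>; for horizontal fields it equals
  -1/2 \<theta>([X, JY]), which is visibly smooth.\<close>

lemma g_smooth:
  assumes "hvf_near C x X" "hvf_near C x Y"
  shows "smooth_near \<A> x (\<lambda>y. g y (X y) (Y y))"
proof -
  note JY = hvf_near_J[OF assms(2)]
  obtain U where U: "x \<in> U" "open U" "hvf_on C U X" "hvf_on C U (cplx_vf C Y)" using hvf_near2E[OF assms(1) JY] .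
  have "vf_on \<A> U (bracket \<A> X (cplx_vf C Y))"
    using U bracket_vf_on by (simp add: hvf_on_def)
  then have "smooth_near \<A> x (\<lambda>y. (- 1/2) * \<theta> y (bracket \<A> X (cplx_vf C Y) y))"
    using U by (intro smooth_near_mult smooth_near_const) (auto intro: smooth_nearI theta_smooth)
  moreover have "(- 1/2) * \<theta> y (bracket \<A> X (cplx_vf C Y) y) = g y (X y) (Y y)" if "y \<in> U" for y
  proof -
    have "hvf_near C y X" "hvf_near C y (cplx_vf C Y)" using U(3,4) that unfolding hvf_near_def by blast+
    from dtheta_horizontal[OF this] show ?thesis by (simp add: gtheta_def cplx_vf_def)
  qed
  ultimately show ?thesis using smooth_near_cong_on[OF U(2,1)] by (metis (no_types, lifting))
qed

subsection \<open>Unitary frames\<close>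

text \<open>The witness is v minus its orthogonal projection. It is used both to show that 2m
  orthonormal vectors span and to enlarge a unitary system.\<close>

lemma orthonormal_complement:
  fixes k :: nat
  assumes s: "\<And>a. a < k \<Longrightarrow> s a \<in> H x" "\<And>a b. a < k \<Longrightarrow> b < k \<Longrightarrow> g x (s a) (s b) = (if a = b then 1 else 0)"
    and v: "v \<in> H x" and ne: "v \<noteq> tv_sum {..<k} (\<lambda>a. g x v (s a)) s"
  obtains w where "w \<in> H x" "w \<noteq> (\<lambda>_. 0)" "\<forall>a<k. g x w (s a) = 0"
proof
  define p where "p = tv_sum {..<k} (\<lambda>a. g x v (s a)) s"
  have p: "p \<in> H x" unfolding p_def by (rule levi_sum) (use s in auto)
  show "tv_lin 1 v (-1) p \<in> H x" by (rule levi_lin[OF v p])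
  show "tv_lin 1 v (-1) p \<noteq> (\<lambda>_. 0)"
    using ne unfolding p_def[symmetric] tv_lin_def by (auto simp: fun_eq_iff)
  show "\<forall>a<k. g x (tv_lin 1 v (-1) p) (s a) = 0"
  proof (intro allI impI)
    fix a assume a: "a < k"
    have "g x p (s a) = (\<Sum>b<k. g x v (s b) * g x (s b) (s a))"
      unfolding p_def by (rule g_sum_left) (use s a in auto)
    also have "\<dots> = (\<Sum>b<k. if b = a then g x v (s b) else 0)"
      by (rule sum.cong) (use s(2) a in auto)
    finally have "g x p (s a) = g x v (s a)" using a by simp
    then show "g x (tv_lin 1 v (-1) p) (s a) = 0"
      using g_lin_left[OF v p s(1)[OF a], of 1 "-1"] by simp
  qed
qed

text \<open>A vector outside the span would yield a nonzero vector orthogonal to all s_a, and so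
  2m+1 independent vectors in H(M).\<close>

lemma orthonormal_expand:
  assumes "\<And>a. a < 2*m \<Longrightarrow> s a \<in> H x" "\<And>a b. a < 2*m \<Longrightarrow> b < 2*m \<Longrightarrow> g x (s a) (s b) = (if a = b then 1 else 0)"
    and v: "v \<in> H x"
  shows "v = tv_sum {..<2*m} (\<lambda>a. g x v (s a)) s"
proof (rule ccontr)
  assume "v \<noteq> tv_sum {..<2*m} (\<lambda>a. g x v (s a)) s"
  from orthonormal_complement[OF assms(1,2) v this]
  obtain w where w: "w \<in> H x" and w0: "w \<noteq> (\<lambda>_. 0)" and ws: "\<forall>a<2*m. g x w (s a) = 0" .
  define u where "u = (\<lambda>a. if a < 2*m then s a else w)"
  have "card {..2*m} \<le> 2*m"
  proof (rule levi_independent_bound)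
    show uH: "u i \<in> H x" if "i \<in> {..2*m}" for i using assms(1) w by (simp add: u_def)
    fix c assume c: "tv_sum {..2*m} c u = (\<lambda>_. 0)"
    show "\<forall>i\<in>{..2*m}. c i = 0"
    proof
      fix i assume i: "i \<in> {..2*m}"
      have gu: "g x (u b) (u i) = 0" if "b \<in> {..2*m}" "b \<noteq> i" for b
        using that i assms(2) ws g_sym[OF assms(1) w] by (auto simp: u_def)
      have "0 = g x (tv_sum {..2*m} c u) (u i)" unfolding c using g_sum_left[of "{}" _ x "u i"] uH[OF i] by (simp add: tv_sum_def)
      also have "\<dots> = (\<Sum>b\<le>2*m. c b * g x (u b) (u i))" by (rule g_sum_left) (use uH i in auto)
      also have "\<dots> = (\<Sum>b\<le>2*m. if b = i then c b * g x (u i) (u i) else 0)" by (rule sum.cong) (use gu in auto)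
      finally have "c i * g x (u i) (u i) = 0" using i by simp
      moreover have "g x (u i) (u i) \<noteq> 0"
        using assms(2)[of i i] g_zero_iff[OF w] w0 i by (auto simp: u_def)
      ultimately show "c i = 0" by simp
    qed
  qed simp
  then show False by simp
qed

lemma unitary_orthonormal:
  assumes "unitary_frame C h x e"
  defines "s \<equiv> \<lambda>a. if a < m then e a else J x (e (a - m))"
  shows "\<And>a. a < 2*m \<Longrightarrow> s a \<in> H x"
    and "\<And>a b. a < 2*m \<Longrightarrow> b < 2*m \<Longrightarrow> g x (s a) (s b) = (if a = b then 1 else 0)"
proof -
  have e: "\<And>a. a < m \<Longrightarrow> e a \<in> H x"
    "\<And>a b. a < m \<Longrightarrow> b < m \<Longrightarrow> g x (e a) (e b) = (if a = b then 1 else 0)"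
    "\<And>a b. a < m \<Longrightarrow> b < m \<Longrightarrow> g x (e a) (J x (e b)) = 0"
    using assms(1) unfolding unitary_frame_def by auto
  show "s a \<in> H x" if "a < 2*m" for a using e(1)[of a] J_levi[OF e(1), of "a - m"] that by (auto simp: s_def)
  show "g x (s a) (s b) = (if a = b then 1 else 0)" if "a < 2*m" "b < 2*m" for a b
    using e(2)[of a b] e(3)[of a "b - m"] e(3)[of b "a - m"] e(2)[of "a - m" "b - m"]
      g_JJ[OF e(1) e(1), of "a - m" "b - m"] g_sym[OF e(1) J_levi[OF e(1)], of b "a - m"] that
    by (auto simp: s_def)
qed

lemma unitary_expand:
  assumes e: "unitary_frame C h x e" and v: "v \<in> H x"
  shows "v = (\<lambda>k. \<Sum>a<m. g x v (e a) * e a k + g x v (J x (e a)) * J x (e a) k)"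
proof
  fix k
  define s where "s = (\<lambda>a. if a < m then e a else J x (e (a - m)))"
  have "v = tv_sum {..<2*m} (\<lambda>a. g x v (s a)) s"
    by (rule orthonormal_expand) (use unitary_orthonormal[OF e] v in \<open>auto simp: s_def\<close>)
  then have "v k = (\<Sum>a<m+m. g x v (s a) * s a k)" by (metis mult_2 tv_sum_def)
  also have "\<dots> = (\<Sum>a<m. g x v (s a) * s a k) + (\<Sum>a<m. g x v (s (m + a)) * s (m + a) k)"
    by (rule sum_lessThan_add)
  finally show "v k = (\<Sum>a<m. g x v (e a) * e a k + g x v (J x (e a)) * J x (e a) k)"
    by (simp add: s_def sum.distrib)
qed

text \<open>Complex Gram-Schmidt. As long as n < m, the 2n vectors e_a, Je_a do not span H(M); a
  unit vector orthogonal to all of them is also J-orthogonal to the e_a, since J is skew.\<close>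

lemma unitary_frame_exists: "\<exists>e. unitary_frame C h x e"
proof -
  define P where "P n e \<longleftrightarrow> (\<forall>a<n. e a \<in> H x) \<and> (\<forall>a<n. \<forall>b<n. g x (e a) (e b) = (if a = b then 1 else 0) \<and>
        g x (e a) (J x (e b)) = 0)" for n :: nat and e
  have "\<exists>e. P n e" if "n \<le> m" for n
    using that
  proof (induction n)
    case 0
    then show ?case by (simp add: P_def)
  next
    case (Suc n)
    then obtain e where "P n e" by auto
    then have e: "\<And>a. a < n \<Longrightarrow> e a \<in> H x"
      "\<And>a b. a < n \<Longrightarrow> b < n \<Longrightarrow> g x (e a) (e b) = (if a = b then 1 else 0)"
      "\<And>a b. a < n \<Longrightarrow> b < n \<Longrightarrow> g x (e a) (J x (e b)) = 0"
      by (auto simp: P_def)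
    define s where "s = (\<lambda>a. if a < n then e a else J x (e (a - n)))"
    have s: "s a \<in> H x" if "a < 2*n" for a using e(1)[of a] J_levi[OF e(1), of "a - n"] that by (auto simp: s_def)
    have gs: "g x (s a) (s b) = (if a = b then 1 else 0)" if "a < 2*n" "b < 2*n" for a b
      using e(2)[of a b] e(3)[of a "b - n"] e(3)[of b "a - n"] e(2)[of "a - n" "b - n"]
        g_JJ[OF e(1) e(1), of "a - n" "b - n"] g_sym[OF e(1) J_levi[OF e(1)], of b "a - n"] that
      by (auto simp: s_def)
    have "\<exists>v\<in>H x. \<forall>c. v \<noteq> tv_sum {..<2*n} c s"
    proof (rule ccontr)
      assume "\<not> ?thesis"
      then have "2 * m \<le> card {..<2*n}" by (intro levi_spanning_bound[where w = s and x = x]) auto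
      then show False using Suc.prems by simp
    qed
    then obtain v where v: "v \<in> H x" "v \<noteq> tv_sum {..<2*n} (\<lambda>a. g x v (s a)) s" by blast
    from orthonormal_complement[OF s gs v]
    obtain w where w: "w \<in> H x" and "w \<noteq> (\<lambda>_. 0)" and ws: "\<forall>a<2*n. g x w (s a) = 0" .
    then have wp: "0 < g x w w" using g_pos by blast
    define r where "r = 1 / sqrt (g x w w)"
    define w' where "w' = tv_lin r w 0 w"
    have w': "w' \<in> H x" unfolding w'_def by (rule levi_lin[OF w w])
    have w's: "g x w' (s a) = 0" if "a < 2*n" for a
      unfolding w'_def using g_lin_left[OF w w s[OF that]] ws that by simp
    have "g x w' w' = r * r * g x w w"
      unfolding w'_def using g_lin_left[OF w w w'[unfolded w'_def]] g_lin_right[OF w w w] by simp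
    then have w'1: "g x w' w' = 1" using wp by (simp add: r_def field_simps)
    have we: "g x w' (e a) = 0" "g x w' (J x (e a)) = 0" if "a < n" for a
      using w's[of a] w's[of "n + a"] that by (auto simp: s_def)
    have "P (Suc n) (e(n := w'))"
      unfolding P_def
    proof (intro conjI allI impI)
      fix a b assume ab: "a < Suc n" "b < Suc n"
      show "(e(n := w')) a \<in> H x" using ab e(1) w' by auto
      show "g x ((e(n := w')) a) ((e(n := w')) b) = (if a = b then 1 else 0)"
        using ab e(2) we(1) w'1 g_sym[OF e(1) w'] by (auto simp: less_Suc_eq)
      have "g x (e a) (J x w') = 0" if "a < n"
        using g_J_skew[OF e(1)[OF that] w'] g_sym[OF w' J_levi[OF e(1)[OF that]]] we(2)[OF that] by simp
      then show "g x ((e(n := w')) a) (J x ((e(n := w')) b)) = 0"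
        using ab e(3) we(2) g_J_self[OF w'] by (auto simp: less_Suc_eq)
    qed
    then show ?case by blast
  qed
  then show ?thesis unfolding P_def unitary_frame_def by blast
qed

lemma some_unitary: "unitary_frame C h x (some_unitary_frame C h x)"
  unfolding some_unitary_frame_def using unitary_frame_exists by (rule someI_ex)

text \<open>The transition matrix between orthonormal bases is orthogonal. Values in an arbitrary
  real vector space are allowed because spinor-valued bilinear maps are traced later.\<close>

lemma trace_orthonormal:
  fixes B :: "'a tvec \<Rightarrow> 'a tvec \<Rightarrow> 'v::real_vector"
  assumes lin1: "\<And>a b u v w. u \<in> H x \<Longrightarrow> v \<in> H x \<Longrightarrow> w \<in> H x \<Longrightarrow> B (tv_lin a u b v) w = a *\<^sub>R B u w + b *\<^sub>R B v w"
    and lin2: "\<And>a b u v w. u \<in> H x \<Longrightarrow> v \<in> H x \<Longrightarrow> w \<in> H x \<Longrightarrow> B w (tv_lin a u b v) = a *\<^sub>R B w u + b *\<^sub>R B w v"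
    and s: "\<And>a. a < 2*m \<Longrightarrow> s a \<in> H x" "\<And>a b. a < 2*m \<Longrightarrow> b < 2*m \<Longrightarrow> g x (s a) (s b) = (if a = b then 1 else 0)"
    and t: "\<And>a. a < 2*m \<Longrightarrow> t a \<in> H x" "\<And>a b. a < 2*m \<Longrightarrow> b < 2*m \<Longrightarrow> g x (t a) (t b) = (if a = b then 1 else 0)"
  shows "(\<Sum>a<2*m. B (s a) (s a)) = (\<Sum>a<2*m. B (t a) (t a))"
proof -
  have sum1: "B (tv_sum I c e) w = (\<Sum>i\<in>I. c i *\<^sub>R B (e i) w)"
    and sum2: "B w (tv_sum I c e) = (\<Sum>i\<in>I. c i *\<^sub>R B w (e i))"
    if "\<And>i. i \<in> I \<Longrightarrow> e i \<in> H x" "w \<in> H x" for I :: "nat set" and c e w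
    using tv_linear_sum(2)[where L = "\<lambda>v. B v w" and V = "H x" and c = c, OF _ levi_lin levi_zero that(1)]
      tv_linear_sum(2)[where L = "B w" and V = "H x" and c = c, OF _ levi_lin levi_zero that(1)]
      lin1 lin2 that(2) by auto
  have st: "s a = tv_sum {..<2*m} (\<lambda>b. g x (s a) (t b)) t" if "a < 2*m" for a
    by (rule orthonormal_expand) (use s t that in auto)
  \<comment> \<open>Orthogonality of the columns of the transition matrix: this is g(t_b, t_c)
    computed after expanding t_b in the basis s.\<close>
  have orth: "(\<Sum>a<2*m. g x (s a) (t b) * g x (s a) (t c)) = (if b = c then 1 else 0)" if "b < 2*m" "c < 2*m" for b c
  proof -
    have "t b = tv_sum {..<2*m} (\<lambda>a. g x (t b) (s a)) s"
      by (rule orthonormal_expand) (use s t that in auto)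
    then have "g x (t b) (t c) = (\<Sum>a<2*m. g x (t b) (s a) * g x (s a) (t c))"
      using g_sum_left[of "{..<2*m}" s x "t c" "\<lambda>a. g x (t b) (s a)"] s t that by simp
    also have "\<dots> = (\<Sum>a<2*m. g x (s a) (t b) * g x (s a) (t c))"
      by (rule sum.cong) (use s t that in \<open>auto simp: g_sym\<close>)
    finally show ?thesis using t(2)[OF that] by simp
  qed
  have "(\<Sum>a<2*m. B (s a) (s a)) = (\<Sum>a<2*m. \<Sum>b<2*m. \<Sum>c<2*m. (g x (s a) (t b) * g x (s a) (t c)) *\<^sub>R B (t b) (t c))"
  proof (rule sum.cong)
    fix a assume a: "a \<in> {..<2*m}"
    have "B (s a) (s a) = B (tv_sum {..<2*m} (\<lambda>b. g x (s a) (t b)) t) (s a)" using st a by simp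
    also have "\<dots> = (\<Sum>b<2*m. g x (s a) (t b) *\<^sub>R B (t b) (s a))" by (rule sum1) (use s t a in auto)
    also have "\<dots> = (\<Sum>b<2*m. g x (s a) (t b) *\<^sub>R (\<Sum>c<2*m. g x (s a) (t c) *\<^sub>R B (t b) (t c)))"
    proof (rule sum.cong)
      fix b assume b: "b \<in> {..<2*m}"
      have "B (t b) (s a) = B (t b) (tv_sum {..<2*m} (\<lambda>c. g x (s a) (t c)) t)" using st a by simp
      also have "\<dots> = (\<Sum>c<2*m. g x (s a) (t c) *\<^sub>R B (t b) (t c))" by (rule sum2) (use t b in auto)
      finally show "g x (s a) (t b) *\<^sub>R B (t b) (s a) = g x (s a) (t b) *\<^sub>R (\<Sum>c<2*m. g x (s a) (t c) *\<^sub>R B (t b) (t c))" by simp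
    qed simp
    finally show "B (s a) (s a) = (\<Sum>b<2*m. \<Sum>c<2*m. (g x (s a) (t b) * g x (s a) (t c)) *\<^sub>R B (t b) (t c))"
      by (simp add: scaleR_sum_right)
  qed simp
  also have "\<dots> = (\<Sum>b<2*m. \<Sum>c<2*m. \<Sum>a<2*m. (g x (s a) (t b) * g x (s a) (t c)) *\<^sub>R B (t b) (t c))"
    by (subst sum.swap, rule sum.cong[OF refl], subst sum.swap, rule refl)
  also have "\<dots> = (\<Sum>b<2*m. \<Sum>c<2*m. if c = b then B (t b) (t c) else 0)"
    by (intro sum.cong refl) (use orth in \<open>auto simp: scaleR_sum_left[symmetric]\<close>)
  finally show ?thesis by simp
qed

text \<open>The passage from sums over an uncontrolled chosen unitary frame to sums over a
  prescribed orthonormal frame. \<Theta> and the Dirac operators are evaluated in this way.\<close>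

lemma trace_unitary:
  fixes B :: "'a tvec \<Rightarrow> 'a tvec \<Rightarrow> 'v::real_vector"
  assumes lin1: "\<And>a b u v w. u \<in> H x \<Longrightarrow> v \<in> H x \<Longrightarrow> w \<in> H x \<Longrightarrow> B (tv_lin a u b v) w = a *\<^sub>R B u w + b *\<^sub>R B v w"
    and lin2: "\<And>a b u v w. u \<in> H x \<Longrightarrow> v \<in> H x \<Longrightarrow> w \<in> H x \<Longrightarrow> B w (tv_lin a u b v) = a *\<^sub>R B w u + b *\<^sub>R B w v"
    and s: "\<And>a. a < 2*m \<Longrightarrow> s a \<in> H x" "\<And>a b. a < 2*m \<Longrightarrow> b < 2*m \<Longrightarrow> g x (s a) (s b) = (if a = b then 1 else 0)"
    and e: "unitary_frame C h x e"
  shows "(\<Sum>a<m. B (e a) (e a) + B (J x (e a)) (J x (e a))) = (\<Sum>a<2*m. B (s a) (s a))"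
proof -
  define t where "t = (\<lambda>a. if a < m then e a else J x (e (a - m)))"
  have "(\<Sum>a<2*m. B (s a) (s a)) = (\<Sum>a<2*m. B (t a) (t a))"
    by (rule trace_orthonormal[OF lin1 lin2 s]) (use unitary_orthonormal[OF e] in \<open>auto simp: t_def\<close>)
  also have "\<dots> = (\<Sum>a<m+m. B (t a) (t a))" by (simp add: mult_2)
  also have "\<dots> = (\<Sum>a<m. B (t a) (t a)) + (\<Sum>a<m. B (t (m + a)) (t (m + a)))"
    by (rule sum_lessThan_add)
  finally show ?thesis by (simp add: t_def sum.distrib)
qed

end

section \<open>Calculus with the Webster--Tanaka connection\<close>

context pherm
begin

lemma connection: "connection_on_TM \<A> D"
  using ph unfolding pseudo_hermitian_def webster_tanaka_def Let_def by blast

lemma D_rules: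
  assumes "vf_near \<A> x Y" "vf_near \<A> x Z" "smooth_near \<A> x k" "u \<in> TM x" "w \<in> TM x"
  shows "D x u Y \<in> TM x"
    and "D x (tv_lin a u b w) Y = tv_lin a (D x u Y) b (D x w Y)"
    and "D x u (\<lambda>y. tv_lin 1 (Y y) 1 (Z y)) = tv_lin 1 (D x u Y) 1 (D x u Z)"
    and "D x u (\<lambda>y j. k y * Y y j) = tv_lin (u k) (Y x) (k x) (D x u Y)"
  using conjunct1[OF connection[unfolded connection_on_TM_def], rule_format, OF assms] by blast+

lemma D_tangent: "vf_near \<A> x Y \<Longrightarrow> u \<in> TM x \<Longrightarrow> D x u Y \<in> TM x"
  using D_rules(1)[of x Y Y "\<lambda>_. 0" u u] by (simp add: smooth_near_const)

lemma D_lin_dir: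
  "vf_near \<A> x Y \<Longrightarrow> u \<in> TM x \<Longrightarrow> w \<in> TM x \<Longrightarrow> D x (tv_lin a u b w) Y = tv_lin a (D x u Y) b (D x w Y)"
  using D_rules(2)[of x Y Y "\<lambda>_. 0" u w] by (simp add: smooth_near_const)

lemma D_add:
  "vf_near \<A> x Y \<Longrightarrow> vf_near \<A> x Z \<Longrightarrow> u \<in> TM x \<Longrightarrow>
    D x u (\<lambda>y j. Y y j + Z y j) = tv_lin 1 (D x u Y) 1 (D x u Z)"
  using D_rules(3)[of x Y Z "\<lambda>_. 0" u u] by (simp add: smooth_near_const tv_lin_def)

lemma D_scale:
  "vf_near \<A> x Y \<Longrightarrow> smooth_near \<A> x k \<Longrightarrow> u \<in> TM x \<Longrightarrow>
    D x u (\<lambda>y j. k y * Y y j) = tv_lin (u k) (Y x) (k x) (D x u Y)"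
  using D_rules(4)[of x Y Y k u u] by simp

text \<open>D is not tensorial in the field, so cutting off with an indicator also produces the
  derivative of the indicator; that derivative vanishes because the indicator is constant near
  x.\<close>

lemma D_local:
  assumes Y: "vf_near \<A> x Y" and u: "u \<in> TM x" and W: "open W" "x \<in> W" "\<And>y. y \<in> W \<Longrightarrow> Y y = Z y"
  shows "D x u Y = D x u Z"
proof -
  let ?i = "\<lambda>y. if y \<in> W then 1 else 0 :: real"
  have Z: "vf_near \<A> x Z" using vf_near_cong_on[OF Y W] .
  have i: "smooth_near \<A> x ?i" by (rule smooth_near_indicator[OF W(1,2)])
  have "u ?i = u (\<lambda>_. 1)" by (rule tv_cong_on[OF u W(1,2)]) simp
  then have "u ?i = 0" using tv_const[OF u] by simp
  then have "D x u (\<lambda>y j. ?i y * Y y j) = D x u Y" "D x u (\<lambda>y j. ?i y * Z y j) = D x u Z"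
    using D_scale[OF Y i u] D_scale[OF Z i u] W(2) by (simp_all add: tv_lin_def)
  moreover have "(\<lambda>y j. ?i y * Y y j) = (\<lambda>y j. ?i y * Z y j)" using W(3) by (auto simp: fun_eq_iff)
  ultimately show ?thesis by simp
qed

lemma webster: "webster_tanaka C h"
  using ph by (simp add: pseudo_hermitian_def)

lemma D_reeb: "v \<in> TM x \<Longrightarrow> D x v T = (\<lambda>_. 0)"
  using webster unfolding webster_tanaka_def Let_def by blast

lemma D_levi: "v \<in> TM x \<Longrightarrow> hvf_near C x Y \<Longrightarrow> D x v Y \<in> H x"
  using webster unfolding webster_tanaka_def Let_def by blast

lemma D_J: "v \<in> TM x \<Longrightarrow> hvf_near C x Y \<Longrightarrow> D x v (cplx_vf C Y) = J x (D x v Y)"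
  using webster unfolding webster_tanaka_def Let_def by blast

lemma D_metric:
  "v \<in> TM x \<Longrightarrow> hvf_near C x Y \<Longrightarrow> hvf_near C x Z \<Longrightarrow>
    v (\<lambda>y. g y (Y y) (Z y)) = g x (D x v Y) (Z x) + g x (Y x) (D x v Z)"
  using webster unfolding webster_tanaka_def Let_def by blast

lemma D_torsion:
  assumes "hvf_near C x X" "hvf_near C x Y"
  shows "D x (X x) Y k - D x (Y x) X k - bracket \<A> X Y x k = d\<theta> x (X x) (Y x) * T x k"
proof -
  have "tv_lin 1 (tv_lin 1 (D x (X x) Y) (-1) (D x (Y x) X)) (-1) (bracket \<A> X Y x)
      = (\<lambda>k. d\<theta> x (X x) (Y x) * T x k)"
    using webster assms unfolding webster_tanaka_def Let_def by blast
  from fun_cong[OF this, of k] show ?thesis by (simp add: tv_lin_def)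
qed

end

section \<open>Conformal change of the Webster--Tanaka connection\<close>

locale conformal = cr C + P: pherm C h + Q: pherm C h'
  for C :: "('a::{t2_space, second_countable_topology}, 'n::finite) cr_structure" and h h' +
  fixes f :: "'a \<Rightarrow> real"
  assumes f_smooth: "smooth_fun (charts C) UNIV f" and conf: "conformal_change C f h h'"
begin

abbreviation "u \<equiv> \<lambda>y. exp (f y)"

text \<open>On tangent vectors \<open>\<delta>\<close> is \<open>df\<close>, written as the logarithmic derivative of \<open>e\<^sup>f\<close> because all
  conformal factors are powers of \<open>e\<^sup>f\<close>, so that the Leibniz rule suffices.\<close>

definition \<delta> :: "'a \<Rightarrow> 'a tvec \<Rightarrow> real" where "\<delta> x v = v u / u x"

lemma u_smooth: "smooth_fun \<A> UNIV u"
  by (rule smooth_fun_exp[OF f_smooth])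

lemma u_near: "smooth_near \<A> x u"
  by (rule smooth_nearI[OF u_smooth]) simp

lemma tv_u: "v u = u x * \<delta> x v"
  by (simp add: \<delta>_def)

lemma \<delta>_lin: "\<delta> x (tv_lin a v b w) = a * \<delta> x v + b * \<delta> x w"
  by (simp add: \<delta>_def tv_lin_def add_divide_distrib)

lemma tv_u_square: "v \<in> TM x \<Longrightarrow> v (\<lambda>y. u y * u y) = 2 * (u x * u x) * \<delta> x v"
  using tv_mult[OF _ u_near u_near, of v x] by (simp add: tv_u[of v x])

lemma theta': "v \<in> TM x \<Longrightarrow> theta h' x v = (u x * u x) * theta h x v"
  using conf unfolding conformal_change_def by (simp add: exp_double power2_eq_square)

lemma dtheta':
  assumes "v \<in> H x" "w \<in> H x"
  shows "dtheta C h' x v w = (u x * u x) * dtheta C h x v w"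
proof -
  obtain X where X: "hvf_near C x X" "X x = v" using levi_extend[OF assms(1)] .
  obtain Y where Y: "hvf_near C x Y" "Y x = w" using levi_extend[OF assms(2)] .
  show ?thesis
    using P.dtheta_horizontal[OF X(1) Y(1)] Q.dtheta_horizontal[OF X(1) Y(1)] X(2) Y(2)
      theta'[OF bracket_tangent[OF hvf_near_vf[OF X(1)] hvf_near_vf[OF Y(1)]]] by simp
qed

lemma g': "v \<in> H x \<Longrightarrow> w \<in> H x \<Longrightarrow> Q.g x v w = (u x * u x) * P.g x v w"
  by (simp add: gtheta_def dtheta' J_levi)

text \<open>Both u^2 T' and T have \<theta>-value 1, so their difference is horizontal.\<close>

definition W :: "'a vfield" where "W x = (\<lambda>k. u x * u x * Q.T x k - P.T x k)"

lemma theta_Q_reeb: "(u x * u x) * theta h x (Q.T x) = 1"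
  using theta'[OF Q.reeb_tangent] Q.theta_reeb by simp

lemma W_vf: "vf_on \<A> UNIV W"
proof -
  have "vf_on \<A> UNIV (\<lambda>y k. (u y * u y) * Q.T y k + (-1) * P.T y k)"
    by (intro vf_on_lin P.reeb_vf Q.reeb_vf smooth_fun_mult u_smooth smooth_fun_const) simp
  then show ?thesis by (simp add: W_def[abs_def])
qed

lemma W_tv: "W x = tv_lin (u x * u x) (Q.T x) (-1) (P.T x)"
  by (simp add: W_def tv_lin_def)

lemma W_levi: "W x \<in> H x"
proof -
  have "W x \<in> TM x" using W_vf by (simp add: vf_on_def)
  moreover have "theta h x (W x) = 0"
    unfolding W_tv using P.theta_lin[OF Q.reeb_tangent P.reeb_tangent] theta_Q_reeb P.theta_reeb by simp
  ultimately show ?thesis using P.levi_iff by blast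
qed

lemma W_near: "hvf_near C x W"
  unfolding hvf_near_def hvf_on_def using W_vf W_levi by blast

text \<open>For horizontal Y the Reeb condition for \<theta>' gives \<theta>([T', Y]) = 0.
  Multiplying T' by u^2 adds -Y(u^2) T' to the bracket, and \<theta> of this is -2 \<delta>(Y); in
  d\<theta>(u^2 T', Y) the sign changes once more, while T contributes nothing.\<close>

lemma dtheta_W:
  assumes v: "v \<in> H x"
  shows "P.d\<theta> x (W x) v = 2 * \<delta> x v"
proof -
  obtain Y where Y: "hvf_near C x Y" "Y x = v" using levi_extend[OF v] .
  note Yv = hvf_near_vf[OF Y(1)] and Yt = vf_near_tangent[OF hvf_near_vf[OF Y(1)]]
  obtain U where U: "x \<in> U" "hvf_on C U Y" using Y(1) unfolding hvf_near_def by blast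
  have Uo: "open U" using U by (simp add: hvf_on_def vf_on_def)
  have TY: "Q.T x (\<lambda>y. theta h' y (Y y)) = 0"
    using tv_cong_on[OF Q.reeb_tangent Uo U(1), of "\<lambda>y. theta h' y (Y y)" "\<lambda>_. 0"] U tv_const[OF Q.reeb_tangent]
    by (auto simp: hvf_on_def Q.levi_iff)
  have "Q.ext_expr x Q.T Y = 0"
    using Q.dtheta_fields[OF Q.reeb_near Yv] Q.dtheta_reeb[OF Yt] by simp
  then have "theta h' x (bracket \<A> Q.T Y x) = 0"
    unfolding Q.ext_expr_def using TY tv_const[OF Yt] by (simp add: Q.theta_reeb)
  then have br0: "theta h x (bracket \<A> Q.T Y x) = 0"
    using theta'[OF bracket_tangent[OF Q.reeb_near Yv]] by simp
  \<comment> \<open>The multiple of T' that is normalised for \<theta>, so that \<theta>(Z) is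
    constant and differentiates to 0.\<close>
  define Z where "Z = (\<lambda>y k. (u y * u y) * Q.T y k)"
  have uu: "smooth_near \<A> x (\<lambda>y. u y * u y)" by (intro smooth_near_mult u_near)
  have Z: "vf_near \<A> x Z" unfolding Z_def by (intro vf_near_scale Q.reeb_near uu)
  have thZ: "theta h y (Z y) = 1" for y
    unfolding Z_def using P.theta_scale[OF Q.reeb_tangent] theta_Q_reeb by simp
  have ZY: "Z x (\<lambda>y. theta h y (Y y)) = 0"
    using tv_cong_on[OF vf_near_tangent[OF Z] Uo U(1), of "\<lambda>y. theta h y (Y y)" "\<lambda>_. 0"] U
      tv_const[OF vf_near_tangent[OF Z]]
    by (auto simp: hvf_on_def P.levi_iff)
  have "theta h x (bracket \<A> Z Y x) = - Y x (\<lambda>y. u y * u y) * theta h x (Q.T x)"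
    unfolding Z_def bracket_scale_left[OF Q.reeb_near uu Yv]
    using P.theta_lin[OF bracket_tangent[OF Q.reeb_near Yv] Q.reeb_tangent] br0 by simp
  also have "\<dots> = - 2 * \<delta> x (Y x) * ((u x * u x) * theta h x (Q.T x))"
    using tv_u_square[OF Yt] by simp
  finally have "theta h x (bracket \<A> Z Y x) = - 2 * \<delta> x v" using theta_Q_reeb Y(2) by simp
  then have "P.d\<theta> x (Z x) v = 2 * \<delta> x v"
    using P.dtheta_fields[OF Z Yv] ZY thZ tv_const[OF Yt] Y(2) by (simp add: P.ext_expr_def)
  moreover have "W x = tv_lin 1 (Z x) (-1) (P.T x)" by (simp add: W_def Z_def tv_lin_def)
  ultimately show ?thesis
    using P.dtheta_lin_left[OF vf_near_tangent[OF Z] P.reeb_tangent levi_tangent[OF v]]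
      P.dtheta_reeb[OF levi_tangent[OF v]] by simp
qed

text \<open>This is W = -JG. The gradient itself is not introduced as a vector field; it enters
  through g(G, Z) = \<delta>(Z) and g(JG, Z) = -\<delta>(JZ).\<close>

lemma g_W: "v \<in> H x \<Longrightarrow> P.g x (W x) v = \<delta> x (J x v)"
  by (simp add: gtheta_def dtheta_W J_levi)

text \<open>The change of the connection paired with Z, with G eliminated by g(G, Z) = \<delta>(Z)
  and g(JG, Z) = -\<delta>(JZ).\<close>

definition diff_form :: "'a \<Rightarrow> 'a tvec \<Rightarrow> 'a tvec \<Rightarrow> 'a tvec \<Rightarrow> real" where
  "diff_form x X Y Z = \<delta> x X * P.g x Y Z + \<delta> x Y * P.g x X Z - \<delta> x (J x X) * P.g x (J x Y) Z
    - \<delta> x (J x Y) * P.g x (J x X) Z - P.g x X Y * \<delta> x Z + P.g x (J x X) Y * \<delta> x (J x Z)"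

text \<open>The torsions are d\<theta>(X,Y) T and d\<theta>'(X,Y) T' = d\<theta>(X,Y) u^2 T', so
  they differ by d\<theta>(X,Y) W; the bracket is common to both.\<close>

lemma conn_diff_torsion:
  assumes "hvf_near C x X" "hvf_near C x Y" "Z \<in> H x"
  shows "P.g x (Q.D x (X x) Y) Z - P.g x (Q.D x (Y x) X) Z =
    P.g x (P.D x (X x) Y) Z - P.g x (P.D x (Y x) X) Z + 2 * P.g x (J x (X x)) (Y x) * \<delta> x (J x Z)"
proof -
  have XY: "X x \<in> H x" "Y x \<in> H x" using assms hvf_near_levi by auto
  note t = XY[THEN levi_tangent]
  have l: "Q.D x (Y x) X \<in> H x" "P.D x (X x) Y \<in> H x" "P.D x (Y x) X \<in> H x"
    using P.D_levi Q.D_levi t assms by auto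
  have "Q.D x (X x) Y = tv_lin 1 (tv_lin 1 (Q.D x (Y x) X) 1 (tv_lin 1 (P.D x (X x) Y) (-1) (P.D x (Y x) X)))
      (P.d\<theta> x (X x) (Y x)) (W x)"
  proof
    fix k
    have "Q.D x (X x) Y k - Q.D x (Y x) X k - (P.D x (X x) Y k - P.D x (Y x) X k)
        = P.d\<theta> x (X x) (Y x) * (u x * u x * Q.T x k - P.T x k)"
      using P.D_torsion[OF assms(1,2), of k] Q.D_torsion[OF assms(1,2), of k] dtheta'[OF XY]
      by (simp add: algebra_simps)
    then show "Q.D x (X x) Y k = tv_lin 1 (tv_lin 1 (Q.D x (Y x) X) 1 (tv_lin 1 (P.D x (X x) Y) (-1) (P.D x (Y x) X)))
      (P.d\<theta> x (X x) (Y x)) (W x) k"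
      by (simp add: tv_lin_def W_def)
  qed
  then show ?thesis
    using l W_levi levi_lin assms(3) P.dtheta_g[OF XY] g_W[OF assms(3)] by (simp add: P.g_lin_left)
qed

text \<open>Both metrics are parallel for their connections. Differentiating g' = u^2 g yields the
  extra term 2 \<delta>(v) g, and the factor u^2 is divided out.\<close>

lemma conn_diff_metric:
  assumes "v \<in> TM x" "hvf_near C x Y" "hvf_near C x Z"
  shows "P.g x (Q.D x v Y) (Z x) + P.g x (Y x) (Q.D x v Z) =
    P.g x (P.D x v Y) (Z x) + P.g x (Y x) (P.D x v Z) + 2 * \<delta> x v * P.g x (Y x) (Z x)"
proof -
  obtain U where U: "x \<in> U" "open U" "hvf_on C U Y" "hvf_on C U Z" using hvf_near2E[OF assms(2,3)] .
  have uu: "smooth_near \<A> x (\<lambda>y. u y * u y)" by (intro smooth_near_mult u_near)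
  have "v (\<lambda>y. Q.g y (Y y) (Z y)) = v (\<lambda>y. (u y * u y) * P.g y (Y y) (Z y))"
    by (rule tv_cong_on[OF assms(1) U(2,1)]) (use U g' in \<open>auto simp: hvf_on_def\<close>)
  also have "\<dots> = (u x * u x) * v (\<lambda>y. P.g y (Y y) (Z y)) + P.g x (Y x) (Z x) * v (\<lambda>y. u y * u y)"
    by (rule tv_mult[OF assms(1) uu P.g_smooth[OF assms(2,3)]])
  also have "\<dots> = (u x * u x) * (v (\<lambda>y. P.g y (Y y) (Z y)) + 2 * \<delta> x v * P.g x (Y x) (Z x))"
    by (simp add: tv_u_square[OF assms(1)] algebra_simps)
  finally have "(u x * u x) * (P.g x (Q.D x v Y) (Z x) + P.g x (Y x) (Q.D x v Z)) =
    (u x * u x) * (P.g x (P.D x v Y) (Z x) + P.g x (Y x) (P.D x v Z) + 2 * \<delta> x v * P.g x (Y x) (Z x))"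
    using Q.D_metric[OF assms] P.D_metric[OF assms] g'[OF Q.D_levi[OF assms(1,2)] hvf_near_levi[OF assms(3)]]
      g'[OF hvf_near_levi[OF assms(2)] Q.D_levi[OF assms(1,3)]]
    by (simp add: algebra_simps)
  then show ?thesis by simp
qed

text \<open>As for the Levi-Civita connection: a trilinear expression that is symmetric in the first two
  and skew in the last two arguments vanishes.\<close>

lemma conn_diff:
  assumes "X \<in> H x" "hvf_near C x Y" "Z \<in> H x"
  shows "P.g x (Q.D x X Y) Z = P.g x (P.D x X Y) Z + diff_form x X (Y x) Z"
proof -
  define F where "F X Y Z = P.g x (Q.D x (X x) Y) (Z x) - P.g x (P.D x (X x) Y) (Z x)
    - diff_form x (X x) (Y x) (Z x)" for X Y Z
  have sym: "F X Y Z = F Y X Z" if "hvf_near C x X" "hvf_near C x Y" "hvf_near C x Z" for X Y Z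
  proof -
    note l = that[THEN hvf_near_levi]
    have "P.g x (J x (Y x)) (X x) = - P.g x (J x (X x)) (Y x)"
      using P.g_J_skew[OF l(1,2)] P.g_sym[OF l(1) J_levi[OF l(2)]] by simp
    then show ?thesis
      using conn_diff_torsion[OF that(1,2) l(3)] P.g_sym[OF l(1,2)]
      by (simp add: F_def diff_form_def algebra_simps)
  qed
  have skew: "F X Y Z = - F X Z Y" if "hvf_near C x X" "hvf_near C x Y" "hvf_near C x Z" for X Y Z
  proof -
    note l = that[THEN hvf_near_levi]
    note t = l(1)[THEN levi_tangent]
    have "P.g x (J x (Z x)) (Y x) = - P.g x (J x (Y x)) (Z x)"
      using P.g_J_skew[OF l(2,3)] P.g_sym[OF l(2) J_levi[OF l(3)]] by simp
    moreover have "P.g x (Y x) (Q.D x (X x) Z) = P.g x (Q.D x (X x) Z) (Y x)"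
      "P.g x (Y x) (P.D x (X x) Z) = P.g x (P.D x (X x) Z) (Y x)"
      using P.g_sym[OF _ l(2)] Q.D_levi[OF t that(3)] P.D_levi[OF t that(3)] by auto
    ultimately show ?thesis
      using conn_diff_metric[OF t that(2,3)] P.g_sym[OF l(2,3)]
      by (simp add: F_def diff_form_def algebra_simps)
  qed
  obtain X' where X': "hvf_near C x X'" "X' x = X" using levi_extend[OF assms(1)] .
  obtain Z' where Z': "hvf_near C x Z'" "Z' x = Z" using levi_extend[OF assms(3)] .
  \<comment> \<open>Three uses of the symmetry and three of the skewness in alternation lead through
    all orderings back to the start, with total sign -1.\<close>
  have "F X' Y Z' = - F X' Y Z'"
    using sym[of X' Y Z'] skew[of Y X' Z'] sym[of Y Z' X'] skew[of Z' Y X'] sym[of Z' X' Y] skew[of X' Z' Y]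
      X' Z' assms(2) by simp
  then show ?thesis using X' Z' by (simp add: F_def)
qed

end

section \<open>Canonical forms\<close>

context cr
begin

text \<open>Canonical forms as functions of m+1 arguments indexed by natural numbers, which allows
  replacing one argument by a function update.\<close>

definition cform :: "'a \<Rightarrow> ((nat \<Rightarrow> 'a tvec) \<Rightarrow> complex) \<Rightarrow> bool" where
  "cform x \<Omega> \<longleftrightarrow>
    (\<forall>F G. (\<forall>i\<le>m. F i = G i) \<longrightarrow> \<Omega> F = \<Omega> G) \<and>
    (\<forall>F i u w a b. (\<forall>j\<le>m. F j \<in> TM x) \<longrightarrow> i \<le> m \<longrightarrow> u \<in> TM x \<longrightarrow> w \<in> TM x \<longrightarrow>
      \<Omega> (F(i := tv_lin a u b w)) = of_real a * \<Omega> (F(i := u)) + of_real b * \<Omega> (F(i := w))) \<and>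
    (\<forall>F i j. (\<forall>k\<le>m. F k \<in> TM x) \<longrightarrow> i \<le> m \<longrightarrow> j < i \<longrightarrow> F i = F j \<longrightarrow> \<Omega> F = 0) \<and>
    (\<forall>F X. (\<forall>j\<le>m. F j \<in> TM x) \<longrightarrow> X \<in> H x \<longrightarrow> \<Omega> (F(0 := X)) + \<i> * \<Omega> (F(0 := J x X)) = 0)"

lemma canonical_form_cform:
  assumes "canonical_form C x \<omega>"
  shows "cform x (\<lambda>F. \<omega> (map F [0..<m + 1]))"
proof -
  have upd: "map (F(i := v)) [0..<m + 1] = (map F [0..<m + 1])[i := v]" if "i \<le> m" for F :: "nat \<Rightarrow> 'a tvec" and i v
    by (rule nth_equalityI) (use that in \<open>auto simp del: upt_Suc simp: nth_list_update\<close>)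
  have tup: "tuple_at C x (map F [0..<m + 1])" if "\<forall>j\<le>m. F j \<in> TM x" for F
    using that by (auto simp: tuple_at_def simp del: upt_Suc)
  note cf = assms[unfolded canonical_form_def, rule_format, OF tup]
  show ?thesis
    unfolding cform_def
  proof (intro conjI allI impI)
    fix F G :: "nat \<Rightarrow> 'a tvec" assume "\<forall>i\<le>m. F i = G i"
    then have "map F [0..<m + 1] = map G [0..<m + 1]" by (intro map_cong) auto
    then show "\<omega> (map F [0..<m + 1]) = \<omega> (map G [0..<m + 1])" by (simp only:)
  next
    fix F i u w and a b :: real
    assume F: "\<forall>j\<le>m. F j \<in> TM x" and *: "i \<le> m" "u \<in> TM x" "w \<in> TM x"
    show "\<omega> (map (F(i := tv_lin a u b w)) [0..<m + 1]) =
      complex_of_real a * \<omega> (map (F(i := u)) [0..<m + 1]) + complex_of_real b * \<omega> (map (F(i := w)) [0..<m + 1])"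
      unfolding upd[OF *(1)] using conjunct1[OF cf[OF F]] * by auto
  next
    fix F i j assume F: "\<forall>k\<le>m. F k \<in> TM x" and *: "i \<le> m" "j < i" "F i = F j"
    have eq: "map F [0..<m + 1] ! i = map F [0..<m + 1] ! j" using * by (simp del: upt_Suc)
    show "\<omega> (map F [0..<m + 1]) = 0"
      by (rule conjunct1[OF conjunct2[OF cf[OF F]], rule_format, OF _ *(2) eq]) (use *(1) in simp)
  next
    fix F X assume F: "\<forall>j\<le>m. F j \<in> TM x" and X: "X \<in> H x"
    show "\<omega> (map (F(0 := X)) [0..<m + 1]) + \<i> * \<omega> (map (F(0 := J x X)) [0..<m + 1]) = 0"
      unfolding upd[OF le0] using conjunct2[OF conjunct2[OF cf[OF F]]] X by auto
  qed
qed

context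
  fixes x \<Omega>
  assumes cf: "cform x \<Omega>"
begin

lemma cf_cong: "(\<And>i. i \<le> m \<Longrightarrow> F i = G i) \<Longrightarrow> \<Omega> F = \<Omega> G"
  using cf unfolding cform_def by blast

lemma cf_lin: "(\<forall>j\<le>m. F j \<in> TM x) \<Longrightarrow> i \<le> m \<Longrightarrow> u \<in> TM x \<Longrightarrow> w \<in> TM x \<Longrightarrow>
    \<Omega> (F(i := tv_lin a u b w)) = of_real a * \<Omega> (F(i := u)) + of_real b * \<Omega> (F(i := w))"
  using cf unfolding cform_def by blast

lemma cf_alt: "(\<forall>k\<le>m. F k \<in> TM x) \<Longrightarrow> i \<le> m \<Longrightarrow> j \<le> m \<Longrightarrow> i \<noteq> j \<Longrightarrow> F i = F j \<Longrightarrow> \<Omega> F = 0"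
proof -
  assume *: "\<forall>k\<le>m. F k \<in> TM x" "i \<le> m" "j \<le> m" "i \<noteq> j" "F i = F j"
  have c: "\<forall>F i j. (\<forall>k\<le>m. F k \<in> TM x) \<longrightarrow> i \<le> m \<longrightarrow> j < i \<longrightarrow> F i = F j \<longrightarrow> \<Omega> F = 0"
    using cf unfolding cform_def by (elim conjE)
  show ?thesis
    using c[rule_format, of F i j] c[rule_format, of F j i] * by (cases "j < i") auto
qed

lemma cf_J0: "(\<forall>j\<le>m. F j \<in> TM x) \<Longrightarrow> X \<in> H x \<Longrightarrow> \<Omega> (F(0 := J x X)) = \<i> * \<Omega> (F(0 := X))"
proof -
  assume "\<forall>j\<le>m. F j \<in> TM x" "X \<in> H x"
  then have "\<Omega> (F(0 := X)) + \<i> * \<Omega> (F(0 := J x X)) = 0" using cf unfolding cform_def by blast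
  then have "\<Omega> (F(0 := X)) = - (\<i> * \<Omega> (F(0 := J x X)))" by (simp add: eq_neg_iff_add_eq_0)
  then show ?thesis by simp
qed

text \<open>Polarisation: the sum F_i + F_j is put into both slots, where the form vanishes.\<close>

lemma cf_swap:
  assumes F: "\<forall>j\<le>m. F j \<in> TM x" and ij: "i \<le> m" "j \<le> m" "i \<noteq> j"
  shows "\<Omega> (F(i := F j, j := F i)) = - \<Omega> F"
proof -
  define s where "s = tv_lin 1 (F i) 1 (F j)"
  note t = F[rule_format, OF ij(1)] F[rule_format, OF ij(2)]
  have s: "s \<in> TM x" unfolding s_def by (rule tangent_lin[OF t])
  have up: "(F(p := a, q := b)) k \<in> TM x" if "k \<le> m" "a \<in> TM x" "b \<in> TM x" for p q a b k
    using F[rule_format, OF that(1)] that by auto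
  have z: "\<Omega> (F(i := a, j := a)) = 0" if "a \<in> TM x" for a
    by (rule cf_alt[of _ i j]) (use up that ij in auto)
  have a: "\<Omega> (F(i := s, j := s)) = \<Omega> (F(i := s, j := F i)) + \<Omega> (F(i := s, j := F j))"
    using cf_lin[of "F(i := s)" j "F i" "F j" 1 1] F s t ij by (auto simp: s_def[symmetric])
  have b: "\<Omega> (F(i := s, j := b)) = \<Omega> (F(i := F i, j := b)) + \<Omega> (F(i := F j, j := b))" if "b \<in> TM x" for b
    unfolding fun_upd_twist[OF ij(3)]
    using cf_lin[of "F(j := b)" i "F i" "F j" 1 1] F s t ij that by (auto simp: s_def[symmetric])
  have "\<Omega> (F(i := F j, j := F i)) + \<Omega> F = 0"
    using a b[OF t(1)] b[OF t(2)] z[OF s] z[OF t(1)] z[OF t(2)]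
    by (simp only: fun_upd_triv add_0_left add_0_right)
  then show ?thesis by (simp add: eq_neg_iff_add_eq_0)
qed

text \<open>The type condition is stated for slot 0; a transposition carries it to slot i.\<close>

lemma cf_J:
  assumes F: "\<forall>j\<le>m. F j \<in> TM x" and "i \<le> m" "X \<in> H x"
  shows "\<Omega> (F(i := J x X)) = \<i> * \<Omega> (F(i := X))"
proof (cases "i = 0")
  case False
  have *: "\<Omega> (F(i := Y)) = - \<Omega> (F(i := F 0, 0 := Y))" if "Y \<in> TM x" for Y
    using cf_swap[of "F(i := Y)" 0 i] F assms(2) False that by (simp add: fun_upd_twist[of 0 i])
  have "\<Omega> ((F(i := F 0))(0 := J x X)) = \<i> * \<Omega> ((F(i := F 0))(0 := X))"
    by (rule cf_J0) (use F assms in auto)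
  then show ?thesis using *[OF levi_tangent[OF J_levi]] *[OF levi_tangent] assms(3) by simp
qed (use assms cf_J0 in auto)

lemma cf_sum:
  assumes F: "\<forall>j\<le>m. F j \<in> TM x" and "i \<le> m" "\<And>a. a \<in> I \<Longrightarrow> w a \<in> TM x"
  shows "\<Omega> (F(i := tv_sum I c w)) = (\<Sum>a\<in>I. of_real (c a) * \<Omega> (F(i := w a)))"
  using tv_linear_sum(2)[where L = "\<lambda>v. \<Omega> (F(i := v))" and V = "TM x" and c = c,
      OF _ tangent_lin tangent_zero assms(3)] cf_lin[OF F assms(2)]
  by (simp add: scaleR_conv_of_real)

text \<open>Slot 0 is left alone because it will hold a Reeb field, which rescales differently from
  the horizontal vectors.\<close>

lemma cf_scale:
  assumes F: "\<forall>j\<le>m. F j \<in> TM x"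
  shows "k \<le> m \<Longrightarrow> \<Omega> (\<lambda>i. if 1 \<le> i \<and> i \<le> k then (\<lambda>l. s * F i l) else F i) = of_real s ^ k * \<Omega> F"
proof (induction k)
  case 0
  have "(\<lambda>i. if 1 \<le> i \<and> i \<le> 0 then (\<lambda>l. s * F i l) else F i) = F" by auto
  then show ?case by simp
next
  case (Suc k)
  let ?G = "\<lambda>i. if 1 \<le> i \<and> i \<le> k then (\<lambda>l. s * F i l) else F i"
  have G: "\<forall>j\<le>m. ?G j \<in> TM x"
    using tangent_lin[OF F[rule_format] F[rule_format], of _ _ s 0] F by (simp add: tv_lin_def)
  have "(\<lambda>i. if 1 \<le> i \<and> i \<le> Suc k then (\<lambda>l. s * F i l) else F i) = ?G(Suc k := tv_lin s (F (Suc k)) 0 (F (Suc k)))"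
    by (auto simp: fun_eq_iff tv_lin_def le_Suc_eq)
  moreover have "?G(Suc k := F (Suc k)) = ?G" by (auto simp: fun_eq_iff)
  moreover have "\<Omega> (?G(Suc k := tv_lin s (F (Suc k)) 0 (F (Suc k)))) = of_real s * \<Omega> (?G(Suc k := F (Suc k)))"
    using cf_lin[OF G, of "Suc k" "F (Suc k)" "F (Suc k)" s 0] Suc.prems F by simp
  ultimately show ?case using Suc by simp
qed

lemma cf_permute:
  assumes F: "\<forall>j\<le>m. F j \<in> TM x" and p: "p permutes {..m}"
  shows "cmod (\<Omega> (F \<circ> p)) = cmod (\<Omega> F)"
  using finite_atMost p
proof (induction rule: permutes_rev_induct)
  case (swap a b p)
  have eq: "F \<circ> (p \<circ> Transposition.transpose a b) = (F \<circ> p)(a := (F \<circ> p) b, b := (F \<circ> p) a)"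
    using swap(3) by (auto simp: fun_eq_iff Transposition.transpose_def)
  have "\<forall>j\<le>m. (F \<circ> p) j \<in> TM x"
    using permutes_in_image[OF \<open>p permutes {..m}\<close>] F by auto
  then have sw: "\<Omega> ((F \<circ> p)(a := (F \<circ> p) b, b := (F \<circ> p) a)) = - \<Omega> (F \<circ> p)"
    by (rule cf_swap) (use swap(1-3) in auto)
  show ?case
    unfolding eq sw norm_minus_cancel using \<open>cmod (\<Omega> (F \<circ> p)) = cmod (\<Omega> F)\<close> .
qed simp

text \<open>An injective index map is a permutation of the slots; any other repeats an
  argument.\<close>

lemma cf_index:
  assumes F: "\<forall>j\<le>m. F j \<in> TM x" and j: "\<And>i. i \<le> m \<Longrightarrow> j i \<le> m"
  shows "cmod (\<Omega> (F \<circ> j)) = (if inj_on j {..m} then cmod (\<Omega> F) else 0)"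
proof (cases "inj_on j {..m}")
  case True
  define p where "p = (\<lambda>i. if i \<le> m then j i else i)"
  have "j ` {..m} = {..m}" using True j by (intro endo_inj_surj) auto
  then have "bij_betw p {..m} {..m}"
    using True by (auto simp: bij_betw_def p_def inj_on_def image_iff)
  then have "p permutes {..m}" by (rule bij_imp_permutes) (simp add: p_def)
  moreover have "\<Omega> (F \<circ> j) = \<Omega> (F \<circ> p)" by (rule cf_cong) (simp add: p_def)
  ultimately show ?thesis using cf_permute[OF F] True by simp
next
  case False
  then obtain a b where "a \<le> m" "b \<le> m" "a \<noteq> b" "j a = j b" by (auto simp: inj_on_def)
  then have "\<Omega> (F \<circ> j) = 0" by (intro cf_alt[of _ a b]) (use F j in auto)
  then show ?thesis using False by simp
qed

end

end

context pherm
begin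

definition hor :: "'a \<Rightarrow> 'a tvec \<Rightarrow> 'a tvec" where "hor x v = (\<lambda>k. v k - \<theta> x v * T x k)"

text \<open>The vectors T, e_0, ..., e_(m-1) are a complex basis of the complexified tangent space
  modulo T01, the space on which canonical forms are top-degree forms.\<close>

definition adapted_basis :: "'a \<Rightarrow> (nat \<Rightarrow> 'a tvec) \<Rightarrow> nat \<Rightarrow> 'a tvec" where
  "adapted_basis x e = case_nat (T x) e"

text \<open>The complex coordinates modulo T01: there J acts as multiplication by i, so the
  coefficient of Je_a becomes the imaginary part of that of e_a.\<close>

definition adapted_coeff :: "'a \<Rightarrow> (nat \<Rightarrow> 'a tvec) \<Rightarrow> nat \<Rightarrow> 'a tvec \<Rightarrow> complex" where
  "adapted_coeff x e j v = (case j of 0 \<Rightarrow> of_real (\<theta> x v)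
     | Suc a \<Rightarrow> Complex (g x (hor x v) (e a)) (g x (hor x v) (J x (e a))))"

lemma hor_levi: "v \<in> TM x \<Longrightarrow> hor x v \<in> H x"
  unfolding hor_def by (rule tangent_split)

lemma hor_id: "v \<in> H x \<Longrightarrow> hor x v = v"
  by (simp add: hor_def levi_iff)

lemma unitary_levi: "unitary_frame C h x e \<Longrightarrow> a < m \<Longrightarrow> e a \<in> H x"
  by (simp add: unitary_frame_def)

context
  fixes x e
  assumes e: "unitary_frame C h x e"
begin

lemma adapted_basis_tangent: "\<forall>j\<le>m. adapted_basis x e j \<in> TM x"
  using reeb_tangent levi_tangent[OF unitary_levi[OF e]] by (auto simp: adapted_basis_def split: nat.split)

lemma cf_expand:
  assumes cf: "cform x \<Omega>" and F: "\<forall>j\<le>m. F j \<in> TM x" and i: "i \<le> m" and v: "v \<in> TM x"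
  shows "\<Omega> (F(i := v)) = (\<Sum>j\<le>m. adapted_coeff x e j v * \<Omega> (F(i := adapted_basis x e j)))"
proof -
  note el = unitary_levi[OF e]
  define p where "p = tv_sum {..<m} (\<lambda>a. g x (hor x v) (e a)) e"
  define q where "q = tv_sum {..<m} (\<lambda>a. g x (hor x v) (J x (e a))) (\<lambda>a. J x (e a))"
  have pq: "p \<in> TM x" "q \<in> TM x"
    unfolding p_def q_def by (intro tangent_sum; use el J_levi levi_tangent in auto)+
  have "hor x v = tv_lin 1 p 1 q"
    using unitary_expand[OF e hor_levi[OF v]]
    by (simp add: p_def q_def tv_lin_def tv_sum_def sum.distrib fun_eq_iff)
  moreover have "v = tv_lin 1 (hor x v) (\<theta> x v) (T x)" by (simp add: hor_def tv_lin_def)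
  ultimately have "\<Omega> (F(i := v)) = of_real (\<theta> x v) * \<Omega> (F(i := T x)) + (\<Omega> (F(i := p)) + \<Omega> (F(i := q)))"
    using cf_lin[OF cf F i levi_tangent[OF hor_levi[OF v]] reeb_tangent, of 1 "\<theta> x v"]
      cf_lin[OF cf F i pq, of 1 1] by simp
  also have "\<Omega> (F(i := p)) + \<Omega> (F(i := q)) =
      (\<Sum>a<m. of_real (g x (hor x v) (e a)) * \<Omega> (F(i := e a))) +
      (\<Sum>a<m. of_real (g x (hor x v) (J x (e a))) * \<Omega> (F(i := J x (e a))))"
    unfolding p_def q_def using el J_levi levi_tangent by (intro arg_cong2[of _ _ _ _ "(+)"] cf_sum[OF cf F i]) auto
  also have "\<dots> = (\<Sum>a<m. Complex (g x (hor x v) (e a)) (g x (hor x v) (J x (e a))) * \<Omega> (F(i := e a)))"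
    unfolding sum.distrib[symmetric]
  proof (rule sum.cong)
    fix a assume "a \<in> {..<m}"
    then show "of_real (g x (hor x v) (e a)) * \<Omega> (F(i := e a)) +
        of_real (g x (hor x v) (J x (e a))) * \<Omega> (F(i := J x (e a))) =
        Complex (g x (hor x v) (e a)) (g x (hor x v) (J x (e a))) * \<Omega> (F(i := e a))"
      using cf_J[OF cf F i el] by (simp add: Complex_eq algebra_simps)
  qed simp
  finally have 1: "\<Omega> (F(i := v)) = of_real (\<theta> x v) * \<Omega> (F(i := T x)) +
    (\<Sum>a<m. Complex (g x (hor x v) (e a)) (g x (hor x v) (J x (e a))) * \<Omega> (F(i := e a)))" .
  have 2: "adapted_basis x e 0 = T x" "adapted_coeff x e 0 v = of_real (\<theta> x v)"
    "adapted_basis x e (Suc a) = e a"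
    "adapted_coeff x e (Suc a) v = Complex (g x (hor x v) (e a)) (g x (hor x v) (J x (e a)))" for a
    by (simp_all add: adapted_basis_def adapted_coeff_def)
  show ?thesis
    unfolding 1 lessThan_Suc_atMost[symmetric] sum.lessThan_Suc_shift 2 ..
qed

text \<open>Expanding one slot after another leaves basis vectors in all slots, where the value is
  that of the adapted basis up to sign, or 0.\<close>

lemma cf_zero:
  assumes cf: "cform x \<Omega>" and z: "\<Omega> (adapted_basis x e) = 0" and F: "\<forall>j\<le>m. F j \<in> TM x"
  shows "\<Omega> F = 0"
proof -
  note bt = adapted_basis_tangent
  \<comment> \<open>Slots below \<open>k\<close> carry arbitrary vectors, the others basis vectors
    with an arbitrary index map \<open>j\<close>; it must stay arbitrary since the expansion of slot
    \<open>k\<close> changes it.\<close>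
  have "\<Omega> (\<lambda>i. if i < k then F i else adapted_basis x e (j i)) = 0"
    if "k \<le> m + 1" "\<And>i. j i \<le> m" for k j
    using that
  proof (induction k arbitrary: j)
    case 0
    have "cmod (\<Omega> (adapted_basis x e \<circ> j)) = 0"
      by (subst cf_index[OF cf bt]) (use 0 z in auto)
    then show ?case by (simp add: o_def)
  next
    case (Suc k)
    let ?G = "\<lambda>i. if i < k then F i else adapted_basis x e (j i)"
    have G: "\<forall>i\<le>m. ?G i \<in> TM x" using F bt Suc.prems by auto
    have k: "k \<le> m" using Suc.prems by simp
    have "(\<lambda>i. if i < Suc k then F i else adapted_basis x e (j i)) = ?G(k := F k)"
      by (auto simp: fun_eq_iff less_Suc_eq)
    moreover have "\<Omega> (?G(k := F k)) = (\<Sum>l\<le>m. adapted_coeff x e l (F k) * \<Omega> (?G(k := adapted_basis x e l)))"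
      by (rule cf_expand[OF cf G k F[rule_format, OF k]])
    moreover have "\<Omega> (?G(k := adapted_basis x e l)) = 0" if "l \<le> m" for l
    proof -
      have "?G(k := adapted_basis x e l) = (\<lambda>i. if i < k then F i else adapted_basis x e ((j(k := l)) i))"
        by (auto simp: fun_eq_iff)
      then show ?thesis using Suc.IH[of "j(k := l)"] Suc.prems that by simp
    qed
    ultimately show ?case by simp
  qed
  from this[of "m + 1" "\<lambda>_. 0"] have "\<Omega> (\<lambda>i. if i < m + 1 then F i else adapted_basis x e 0) = 0" by simp
  then show ?thesis using cf_cong[OF cf, of F "\<lambda>i. if i < m + 1 then F i else adapted_basis x e 0"] by simp
qed

text \<open>The canonical forms at a point are a line: the difference of the two sides is itself a
  canonical form and vanishes on the adapted basis.\<close>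

lemma cf_proportional:
  assumes cf: "cform x \<Omega>" "cform x \<Omega>'" and F: "\<forall>j\<le>m. F j \<in> TM x"
  shows "\<Omega>' F * \<Omega> (adapted_basis x e) = \<Omega> F * \<Omega>' (adapted_basis x e)"
proof -
  define \<Xi> where "\<Xi> F = \<Omega>' F * \<Omega> (adapted_basis x e) - \<Omega> F * \<Omega>' (adapted_basis x e)" for F
  have "cform x \<Xi>"
    unfolding cform_def
  proof (intro conjI allI impI)
    show "\<Xi> F = \<Xi> G" if "\<forall>i\<le>m. F i = G i" for F G
      using cf_cong[OF cf(1), of F G] cf_cong[OF cf(2), of F G] that by (simp add: \<Xi>_def)
    show "\<Xi> (F(i := tv_lin a u b w)) = of_real a * \<Xi> (F(i := u)) + of_real b * \<Xi> (F(i := w))"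
      if "\<forall>j\<le>m. F j \<in> TM x" "i \<le> m" "u \<in> TM x" "w \<in> TM x" for F i u w a b
      using cf_lin[OF cf(1), of F i u w a b] cf_lin[OF cf(2), of F i u w a b] that by (simp add: \<Xi>_def algebra_simps)
    show "\<Xi> F = 0" if "\<forall>k\<le>m. F k \<in> TM x" "i \<le> m" "j < i" "F i = F j" for F i j
      using cf_alt[OF cf(1), of F i j] cf_alt[OF cf(2), of F i j] that by (simp add: \<Xi>_def)
    show "\<Xi> (F(0 := X)) + \<i> * \<Xi> (F(0 := J x X)) = 0" if "\<forall>j\<le>m. F j \<in> TM x" "X \<in> H x" for F X
      using cf_J0[OF cf(1), of F X] cf_J0[OF cf(2), of F X] that by (simp add: \<Xi>_def algebra_simps)
  qed
  from cf_zero[OF this _ F] show ?thesis by (simp add: \<Xi>_def)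
qed

text \<open>In the expansion of v every basis vector except the i-th already occupies another slot.
  Summed over i this makes the complex trace of an endomorphism appear.\<close>

lemma cf_slot:
  assumes cf: "cform x \<Omega>" and i: "i \<le> m" and v: "v \<in> TM x"
  shows "\<Omega> ((adapted_basis x e)(i := v)) = adapted_coeff x e i v * \<Omega> (adapted_basis x e)"
proof -
  have z: "\<Omega> ((adapted_basis x e)(i := adapted_basis x e j)) = (if j = i then \<Omega> (adapted_basis x e) else 0)"
    if "j \<le> m" for j
    using cf_alt[OF cf, of "(adapted_basis x e)(i := adapted_basis x e j)" i j] adapted_basis_tangent that i
    by auto
  have "\<Omega> ((adapted_basis x e)(i := v)) =
      (\<Sum>j\<le>m. adapted_coeff x e j v * \<Omega> ((adapted_basis x e)(i := adapted_basis x e j)))"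
    by (rule cf_expand[OF cf adapted_basis_tangent i v])
  also have "\<dots> = (\<Sum>j\<le>m. if j = i then adapted_coeff x e j v * \<Omega> (adapted_basis x e) else 0)"
    by (rule sum.cong) (use z in auto)
  finally show ?thesis using i by simp
qed

end

subsection \<open>The norm of a canonical form\<close>

text \<open>Independence of the unitary frame: the sum of \<open>|\<Omega>(T, e\<^bsub>j(1)\<^esub>, \<dots>, e\<^bsub>j(m)\<^esub>)|\<^sup>2\<close> over all
  index tuples is a positive multiple of the summand at the identity, and is invariant by
  Parseval's identity in each argument.\<close>

primrec square_sum :: "((nat \<Rightarrow> 'a tvec) \<Rightarrow> complex) \<Rightarrow> (nat \<Rightarrow> 'a tvec) \<Rightarrow> nat \<Rightarrow> (nat \<Rightarrow> 'a tvec) \<Rightarrow> real" where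
  "square_sum \<Omega> e 0 F = (cmod (\<Omega> F))\<^sup>2"
| "square_sum \<Omega> e (Suc k) F = (\<Sum>a<m. square_sum \<Omega> e k (F(Suc k := e a)))"

text \<open>The number of index tuples in \<open>square_sum\<close> that give an injective index
  map, that is, of the nonvanishing summands. Only its positivity matters.\<close>

primrec index_count :: "nat \<Rightarrow> (nat \<Rightarrow> nat) \<Rightarrow> nat" where
  "index_count 0 j = (if inj_on j {..m} then 1 else 0)"
| "index_count (Suc k) j = (\<Sum>a<m. index_count k (j(Suc k := Suc a)))"

lemma index_count_pos:
  "k \<le> m \<Longrightarrow> j 0 = 0 \<Longrightarrow> (\<And>i. k < i \<Longrightarrow> i \<le> m \<Longrightarrow> j i = i) \<Longrightarrow> 0 < index_count k j"
proof (induction k arbitrary: j)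
  case 0
  then have "j i = i" if "i \<le> m" for i using that by (cases "i = 0") auto
  then show ?case by (simp add: inj_on_def)
next
  case (Suc k)
  have "0 < index_count k (j(Suc k := Suc k))"
    by (rule Suc.IH) (use Suc.prems in auto)
  also have "\<dots> \<le> (\<Sum>a<m. index_count k (j(Suc k := Suc a)))"
    by (rule member_le_sum[of k "{..<m}" "\<lambda>a. index_count k (j(Suc k := Suc a))"]) (use Suc.prems in auto)
  finally show ?case by simp
qed

context
  fixes x \<Omega>
  assumes cf: "cform x \<Omega>"
begin

lemma square_sum_cong:
  "k \<le> m \<Longrightarrow> (\<And>i. i = 0 \<or> k < i \<Longrightarrow> i \<le> m \<Longrightarrow> F i = G i) \<Longrightarrow> square_sum \<Omega> e k F = square_sum \<Omega> e k G"
proof (induction k arbitrary: F G)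
  case 0
  have "\<Omega> F = \<Omega> G"
  proof (rule cf_cong[OF cf])
    show "F i = G i" if "i \<le> m" for i using 0(2)[of i] that by (cases "i = 0") auto
  qed
  then show ?case by simp
next
  case (Suc k)
  have "square_sum \<Omega> e k (F(Suc k := e a)) = square_sum \<Omega> e k (G(Suc k := e a))" for a
    by (rule Suc.IH) (use Suc.prems in auto)
  then show ?case by simp
qed

lemma square_sum_index:
  assumes e: "unitary_frame C h x e"
  shows "k \<le> m \<Longrightarrow> (\<And>i. i \<le> m \<Longrightarrow> j i \<le> m) \<Longrightarrow>
    square_sum \<Omega> e k (adapted_basis x e \<circ> j) = index_count k j * (cmod (\<Omega> (adapted_basis x e)))\<^sup>2"
proof (induction k arbitrary: j)
  case 0
  then show ?case using cf_index[OF cf adapted_basis_tangent[OF e], of j] by (simp add: o_def)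
next
  case (Suc k)
  have "square_sum \<Omega> e k ((adapted_basis x e \<circ> j)(Suc k := e a)) =
      index_count k (j(Suc k := Suc a)) * (cmod (\<Omega> (adapted_basis x e)))\<^sup>2" if "a < m" for a
  proof -
    have upd: "(adapted_basis x e \<circ> j)(Suc k := e a) = adapted_basis x e \<circ> (j(Suc k := Suc a))"
      by (auto simp: adapted_basis_def)
    show ?thesis unfolding upd by (rule Suc.IH) (use Suc.prems that in auto)
  qed
  then show ?case by (simp add: sum_distrib_right o_def fun_upd_def)
qed

text \<open>As a function of slot i the form is complex linear on H(M). Hence |L(v)| = |L(Jv)|, and
  twice the sum is the real trace of Re(L(v) cnj(L(w))).\<close>

lemma slot_parseval:
  assumes e: "unitary_frame C h x e" and e': "unitary_frame C h x e'"
    and F: "\<forall>j\<le>m. F j \<in> TM x" and i: "i \<le> m"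
  shows "(\<Sum>a<m. (cmod (\<Omega> (F(i := e a))))\<^sup>2) = (\<Sum>a<m. (cmod (\<Omega> (F(i := e' a))))\<^sup>2)"
proof -
  define L where "L v = \<Omega> (F(i := v))" for v
  define B where "B v w = Re (L v * cnj (L w))" for v w
  have L: "L (tv_lin a v b w) = of_real a * L v + of_real b * L w" if "v \<in> H x" "w \<in> H x" for a b v w
    unfolding L_def by (rule cf_lin[OF cf F i]) (use that levi_tangent in auto)
  have LJ: "L (J x v) = \<i> * L v" if "v \<in> H x" for v
    unfolding L_def by (rule cf_J[OF cf F i that])
  have B1: "B (tv_lin a v b w) z = a *\<^sub>R B v z + b *\<^sub>R B w z" if "v \<in> H x" "w \<in> H x" "z \<in> H x" for a b v w z
    by (simp add: B_def L[OF that(1,2)] algebra_simps)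
  have B2: "B z (tv_lin a v b w) = a *\<^sub>R B z v + b *\<^sub>R B z w" if "v \<in> H x" "w \<in> H x" "z \<in> H x" for a b v w z
    by (simp add: B_def L[OF that(1,2)] algebra_simps)
  define s where "s = (\<lambda>a. if a < m then e a else J x (e (a - m)))"
  have s: "\<And>a. a < 2*m \<Longrightarrow> s a \<in> H x"
    "\<And>a b. a < 2*m \<Longrightarrow> b < 2*m \<Longrightarrow> g x (s a) (s b) = (if a = b then 1 else 0)"
    using unitary_orthonormal[OF e] by (auto simp: s_def)
  have *: "2 * (\<Sum>a<m. (cmod (L (e a)))\<^sup>2) = (\<Sum>a<2*m. B (s a) (s a))" if "unitary_frame C h x e" for e
  proof -
    have "(\<Sum>a<m. B (e a) (e a) + B (J x (e a)) (J x (e a))) = (\<Sum>a<2*m. B (s a) (s a))"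
      by (rule trace_unitary[OF B1 B2 s that])
    moreover have "B (e a) (e a) + B (J x (e a)) (J x (e a)) = 2 * (cmod (L (e a)))\<^sup>2" if "a < m" for a
      using LJ[OF unitary_levi[OF \<open>unitary_frame C h x e\<close> that]]
      by (simp add: B_def cmod_power2) (simp add: power2_eq_square)
    ultimately show ?thesis by (simp add: sum_distrib_left)
  qed
  show ?thesis using *[OF e] *[OF e'] unfolding L_def by simp
qed

text \<open>The slot i above k is changed while slots 1 to k are being summed: interchanging the
  sums brings it innermost, where \<open>slot_parseval\<close> applies.\<close>

lemma square_sum_slot:
  assumes e: "unitary_frame C h x e" and e': "unitary_frame C h x e'"
  shows "k < i \<Longrightarrow> i \<le> m \<Longrightarrow> (\<forall>j\<le>m. F j \<in> TM x) \<Longrightarrow>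
    (\<Sum>a<m. square_sum \<Omega> e k (F(i := e a))) = (\<Sum>a<m. square_sum \<Omega> e k (F(i := e' a)))"
proof (induction k arbitrary: F)
  case 0
  then show ?case using slot_parseval[OF e e', of F i] by (simp add: fun_upd_def)
next
  case (Suc k)
  have eq: "(\<Sum>a<m. square_sum \<Omega> e (Suc k) (F(i := w a))) =
      (\<Sum>b<m. \<Sum>a<m. square_sum \<Omega> e k (F(Suc k := e b, i := w a)))" for w
    using Suc.prems(1) by (subst sum.swap) (simp add: fun_upd_twist)
  have slot: "(\<Sum>a<m. square_sum \<Omega> e k (F(Suc k := e b, i := e a))) =
      (\<Sum>a<m. square_sum \<Omega> e k (F(Suc k := e b, i := e' a)))" if "b < m" for b
    by (rule Suc.IH) (use Suc.prems levi_tangent[OF unitary_levi[OF e that]] in auto)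
  show ?case unfolding eq by (rule sum.cong[OF refl], rule slot) simp
qed

lemma square_sum_frame:
  assumes e: "unitary_frame C h x e" and e': "unitary_frame C h x e'"
  shows "k \<le> m \<Longrightarrow> (\<forall>j\<le>m. F j \<in> TM x) \<Longrightarrow> square_sum \<Omega> e k F = square_sum \<Omega> e' k F"
proof (induction k arbitrary: F)
  case (Suc k)
  have "square_sum \<Omega> e (Suc k) F = (\<Sum>a<m. square_sum \<Omega> e k (F(Suc k := e' a)))"
    using square_sum_slot[OF e e', of k "Suc k" F] Suc.prems by simp
  also have "\<dots> = (\<Sum>a<m. square_sum \<Omega> e' k (F(Suc k := e' a)))"
    by (rule sum.cong[OF refl], rule Suc.IH) (use Suc.prems levi_tangent[OF unitary_levi[OF e']] in auto)
  finally show ?case by simp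
qed simp

lemma cform_norm_frame:
  assumes e: "unitary_frame C h x e" and e': "unitary_frame C h x e'"
  shows "cmod (\<Omega> (adapted_basis x e)) = cmod (\<Omega> (adapted_basis x e'))"
proof -
  have *: "square_sum \<Omega> e m (adapted_basis x e) = index_count m id * (cmod (\<Omega> (adapted_basis x e)))\<^sup>2"
    if "unitary_frame C h x e" for e
    using square_sum_index[OF that, of m id] by simp
  have "square_sum \<Omega> e m (adapted_basis x e) = square_sum \<Omega> e' m (adapted_basis x e)"
    by (rule square_sum_frame[OF e e']) (use adapted_basis_tangent[OF e] in auto)
  also have "\<dots> = square_sum \<Omega> e' m (adapted_basis x e')"
    by (rule square_sum_cong) (auto simp: adapted_basis_def)
  finally show ?thesis
    using *[OF e] *[OF e'] index_count_pos[of m id] by simp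
qed

end

end

section \<open>Conformal change of the norm of canonical forms\<close>

context conformal
begin

lemma unitary_rescale:
  assumes "unitary_frame C h' x e"
  shows "unitary_frame C h x (\<lambda>a k. u x * e a k)"
proof -
  note el = Q.unitary_levi[OF assms]
  have s: "(\<lambda>k. u x * e a k) = tv_lin (u x) (e a) 0 (e a)" for a by (simp add: tv_lin_def)
  have Js: "J x (tv_lin (u x) (e a) 0 (e a)) = tv_lin (u x) (J x (e a)) 0 (J x (e a))" if "a < m" for a
    using J_lin[OF el[OF that] el[OF that]] .
  show ?thesis
    unfolding unitary_frame_def
  proof (intro conjI allI impI)
    fix a b assume ab: "a < m" "b < m"
    note l = el[OF ab(1)] el[OF ab(2)]
    show "(\<lambda>k. u x * e a k) \<in> H x" unfolding s by (rule levi_lin[OF l(1) l(1)])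
    show "P.g x (\<lambda>k. u x * e a k) (\<lambda>k. u x * e b k) = (if a = b then 1 else 0)"
      unfolding s using P.g_lin_left[OF l(1) l(1) levi_lin[OF l(2) l(2)]] P.g_lin_right[OF l(2) l(2) l(1)]
        g'[OF l] assms ab unfolding unitary_frame_def by (simp add: mult.assoc)
    show "P.g x (\<lambda>k. u x * e a k) (J x (\<lambda>k. u x * e b k)) = 0"
      unfolding s Js[OF ab(2)]
      using P.g_lin_left[OF l(1) l(1) levi_lin[OF J_levi[OF l(2)] J_levi[OF l(2)]]]
        P.g_lin_right[OF J_levi[OF l(2)] J_levi[OF l(2)] l(1)]
        g'[OF l(1) J_levi[OF l(2)]] assms ab unfolding unitary_frame_def by simp
  qed
qed

text \<open>The exponent counts one factor u for each of the m horizontal slots and u^2 for the Reeb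
  slot, since T' has \<theta>-value u^(-2) and its horizontal part does not contribute.\<close>

lemma cform_norm_conformal:
  assumes cf: "cform x \<Omega>" and e: "unitary_frame C h x e" and e': "unitary_frame C h' x e'"
  shows "cmod (\<Omega> (P.adapted_basis x e)) = u x ^ (m + 2) * cmod (\<Omega> (Q.adapted_basis x e'))"
proof -
  define e1 where "e1 = (\<lambda>a k. u x * e' a k)"
  have e1: "unitary_frame C h x e1" unfolding e1_def by (rule unitary_rescale[OF e'])
  note bt = Q.adapted_basis_tangent[OF e']
  let ?S = "\<lambda>i. if 1 \<le> i \<and> i \<le> m then (\<lambda>l. u x * Q.adapted_basis x e' i l) else Q.adapted_basis x e' i"
  have "\<Omega> ?S = of_real (u x) ^ m * \<Omega> (Q.adapted_basis x e')"
    by (rule cf_scale[OF cf bt]) auto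
  moreover have "\<Omega> ?S = \<Omega> ((P.adapted_basis x e1)(0 := Q.T x))"
    by (rule cf_cong[OF cf]) (auto simp: P.adapted_basis_def Q.adapted_basis_def e1_def split: nat.split)
  moreover have "\<Omega> ((P.adapted_basis x e1)(0 := Q.T x)) = of_real (theta h x (Q.T x)) * \<Omega> (P.adapted_basis x e1)"
    using P.cf_slot[OF e1 cf, of 0 "Q.T x"] Q.reeb_tangent by (simp add: P.adapted_coeff_def)
  ultimately have 1: "of_real (theta h x (Q.T x)) * \<Omega> (P.adapted_basis x e1) =
      of_real (u x) ^ m * \<Omega> (Q.adapted_basis x e')" by simp
  have 2: "complex_of_real (u x * u x) * of_real (theta h x (Q.T x)) = 1"
    using theta_Q_reeb[of x] by (metis of_real_1 of_real_mult)
  have "\<Omega> (P.adapted_basis x e1) =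
      (complex_of_real (u x * u x) * of_real (theta h x (Q.T x))) * \<Omega> (P.adapted_basis x e1)"
    unfolding 2 by simp
  also have "\<dots> = complex_of_real (u x * u x) * (of_real (theta h x (Q.T x)) * \<Omega> (P.adapted_basis x e1))"
    by (simp only: mult.assoc)
  also have "\<dots> = of_real (u x) ^ (m + 2) * \<Omega> (Q.adapted_basis x e')"
    unfolding 1 by (simp add: power2_eq_square mult_ac power_add)
  finally have "\<Omega> (P.adapted_basis x e1) = of_real (u x) ^ (m + 2) * \<Omega> (Q.adapted_basis x e')" .
  then have "cmod (\<Omega> (P.adapted_basis x e1)) = u x ^ (m + 2) * cmod (\<Omega> (Q.adapted_basis x e'))"
    by (simp add: norm_mult norm_power)
  then show ?thesis using P.cform_norm_frame[OF cf e e1] by simp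
qed

end

section \<open>The Webster--Tanaka connection on canonical forms\<close>

context smooth_mfd
begin

lemma smooth_near_Re: "smooth_near A x h \<Longrightarrow> smooth_near A x (\<lambda>y. Re (h y))"
  by (rule smooth_near_linear[OF bounded_linear_Re])

lemma smooth_near_Im: "smooth_near A x h \<Longrightarrow> smooth_near A x (\<lambda>y. Im (h y))"
  by (rule smooth_near_linear[OF bounded_linear_Im])

lemma cder_lin_dir: "cder (tv_lin a v b w) h = of_real a * cder v h + of_real b * cder w h"
  by (simp add: cder_def tv_lin_def complex_eq_iff)

context
  fixes x v
  assumes v: "v \<in> tangent_space A x"
begin

lemma cder_add:
  assumes "smooth_near A x h" "smooth_near A x k"
  shows "cder v (\<lambda>y. h y + k y) = cder v h + cder v k"
  using tv_add[OF v smooth_near_Re[OF assms(1)] smooth_near_Re[OF assms(2)]]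
    tv_add[OF v smooth_near_Im[OF assms(1)] smooth_near_Im[OF assms(2)]]
  by (simp add: cder_def complex_eq_iff)

lemma cder_mult_real:
  assumes "smooth_near A x r" "smooth_near A x h"
  shows "cder v (\<lambda>y. of_real (r y) * h y) = of_real (r x) * cder v h + of_real (v r) * h x"
  using tv_mult[OF v assms(1) smooth_near_Re[OF assms(2)]] tv_mult[OF v assms(1) smooth_near_Im[OF assms(2)]]
  by (simp add: cder_def complex_eq_iff mult.commute)

lemma cder_scale:
  assumes "smooth_near A x h"
  shows "cder v (\<lambda>y. c * h y) = c * cder v h"
  using tv_smooth_lin[OF v smooth_near_Re[OF assms] smooth_near_Im[OF assms], of "Re c" "- Im c"]
    tv_smooth_lin[OF v smooth_near_Re[OF assms] smooth_near_Im[OF assms], of "Im c" "Re c"]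
  by (simp add: cder_def complex_eq_iff algebra_simps)

lemma cder_cong_on: "open W \<Longrightarrow> x \<in> W \<Longrightarrow> (\<And>y. y \<in> W \<Longrightarrow> h y = k y) \<Longrightarrow> cder v h = cder v k"
  using tv_cong_on[OF v, of W "\<lambda>y. Re (h y)" "\<lambda>y. Re (k y)"] tv_cong_on[OF v, of W "\<lambda>y. Im (h y)" "\<lambda>y. Im (k y)"]
  by (simp add: cder_def)

lemma cder_zero: "cder v (\<lambda>_. 0) = 0"
  using tv_const[OF v, of 0] by (simp add: cder_def complex_eq_iff)

end

end

context cr
begin

definition form_on :: "('a \<Rightarrow> 'a tvec list \<Rightarrow> complex) \<Rightarrow> 'a \<Rightarrow> (nat \<Rightarrow> 'a tvec) \<Rightarrow> complex" where
  "form_on \<eta> y F = \<eta> y (map F [0..<m + 1])"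

end

context pherm
begin

text \<open>The covariant derivative of \<eta> in direction v on the tuple \<open>F\<close>. Its
  terms depend on the fields near x, the total only on their values at x.\<close>

definition form_deriv ::
  "('a \<Rightarrow> 'a tvec list \<Rightarrow> complex) \<Rightarrow> 'a \<Rightarrow> 'a tvec \<Rightarrow> (nat \<Rightarrow> 'a vfield) \<Rightarrow> complex" where
  "form_deriv \<eta> x v F = cder v (\<lambda>y. form_on \<eta> y (\<lambda>i. F i y))
    - (\<Sum>i\<le>m. form_on \<eta> x ((\<lambda>l. F l x)(i := D x v (F i))))"

text \<open>Separates the three ways in which slot i enters: differentiated with the form,
  covariantly differentiated itself, or as a spectator of another derivative. Additivity and
  homogeneity are then checked term by term.\<close>

lemma form_deriv_upd:
  assumes "i \<le> m"
  shows "form_deriv \<eta> x v (F(i := X)) = cder v (\<lambda>y. form_on \<eta> y ((\<lambda>l. F l y)(i := X y)))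
    - form_on \<eta> x ((\<lambda>l. F l x)(i := D x v X))
    - (\<Sum>j\<in>{..m} - {i}. form_on \<eta> x ((\<lambda>l. F l x)(j := D x v (F j), i := X x)))"
proof -
  have upd: "(\<lambda>l. (F(i := X)) l y) = (\<lambda>l. F l y)(i := X y)" for y by (auto simp: fun_eq_iff)
  have A: "(\<Sum>j\<le>m. form_on \<eta> x ((\<lambda>l. F l x)(i := X x, j := D x v ((F(i := X)) j)))) =
      form_on \<eta> x ((\<lambda>l. F l x)(i := D x v X)) +
      (\<Sum>j\<in>{..m} - {i}. form_on \<eta> x ((\<lambda>l. F l x)(i := X x, j := D x v ((F(i := X)) j))))"
    by (subst sum.remove[of _ i]) (use assms in auto)
  have B: "(\<Sum>j\<in>{..m} - {i}. form_on \<eta> x ((\<lambda>l. F l x)(i := X x, j := D x v ((F(i := X)) j)))) =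
      (\<Sum>j\<in>{..m} - {i}. form_on \<eta> x ((\<lambda>l. F l x)(j := D x v (F j), i := X x)))"
    by (rule sum.cong[OF refl], rule arg_cong[of _ _ "form_on \<eta> x"]) (auto simp: fun_eq_iff)
  show ?thesis unfolding form_deriv_def upd A B by (simp only: diff_diff_eq)
qed

context
  fixes \<eta> x v U
  assumes U: "open U" "x \<in> U"
    and cf: "\<And>y. y \<in> U \<Longrightarrow> cform y (form_on \<eta> y)"
    and sm: "\<And>F. (\<forall>i\<le>m. vf_near \<A> x (F i)) \<Longrightarrow> smooth_near \<A> x (\<lambda>y. form_on \<eta> y (\<lambda>i. F i y))"
    and v: "v \<in> TM x"
begin

lemma tuple_tangent: "\<forall>i\<le>m. vf_near \<A> x (F i) \<Longrightarrow> \<forall>i\<le>m. F i x \<in> TM x"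
  using vf_near_tangent by blast

lemma tuple_tangent_near:
  assumes "\<forall>i\<le>m. vf_near \<A> x (F i)"
  obtains W where "open W" "x \<in> W" "W \<subseteq> U" "\<forall>y\<in>W. \<forall>i\<le>m. F i y \<in> TM y"
proof -
  have "\<forall>i. \<exists>V. i \<le> m \<longrightarrow> x \<in> V \<and> vf_on \<A> V (F i)" using assms unfolding vf_near_def by blast
  then obtain V where V: "\<And>i. i \<le> m \<Longrightarrow> x \<in> V i \<and> vf_on \<A> (V i) (F i)" by metis
  have "open (\<Inter>i\<in>{..m}. V i)" by (rule open_INT) (use V in \<open>auto simp: vf_on_def\<close>)
  then show ?thesis
    using that[of "U \<inter> (\<Inter>i\<in>{..m}. V i)"] U V by (auto simp: vf_on_def)
qed

lemma form_smooth_upd: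
  assumes "\<forall>i\<le>m. vf_near \<A> x (F i)" "vf_near \<A> x X"
  shows "smooth_near \<A> x (\<lambda>y. form_on \<eta> y ((\<lambda>l. F l y)(i := X y)))"
proof -
  have "smooth_near \<A> x (\<lambda>y. form_on \<eta> y (\<lambda>l. (F(i := X)) l y))" by (rule sm) (use assms in auto)
  moreover have "(\<lambda>l. (F(i := X)) l y) = (\<lambda>l. F l y)(i := X y)" for y by (auto simp: fun_eq_iff)
  ultimately show ?thesis by simp
qed

lemma form_deriv_cong: "(\<And>i. i \<le> m \<Longrightarrow> F i = G i) \<Longrightarrow> form_deriv \<eta> x v F = form_deriv \<eta> x v G"
proof -
  assume FG: "\<And>i. i \<le> m \<Longrightarrow> F i = G i"
  have 1: "form_on \<eta> y (\<lambda>i. F i y) = form_on \<eta> y (\<lambda>i. G i y)" for y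
    unfolding form_on_def by (rule arg_cong[of _ _ "\<eta> y"]) (use FG in auto)
  have 2: "form_on \<eta> x ((\<lambda>l. F l x)(i := D x v (F i))) = form_on \<eta> x ((\<lambda>l. G l x)(i := D x v (G i)))"
    if "i \<in> {..m}" for i
    unfolding form_on_def by (rule arg_cong[of _ _ "\<eta> x"]) (use FG that in auto)
  have 3: "(\<Sum>i\<le>m. form_on \<eta> x ((\<lambda>l. F l x)(i := D x v (F i)))) =
      (\<Sum>i\<le>m. form_on \<eta> x ((\<lambda>l. G l x)(i := D x v (G i))))"
    by (rule sum.cong[OF refl 2])
  show ?thesis unfolding form_deriv_def 1 3 ..
qed

lemma form_deriv_add:
  assumes F: "\<forall>i\<le>m. vf_near \<A> x (F i)" and i: "i \<le> m" and X: "vf_near \<A> x X" and Y: "vf_near \<A> x Y"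
  shows "form_deriv \<eta> x v (F(i := (\<lambda>y k. X y k + Y y k))) = form_deriv \<eta> x v (F(i := X)) + form_deriv \<eta> x v (F(i := Y))"
proof -
  obtain W where W': "open W" "x \<in> W" "W \<subseteq> U" "\<forall>y\<in>W. \<forall>i\<le>m. F i y \<in> TM y"
    using tuple_tangent_near[OF F] .
  note W = W'(1-3) W'(4)[THEN bspec]
  obtain V where V: "x \<in> V" "open V" "vf_on \<A> V X" "vf_on \<A> V Y" using vf_near2E[OF X Y] .
  have lin: "form_on \<eta> y (G(i := (\<lambda>k. a k + b k))) = form_on \<eta> y (G(i := a)) + form_on \<eta> y (G(i := b))"
    if "y \<in> U" "\<forall>j\<le>m. G j \<in> TM y" "a \<in> TM y" "b \<in> TM y" for y G a b
    using cf_lin[OF cf[OF that(1)] that(2) i that(3,4), of 1 1] by (simp add: tv_lin_def)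
  have "cder v (\<lambda>y. form_on \<eta> y ((\<lambda>l. F l y)(i := (\<lambda>k. X y k + Y y k)))) =
      cder v (\<lambda>y. form_on \<eta> y ((\<lambda>l. F l y)(i := X y)) + form_on \<eta> y ((\<lambda>l. F l y)(i := Y y)))"
  proof (rule cder_cong_on[OF v, of "W \<inter> V"])
    fix y assume y: "y \<in> W \<inter> V"
    show "form_on \<eta> y ((\<lambda>l. F l y)(i := (\<lambda>k. X y k + Y y k))) =
        form_on \<eta> y ((\<lambda>l. F l y)(i := X y)) + form_on \<eta> y ((\<lambda>l. F l y)(i := Y y))"
      by (rule lin[OF _ W(4)]) (use y W(3) V in \<open>auto simp: vf_on_def\<close>)
  qed (use W V in auto)
  also have "\<dots> = cder v (\<lambda>y. form_on \<eta> y ((\<lambda>l. F l y)(i := X y))) + cder v (\<lambda>y. form_on \<eta> y ((\<lambda>l. F l y)(i := Y y)))"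
    by (rule cder_add[OF v form_smooth_upd[OF F X] form_smooth_upd[OF F Y]])
  finally have 1: "cder v (\<lambda>y. form_on \<eta> y ((\<lambda>l. F l y)(i := (\<lambda>k. X y k + Y y k)))) =
     cder v (\<lambda>y. form_on \<eta> y ((\<lambda>l. F l y)(i := X y))) + cder v (\<lambda>y. form_on \<eta> y ((\<lambda>l. F l y)(i := Y y)))" .
  note Ft = tuple_tangent[OF F] and XY = vf_near_tangent[OF X] vf_near_tangent[OF Y]
  have 2: "form_on \<eta> x ((\<lambda>l. F l x)(i := D x v (\<lambda>y k. X y k + Y y k))) =
      form_on \<eta> x ((\<lambda>l. F l x)(i := D x v X)) + form_on \<eta> x ((\<lambda>l. F l x)(i := D x v Y))"
    unfolding D_add[OF X Y v]
    using cf_lin[OF cf[OF U(2)] Ft i D_tangent[OF X v] D_tangent[OF Y v], of 1 1] by simp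
  have 3: "(\<Sum>j\<in>{..m} - {i}. form_on \<eta> x ((\<lambda>l. F l x)(j := D x v (F j), i := (\<lambda>k. X x k + Y x k)))) =
      (\<Sum>j\<in>{..m} - {i}. form_on \<eta> x ((\<lambda>l. F l x)(j := D x v (F j), i := X x)) +
        form_on \<eta> x ((\<lambda>l. F l x)(j := D x v (F j), i := Y x)))"
    by (rule sum.cong[OF refl], rule lin[OF U(2) _ XY]) (use Ft D_tangent[OF _ v] F in auto)
  show ?thesis
    unfolding form_deriv_upd[OF i] 1 2 3 sum.distrib by (simp only: diff_conv_add_uminus minus_add_distrib ac_simps)
qed

text \<open>The term with v(k) from the derivative of the form cancels the one from the Leibniz rule
  of the connection.\<close>

lemma form_deriv_scale:
  assumes F: "\<forall>i\<le>m. vf_near \<A> x (F i)" and i: "i \<le> m" and k: "smooth_near \<A> x k" and X: "vf_near \<A> x X"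
  shows "form_deriv \<eta> x v (F(i := (\<lambda>y j. k y * X y j))) = of_real (k x) * form_deriv \<eta> x v (F(i := X))"
proof -
  obtain W where W': "open W" "x \<in> W" "W \<subseteq> U" "\<forall>y\<in>W. \<forall>i\<le>m. F i y \<in> TM y"
    using tuple_tangent_near[OF F] .
  note W = W'(1-3) W'(4)[THEN bspec]
  obtain V where V: "x \<in> V" "open V" "vf_on \<A> V X" "vf_on \<A> V X" using vf_near2E[OF X X] .
  have lin: "form_on \<eta> y (G(i := (\<lambda>k. c * a k))) = of_real c * form_on \<eta> y (G(i := a))"
    if "y \<in> U" "\<forall>j\<le>m. G j \<in> TM y" "a \<in> TM y" for y G a c
    using cf_lin[OF cf[OF that(1)] that(2) i that(3,3), of c 0] by (simp add: tv_lin_def)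
  have "cder v (\<lambda>y. form_on \<eta> y ((\<lambda>l. F l y)(i := (\<lambda>j. k y * X y j)))) =
      cder v (\<lambda>y. of_real (k y) * form_on \<eta> y ((\<lambda>l. F l y)(i := X y)))"
  proof (rule cder_cong_on[OF v, of "W \<inter> V"])
    fix y assume y: "y \<in> W \<inter> V"
    show "form_on \<eta> y ((\<lambda>l. F l y)(i := (\<lambda>j. k y * X y j))) =
        of_real (k y) * form_on \<eta> y ((\<lambda>l. F l y)(i := X y))"
      by (rule lin[OF _ W(4)]) (use y W(3) V in \<open>auto simp: vf_on_def\<close>)
  qed (use W V in auto)
  also have "\<dots> = of_real (k x) * cder v (\<lambda>y. form_on \<eta> y ((\<lambda>l. F l y)(i := X y)))
      + of_real (v k) * form_on \<eta> x ((\<lambda>l. F l x)(i := X x))"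
    by (rule cder_mult_real[OF v k form_smooth_upd[OF F X]])
  finally have 1: "cder v (\<lambda>y. form_on \<eta> y ((\<lambda>l. F l y)(i := (\<lambda>j. k y * X y j)))) =
     of_real (k x) * cder v (\<lambda>y. form_on \<eta> y ((\<lambda>l. F l y)(i := X y)))
      + of_real (v k) * form_on \<eta> x ((\<lambda>l. F l x)(i := X x))" .
  note Ft = tuple_tangent[OF F] and Xx = vf_near_tangent[OF X]
  have 2: "form_on \<eta> x ((\<lambda>l. F l x)(i := D x v (\<lambda>y j. k y * X y j))) =
      of_real (v k) * form_on \<eta> x ((\<lambda>l. F l x)(i := X x)) + of_real (k x) * form_on \<eta> x ((\<lambda>l. F l x)(i := D x v X))"
    unfolding D_scale[OF X k v]
    by (rule cf_lin[OF cf[OF U(2)] Ft i Xx D_tangent[OF X v]])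
  have 3: "(\<Sum>j\<in>{..m} - {i}. form_on \<eta> x ((\<lambda>l. F l x)(j := D x v (F j), i := (\<lambda>l. k x * X x l)))) =
      (\<Sum>j\<in>{..m} - {i}. of_real (k x) * form_on \<eta> x ((\<lambda>l. F l x)(j := D x v (F j), i := X x)))"
    by (rule sum.cong[OF refl], rule lin[OF U(2) _ Xx]) (use Ft D_tangent[OF _ v] F in auto)
  show ?thesis
    unfolding form_deriv_upd[OF i] 1 2 3 sum_distrib_left[symmetric]
    by (simp only: algebra_simps)
qed

lemma form_deriv_slot:
  assumes F: "\<forall>i\<le>m. vf_near \<A> x (F i)" and i: "i \<le> m" and "vf_near \<A> x X" "vf_near \<A> x Y" "X x = Y x"
  shows "form_deriv \<eta> x v (F(i := X)) = form_deriv \<eta> x v (F(i := Y))"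
  by (rule tensorial[where F = "\<lambda>X. form_deriv \<eta> x v (F(i := X))"])
    (use assms form_deriv_add[OF F i] form_deriv_scale[OF F i] in \<open>auto simp: scaleR_conv_of_real\<close>)

lemma form_deriv_tensor:
  assumes F: "\<forall>i\<le>m. vf_near \<A> x (F i)" and G: "\<forall>i\<le>m. vf_near \<A> x (G i)" and FG: "\<forall>i\<le>m. F i x = G i x"
  shows "form_deriv \<eta> x v F = form_deriv \<eta> x v G"
proof -
  have "form_deriv \<eta> x v (\<lambda>i. if i < k then G i else F i) = form_deriv \<eta> x v F" if "k \<le> m + 1" for k
    using that
  proof (induction k)
    case (Suc k)
    let ?H = "\<lambda>i. if i < k then G i else F i"
    have H: "\<forall>i\<le>m. vf_near \<A> x (?H i)" using F G by auto
    have eq: "(\<lambda>i. if i < Suc k then G i else F i) = ?H(k := G k)" "?H = ?H(k := F k)"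
      by (auto simp: fun_eq_iff less_Suc_eq)
    have k: "k \<le> m" using Suc.prems by simp
    have "form_deriv \<eta> x v (?H(k := G k)) = form_deriv \<eta> x v (?H(k := F k))"
      by (rule form_deriv_slot[OF H k]) (use F G FG k in auto)
    then show ?case using Suc unfolding eq(1) using eq(2) by simp
  qed simp
  from this[of "m + 1"] have "form_deriv \<eta> x v (\<lambda>i. if i < m + 1 then G i else F i) = form_deriv \<eta> x v F" by simp
  moreover have "form_deriv \<eta> x v (\<lambda>i. if i < m + 1 then G i else F i) = form_deriv \<eta> x v G"
    by (rule form_deriv_cong) simp
  ultimately show ?thesis by simp
qed

text \<open>Differentiating a slot other than i and j leaves equal arguments. The two remaining
  terms are interchanged by a transposition, hence opposite.\<close>

lemma form_deriv_alt:
  assumes F: "\<forall>i\<le>m. vf_near \<A> x (F i)" and ij: "i \<le> m" "j \<le> m" "i \<noteq> j" "F i = F j"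
  shows "form_deriv \<eta> x v F = 0"
proof -
  obtain W where W': "open W" "x \<in> W" "W \<subseteq> U" "\<forall>y\<in>W. \<forall>i\<le>m. F i y \<in> TM y"
    using tuple_tangent_near[OF F] .
  note W = W'(1-3) W'(4)[THEN bspec]
  have "form_on \<eta> y (\<lambda>i. F i y) = 0" if "y \<in> W" for y
    by (rule cf_alt[OF cf, of y _ i j]) (use W that ij in auto)
  then have "cder v (\<lambda>y. form_on \<eta> y (\<lambda>i. F i y)) = cder v (\<lambda>_. 0)"
    by (rule cder_cong_on[OF v W(1,2)])
  moreover have "(\<Sum>k\<le>m. form_on \<eta> x ((\<lambda>l. F l x)(k := D x v (F k)))) = 0"
  proof -
    note Ft = tuple_tangent[OF F]
    let ?d = "D x v (F i)"
    have dt: "?d \<in> TM x" using D_tangent[OF _ v] F ij(1) by auto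
    have z: "form_on \<eta> x ((\<lambda>l. F l x)(k := D x v (F k))) = 0" if "k \<in> {..m} - {i, j}" for k
      by (rule cf_alt[OF cf[OF U(2)], of _ i j]) (use that ij Ft D_tangent[OF _ v] F in auto)
    have "(\<Sum>k\<le>m. form_on \<eta> x ((\<lambda>l. F l x)(k := D x v (F k)))) =
        (\<Sum>k\<in>{i, j}. form_on \<eta> x ((\<lambda>l. F l x)(k := D x v (F k))))"
      by (rule sum.mono_neutral_right) (use ij z in auto)
    also have "\<dots> = form_on \<eta> x ((\<lambda>l. F l x)(i := ?d)) + form_on \<eta> x ((\<lambda>l. F l x)(j := ?d))"
      using ij by simp
    also have "form_on \<eta> x ((\<lambda>l. F l x)(j := ?d)) = - form_on \<eta> x ((\<lambda>l. F l x)(i := ?d))"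
    proof -
      let ?G = "(\<lambda>l. F l x)(i := ?d)"
      have "?G(i := ?G j, j := ?G i) = (\<lambda>l. F l x)(j := ?d)" using ij by (auto simp: fun_eq_iff)
      moreover have "form_on \<eta> x (?G(i := ?G j, j := ?G i)) = - form_on \<eta> x ?G"
        by (rule cf_swap[OF cf[OF U(2)]]) (use ij Ft dt in auto)
      ultimately show ?thesis by simp
    qed
    finally show ?thesis by (simp only: add.right_inverse)
  qed
  ultimately show ?thesis using cder_zero[OF v] by (simp add: form_deriv_def)
qed

lemma form_deriv_J:
  assumes F: "\<forall>i\<le>m. vf_near \<A> x (F i)" and X: "hvf_near C x X"
  shows "form_deriv \<eta> x v (F(0 := cplx_vf C X)) = \<i> * form_deriv \<eta> x v (F(0 := X))"
proof -
  obtain W where W': "open W" "x \<in> W" "W \<subseteq> U" "\<forall>y\<in>W. \<forall>i\<le>m. F i y \<in> TM y"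
    using tuple_tangent_near[OF F] .
  note W = W'(1-3) W'(4)[THEN bspec]
  obtain V where V: "x \<in> V" "hvf_on C V X" using X unfolding hvf_near_def by blast
  have Vo: "open V" using V by (simp add: hvf_on_def vf_on_def)
  note Ft = tuple_tangent[OF F] and Xv = hvf_near_vf[OF X] and Xl = hvf_near_levi[OF X]
  have "cder v (\<lambda>y. form_on \<eta> y ((\<lambda>l. F l y)(0 := cplx_vf C X y))) =
      cder v (\<lambda>y. \<i> * form_on \<eta> y ((\<lambda>l. F l y)(0 := X y)))"
  proof (rule cder_cong_on[OF v, of "W \<inter> V"])
    fix y assume y: "y \<in> W \<inter> V"
    then have "y \<in> U" "X y \<in> H y" using W V by (auto simp: hvf_on_def)
    then show "form_on \<eta> y ((\<lambda>l. F l y)(0 := cplx_vf C X y)) = \<i> * form_on \<eta> y ((\<lambda>l. F l y)(0 := X y))"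
      using cf_J0[OF cf W(4)] y by (simp add: cplx_vf_def)
  qed (use W V Vo in auto)
  also have "\<dots> = \<i> * cder v (\<lambda>y. form_on \<eta> y ((\<lambda>l. F l y)(0 := X y)))"
    by (rule cder_scale[OF v form_smooth_upd[OF F Xv]])
  finally have 1: "cder v (\<lambda>y. form_on \<eta> y ((\<lambda>l. F l y)(0 := cplx_vf C X y))) =
      \<i> * cder v (\<lambda>y. form_on \<eta> y ((\<lambda>l. F l y)(0 := X y)))" .
  have 2: "form_on \<eta> x ((\<lambda>l. F l x)(0 := D x v (cplx_vf C X))) = \<i> * form_on \<eta> x ((\<lambda>l. F l x)(0 := D x v X))"
    unfolding D_J[OF v X] by (rule cf_J0[OF cf[OF U(2)] Ft D_levi[OF v X]])
  have 3: "(\<Sum>j\<in>{..m} - {0}. form_on \<eta> x ((\<lambda>l. F l x)(j := D x v (F j), 0 := cplx_vf C X x))) =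
      (\<Sum>j\<in>{..m} - {0}. \<i> * form_on \<eta> x ((\<lambda>l. F l x)(j := D x v (F j), 0 := X x)))"
    unfolding cplx_vf_def
    by (rule sum.cong[OF refl], rule cf_J0[OF cf[OF U(2)] _ Xl]) (use Ft D_tangent[OF _ v] F in auto)
  show ?thesis
    unfolding form_deriv_upd[OF le0] 1 2 3 sum_distrib_left[symmetric] by (simp only: right_diff_distrib)
qed

text \<open>The space of canonical forms at a point is a line and contains the values of
  \<open>\<eta>\<close> and of its covariant derivative; this gives the connection form.\<close>

lemma form_deriv_conn:
  assumes nz: "\<exists>V. (\<forall>i\<le>m. V i \<in> TM x) \<and> form_on \<eta> x V \<noteq> 0"
  shows "\<exists>c. \<forall>F. (\<forall>i\<le>m. vf_near \<A> x (F i)) \<longrightarrow> form_deriv \<eta> x v F = c * form_on \<eta> x (\<lambda>i. F i x)"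
proof -
  \<comment> \<open>Vectors in H(M) get horizontal extensions, so that J can be applied to the
    extension when the type condition is checked.\<close>
  have "\<exists>X. w \<in> TM x \<longrightarrow> vf_near \<A> x X \<and> X x = w \<and> (w \<in> H x \<longrightarrow> hvf_near C x X)" for w
    using tangent_extend[of w x] levi_extend[of w x] hvf_near_vf by metis
  then obtain ext where "\<forall>w. w \<in> TM x \<longrightarrow> vf_near \<A> x (ext w) \<and> ext w x = w \<and> (w \<in> H x \<longrightarrow> hvf_near C x (ext w))"
    by metis
  then have ext: "\<And>w. w \<in> TM x \<Longrightarrow> vf_near \<A> x (ext w)" "\<And>w. w \<in> TM x \<Longrightarrow> ext w x = w"
    "\<And>w. w \<in> H x \<Longrightarrow> hvf_near C x (ext w)"
    using levi_tangent by blast+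
  define \<Omega>' where "\<Omega>' V = form_deriv \<eta> x v (\<lambda>i. ext (V i))" for V
  have upd: "(\<lambda>j. ext ((V(i := w)) j)) = (\<lambda>j. ext (V j))(i := ext w)" for V :: "nat \<Rightarrow> 'a tvec" and i w
    by (auto simp: fun_eq_iff)
  have cf': "cform x \<Omega>'"
    unfolding cform_def
  proof (intro conjI allI impI)
    show "\<Omega>' F = \<Omega>' G" if "\<forall>i\<le>m. F i = G i" for F G
      unfolding \<Omega>'_def by (rule form_deriv_cong) (use that in simp)
    show "\<Omega>' (F(i := tv_lin a u b w)) = of_real a * \<Omega>' (F(i := u)) + of_real b * \<Omega>' (F(i := w))"
      if F: "\<forall>j\<le>m. F j \<in> TM x" and i: "i \<le> m" and uw: "u \<in> TM x" "w \<in> TM x" for F i u w a b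
    proof -
      have eF: "\<forall>i\<le>m. vf_near \<A> x (ext (F i))" using F ext by auto
      have s: "vf_near \<A> x (\<lambda>y k. a * ext u y k)" "vf_near \<A> x (\<lambda>y k. b * ext w y k)"
        by (intro vf_near_scale smooth_near_const ext(1) uw)+
      have "form_deriv \<eta> x v ((\<lambda>i. ext (F i))(i := ext (tv_lin a u b w))) =
          form_deriv \<eta> x v ((\<lambda>i. ext (F i))(i := (\<lambda>y k. a * ext u y k + b * ext w y k)))"
        by (rule form_deriv_slot[OF eF i ext(1)[OF tangent_lin[OF uw]] vf_near_add[OF s]])
          (use ext(2)[OF tangent_lin[OF uw]] ext(2) uw in \<open>simp add: tv_lin_def\<close>)
      then show ?thesis
        unfolding \<Omega>'_def upd form_deriv_add[OF eF i s] form_deriv_scale[OF eF i smooth_near_const ext(1)[OF uw(1)]]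
          form_deriv_scale[OF eF i smooth_near_const ext(1)[OF uw(2)]] .
    qed
    show "\<Omega>' F = 0" if "\<forall>k\<le>m. F k \<in> TM x" "i \<le> m" "j < i" "F i = F j" for F i j
      unfolding \<Omega>'_def by (rule form_deriv_alt[of _ i j]) (use that ext in auto)
    show "\<Omega>' (F(0 := X)) + \<i> * \<Omega>' (F(0 := J x X)) = 0" if F: "\<forall>j\<le>m. F j \<in> TM x" and X: "X \<in> H x" for F X
    proof -
      have eF: "\<forall>i\<le>m. vf_near \<A> x (ext (F i))" using F ext by auto
      have "form_deriv \<eta> x v ((\<lambda>i. ext (F i))(0 := ext (J x X))) =
          form_deriv \<eta> x v ((\<lambda>i. ext (F i))(0 := cplx_vf C (ext X)))"
        by (rule form_deriv_slot[OF eF])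
          (use ext X J_levi levi_tangent hvf_near_vf[OF hvf_near_J] in \<open>auto simp: cplx_vf_def\<close>)
      then show ?thesis
        unfolding \<Omega>'_def upd form_deriv_J[OF eF ext(3)[OF X]] by simp
    qed
  qed
  obtain e where e: "unitary_frame C h x e" using unitary_frame_exists by blast
  let ?b = "adapted_basis x e"
  have b: "form_on \<eta> x ?b \<noteq> 0" using nz cf_zero[OF e cf[OF U(2)]] by blast
  \<comment> \<open>On a line of forms the factor can be read off on the adapted basis, where \<eta>
    does not vanish.\<close>
  define c where "c = \<Omega>' ?b / form_on \<eta> x ?b"
  have "form_deriv \<eta> x v F = c * form_on \<eta> x (\<lambda>i. F i x)" if F: "\<forall>i\<le>m. vf_near \<A> x (F i)" for F
  proof -
    note Ft = tuple_tangent[OF F]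
    have "form_deriv \<eta> x v F = \<Omega>' (\<lambda>i. F i x)"
      unfolding \<Omega>'_def by (rule form_deriv_tensor[OF F]) (use Ft ext in auto)
    then show ?thesis
      using cf_proportional[OF e cf[OF U(2)] cf' Ft] b by (simp add: c_def field_simps)
  qed
  then show ?thesis by blast
qed

text \<open>Resolves the description in \<open>canonical_conn\<close>: lists are translated into
  index functions, existence is \<open>form_deriv_conn\<close>, and a tuple on which \<eta> does not
  vanish gives uniqueness.\<close>

lemma canonical_conn_char:
  assumes nz: "\<exists>V. (\<forall>i\<le>m. V i \<in> TM x) \<and> form_on \<eta> x V \<noteq> 0"
    and F: "\<forall>i\<le>m. vf_near \<A> x (F i)"
  shows "form_deriv \<eta> x v F = canonical_conn C h \<eta> x v * form_on \<eta> x (\<lambda>i. F i x)"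
proof -
  define S where "S c \<longleftrightarrow> (\<forall>Vs. length Vs = m + 1 \<longrightarrow> (\<forall>X\<in>set Vs. vf_near \<A> x X) \<longrightarrow>
       cder v (\<lambda>y. \<eta> y (map (\<lambda>X. X y) Vs))
       - (\<Sum>i<m + 1. \<eta> x ((map (\<lambda>X. X x) Vs)[i := D x v (Vs ! i)]))
       = c * \<eta> x (map (\<lambda>X. X x) Vs))" for c
  have "form_deriv \<eta> x v (\<lambda>i. Vs ! i) = cder v (\<lambda>y. \<eta> y (map (\<lambda>X. X y) Vs))
       - (\<Sum>i<m + 1. \<eta> x ((map (\<lambda>X. X x) Vs)[i := D x v (Vs ! i)]))"
    and "form_on \<eta> x (\<lambda>i. (Vs ! i) x) = \<eta> x (map (\<lambda>X. X x) Vs)" if "length Vs = m + 1" for Vs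
  proof -
    have 1: "map (\<lambda>i. (Vs ! i) y) [0..<m + 1] = map (\<lambda>X. X y) Vs" for y
      by (rule nth_equalityI) (use that in \<open>auto simp del: upt_Suc\<close>)
    have 2: "map ((\<lambda>l. (Vs ! l) x)(i := w)) [0..<m + 1] = (map (\<lambda>X. X x) Vs)[i := w]" if "i \<le> m" for i w
      by (rule nth_equalityI) (use \<open>length Vs = m + 1\<close> that in \<open>auto simp: nth_list_update simp del: upt_Suc\<close>)
    have 3: "(\<Sum>i\<le>m. form_on \<eta> x ((\<lambda>l. (Vs ! l) x)(i := D x v (Vs ! i)))) =
      (\<Sum>i<m + 1. \<eta> x ((map (\<lambda>X. X x) Vs)[i := D x v (Vs ! i)]))"
      unfolding form_on_def Suc_eq_plus1[symmetric] lessThan_Suc_atMost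
      by (rule sum.cong[OF refl]) (use 2 in \<open>simp del: upt_Suc\<close>)
    show "form_on \<eta> x (\<lambda>i. (Vs ! i) x) = \<eta> x (map (\<lambda>X. X x) Vs)" unfolding form_on_def 1 ..
    show "form_deriv \<eta> x v (\<lambda>i. Vs ! i) = cder v (\<lambda>y. \<eta> y (map (\<lambda>X. X y) Vs))
       - (\<Sum>i<m + 1. \<eta> x ((map (\<lambda>X. X x) Vs)[i := D x v (Vs ! i)]))"
      unfolding form_deriv_def 3 unfolding form_on_def 1 ..
  qed
  note list = this
  have S_iff: "S c \<longleftrightarrow> (\<forall>F. (\<forall>i\<le>m. vf_near \<A> x (F i)) \<longrightarrow> form_deriv \<eta> x v F = c * form_on \<eta> x (\<lambda>i. F i x))" for c
  proof
    assume S: "S c"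
    show "\<forall>F. (\<forall>i\<le>m. vf_near \<A> x (F i)) \<longrightarrow> form_deriv \<eta> x v F = c * form_on \<eta> x (\<lambda>i. F i x)"
    proof (intro allI impI)
      fix F :: "nat \<Rightarrow> 'a vfield" assume F: "\<forall>i\<le>m. vf_near \<A> x (F i)"
      let ?Vs = "map F [0..<m + 1]"
      have len: "length ?Vs = m + 1" by simp
      have nth: "?Vs ! i = F i" if "i \<le> m" for i using that by (simp del: upt_Suc)
      have "\<forall>X\<in>set ?Vs. vf_near \<A> x X" using F by auto
      then have "form_deriv \<eta> x v (\<lambda>i. ?Vs ! i) = c * form_on \<eta> x (\<lambda>i. (?Vs ! i) x)"
        using S len unfolding S_def list[OF len] by blast
      moreover have "form_deriv \<eta> x v (\<lambda>i. ?Vs ! i) = form_deriv \<eta> x v F"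
        by (rule form_deriv_cong) (rule nth)
      moreover have "form_on \<eta> x (\<lambda>i. (?Vs ! i) x) = form_on \<eta> x (\<lambda>i. F i x)"
        by (rule cf_cong[OF cf[OF U(2)]]) (simp only: nth)
      ultimately show "form_deriv \<eta> x v F = c * form_on \<eta> x (\<lambda>i. F i x)" by simp
    qed
  next
    assume *: "\<forall>F. (\<forall>i\<le>m. vf_near \<A> x (F i)) \<longrightarrow> form_deriv \<eta> x v F = c * form_on \<eta> x (\<lambda>i. F i x)"
    show "S c"
      unfolding S_def
    proof (intro allI impI)
      fix Vs assume Vs: "length Vs = m + 1" "\<forall>X\<in>set Vs. vf_near \<A> x X"
      have "\<forall>i\<le>m. vf_near \<A> x (Vs ! i)" using Vs by auto
      then show "cder v (\<lambda>y. \<eta> y (map (\<lambda>X. X y) Vs))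
       - (\<Sum>i<m + 1. \<eta> x ((map (\<lambda>X. X x) Vs)[i := D x v (Vs ! i)]))
       = c * \<eta> x (map (\<lambda>X. X x) Vs)"
        using *[rule_format, of "\<lambda>i. Vs ! i"] unfolding list[OF Vs(1)] by blast
    qed
  qed
  obtain c where c: "S c" using form_deriv_conn[OF nz] unfolding S_iff by blast
  have uniq: "c' = c" if "S c'" for c'
  proof -
    obtain V where V: "\<forall>i\<le>m. V i \<in> TM x" "form_on \<eta> x V \<noteq> 0" using nz by blast
    have "\<forall>i. \<exists>X. i \<le> m \<longrightarrow> vf_near \<A> x X \<and> X x = V i" using tangent_extend V(1) by metis
    then obtain X where X: "\<And>i. i \<le> m \<Longrightarrow> vf_near \<A> x (X i) \<and> X i x = V i" by metis
    have "form_on \<eta> x (\<lambda>i. X i x) = form_on \<eta> x V" by (rule cf_cong[OF cf[OF U(2)]]) (use X in blast)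
    then have "c' * form_on \<eta> x V = c * form_on \<eta> x V"
      using that c X unfolding S_iff by metis
    then show ?thesis using V(2) by simp
  qed
  have "canonical_conn C h \<eta> x v = (THE c. S c)" by (simp only: canonical_conn_def S_def)
  also have "\<dots> = c" by (rule the_equality[of S, OF c uniq])
  finally show ?thesis using c F unfolding S_iff by blast
qed

end

lemma canonical_conn_lin:
  assumes U: "open U" "x \<in> U"
    and cf: "\<And>y. y \<in> U \<Longrightarrow> cform y (form_on \<eta> y)"
    and sm: "\<And>F. (\<forall>i\<le>m. vf_near \<A> x (F i)) \<Longrightarrow> smooth_near \<A> x (\<lambda>y. form_on \<eta> y (\<lambda>i. F i y))"
    and nz: "\<exists>V. (\<forall>i\<le>m. V i \<in> TM x) \<and> form_on \<eta> x V \<noteq> 0"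
    and vw: "v \<in> TM x" "w \<in> TM x"
  shows "canonical_conn C h \<eta> x (tv_lin a v b w) =
    of_real a * canonical_conn C h \<eta> x v + of_real b * canonical_conn C h \<eta> x w"
proof -
  obtain V where V: "\<forall>i\<le>m. V i \<in> TM x" "form_on \<eta> x V \<noteq> 0" using nz by blast
  have "\<forall>i. \<exists>X. i \<le> m \<longrightarrow> vf_near \<A> x X \<and> X x = V i" using tangent_extend V(1) by metis
  then obtain F where F: "\<And>i. i \<le> m \<Longrightarrow> vf_near \<A> x (F i) \<and> F i x = V i" by metis
  then have Fn: "\<forall>i\<le>m. vf_near \<A> x (F i)" by blast
  have Ft: "\<forall>i\<le>m. F i x \<in> TM x" using F V(1) by auto
  have nz': "form_on \<eta> x (\<lambda>i. F i x) \<noteq> 0"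
    using cf_cong[OF cf[OF U(2)], of "\<lambda>i. F i x" V] F V(2) by simp
  have lin: "(\<Sum>i\<le>m. form_on \<eta> x ((\<lambda>l. F l x)(i := D x (tv_lin a v b w) (F i)))) =
      (\<Sum>i\<le>m. of_real a * form_on \<eta> x ((\<lambda>l. F l x)(i := D x v (F i))) +
        of_real b * form_on \<eta> x ((\<lambda>l. F l x)(i := D x w (F i))))"
  proof (rule sum.cong[OF refl])
    fix i assume "i \<in> {..m}"
    then have Fi: "vf_near \<A> x (F i)" "i \<le> m" using Fn by auto
    show "form_on \<eta> x ((\<lambda>l. F l x)(i := D x (tv_lin a v b w) (F i))) =
      of_real a * form_on \<eta> x ((\<lambda>l. F l x)(i := D x v (F i))) + of_real b * form_on \<eta> x ((\<lambda>l. F l x)(i := D x w (F i)))"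
      unfolding D_lin_dir[OF Fi(1) vw]
      by (rule cf_lin[OF cf[OF U(2)] Ft Fi(2) D_tangent[OF Fi(1) vw(1)] D_tangent[OF Fi(1) vw(2)]])
  qed
  have "form_deriv \<eta> x (tv_lin a v b w) F = of_real a * form_deriv \<eta> x v F + of_real b * form_deriv \<eta> x w F"
    unfolding form_deriv_def cder_lin_dir lin sum.distrib sum_distrib_left[symmetric]
    by (simp add: algebra_simps)
  then have "canonical_conn C h \<eta> x (tv_lin a v b w) * form_on \<eta> x (\<lambda>i. F i x) =
      (of_real a * canonical_conn C h \<eta> x v + of_real b * canonical_conn C h \<eta> x w) * form_on \<eta> x (\<lambda>i. F i x)"
    using canonical_conn_char[OF U cf sm tangent_lin[OF vw] nz Fn] canonical_conn_char[OF U cf sm vw(1) nz Fn]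
      canonical_conn_char[OF U cf sm vw(2) nz Fn] by (simp add: algebra_simps)
  then show ?thesis using nz' by simp
qed

end

section \<open>Conformal change of the connection of the canonical bundle\<close>

context conformal
begin

text \<open>On forms of top degree modulo T01 the connection changes by minus the complex trace of
  its change on vectors. The real part of the trace is 2 \<delta>(v) from the Reeb direction and
  \<delta>(v) from each of the m complex directions; the imaginary part comes from H(M) alone and is
  -(m+2) \<delta>(Jv).\<close>

lemma canonical_conn_conformal:
  assumes U: "open U" "x \<in> U"
    and cf: "\<And>y. y \<in> U \<Longrightarrow> cform y (form_on \<eta> y)"
    and sm: "\<And>F. (\<forall>i\<le>m. vf_near \<A> x (F i)) \<Longrightarrow> smooth_near \<A> x (\<lambda>y. form_on \<eta> y (\<lambda>i. F i y))"
    and nz: "\<exists>V. (\<forall>i\<le>m. V i \<in> TM x) \<and> form_on \<eta> x V \<noteq> 0"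
    and v: "v \<in> H x"
  shows "canonical_conn C h' \<eta> x v = canonical_conn C h \<eta> x v
    - of_nat (m + 2) * Complex (\<delta> x v) (- \<delta> x (J x v))"
proof -
  obtain e where e: "unitary_frame C h x e" using P.unitary_frame_exists by blast
  note el = P.unitary_levi[OF e] and vt = levi_tangent[OF v]
  let ?b = "P.adapted_basis x e"
  have b: "form_on \<eta> x ?b \<noteq> 0" using nz P.cf_zero[OF e cf[OF U(2)]] by blast
  have "\<exists>X. a < m \<longrightarrow> hvf_near C x X \<and> X x = e a" for a using levi_extend el by metis
  then obtain E where E: "\<And>a. a < m \<Longrightarrow> hvf_near C x (E a) \<and> E a x = e a" by metis
  define F where "F = case_nat P.T E"
  have Fn: "\<forall>i\<le>m. vf_near \<A> x (F i)"
    using P.reeb_near E hvf_near_vf by (auto simp: F_def split: nat.split)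
  have Fx: "F i x = ?b i" if "i \<le> m" for i
    using E that by (auto simp: F_def P.adapted_basis_def split: nat.split)
  have form_F: "form_on \<eta> x (\<lambda>i. F i x) = form_on \<eta> x ?b"
    by (rule cf_cong[OF cf[OF U(2)]]) (rule Fx)
  have slot: "form_on \<eta> x ((\<lambda>l. F l x)(i := w)) = P.adapted_coeff x e i w * form_on \<eta> x ?b"
    if "i \<le> m" "w \<in> TM x" for i w
    using P.cf_slot[OF e cf[OF U(2)] that] cf_cong[OF cf[OF U(2)], of "(\<lambda>l. F l x)(i := w)" "?b(i := w)"] Fx
    by simp
  have "(canonical_conn C h' \<eta> x v - canonical_conn C h \<eta> x v) * form_on \<eta> x ?b =
      Q.form_deriv \<eta> x v F - P.form_deriv \<eta> x v F"
    using P.canonical_conn_char[OF U cf sm vt nz Fn] Q.canonical_conn_char[OF U cf sm vt nz Fn] form_F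
    by (simp add: algebra_simps)
  also have "\<dots> = (\<Sum>i\<le>m. form_on \<eta> x ((\<lambda>l. F l x)(i := P.D x v (F i)))) -
      (\<Sum>i\<le>m. form_on \<eta> x ((\<lambda>l. F l x)(i := Q.D x v (F i))))"
    by (simp add: P.form_deriv_def Q.form_deriv_def)
  also have "\<dots> = - (\<Sum>i\<le>m. P.adapted_coeff x e i (Q.D x v (F i)) - P.adapted_coeff x e i (P.D x v (F i))) * form_on \<eta> x ?b"
  proof -
    have "(\<Sum>i\<le>m. form_on \<eta> x ((\<lambda>l. F l x)(i := P.D x v (F i)))) =
        (\<Sum>i\<le>m. P.adapted_coeff x e i (P.D x v (F i)) * form_on \<eta> x ?b)"
      by (rule sum.cong[OF refl], rule slot) (use P.D_tangent[OF _ vt] Fn in auto)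
    moreover have "(\<Sum>i\<le>m. form_on \<eta> x ((\<lambda>l. F l x)(i := Q.D x v (F i)))) =
        (\<Sum>i\<le>m. P.adapted_coeff x e i (Q.D x v (F i)) * form_on \<eta> x ?b)"
      by (rule sum.cong[OF refl], rule slot) (use Q.D_tangent[OF _ vt] Fn in auto)
    ultimately show ?thesis by (simp add: sum_subtractf sum_distrib_right left_diff_distrib)
  qed
  finally have main: "canonical_conn C h' \<eta> x v - canonical_conn C h \<eta> x v =
      - (\<Sum>i\<le>m. P.adapted_coeff x e i (Q.D x v (F i)) - P.adapted_coeff x e i (P.D x v (F i)))"
    by (rule mult_right_cancel[OF b, THEN iffD1])
  \<comment> \<open>Write T = u^2 T' - W. The new connection has T' parallel and preserves H(M), so
    modulo H(M) only the derivative of u^2 is left.\<close>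
  have c0: "P.adapted_coeff x e 0 (Q.D x v (F 0)) - P.adapted_coeff x e 0 (P.D x v (F 0)) = of_real (2 * \<delta> x v)"
  proof -
    have uu: "smooth_near \<A> x (\<lambda>y. u y * u y)" by (intro smooth_near_mult u_near)
    have Zn: "vf_near \<A> x (\<lambda>y k. (u y * u y) * Q.T y k)" by (intro vf_near_scale Q.reeb_near uu)
    have Wn: "vf_near \<A> x (\<lambda>y k. (-1) * W y k)"
      by (intro vf_near_scale hvf_near_vf[OF W_near] smooth_near_const)
    have "P.T = (\<lambda>y k. (u y * u y) * Q.T y k + (-1) * W y k)" by (simp add: W_def fun_eq_iff)
    then have "Q.D x v P.T = tv_lin 1 (Q.D x v (\<lambda>y k. (u y * u y) * Q.T y k)) 1 (Q.D x v (\<lambda>y k. (-1) * W y k))"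
      using Q.D_add[OF Zn Wn vt] by simp
    also have "Q.D x v (\<lambda>y k. (u y * u y) * Q.T y k) = tv_lin (v (\<lambda>y. u y * u y)) (Q.T x) (u x * u x) (\<lambda>_. 0)"
      using Q.D_scale[OF Q.reeb_near uu vt] Q.D_reeb[OF vt] by simp
    also have "Q.D x v (\<lambda>y k. (-1) * W y k) = tv_lin (v (\<lambda>_. - 1)) (W x) (- 1) (Q.D x v W)"
      by (rule Q.D_scale[OF hvf_near_vf[OF W_near] smooth_near_const vt])
    finally have "Q.D x v P.T = tv_lin 1 (tv_lin (v (\<lambda>y. u y * u y)) (Q.T x) (u x * u x) (\<lambda>_. 0)) 1
        (tv_lin (v (\<lambda>_. - 1)) (W x) (- 1) (Q.D x v W))" .
    moreover have "tv_lin (v (\<lambda>_. - 1)) (W x) (- 1) (Q.D x v W) \<in> H x"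
      by (rule levi_lin[OF W_levi Q.D_levi[OF vt W_near]])
    ultimately have "theta h x (Q.D x v P.T) = v (\<lambda>y. u y * u y) * theta h x (Q.T x) + (u x * u x) * theta h x (\<lambda>_. 0)"
      using P.theta_lin[OF tangent_lin[OF Q.reeb_tangent tangent_zero] levi_tangent, of "tv_lin (v (\<lambda>_. - 1)) (W x) (- 1) (Q.D x v W)" x 1 _ _ 1]
        P.theta_lin[OF Q.reeb_tangent tangent_zero] by (simp add: P.levi_iff)
    also have "\<dots> = 2 * \<delta> x v * ((u x * u x) * theta h x (Q.T x))"
      using tv_u_square[OF vt] P.levi_iff[of "\<lambda>_. 0" x] levi_zero by simp
    finally have "theta h x (Q.D x v P.T) = 2 * \<delta> x v" using theta_Q_reeb by simp
    moreover have "theta h x (P.D x v P.T) = 0" using P.D_reeb[OF vt] P.levi_iff[of "\<lambda>_. 0" x] levi_zero by simp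
    ultimately show ?thesis by (simp add: P.adapted_coeff_def F_def)
  qed
  have cS: "P.adapted_coeff x e (Suc a) (Q.D x v (F (Suc a))) - P.adapted_coeff x e (Suc a) (P.D x v (F (Suc a))) =
      Complex (diff_form x v (e a) (e a)) (diff_form x v (e a) (J x (e a)))" if "a < m" for a
  proof -
    note Ea = E[OF that, THEN conjunct1] and Ex = E[OF that, THEN conjunct2] and ea = el[OF that]
    show ?thesis
      using conn_diff[OF v Ea ea] conn_diff[OF v Ea J_levi[OF ea]] Ex
      by (simp add: P.adapted_coeff_def F_def P.hor_id[OF P.D_levi[OF vt Ea]] P.hor_id[OF Q.D_levi[OF vt Ea]]
          complex_eq_iff)
  qed
  \<comment> \<open>Summed over a, the bracket is the expansion of \<delta>(Jv) in the unitary
    frame; it supplies the 2 in m+2.\<close>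
  have tr: "diff_form x v (e a) (e a) = \<delta> x v"
    "diff_form x v (e a) (J x (e a)) = - \<delta> x (J x v)
      - 2 * (P.g x (J x v) (e a) * \<delta> x (e a) + P.g x (J x v) (J x (e a)) * \<delta> x (J x (e a)))" if "a < m" for a
  proof -
    note ea = el[OF that]
    have *: "P.g x (e a) (e a) = 1" using e that by (simp add: unitary_frame_def)
    have Je: "P.g x (e a) (J x (e a)) = 0" "P.g x (J x (e a)) (e a) = 0"
      using P.g_J_self[OF ea] P.g_sym[OF ea J_levi[OF ea]] by auto
    have JJe: "\<delta> x (J x (J x (e a))) = - \<delta> x (e a)"
      unfolding JJ[OF ea] using \<delta>_lin[of x "-1" "e a" 0 "e a"] by simp
    show "diff_form x v (e a) (e a) = \<delta> x v"
      by (simp add: diff_form_def * Je)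
    show "diff_form x v (e a) (J x (e a)) = - \<delta> x (J x v)
      - 2 * (P.g x (J x v) (e a) * \<delta> x (e a) + P.g x (J x v) (J x (e a)) * \<delta> x (J x (e a)))"
      using * by (simp add: diff_form_def Je JJe P.g_JJ[OF ea ea] P.g_JJ[OF v ea] P.g_J_skew[OF v ea] algebra_simps)
  qed
  have Jv: "\<delta> x (J x v) = (\<Sum>a<m. P.g x (J x v) (e a) * \<delta> x (e a) + P.g x (J x v) (J x (e a)) * \<delta> x (J x (e a)))"
    unfolding \<delta>_def using fun_cong[OF P.unitary_expand[OF e J_levi[OF v]], of u]
    by (simp add: sum_divide_distrib add_divide_distrib)
  have "(\<Sum>i\<le>m. P.adapted_coeff x e i (Q.D x v (F i)) - P.adapted_coeff x e i (P.D x v (F i))) =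
      of_real (2 * \<delta> x v) + (\<Sum>a<m. Complex (diff_form x v (e a) (e a)) (diff_form x v (e a) (J x (e a))))"
    unfolding lessThan_Suc_atMost[symmetric] sum.lessThan_Suc_shift c0 using cS by simp
  also have "(\<Sum>a<m. Complex (diff_form x v (e a) (e a)) (diff_form x v (e a) (J x (e a)))) =
      Complex (m * \<delta> x v) (- m * \<delta> x (J x v) - 2 * \<delta> x (J x v))"
  proof -
    have "(\<Sum>a<m. 2 * (P.g x (J x v) (e a) * \<delta> x (e a)) +
        2 * (P.g x (J x v) (J x (e a)) * \<delta> x (J x (e a)))) = 2 * \<delta> x (J x v)"
      unfolding Jv by (simp add: sum_distrib_left distrib_left)
    then show ?thesis using tr by (simp add: complex_eq_iff sum_subtractf)
  qed
  finally show ?thesis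
    using main by (simp add: complex_eq_iff algebra_simps)
qed

end

section \<open>Densities and spinor frames\<close>

context smooth_mfd
begin

lemma principal_bundleD:
  assumes "principal_bundle A G mul one pr act Sec"
  shows "\<And>p g g'. g \<in> G \<Longrightarrow> g' \<in> G \<Longrightarrow> act (act p g) g' = act p (mul g g')"
    and "\<And>p g. g \<in> G \<Longrightarrow> pr (act p g) = pr p"
    and "\<And>p p'. pr p = pr p' \<Longrightarrow> \<exists>!g. g \<in> G \<and> p' = act p g"
    and "\<exists>U t. (U, t) \<in> Sec \<and> x \<in> U"
    and "\<And>U t. (U, t) \<in> Sec \<Longrightarrow> open U \<and> (\<forall>x\<in>U. pr (t x) = x)"
    and "\<And>U s V t. (U, s) \<in> Sec \<Longrightarrow> (V, t) \<in> Sec \<Longrightarrow>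
      \<exists>g. smooth_fun A (U \<inter> V) g \<and> (\<forall>x\<in>U \<inter> V. g x \<in> G \<and> t x = act (s x) (g x))"
  subgoal using assms[unfolded principal_bundle_def, THEN conjunct2, THEN conjunct1] by blast
  subgoal using assms[unfolded principal_bundle_def, THEN conjunct2, THEN conjunct2, THEN conjunct1] by blast
  subgoal using assms[unfolded principal_bundle_def, THEN conjunct2, THEN conjunct2, THEN conjunct2, THEN conjunct1] by blast
  subgoal using assms[unfolded principal_bundle_def, THEN conjunct2, THEN conjunct2, THEN conjunct2, THEN conjunct2, THEN conjunct1, THEN spec, of x] by auto
  subgoal for U t using assms[unfolded principal_bundle_def, THEN conjunct2, THEN conjunct2, THEN conjunct2, THEN conjunct2, THEN conjunct2, THEN conjunct1, THEN bspec, of "(U, t)"] by simp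
  subgoal for U s V t
    using assms[unfolded principal_bundle_def, THEN conjunct2, THEN conjunct2, THEN conjunct2, THEN conjunct2, THEN conjunct2, THEN conjunct2, THEN bspec, of "(U, s)"] by (auto dest!: bspec[of _ _ "(V, t)"])
  done

lemma principal_section:
  assumes "principal_bundle A G mul one pr act Sec"
  shows "\<exists>U t. (U, t) \<in> Sec \<and> x \<in> U \<and> local_section A G pr act Sec U t"
proof -
  note pb = principal_bundleD[OF assms]
  obtain U t where Ut: "(U, t) \<in> Sec" "x \<in> U" using pb(4)[of x] by blast
  have "local_section A G pr act Sec U t"
    unfolding local_section_def
  proof (intro conjI ballI)
    fix Vs assume "Vs \<in> Sec"
    then show "case Vs of (V, s) \<Rightarrow> \<exists>g. smooth_fun A (U \<inter> V) g \<and> (\<forall>x\<in>U \<inter> V. g x \<in> G \<and> t x = act (s x) (g x))"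
      using pb(6)[OF _ Ut(1)] by (cases Vs) (simp add: Int_commute)
  qed (use pb(5)[OF Ut(1)] in auto)
  then show ?thesis using Ut by blast
qed

lemma local_sectionD:
  assumes "local_section A G pr act Sec U t"
  shows "open U" "\<And>y. y \<in> U \<Longrightarrow> pr (t y) = y"
    and "\<And>V s. (V, s) \<in> Sec \<Longrightarrow>
      \<exists>g. smooth_fun A (U \<inter> V) g \<and> (\<forall>x\<in>U \<inter> V. g x \<in> G \<and> t x = act (s x) (g x))"
  using assms unfolding local_section_def by auto

lemma local_section_subset:
  assumes "local_section A G pr act Sec U t" "open W" "W \<subseteq> U"
  shows "local_section A G pr act Sec W t"
  unfolding local_section_def
proof (intro conjI ballI)
  show "open W" by fact
  show "pr (t x) = x" if "x \<in> W" for x using local_sectionD(2)[OF assms(1)] assms(3) that by blast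
  fix Vs assume "Vs \<in> Sec"
  then obtain V s where Vs: "Vs = (V, s)" "(V, s) \<in> Sec" by (cases Vs) auto
  then obtain g where g: "smooth_fun A (U \<inter> V) g" "\<forall>x\<in>U \<inter> V. g x \<in> G \<and> t x = act (s x) (g x)"
    using local_sectionD(3)[OF assms(1)] by blast
  have "W \<inter> V = W \<inter> (U \<inter> V)" using assms(3) by blast
  then have "open (W \<inter> V)" using smooth_fun_open[OF g(1)] assms(2) by auto
  then have "smooth_fun A (W \<inter> V) g" using smooth_fun_subset[OF g(1)] assms(3) by blast
  then show "case Vs of (V, s) \<Rightarrow> \<exists>g. smooth_fun A (W \<inter> V) g \<and> (\<forall>x\<in>W \<inter> V. g x \<in> G \<and> t x = act (s x) (g x))"
    using g(2) assms(3) Vs(1) by blast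
qed

lemma tv_powi:
  assumes v: "v \<in> tangent_space A x" and h: "smooth_near A x h" "h x \<noteq> 0"
  shows "smooth_near A x (\<lambda>y. h y powi k)" "v (\<lambda>y. h y powi k) = of_int k * h x powi k * (v h / h x)"
proof -
  have pow: "smooth_near A x (\<lambda>y. h y ^ n) \<and> v (\<lambda>y. h y ^ n) = of_nat n * h x ^ n * (v h / h x)" for n
  proof (induction n)
    case 0
    show ?case using smooth_near_const[of x 1] tv_const[OF v, of 1] by simp
  next
    case (Suc n)
    have "smooth_near A x (\<lambda>y. h y * h y ^ n)" by (rule smooth_near_mult[OF h(1)]) (use Suc in blast)
    moreover have "v (\<lambda>y. h y * h y ^ n) = h x * v (\<lambda>y. h y ^ n) + h x ^ n * v h"
      by (rule tv_mult[OF v h(1)]) (use Suc in blast)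
    ultimately show ?case using Suc h(2) by (simp add: field_simps)
  qed
  have "smooth_near A x (\<lambda>y. h y powi k) \<and> v (\<lambda>y. h y powi k) = of_int k * h x powi k * (v h / h x)"
  proof (cases k rule: int_cases2)
    case (nonneg n)
    then show ?thesis using pow[of n] by simp
  next
    case (nonpos n)
    have "smooth_near A x (\<lambda>y. inverse (h y ^ n))"
      by (rule smooth_near_inverse) (use pow h(2) in auto)
    moreover have "v (\<lambda>y. inverse (h y ^ n)) = - v (\<lambda>y. h y ^ n) / (h x ^ n)\<^sup>2"
      by (rule tv_inverse[OF v]) (use pow h(2) in auto)
    ultimately show ?thesis
      using pow[of n] nonpos h(2) by (simp add: power_int_minus field_simps power2_eq_square)
  qed
  then show "smooth_near A x (\<lambda>y. h y powi k)" "v (\<lambda>y. h y powi k) = of_int k * h x powi k * (v h / h x)"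
    by blast+
qed

end

section \<open>Local frames and norms of the density bundles\<close>

locale density_mfd = cr C for C :: "('a::{t2_space, second_countable_topology}, 'n::finite) cr_structure" +
  fixes E :: "('a, 'q) density"
  assumes dens: "density_bundle C E"
begin

lemma density_section_exists: "\<exists>q U. x \<in> U \<and> density_section C E U q"
  using principal_section[of "{z::complex. z \<noteq> 0}" "(*)" 1 "qproj E" "qact E" "qsec E" x] dens
  unfolding density_bundle_def density_section_def by blast

lemma density_section_subset: "density_section C E U q \<Longrightarrow> open W \<Longrightarrow> W \<subseteq> U \<Longrightarrow> density_section C E W q"
  unfolding density_section_def by (rule local_section_subset)

lemma density_section_open: "density_section C E U q \<Longrightarrow> open U"
  unfolding density_section_def by (rule local_sectionD(1))

lemma density_section_proj: "density_section C E U q \<Longrightarrow> y \<in> U \<Longrightarrow> qproj E (q y) = y"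
  unfolding density_section_def by (rule local_sectionD(2))

lemma kappa_canonical: "canonical_form C (qproj E q) (kappa E q)"
  using dens unfolding density_bundle_def by blast

lemma kappa_nonzero: "\<exists>V. tuple_at C (qproj E q) V \<and> kappa E q V \<noteq> 0"
  using dens unfolding density_bundle_def by blast

lemma kappa_cform: "cform (qproj E q) (\<lambda>F. kappa E q (map F [0..<m + 1]))"
  by (rule canonical_form_cform[OF kappa_canonical])

lemma kappa_nonzero_tuple: "\<exists>F. (\<forall>i\<le>m. F i \<in> TM (qproj E q)) \<and> kappa E q (map F [0..<m + 1]) \<noteq> 0"
proof -
  obtain V where V: "tuple_at C (qproj E q) V" "kappa E q V \<noteq> 0" using kappa_nonzero by blast
  then have len: "length V = m + 1" "set V \<subseteq> TM (qproj E q)" by (auto simp: tuple_at_def)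
  then have "map (\<lambda>i. V ! i) [0..<m + 1] = V" using map_nth[of V] by simp
  moreover have "V ! i \<in> TM (qproj E q)" if "i \<le> m" for i using len nth_mem[of i V] that by auto
  ultimately show ?thesis using V(2) by (intro exI[of _ "\<lambda>i. V ! i"]) simp
qed

context
  fixes U q x
  assumes q: "density_section C E U q" and x: "x \<in> U"
begin

lemma section_cform: "y \<in> U \<Longrightarrow> cform y (form_on (\<lambda>y. kappa E (q y)) y)"
  using kappa_cform[of "q y"] density_section_proj[OF q] by (simp add: form_on_def[abs_def])

lemma section_nonzero: "\<exists>V. (\<forall>i\<le>m. V i \<in> TM x) \<and> form_on (\<lambda>y. kappa E (q y)) x V \<noteq> 0"
  using kappa_nonzero_tuple[of "q x"] density_section_proj[OF q x] by (simp add: form_on_def)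

lemma section_smooth:
  assumes F: "\<forall>i\<le>m. vf_near \<A> x (F i)"
  shows "smooth_near \<A> x (\<lambda>y. form_on (\<lambda>y. kappa E (q y)) y (\<lambda>i. F i y))"
proof -
  have "\<forall>i. \<exists>V. i \<le> m \<longrightarrow> x \<in> V \<and> vf_on \<A> V (F i)" using F unfolding vf_near_def by blast
  then obtain V where V: "\<And>i. i \<le> m \<Longrightarrow> x \<in> V i \<and> vf_on \<A> (V i) (F i)" by metis
  define W where "W = U \<inter> (\<Inter>i\<in>{..m}. V i)"
  have "open (\<Inter>i\<in>{..m}. V i)" by (rule open_INT) (use V in \<open>auto simp: vf_on_def\<close>)
  then have W: "open W" "x \<in> W" "W \<subseteq> U"
    using density_section_open[OF q] x V by (auto simp: W_def)
  have sec: "density_section C E W q" by (rule density_section_subset[OF q W(1,3)])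
  have "vf_on \<A> W (F i)" if "i \<le> m" for i
    by (rule vf_on_subset[of "V i"]) (use V W that in \<open>auto simp: W_def\<close>)
  then have "\<forall>X\<in>set (map F [0..<m + 1]). vf_on \<A> W X" by auto
  moreover have "length (map F [0..<m + 1]) = m + 1" by simp
  ultimately have "smooth_fun \<A> W (\<lambda>y. kappa E (q y) (map (\<lambda>X. X y) (map F [0..<m + 1])))"
    using dens sec unfolding density_bundle_def by blast
  moreover have "map (\<lambda>X. X y) (map F [0..<m + 1]) = map (\<lambda>i. F i y) [0..<m + 1]" for y
    by (simp del: upt_Suc)
  ultimately have "smooth_fun \<A> W (\<lambda>y. form_on (\<lambda>y. kappa E (q y)) y (\<lambda>i. F i y))"
    unfolding form_on_def by (simp only:)
  then show ?thesis using W(2) by (rule smooth_nearI)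
qed

end

text \<open>The frame selected inside \<open>density_logder\<close>. The selection does not involve
  the pseudo-Hermitian structure, so \<theta> and \<theta>' share it.\<close>

definition some_section :: "'a \<Rightarrow> 'a \<Rightarrow> 'q" where
  "some_section x = (SOME q. \<exists>U. x \<in> U \<and> density_section C E U q)"

lemma some_section: obtains U where "x \<in> U" "density_section C E U (some_section x)"
  unfolding some_section_def using someI_ex[OF density_section_exists[of x]] by blast

end

locale density_pherm = density_mfd C E + pherm C h
  for C :: "('a::{t2_space, second_countable_topology}, 'n::finite) cr_structure" and E :: "('a, 'q) density" and h
begin

lemma density_logder_eq:
  "density_logder C h E l w x v = cder v (\<lambda>y. w y (some_section x y)) / w x (some_section x x)
    + of_int l * (- canonical_conn C h (\<lambda>y. kappa E (some_section x y)) x v / of_nat (m + 2))"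
  by (simp add: density_logder_def some_section_def Let_def)

lemma density_logder_lin:
  assumes vw: "v \<in> TM x" "w \<in> TM x"
  shows "density_logder C h E l z x (tv_lin a v b w) =
    of_real a * density_logder C h E l z x v + of_real b * density_logder C h E l z x w"
proof -
  obtain U where U: "x \<in> U" "density_section C E U (some_section x)" by (rule some_section)
  have conn: "canonical_conn C h (\<lambda>y. kappa E (some_section x y)) x (tv_lin a v b w) =
      of_real a * canonical_conn C h (\<lambda>y. kappa E (some_section x y)) x v +
      of_real b * canonical_conn C h (\<lambda>y. kappa E (some_section x y)) x w"
  proof (rule canonical_conn_lin[OF density_section_open[OF U(2)] U(1) _ _ _ vw])
    show "cform y (form_on (\<lambda>y. kappa E (some_section x y)) y)" if "y \<in> U" for y
      by (rule section_cform[OF U(2,1) that])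
    show "smooth_near \<A> x (\<lambda>y. form_on (\<lambda>y. kappa E (some_section x y)) y (\<lambda>i. F i y))"
      if "\<forall>i\<le>m. vf_near \<A> x (F i)" for F by (rule section_smooth[OF U(2,1) that])
  qed (rule section_nonzero[OF U(2,1)])
  show ?thesis
    unfolding density_logder_eq cder_lin_dir conn
    by (simp add: add_divide_distrib diff_divide_distrib algebra_simps)
qed

lemma canonical_norm_eq:
  "canonical_norm C h x \<omega> = cmod (\<omega> (map (adapted_basis x (some_unitary_frame C h x)) [0..<m + 1]))"
proof -
  have "map (adapted_basis x (some_unitary_frame C h x)) [0..<m + 1] =
      adapted_basis x (some_unitary_frame C h x) 0 # map (adapted_basis x (some_unitary_frame C h x)) (map Suc [0..<m])"
    by (simp only: map_Suc_upt Suc_eq_plus1[symmetric] upt_conv_Cons[OF zero_less_Suc] list.map)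
  also have "\<dots> = T x # map (some_unitary_frame C h x) [0..<m]"
    by (simp add: adapted_basis_def)
  finally show ?thesis by (simp add: canonical_norm_def)
qed

text \<open>A canonical form that is 0 on an adapted basis is 0, whereas \<open>kappa\<close> takes
  nonzero forms as values.\<close>

lemma canonical_norm_pos: "0 < canonical_norm C h (qproj E q) (kappa E q)"
  using kappa_nonzero_tuple[of q] cf_zero[OF some_unitary kappa_cform[of q]]
  unfolding canonical_norm_eq by (metis zero_less_norm_iff)

end

locale density_conformal = density_mfd C E + conformal C h h' f
  for C :: "('a::{t2_space, second_countable_topology}, 'n::finite) cr_structure" and E :: "('a, 'q) density" and h h' f
begin

sublocale P: density_pherm C E h ..
sublocale Q: density_pherm C E h' ..

lemma canonical_norm_conformal:
  "canonical_norm C h (qproj E q) (kappa E q) = u (qproj E q) ^ (m + 2) * canonical_norm C h' (qproj E q) (kappa E q)"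
  unfolding P.canonical_norm_eq Q.canonical_norm_eq
  by (rule cform_norm_conformal[OF kappa_cform P.some_unitary Q.some_unitary])

text \<open>The canonical norm for \<theta> is u^(m+2) times that for \<theta>'. The exponent
  -1/(m+2) turns this into a factor u between the norms on E(1), u^l on E(l), and vectors of unit
  length are rescaled by u^(-l).\<close>

lemma density_norm_ratio:
  assumes "density_norm C h E l w q = 1" "density_norm C h' E l w' q = 1"
    and r: "0 < r" "w' q = of_real r * w q"
  shows "r = u (qproj E q) powi (- l)" "w q \<noteq> 0"
proof -
  let ?x = "qproj E q"
  define t where "t = - 1 / real (m + 2)"
  define K where "K = canonical_norm C h ?x (kappa E q)"
  define K' where "K' = canonical_norm C h' ?x (kappa E q)"
  have K': "0 < K'" unfolding K'_def by (rule Q.canonical_norm_pos)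
  have KK': "K = u ?x ^ (m + 2) * K'" unfolding K_def K'_def by (rule canonical_norm_conformal)
  have "(u ?x ^ (m + 2)) powr t = u ?x powr (real (m + 2) * t)"
    by (simp only: powr_realpow[OF exp_gt_zero, symmetric] powr_powr)
  also have "real (m + 2) * t = - 1" by (simp add: t_def)
  also have "u ?x powr - 1 = inverse (u ?x)" by (simp add: powr_minus)
  finally have Kt: "K powr t = inverse (u ?x) * K' powr t"
    unfolding KK' using K' by (simp add: powr_mult)
  have 1: "cmod (w q) * (K powr t) powi l = 1" using assms(1) by (simp add: density_norm_def K_def t_def)
  have 2: "r * cmod (w q) * (K' powr t) powi l = 1"
    using assms(2) r by (simp add: density_norm_def K'_def t_def norm_mult)
  show "w q \<noteq> 0" using 1 by auto
  have p: "0 < (K' powr t) powi l" using K' by simp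
  have "(K powr t) powi l = u ?x powi (- l) * (K' powr t) powi l"
    unfolding Kt by (simp add: power_int_mult_distrib power_int_minus power_int_inverse)
  with 1 2 have "r * (cmod (w q) * (K' powr t) powi l) = u ?x powi (- l) * (cmod (w q) * (K' powr t) powi l)"
    by (simp add: mult_ac)
  moreover have "cmod (w q) * (K' powr t) powi l \<noteq> 0" using \<open>w q \<noteq> 0\<close> K' by simp
  ultimately show "r = u ?x powi (- l)" using mult_right_cancel by blast
qed

text \<open>The real parts of the change of the connection and of the frame of E(l) cancel.\<close>

lemma density_logder_conformal:
  assumes v: "v \<in> H x"
    and V: "open V" "x \<in> V"
    and w: "smooth_near \<A> x (\<lambda>y. w y (some_section x y))" "w x (some_section x x) \<noteq> 0"
    and w': "\<And>y. y \<in> V \<Longrightarrow> w' y (some_section x y) = of_real (u y powi (- l)) * w y (some_section x y)"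
  shows "density_logder C h' E l w' x v = density_logder C h E l w x v - \<i> * of_int l * of_real (\<delta> x (J x v))"
proof -
  note vt = levi_tangent[OF v]
  obtain U where U: "x \<in> U" "density_section C E U (some_section x)" by (rule some_section)
  have conn: "canonical_conn C h' (\<lambda>y. kappa E (some_section x y)) x v =
      canonical_conn C h (\<lambda>y. kappa E (some_section x y)) x v - of_nat (m + 2) * Complex (\<delta> x v) (- \<delta> x (J x v))"
  proof (rule canonical_conn_conformal[OF density_section_open[OF U(2)] U(1) _ _ _ v])
    show "cform y (form_on (\<lambda>y. kappa E (some_section x y)) y)" if "y \<in> U" for y
      by (rule section_cform[OF U(2,1) that])
    show "smooth_near \<A> x (\<lambda>y. form_on (\<lambda>y. kappa E (some_section x y)) y (\<lambda>i. F i y))"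
      if "\<forall>i\<le>m. vf_near \<A> x (F i)" for F by (rule section_smooth[OF U(2,1) that])
  qed (rule section_nonzero[OF U(2,1)])
  let ?w = "\<lambda>y. w y (some_section x y)"
  note up = tv_powi[OF vt u_near, of "- l"]
  have "cder v (\<lambda>y. w' y (some_section x y)) = cder v (\<lambda>y. of_real (u y powi (- l)) * ?w y)"
    by (rule cder_cong_on[OF vt V]) (rule w')
  also have "\<dots> = of_real (u x powi (- l)) * cder v ?w + of_real (v (\<lambda>y. u y powi (- l))) * ?w x"
    by (rule cder_mult_real[OF vt up(1) w(1)]) simp
  also have "v (\<lambda>y. u y powi (- l)) = - of_int l * u x powi (- l) * \<delta> x v"
    using up(2) by (simp add: \<delta>_def)
  finally have quot: "cder v (\<lambda>y. w' y (some_section x y)) / w' x (some_section x x) = cder v ?w / ?w x - of_int l * of_real (\<delta> x v)"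
    using w'[OF V(2)] w(2) by (simp add: field_simps)
  have fr: "- (cc - of_nat (m + 2) * Z) / of_nat (m + 2) = - cc / of_nat (m + 2) + Z" for cc Z :: complex
  proof -
    have "of_nat (m + 2) \<noteq> (0 :: complex)" by (metis of_nat_eq_0_iff add_is_0 zero_neq_numeral)
    then show ?thesis by (simp add: diff_divide_distrib del: of_nat_add)
  qed
  \<comment> \<open>The quotient contributes -l \<delta>(v), the connection l (\<delta>(v) - i
    \<delta>(Jv)).\<close>
  show ?thesis
    unfolding P.density_logder_eq Q.density_logder_eq conn fr quot by (simp add: Complex_eq algebra_simps)
qed

end

subsection \<open>Spinor frames\<close>

lemma mat_mult_component: "(mat z ** A) $ i $ k = z * A $ i $ k" "(A ** mat z) $ i $ k = A $ i $ k * z"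
  for A :: "complex ^ 's ^ 's::finite"
proof -
  have "(mat z ** A) $ i $ k = (\<Sum>l\<in>UNIV. (if i = l then z else 0) * A $ l $ k)"
    unfolding matrix_matrix_mult_def mat_def by simp
  also have "\<dots> = (\<Sum>l\<in>UNIV. if l = i then z * A $ l $ k else 0)" by (rule sum.cong) auto
  finally show "(mat z ** A) $ i $ k = z * A $ i $ k" by simp
  have "(A ** mat z) $ i $ k = (\<Sum>l\<in>UNIV. A $ i $ l * (if l = k then z else 0))"
    unfolding matrix_matrix_mult_def mat_def by simp
  also have "\<dots> = (\<Sum>l\<in>UNIV. if l = k then A $ i $ l * z else 0)" by (rule sum.cong) auto
  finally show "(A ** mat z) $ i $ k = A $ i $ k * z" by simp
qed

lemma mat_mult_commute: "mat z ** A = A ** mat (z :: complex)"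
  for A :: "complex ^ 's ^ 's::finite"
  by (simp add: vec_eq_iff mat_mult_component)

lemma mat_mult_mat: "mat z ** mat w = (mat (z * w) :: complex ^ 's ^ 's::finite)"
  by (simp add: vec_eq_iff mat_mult_component) (simp add: mat_def)

text \<open>The group is generated by multiplication on the right, so the induction is on the right
  factor.\<close>

lemma spin_group_mult: "g' \<in> spin_group m \<gamma> \<Longrightarrow> g \<in> spin_group m \<gamma> \<Longrightarrow> g ** g' \<in> spin_group m \<gamma>"
proof (induction g' rule: spin_group.induct)
  case (step g' v w)
  then have "(g ** g') ** cliff m \<gamma> v ** cliff m \<gamma> w \<in> spin_group m \<gamma>" by (intro spin_group.step) auto
  then show ?case by (simp add: matrix_mul_assoc)
qed (simp add: matrix_mul_rid)

lemma spinc_group_mult: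
  assumes "g \<in> spinc_group m \<gamma>" "g' \<in> spinc_group m \<gamma>"
  shows "g ** g' \<in> spinc_group m \<gamma>"
proof -
  obtain z k z' k' where *: "g = mat z ** k" "cmod z = 1" "k \<in> spin_group m \<gamma>"
    "g' = mat z' ** k'" "cmod z' = 1" "k' \<in> spin_group m \<gamma>"
    using assms unfolding spinc_group_def by blast
  have "g ** g' = (mat z ** mat z') ** (k ** k')"
    unfolding *(1,4) by (metis matrix_mul_assoc mat_mult_commute)
  then have "g ** g' = mat (z * z') ** (k ** k')" by (simp only: mat_mult_mat)
  moreover have "cmod (z * z') = 1" using * by (simp add: norm_mult)
  ultimately show ?thesis using spin_group_mult[OF *(6,3)] unfolding spinc_group_def by blast
qed

lemma bounded_linear_matrix_mult_right: "bounded_linear (\<lambda>A :: complex ^ 's ^ 's::finite. A ** B)"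
proof -
  have "linear (\<lambda>A :: complex ^ 's ^ 's. A ** B)"
    by (rule linearI) (simp_all add: matrix_matrix_mult_def vec_eq_iff sum.distrib distrib_right scaleR_sum_right)
  then show ?thesis by (rule linear_conv_bounded_linear[THEN iffD1])
qed

context cr
begin

text \<open>A bundle section over the point is translated by the constant group element that leads
  to p. Transition functions are then multiplied by a fixed matrix, which preserves smoothness and
  membership in the group.\<close>

lemma spinor_frame_through:
  fixes \<gamma> :: "nat \<Rightarrow> complex ^ 's ^ 's::finite"
  assumes "principal_bundle \<A> (spinc_group m \<gamma>) (**) (mat 1) (pproj S) (pact S) (psec S)"
  shows "\<exists>s U. pproj S p \<in> U \<and> s (pproj S p) = p \<and> spinor_frame C \<gamma> S U s"
proof -
  let ?G = "spinc_group m \<gamma>" and ?x = "pproj S p"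
  note pb = principal_bundleD[OF assms]
  obtain U t where Ut: "(U, t) \<in> psec S" "?x \<in> U" "local_section \<A> ?G (pproj S) (pact S) (psec S) U t"
    using principal_section[OF assms, of ?x] by blast
  have act: "\<And>p g g'. g \<in> ?G \<Longrightarrow> g' \<in> ?G \<Longrightarrow> pact S (pact S p g) g' = pact S p (g ** g')"
    "\<And>p g. g \<in> ?G \<Longrightarrow> pproj S (pact S p g) = pproj S p"
    by (rule pb(1), assumption+) (rule pb(2), assumption)
  have proj: "pproj S (t y) = y" if "y \<in> U" for y by (rule local_sectionD(2)[OF Ut(3) that])
  have "\<exists>!g. g \<in> ?G \<and> p = pact S (t ?x) g"
    by (rule pb(3)) (rule proj[OF Ut(2)])
  then obtain g where g: "g \<in> ?G" "p = pact S (t ?x) g" by blast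
  define s where "s = (\<lambda>y. pact S (t y) g)"
  have "spinor_frame C \<gamma> S U s"
    unfolding spinor_frame_def local_section_def
  proof (intro conjI ballI)
    show "open U" by (rule local_sectionD(1)[OF Ut(3)])
    show "pproj S (s y) = y" if "y \<in> U" for y using act(2)[OF g(1)] proj[OF that] by (simp add: s_def)
    fix Vs assume "Vs \<in> psec S"
    then obtain V s2 where Vs: "Vs = (V, s2)" "(V, s2) \<in> psec S" by (cases Vs) auto
    then obtain k where k: "smooth_fun \<A> (U \<inter> V) k" "\<forall>x\<in>U \<inter> V. k x \<in> ?G \<and> t x = pact S (s2 x) (k x)"
      using local_sectionD(3)[OF Ut(3)] by blast
    have "smooth_fun \<A> (U \<inter> V) (\<lambda>y. k y ** g)"
      by (rule smooth_fun_linear[OF bounded_linear_matrix_mult_right k(1)])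
    moreover have "k y ** g \<in> ?G \<and> s y = pact S (s2 y) (k y ** g)" if "y \<in> U \<inter> V" for y
      using spinc_group_mult[OF _ g(1), of "k y"] act(1)[OF _ g(1), of "k y" "s2 y"] k(2) that by (simp add: s_def)
    ultimately show "case Vs of (V, s2) \<Rightarrow> \<exists>g. smooth_fun \<A> (U \<inter> V) g \<and>
        (\<forall>x\<in>U \<inter> V. g x \<in> spinc_group (crdim C) \<gamma> \<and> s x = pact S (s2 x) (g x))"
      unfolding Vs(1) by auto
  qed
  moreover have "s ?x = p" using g(2) by (simp add: s_def)
  ultimately show ?thesis using Ut(2) by (intro exI[of _ s] exI[of _ U] conjI)
qed

lemma spinor_frame_subset: "spinor_frame C \<gamma> S U s \<Longrightarrow> open W \<Longrightarrow> W \<subseteq> U \<Longrightarrow> spinor_frame C \<gamma> S W s"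
  unfolding spinor_frame_def by (rule local_section_subset)

end

section \<open>Clifford algebra\<close>

lemma scaleR_complex: "r *\<^sub>R (z :: complex) = of_real r * z"
  by (rule scaleR_conv_of_real)

lemma scaleR_eq_smult: "r *\<^sub>R (\<psi> :: complex ^ 's::finite) = of_real r *s \<psi>"
  by (simp add: vec_eq_iff scaleR_complex)

lemma matrix_vector_linear_left: "linear (\<lambda>A :: complex ^ 's ^ 's::finite. A *v \<psi>)"
  by (rule linearI)
    (simp_all add: matrix_vector_mult_add_rdistrib, simp add: vec_eq_iff matrix_vector_mult_def scaleR_sum_right)

text \<open>The algebra at one point. Vectors are given by coefficients in an orthonormal frame, and
  \<open>j a\<close> holds the coefficients of J applied to the a-th frame vector.\<close>

locale hermitian_clifford =
  fixes n :: nat and \<gamma> :: "nat \<Rightarrow> complex ^ 's ^ 's::finite" and j :: "nat \<Rightarrow> nat \<Rightarrow> real"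
  assumes anti: "\<And>a b. a < n \<Longrightarrow> b < n \<Longrightarrow> \<gamma> a ** \<gamma> b + \<gamma> b ** \<gamma> a = (if a = b then mat (-2) else 0)"
    and skew: "\<And>a b. a < n \<Longrightarrow> b < n \<Longrightarrow> j b a = - j a b"
    and jj: "\<And>a c. a < n \<Longrightarrow> c < n \<Longrightarrow> (\<Sum>b<n. j a b * j b c) = (if a = c then -1 else 0)"
begin

definition c :: "(nat \<Rightarrow> real) \<Rightarrow> complex ^ 's \<Rightarrow> complex ^ 's" where
  "c w \<psi> = (\<Sum>a<n. w a *\<^sub>R (\<gamma> a *v \<psi>))"

definition dot :: "(nat \<Rightarrow> real) \<Rightarrow> (nat \<Rightarrow> real) \<Rightarrow> real" where
  "dot w w' = (\<Sum>a<n. w a * w' a)"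

definition rot :: "(nat \<Rightarrow> real) \<Rightarrow> nat \<Rightarrow> real" where
  "rot w b = (\<Sum>a<n. w a * j a b)"

text \<open>The sum of s_a \<cdot> Js_a over a full orthonormal frame. It counts each complex
  direction twice, so \<Theta> = (i/2) N.\<close>

definition N :: "complex ^ 's \<Rightarrow> complex ^ 's" where
  "N \<psi> = (\<Sum>a<n. \<gamma> a *v c (j a) \<psi>)"

lemma c_cliff: "n = 2 * k \<Longrightarrow> c w \<psi> = cliff k \<gamma> w *v \<psi>"
  unfolding c_def cliff_def
  by (simp add: linear_sum[OF matrix_vector_linear_left] linear_scale[OF matrix_vector_linear_left])

lemma gamma_linear: "linear (\<lambda>\<psi>. \<gamma> a *v \<psi>)"
  by (rule linearI) (simp_all add: matrix_vector_right_distrib scaleR_eq_smult vector_scalar_commute)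

lemma gamma_smult: "\<gamma> a *v (z *s \<psi>) = z *s (\<gamma> a *v \<psi>)"
  by (simp add: vector_scalar_commute)

lemma c_linear: "linear (c w)"
  unfolding c_def
  by (rule linearI)
    (simp_all add: linear_add[OF gamma_linear] linear_scale[OF gamma_linear] scaleR_add_right sum.distrib
      scaleR_sum_right mult.commute)

lemma c_smult: "c w (z *s \<psi>) = z *s c w \<psi>"
  unfolding c_def
  by (simp add: gamma_smult vec_eq_iff sum_distrib_left sum_component algebra_simps scaleR_complex)

lemma c_cong: "(\<And>a. a < n \<Longrightarrow> w a = w' a) \<Longrightarrow> c w \<psi> = c w' \<psi>"
  by (simp add: c_def)

lemma c_sum_coeff: "c (\<lambda>a. \<Sum>i\<in>I. r i * w i a) \<psi> = (\<Sum>i\<in>I. r i *\<^sub>R c (w i) \<psi>)"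
  unfolding c_def
  by (simp add: scaleR_sum_left scaleR_sum_right sum.swap[of _ "{..<n}" I])

lemma c_scale: "c (\<lambda>a. r * w a) \<psi> = r *\<^sub>R c w \<psi>"
  by (simp add: c_def scaleR_sum_right)

lemma c_minus: "c (\<lambda>a. - w a) \<psi> = - c w \<psi>"
  using c_scale[of "-1" w \<psi>] by simp

lemma gamma_anti:
  assumes "a < n" "b < n"
  shows "\<gamma> a *v (\<gamma> b *v \<psi>) + \<gamma> b *v (\<gamma> a *v \<psi>) = (if a = b then - 2 *\<^sub>R \<psi> else 0)"
proof -
  have "\<gamma> a *v (\<gamma> b *v \<psi>) + \<gamma> b *v (\<gamma> a *v \<psi>) = (\<gamma> a ** \<gamma> b + \<gamma> b ** \<gamma> a) *v \<psi>"
    by (simp add: matrix_vector_mul_assoc matrix_vector_mult_add_rdistrib)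
  moreover have "mat (-2) *v \<psi> = - 2 *\<^sub>R \<psi>"
  proof -
    have "(mat (-2) *v \<psi>) $ i = (- 2 *\<^sub>R \<psi>) $ i" for i
    proof -
      have "(mat (-2) *v \<psi>) $ i = (\<Sum>l\<in>UNIV. (if i = l then - 2 else 0) * \<psi> $ l)"
        unfolding matrix_vector_mult_def mat_def by simp
      also have "\<dots> = (\<Sum>l\<in>UNIV. if l = i then - 2 * \<psi> $ l else 0)" by (rule sum.cong) auto
      finally show ?thesis by (simp add: scaleR_complex)
    qed
    then show ?thesis by (simp add: vec_eq_iff)
  qed
  ultimately show ?thesis using anti[OF assms] by simp
qed

lemma gamma_c:
  assumes "a < n"
  shows "\<gamma> a *v c w \<psi> + c w (\<gamma> a *v \<psi>) = (- 2 * w a) *\<^sub>R \<psi>"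
proof -
  have "\<gamma> a *v c w \<psi> + c w (\<gamma> a *v \<psi>) = (\<Sum>b<n. w b *\<^sub>R (\<gamma> a *v (\<gamma> b *v \<psi>) + \<gamma> b *v (\<gamma> a *v \<psi>)))"
    unfolding c_def linear_sum[OF gamma_linear] linear_scale[OF gamma_linear]
    by (simp add: sum.distrib scaleR_add_right)
  also have "\<dots> = (\<Sum>b<n. if b = a then (- 2 * w b) *\<^sub>R \<psi> else 0)"
    by (rule sum.cong[OF refl]) (use gamma_anti assms in auto)
  finally show ?thesis using assms by simp
qed

lemma c_anti: "c w (c w' \<psi>) + c w' (c w \<psi>) = (- 2 * dot w w') *\<^sub>R \<psi>"
proof -
  have "c w' (c w \<psi>) = (\<Sum>a<n. w a *\<^sub>R c w' (\<gamma> a *v \<psi>))"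
    by (subst (2) c_def) (simp add: linear_sum[OF c_linear] linear_scale[OF c_linear])
  moreover have "c w (c w' \<psi>) = (\<Sum>a<n. w a *\<^sub>R (\<gamma> a *v c w' \<psi>))"
    by (subst c_def) simp
  ultimately have "c w (c w' \<psi>) + c w' (c w \<psi>) = (\<Sum>a<n. w a *\<^sub>R (\<gamma> a *v c w' \<psi> + c w' (\<gamma> a *v \<psi>)))"
    by (simp add: sum.distrib scaleR_add_right)
  also have "\<dots> = (\<Sum>a<n. (- 2 * (w a * w' a)) *\<^sub>R \<psi>)"
    by (rule sum.cong[OF refl]) (use gamma_c in auto)
  finally show ?thesis
    by (simp only: dot_def scaleR_sum_left[symmetric] sum_distrib_left)
qed

lemma N_double: "N \<psi> = (\<Sum>a<n. \<Sum>b<n. j a b *\<^sub>R (\<gamma> a *v (\<gamma> b *v \<psi>)))"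
  unfolding N_def c_def linear_sum[OF gamma_linear] linear_scale[OF gamma_linear] ..

lemma N_reverse: "(\<Sum>a<n. c (j a) (\<gamma> a *v \<psi>)) = - N \<psi>"
proof -
  have "(\<Sum>a<n. c (j a) (\<gamma> a *v \<psi>)) = (\<Sum>a<n. \<Sum>b<n. j a b *\<^sub>R (\<gamma> b *v (\<gamma> a *v \<psi>)))"
    by (simp add: c_def)
  also have "\<dots> = (\<Sum>b<n. \<Sum>a<n. j a b *\<^sub>R (\<gamma> b *v (\<gamma> a *v \<psi>)))" by (rule sum.swap)
  also have "\<dots> = (\<Sum>b<n. \<Sum>a<n. - (j b a *\<^sub>R (\<gamma> b *v (\<gamma> a *v \<psi>))))"
  proof (intro sum.cong refl)
    fix b a assume "b \<in> {..<n}" "a \<in> {..<n}"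
    then show "j a b *\<^sub>R (\<gamma> b *v (\<gamma> a *v \<psi>)) = - (j b a *\<^sub>R (\<gamma> b *v (\<gamma> a *v \<psi>)))"
      using skew[of b a] by simp
  qed
  finally show ?thesis by (simp add: N_double sum_negf)
qed

lemma gamma_square_sum: "(\<Sum>a<n. \<gamma> a *v (\<gamma> a *v \<psi>)) = - real n *\<^sub>R \<psi>"
proof -
  have "\<gamma> a *v (\<gamma> a *v \<psi>) = - \<psi>" if "a < n" for a
  proof -
    have "2 *\<^sub>R (\<gamma> a *v (\<gamma> a *v \<psi>)) = 2 *\<^sub>R (- \<psi>)"
      using gamma_anti[OF that that, of \<psi>] by (simp add: scaleR_2)
    then show ?thesis by (simp only: real_vector.scale_cancel_left) simp
  qed
  then have "(\<Sum>a<n. \<gamma> a *v (\<gamma> a *v \<psi>)) = (\<Sum>a<n. - \<psi>)" by (intro sum.cong) auto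
  then show ?thesis by (simp add: scaleR_conv_of_real sum_constant_scaleR)
qed

lemma dot_j: "a < n \<Longrightarrow> dot (j a) (j a) = 1"
proof -
  assume a: "a < n"
  have "dot (j a) (j a) = (\<Sum>b<n. - (j a b * j b a))"
    unfolding dot_def
  proof (rule sum.cong[OF refl])
    fix b assume "b \<in> {..<n}"
    then show "j a b * j a b = - (j a b * j b a)" using skew[of a b] a by simp
  qed
  then show ?thesis using jj[OF a a] by (simp add: sum_negf)
qed

lemma j_square_sum: "(\<Sum>a<n. c (j a) (c (j a) \<psi>)) = - real n *\<^sub>R \<psi>"
proof -
  have "c (j a) (c (j a) \<psi>) = - \<psi>" if "a < n" for a
  proof -
    have "2 *\<^sub>R c (j a) (c (j a) \<psi>) = 2 *\<^sub>R (- \<psi>)"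
      using c_anti[of "j a" "j a" \<psi>] dot_j[OF that] by (simp add: scaleR_2)
    then show ?thesis by (simp only: real_vector.scale_cancel_left) simp
  qed
  then have "(\<Sum>a<n. c (j a) (c (j a) \<psi>)) = (\<Sum>a<n. - \<psi>)" by (intro sum.cong) auto
  then show ?thesis by (simp add: scaleR_conv_of_real sum_constant_scaleR)
qed

lemma dot_j_rot:
  assumes "a < n"
  shows "dot (j a) w = - rot w a"
  unfolding dot_def rot_def sum_negf[symmetric]
proof (rule sum.cong[OF refl])
  fix b assume "b \<in> {..<n}"
  then show "j a b * w b = - (w b * j b a)" using skew[of a b] assms by simp
qed

text \<open>Passing w through each of the two factors of N leaves 2 Jw. Thus [\<Theta>, w] = 2i Jw,
  and w - iJw and w + iJw shift the eigenvalue by -2 and +2.\<close>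

lemma N_commutator: "N (c w \<psi>) = c w (N \<psi>) + 4 *\<^sub>R c (rot w) \<psi>"
proof -
  have step: "\<gamma> a *v c (j a) (c w \<psi>) = c w (\<gamma> a *v c (j a) \<psi>) + (2 * w a) *\<^sub>R c (j a) \<psi> + (2 * rot w a) *\<^sub>R (\<gamma> a *v \<psi>)"
    if a: "a < n" for a
  proof -
    have "c (j a) (c w \<psi>) = (2 * rot w a) *\<^sub>R \<psi> - c w (c (j a) \<psi>)"
      using c_anti[of "j a" w \<psi>] dot_j_rot[OF a, of w] by (simp add: eq_diff_eq)
    then have "\<gamma> a *v c (j a) (c w \<psi>) = (2 * rot w a) *\<^sub>R (\<gamma> a *v \<psi>) - \<gamma> a *v c w (c (j a) \<psi>)"
      by (simp add: linear_diff[OF gamma_linear] linear_scale[OF gamma_linear])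
    moreover have "\<gamma> a *v c w (c (j a) \<psi>) = (- 2 * w a) *\<^sub>R c (j a) \<psi> - c w (\<gamma> a *v c (j a) \<psi>)"
      using gamma_c[OF a, of w "c (j a) \<psi>"] by (simp add: eq_diff_eq)
    ultimately show ?thesis by simp
  qed
  have "N (c w \<psi>) = (\<Sum>a<n. c w (\<gamma> a *v c (j a) \<psi>) + (2 * w a) *\<^sub>R c (j a) \<psi> + (2 * rot w a) *\<^sub>R (\<gamma> a *v \<psi>))"
    unfolding N_def by (rule sum.cong[OF refl]) (use step in simp)
  also have "\<dots> = c w (N \<psi>) + 2 *\<^sub>R (\<Sum>a<n. w a *\<^sub>R c (j a) \<psi>) + 2 *\<^sub>R c (rot w) \<psi>"
    by (simp add: sum.distrib N_def linear_sum[OF c_linear] scaleR_sum_right c_def[of "rot w"])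
  also have "(\<Sum>a<n. w a *\<^sub>R c (j a) \<psi>) = c (rot w) \<psi>"
    by (simp add: rot_def[abs_def] c_sum_coeff)
  finally show ?thesis by (simp add: scaleR_left_distrib[symmetric] add.assoc)
qed

lemma rot_rot: "a < n \<Longrightarrow> rot (rot w) a = - w a"
proof -
  assume a: "a < n"
  have "rot (rot w) a = (\<Sum>b<n. \<Sum>i<n. w i * (j i b * j b a))"
    by (simp add: rot_def sum_distrib_right mult.assoc)
  also have "\<dots> = (\<Sum>i<n. w i * (\<Sum>b<n. j i b * j b a))"
    by (subst sum.swap) (simp add: sum_distrib_left)
  also have "\<dots> = (\<Sum>i<n. if i = a then - w i else 0)"
    by (rule sum.cong[OF refl]) (use jj a in auto)
  finally show ?thesis using a by simp
qed

lemma dot_rot_rot: "dot (rot w) (rot w') = dot w w'"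
proof -
  have "dot (rot w) (rot w') = (\<Sum>b<n. \<Sum>a<n. w a * j a b * rot w' b)"
    by (simp add: dot_def rot_def[of w] sum_distrib_right)
  also have "\<dots> = (\<Sum>a<n. w a * (\<Sum>b<n. j a b * rot w' b))"
    by (subst sum.swap) (simp add: sum_distrib_left mult.assoc)
  also have "\<dots> = (\<Sum>a<n. w a * w' a)"
    by (rule sum.cong[OF refl]) (use dot_j_rot[of _ "rot w'"] rot_rot in \<open>auto simp: dot_def\<close>)
  finally show ?thesis by (simp add: dot_def)
qed

text \<open>The action on spinors of the skew endomorphism by which the Webster--Tanaka connection
  changes, with \<open>F\<close> the gradient.\<close>

lemma skew_sum:
  assumes B: "\<And>a b. a < n \<Longrightarrow> b < n \<Longrightarrow> B b a = - B a b"
  shows "(\<Sum>b<n. \<Sum>a<b. B a b *\<^sub>R ((\<gamma> a ** \<gamma> b) *v \<psi>)) = (1/2) *\<^sub>R (\<Sum>a<n. \<Sum>b<n. B a b *\<^sub>R (\<gamma> a *v (\<gamma> b *v \<psi>)))"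
proof -
  let ?t = "\<lambda>a b. B a b *\<^sub>R (\<gamma> a *v (\<gamma> b *v \<psi>))"
  \<comment> \<open>Off the diagonal both \<open>B\<close> and the Clifford product change sign
    under exchange of the indices.\<close>
  have sym: "?t a b = ?t b a" if "a < n" "b < n" for a b
  proof (cases "a = b")
    case False
    then have "\<gamma> a *v (\<gamma> b *v \<psi>) = - (\<gamma> b *v (\<gamma> a *v \<psi>))"
      using gamma_anti[OF that] by (simp add: eq_neg_iff_add_eq_0)
    then show ?thesis using B[OF that] by simp
  qed simp
  have diag: "?t a a = 0" if "a < n" for a using B[OF that that] by simp
  have "(\<Sum>b<k. \<Sum>a<k. ?t a b) = 2 *\<^sub>R (\<Sum>b<k. \<Sum>a<b. ?t a b)" if "k \<le> n" for k
    using that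
  proof (induction k)
    case (Suc k)
    have "(\<Sum>b<Suc k. \<Sum>a<Suc k. ?t a b) = (\<Sum>b<k. \<Sum>a<k. ?t a b) + (\<Sum>b<k. ?t k b) + ((\<Sum>a<k. ?t a k) + ?t k k)"
      by (simp add: sum.distrib)
    also have "(\<Sum>b<k. ?t k b) = (\<Sum>a<k. ?t a k)"
      by (rule sum.cong[OF refl], rule sym) (use Suc.prems in auto)
    finally show ?case using Suc diag[of k] by (simp add: scaleR_2 algebra_simps)
  qed simp
  from this[of n] have "(\<Sum>b<n. \<Sum>a<b. ?t a b) = (1/2) *\<^sub>R (\<Sum>b<n. \<Sum>a<n. ?t a b)" by simp
  then show ?thesis by (subst sum.swap[of _ "{..<n}" "{..<n}"]) (simp add: matrix_vector_mul_assoc)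
qed

lemma product_sum: "(\<Sum>a<n. \<Sum>b<n. (w a * w' b) *\<^sub>R (\<gamma> a *v (\<gamma> b *v \<psi>))) = c w (c w' \<psi>)"
  unfolding c_def linear_sum[OF gamma_linear] linear_scale[OF gamma_linear]
  by (simp add: scaleR_sum_right)

text \<open>\<open>B\<close> is the matrix of the change of the connection, with x for X, F for the
  gradient and s for \<delta>(JX). Reordering F \<cdot> x gives a scalar, and so does its rotated
  copy, equal to the first because J is an isometry. The resulting \<open>2 * dot x F\<close>,
  halved in the spinor derivative, is what the derivative of e^f cancels.\<close>

lemma conformal_spin_action:
  defines "B \<equiv> \<lambda>x F s a b. F a * x b - x a * F b + (rot F a * rot x b - rot x a * rot F b) - s * j a b"
  shows "(\<Sum>b<n. \<Sum>a<b. B x F s a b *\<^sub>R ((\<gamma> a ** \<gamma> b) *v \<psi>)) =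
    - (c x (c F \<psi>) + c (rot x) (c (rot F) \<psi>)) - (2 * dot x F) *\<^sub>R \<psi> - (s / 2) *\<^sub>R N \<psi>"
proof -
  have "(\<Sum>b<n. \<Sum>a<b. B x F s a b *\<^sub>R ((\<gamma> a ** \<gamma> b) *v \<psi>)) =
      (1/2) *\<^sub>R (\<Sum>a<n. \<Sum>b<n. B x F s a b *\<^sub>R (\<gamma> a *v (\<gamma> b *v \<psi>)))"
  proof (rule skew_sum)
    fix a b assume "a < n" "b < n"
    then show "B x F s b a = - B x F s a b" using skew[of a b] by (simp add: B_def algebra_simps)
  qed
  also have "(\<Sum>a<n. \<Sum>b<n. B x F s a b *\<^sub>R (\<gamma> a *v (\<gamma> b *v \<psi>))) =
      c F (c x \<psi>) - c x (c F \<psi>) + (c (rot F) (c (rot x) \<psi>) - c (rot x) (c (rot F) \<psi>)) - s *\<^sub>R N \<psi>"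
    unfolding B_def N_double product_sum[symmetric]
    by (simp add: scaleR_left_diff_distrib scaleR_left_distrib sum.distrib sum_subtractf scaleR_sum_right)
  also have "c F (c x \<psi>) = (- 2 * dot x F) *\<^sub>R \<psi> - c x (c F \<psi>)"
    using c_anti[of x F \<psi>] by (simp add: eq_diff_eq add.commute)
  also have "c (rot F) (c (rot x) \<psi>) = (- 2 * dot x F) *\<^sub>R \<psi> - c (rot x) (c (rot F) \<psi>)"
    using c_anti[of "rot x" "rot F" \<psi>] dot_rot_rot[of x F] by (simp add: eq_diff_eq add.commute)
  finally have eq: "(\<Sum>b<n. \<Sum>a<b. B x F s a b *\<^sub>R ((\<gamma> a ** \<gamma> b) *v \<psi>)) = (1/2) *\<^sub>R
      ((- 2 * dot x F) *\<^sub>R \<psi> - c x (c F \<psi>) - c x (c F \<psi>) +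
       ((- 2 * dot x F) *\<^sub>R \<psi> - c (rot x) (c (rot F) \<psi>) - c (rot x) (c (rot F) \<psi>)) - s *\<^sub>R N \<psi>)" .
  show ?thesis
    unfolding eq by (simp add: vec_eq_iff scaleR_complex algebra_simps)
qed

text \<open>The zeroth order term of the Dirac operators \<open>D\<^sub>\<plusminus>\<close>, where \<open>\<zeta> = \<plusminus>i\<close>.\<close>

lemma conformal_dirac_action:
  assumes N: "N \<psi> = \<nu> *s \<psi>"
  shows "(\<Sum>a<n. \<gamma> a *v (\<gamma> a *v c F \<psi> + c (j a) (c (rot F) \<psi>)) - \<zeta> *s c (j a) (\<gamma> a *v c F \<psi> + c (j a) (c (rot F) \<psi>)))
    = (\<zeta> * \<nu> - of_nat n - 4) *s c F \<psi> + (\<nu> + 4 * \<zeta> + of_nat n * \<zeta>) *s c (rot F) \<psi>"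
proof -
  have "(\<Sum>a<n. \<gamma> a *v (\<gamma> a *v c F \<psi> + c (j a) (c (rot F) \<psi>)) - \<zeta> *s c (j a) (\<gamma> a *v c F \<psi> + c (j a) (c (rot F) \<psi>))) =
      (\<Sum>a<n. \<gamma> a *v (\<gamma> a *v c F \<psi>)) + N (c (rot F) \<psi>)
      - \<zeta> *s ((\<Sum>a<n. c (j a) (\<gamma> a *v c F \<psi>)) + (\<Sum>a<n. c (j a) (c (j a) (c (rot F) \<psi>))))"
    unfolding N_def linear_add[OF gamma_linear] linear_add[OF c_linear]
    by (simp add: sum.distrib sum_subtractf vec_eq_iff sum_component sum_distrib_left distrib_left)
  also have "\<dots> = - real n *\<^sub>R c F \<psi> + N (c (rot F) \<psi>) - \<zeta> *s (- N (c F \<psi>) + - real n *\<^sub>R c (rot F) \<psi>)"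
    unfolding gamma_square_sum j_square_sum N_reverse ..
  \<comment> \<open>The commutator yields 4 J(JF) = -4 F.\<close>
  also have "N (c (rot F) \<psi>) = \<nu> *s c (rot F) \<psi> - 4 *\<^sub>R c F \<psi>"
  proof -
    have "c (rot (rot F)) \<psi> = - c F \<psi>"
      using c_cong[of "rot (rot F)" "\<lambda>a. - F a" \<psi>] rot_rot c_minus[of F \<psi>] by simp
    then show ?thesis unfolding N_commutator N c_smult by simp
  qed
  also have "N (c F \<psi>) = \<nu> *s c F \<psi> + 4 *\<^sub>R c (rot F) \<psi>"
    unfolding N_commutator N c_smult ..
  finally show ?thesis
    by (simp add: vec_eq_iff scaleR_complex algebra_simps)
qed

end

section \<open>Spinors\<close>

locale spinc_pherm = density_pherm C E h
  for C :: "('a::{t2_space, second_countable_topology}, 'n::finite) cr_structure" and E :: "('a, 'q) density" and h +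
  fixes \<gamma> :: "nat \<Rightarrow> complex ^ 's ^ 's::finite" and l :: int and S :: "('a, 'p, 'q, 's) spinc"
  assumes mod: "spinor_module m \<gamma>" and spinc: "spinc_structure C \<gamma> E l h S"
begin

lemmas spinc_conj = spinc[unfolded spinc_structure_def Let_def]

lemma spinc_principal: "principal_bundle \<A> (spinc_group m \<gamma>) (**) (mat 1) (pproj S) (pact S) (psec S)"
  using spinc_conj[THEN conjunct1] .

lemma pframe_so: "so_frame C h (pproj S p) (pframe S p)"
  using spinc_conj[THEN conjunct2, THEN conjunct1] by blast

lemma pframe_vf: "spinor_frame C \<gamma> S U s \<Longrightarrow> a < 2 * m \<Longrightarrow> vf_on \<A> U (\<lambda>y. pframe S (s y) a)"
  using spinc_conj[THEN conjunct2, THEN conjunct2, THEN conjunct2, THEN conjunct1] by blast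

lemma pdet_norm: "qproj E q = pproj S p \<Longrightarrow> density_norm C h E l (pdet S p) q = 1"
  using spinc_conj[THEN conjunct2, THEN conjunct2, THEN conjunct2, THEN conjunct2, THEN conjunct1] by blast

lemma pdet_smooth:
  "spinor_frame C \<gamma> S U s \<Longrightarrow> density_section C E U q \<Longrightarrow> smooth_fun \<A> U (\<lambda>y. pdet S (s y) (q y))"
  using spinc_conj[THEN conjunct2, THEN conjunct2, THEN conjunct2, THEN conjunct2, THEN conjunct2,
      THEN conjunct2, THEN conjunct2] by blast

lemma pframe_levi: "a < 2 * m \<Longrightarrow> pframe S p a \<in> H (pproj S p)"
  and pframe_orth: "a < 2 * m \<Longrightarrow> b < 2 * m \<Longrightarrow>
    g (pproj S p) (pframe S p a) (pframe S p b) = (if a = b then 1 else 0)"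
  using pframe_so[of p] unfolding so_frame_def by blast+

definition through :: "'p \<Rightarrow> 'a \<Rightarrow> 'p" where
  "through p = (SOME s. \<exists>U. pproj S p \<in> U \<and> s (pproj S p) = p \<and> spinor_frame C \<gamma> S U s)"

lemma through:
  obtains U where "pproj S p \<in> U" "through p (pproj S p) = p" "spinor_frame C \<gamma> S U (through p)"
proof -
  have "\<exists>s U. pproj S p \<in> U \<and> s (pproj S p) = p \<and> spinor_frame C \<gamma> S U s"
    by (rule spinor_frame_through[OF spinc_principal])
  from someI_ex[OF this] show ?thesis using that unfolding through_def by blast
qed

lemma spinor_frame_proj: "spinor_frame C \<gamma> S U s \<Longrightarrow> y \<in> U \<Longrightarrow> pproj S (s y) = y"
  unfolding spinor_frame_def by (rule local_sectionD(2))

lemma spinor_frame_open: "spinor_frame C \<gamma> S U s \<Longrightarrow> open U"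
  unfolding spinor_frame_def by (rule local_sectionD(1))

lemma pframe_hvf:
  assumes "spinor_frame C \<gamma> S U s" "a < 2 * m"
  shows "hvf_on C U (\<lambda>y. pframe S (s y) a)"
  unfolding hvf_on_def using pframe_vf[OF assms] pframe_levi[OF assms(2)] spinor_frame_proj[OF assms(1)] by metis

lemma pframe_hvf_near:
  assumes "a < 2 * m"
  shows "hvf_near C (pproj S p) (\<lambda>y. pframe S (through p y) a)"
proof -
  obtain U where "pproj S p \<in> U" "spinor_frame C \<gamma> S U (through p)" by (rule through)
  then show ?thesis unfolding hvf_near_def using pframe_hvf[OF _ assms] by blast
qed

lemma spinor_deriv_eq:
  "spinor_deriv C \<gamma> E l h S \<phi> p v = vder v (\<lambda>y. \<phi> (through p y))
     + (1/2) *\<^sub>R (\<Sum>b<2*m. \<Sum>a<b.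
         g (pproj S p) (D (pproj S p) v (\<lambda>y. pframe S (through p y) a)) (pframe S p b)
           *\<^sub>R ((\<gamma> a ** \<gamma> b) *v \<phi> p))
     + (density_logder C h E l (\<lambda>y. pdet S (through p y)) (pproj S p) v / 2) *s \<phi> p"
  by (simp add: spinor_deriv_def Let_def through_def)

lemma spinor_deriv_lin:
  assumes vw: "v \<in> H (pproj S p)" "w \<in> H (pproj S p)"
  shows "spinor_deriv C \<gamma> E l h S \<phi> p (tv_lin a v b w) =
    a *\<^sub>R spinor_deriv C \<gamma> E l h S \<phi> p v + b *\<^sub>R spinor_deriv C \<gamma> E l h S \<phi> p w"
proof -
  let ?x = "pproj S p"
  note t = vw[THEN levi_tangent]
  have vd: "vder (tv_lin a v b w) k = a *\<^sub>R vder v k + b *\<^sub>R vder w k" for k :: "'a \<Rightarrow> complex ^ 's"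
    by (simp add: vder_def vec_eq_iff cder_lin_dir scaleR_complex)
  have G: "g ?x (D ?x (tv_lin a v b w) (\<lambda>y. pframe S (through p y) i)) (pframe S p k) =
      a * g ?x (D ?x v (\<lambda>y. pframe S (through p y) i)) (pframe S p k) +
      b * g ?x (D ?x w (\<lambda>y. pframe S (through p y) i)) (pframe S p k)" if "k < 2*m" "i < k" for i k
  proof -
    have i: "i < 2 * m" using that by simp
    note hv = pframe_hvf_near[OF i, of p]
    show ?thesis
      unfolding D_lin_dir[OF hvf_near_vf[OF hv] t]
      by (rule g_lin_left[OF D_levi[OF t(1) hv] D_levi[OF t(2) hv] pframe_levi[OF that(1)]])
  qed
  have "(\<Sum>k<2*m. \<Sum>i<k. g ?x (D ?x (tv_lin a v b w) (\<lambda>y. pframe S (through p y) i)) (pframe S p k) *\<^sub>R ((\<gamma> i ** \<gamma> k) *v \<phi> p)) =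
    a *\<^sub>R (\<Sum>k<2*m. \<Sum>i<k. g ?x (D ?x v (\<lambda>y. pframe S (through p y) i)) (pframe S p k) *\<^sub>R ((\<gamma> i ** \<gamma> k) *v \<phi> p)) +
    b *\<^sub>R (\<Sum>k<2*m. \<Sum>i<k. g ?x (D ?x w (\<lambda>y. pframe S (through p y) i)) (pframe S p k) *\<^sub>R ((\<gamma> i ** \<gamma> k) *v \<phi> p))"
    unfolding scaleR_sum_right sum.distrib[symmetric]
    by (intro sum.cong refl) (use G in \<open>simp add: scaleR_left_distrib\<close>)
  note sums = this
  show ?thesis
    unfolding spinor_deriv_eq vd sums density_logder_lin[OF t]
    by (simp add: vec_eq_iff scaleR_complex add_divide_distrib algebra_simps)
qed

definition coeff :: "'p \<Rightarrow> 'a tvec \<Rightarrow> nat \<Rightarrow> real" where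
  "coeff p X a = g (pproj S p) X (pframe S p a)"

lemma pframe_expand: "X \<in> H (pproj S p) \<Longrightarrow> X = tv_sum {..<2*m} (coeff p X) (pframe S p)"
  unfolding coeff_def by (rule orthonormal_expand) (use pframe_levi pframe_orth in auto)

lemma coeff_lin:
  "X \<in> H (pproj S p) \<Longrightarrow> Y \<in> H (pproj S p) \<Longrightarrow> a < 2 * m \<Longrightarrow>
    coeff p (tv_lin r X s Y) a = r * coeff p X a + s * coeff p Y a"
  unfolding coeff_def by (rule g_lin_left) (use pframe_levi in auto)

lemma coeff_pframe: "a < 2 * m \<Longrightarrow> b < 2 * m \<Longrightarrow> coeff p (pframe S p a) b = (if a = b then 1 else 0)"
  unfolding coeff_def by (rule pframe_orth)

lemma coeff_parseval:
  assumes "X \<in> H (pproj S p)" "Y \<in> H (pproj S p)"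
  shows "(\<Sum>a<2*m. coeff p X a * coeff p Y a) = g (pproj S p) X Y"
proof -
  have "g (pproj S p) X Y = g (pproj S p) (tv_sum {..<2*m} (coeff p X) (pframe S p)) Y"
    using pframe_expand[OF assms(1)] by simp
  also have "\<dots> = (\<Sum>a<2*m. coeff p X a * g (pproj S p) (pframe S p a) Y)"
    by (rule g_sum_left) (use pframe_levi assms in auto)
  also have "\<dots> = (\<Sum>a<2*m. coeff p X a * coeff p Y a)"
    by (rule sum.cong[OF refl]) (use g_sym[OF assms(2) pframe_levi] in \<open>simp add: coeff_def\<close>)
  finally show ?thesis by simp
qed

abbreviation Jmat :: "'p \<Rightarrow> nat \<Rightarrow> nat \<Rightarrow> real" where
  "Jmat p a \<equiv> coeff p (J (pproj S p) (pframe S p a))"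

lemma Jmat_skew:
  assumes "a < 2 * m" "b < 2 * m"
  shows "Jmat p b a = - Jmat p a b"
  using g_J_skew[OF pframe_levi[OF assms(2), of p] pframe_levi[OF assms(1), of p]]
    g_sym[OF pframe_levi[OF assms(2), of p] J_levi[OF pframe_levi[OF assms(1), of p]]]
  by (simp add: coeff_def)

text \<open>That the matrix of J squares to -1 follows from J being an isometry and its matrix being
  skew.\<close>

lemma clifford: "hermitian_clifford (2 * m) \<gamma> (Jmat p)"
proof
  show "\<gamma> a ** \<gamma> b + \<gamma> b ** \<gamma> a = (if a = b then mat (- 2) else 0)" if "a < 2 * m" "b < 2 * m" for a b
    using mod that unfolding spinor_module_def by blast
  show "Jmat p b a = - Jmat p a b" if "a < 2 * m" "b < 2 * m" for a b
    by (rule Jmat_skew[OF that])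
  fix a c assume ac: "a < 2 * m" "c < 2 * m"
  have "(\<Sum>b<2*m. Jmat p a b * Jmat p b c) = (\<Sum>b<2*m. - (Jmat p a b * Jmat p c b))"
  proof (rule sum.cong[OF refl])
    fix b assume "b \<in> {..<2*m}"
    then show "Jmat p a b * Jmat p b c = - (Jmat p a b * Jmat p c b)" using Jmat_skew[of c b p] ac by simp
  qed
  also have "\<dots> = - g (pproj S p) (J (pproj S p) (pframe S p a)) (J (pproj S p) (pframe S p c))"
    using coeff_parseval[OF J_levi[OF pframe_levi] J_levi[OF pframe_levi]] ac by (simp add: sum_negf)
  also have "\<dots> = (if a = c then -1 else 0)"
    using g_JJ[OF pframe_levi pframe_levi] pframe_orth ac by simp
  finally show "(\<Sum>b<2*m. Jmat p a b * Jmat p b c) = (if a = c then -1 else 0)" .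
qed

lemma clifford_mult_c:
  "clifford_mult C \<gamma> h S p \<psi> X = hermitian_clifford.c (2 * m) \<gamma> (coeff p X) \<psi>"
  by (simp add: clifford_mult_def coeff_def[abs_def] hermitian_clifford.c_cliff[OF clifford refl])

lemma coeff_J:
  assumes "X \<in> H (pproj S p)" "b < 2 * m"
  shows "coeff p (J (pproj S p) X) b = hermitian_clifford.rot (2 * m) (Jmat p) (coeff p X) b"
proof -
  note pb = pframe_levi[OF assms(2), of p]
  have "coeff p (J (pproj S p) X) b = - g (pproj S p) X (J (pproj S p) (pframe S p b))"
    using g_J_skew[OF assms(1) pb] by (simp add: coeff_def)
  also have "\<dots> = (\<Sum>a<2*m. - (coeff p X a * Jmat p b a))"
    using coeff_parseval[OF assms(1) J_levi[OF pb]] by (simp add: sum_negf)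
  also have "\<dots> = (\<Sum>a<2*m. coeff p X a * Jmat p a b)"
  proof (rule sum.cong[OF refl])
    fix a assume "a \<in> {..<2*m}"
    then show "- (coeff p X a * Jmat p b a) = coeff p X a * Jmat p a b" using Jmat_skew[of a b p] assms(2) by simp
  qed
  finally show ?thesis by (simp add: hermitian_clifford.rot_def[OF clifford])
qed

lemma clifford_mult_lin:
  assumes "X \<in> H (pproj S p)" "Y \<in> H (pproj S p)"
  shows "clifford_mult C \<gamma> h S p \<psi> (tv_lin r X s Y) =
    r *\<^sub>R clifford_mult C \<gamma> h S p \<psi> X + s *\<^sub>R clifford_mult C \<gamma> h S p \<psi> Y"
  unfolding clifford_mult_c hermitian_clifford.c_def[OF clifford]
  by (simp add: coeff_lin[OF assms] scaleR_sum_right sum.distrib[symmetric] scaleR_left_distrib)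

lemma clifford_mult_linear: "linear (\<lambda>\<psi>. clifford_mult C \<gamma> h S p \<psi> X)"
  unfolding clifford_mult_c by (rule hermitian_clifford.c_linear[OF clifford])

lemma clifford_mult_smult: "clifford_mult C \<gamma> h S p (z *s \<psi>) X = z *s clifford_mult C \<gamma> h S p \<psi> X"
  unfolding clifford_mult_c by (rule hermitian_clifford.c_smult[OF clifford])

lemma clifford_mult_pframe:
  assumes "a < 2 * m"
  shows "clifford_mult C \<gamma> h S p \<psi> (pframe S p a) = \<gamma> a *v \<psi>"
proof -
  have "clifford_mult C \<gamma> h S p \<psi> (pframe S p a) = (\<Sum>b<2*m. if b = a then \<gamma> b *v \<psi> else 0)"
    unfolding clifford_mult_c hermitian_clifford.c_def[OF clifford]
    by (rule sum.cong[OF refl]) (use coeff_pframe[OF assms] in auto)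
  then show ?thesis using assms by simp
qed

text \<open>The bilinear map v \<cdot> Jw \<cdot> \<psi> is traced over the spinor frame instead of
  the chosen unitary one. It agrees on (e, e) and (Je, Je), since e and Je anticommute; hence the
  factor 1/2.\<close>

lemma Theta_N:
  "Theta_act C \<gamma> h S p \<psi> = (\<i> / 2) *s hermitian_clifford.N (2 * m) \<gamma> (Jmat p) \<psi>"
proof -
  interpret hc: hermitian_clifford "2 * m" \<gamma> "Jmat p" by (rule clifford)
  let ?x = "pproj S p" and ?cl = "clifford_mult C \<gamma> h S p"
  define e where "e = some_unitary_frame C h ?x"
  have e: "unitary_frame C h ?x e" unfolding e_def by (rule some_unitary)
  note el = unitary_levi[OF e]
  define B where "B v w = ?cl (?cl \<psi> (J ?x w)) v" for v w
  have "(\<Sum>a<m. B (e a) (e a) + B (J ?x (e a)) (J ?x (e a))) = (\<Sum>a<2*m. B (pframe S p a) (pframe S p a))"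
  proof (rule trace_unitary[where B = B and s = "pframe S p", OF _ _ pframe_levi pframe_orth e])
    show "B (tv_lin a u b v) w = a *\<^sub>R B u w + b *\<^sub>R B v w" if "u \<in> H ?x" "v \<in> H ?x" "w \<in> H ?x" for a b u v w
      unfolding B_def by (rule clifford_mult_lin[OF that(1,2)])
    show "B w (tv_lin a u b v) = a *\<^sub>R B w u + b *\<^sub>R B w v" if "u \<in> H ?x" "v \<in> H ?x" "w \<in> H ?x" for a b u v w
      unfolding B_def J_lin[OF that(1,2)] clifford_mult_lin[OF J_levi[OF that(1)] J_levi[OF that(2)]]
      by (simp add: linear_add[OF clifford_mult_linear] linear_scale[OF clifford_mult_linear])
  qed
  moreover have "B (J ?x (e a)) (J ?x (e a)) = B (e a) (e a)" if "a < m" for a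
  proof -
    note ea = el[OF that]
    have f1: "?cl (?cl \<psi> (J ?x (J ?x (e a)))) (J ?x (e a)) = - ?cl (?cl \<psi> (e a)) (J ?x (e a))"
      unfolding JJ[OF ea] clifford_mult_lin[OF ea ea] by (simp add: linear_neg[OF clifford_mult_linear])
    have f2: "?cl (?cl \<psi> (e a)) (J ?x (e a)) + ?cl (?cl \<psi> (J ?x (e a))) (e a) = 0"
      using hc.c_anti[of "coeff p (J ?x (e a))" "coeff p (e a)" \<psi>] coeff_parseval[OF J_levi[OF ea] ea]
        g_J_self[OF ea] g_sym[OF ea J_levi[OF ea]]
      by (simp add: clifford_mult_c hc.dot_def)
    show ?thesis unfolding B_def f1 neg_eq_iff_add_eq_0 by (rule f2)
  qed
  moreover have "B (pframe S p a) (pframe S p a) = \<gamma> a *v hc.c (Jmat p a) \<psi>" if "a < 2 * m" for a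
    unfolding B_def using clifford_mult_pframe[OF that] by (simp add: clifford_mult_c)
  ultimately have "(\<Sum>a<m. 2 *\<^sub>R B (e a) (e a)) = hc.N \<psi>"
    by (simp add: hc.N_def scaleR_2)
  from arg_cong[OF this, of "\<lambda>v. (1/2) *\<^sub>R v"]
  have "(\<Sum>a<m. B (e a) (e a)) = (1/2) *\<^sub>R hc.N \<psi>"
    by (simp add: scaleR_sum_right[symmetric])
  then show ?thesis
    unfolding Theta_act_def Let_def e_def[symmetric] B_def
    by (simp add: vec_eq_iff scaleR_complex)
qed

subsection \<open>The Dirac operators in an orthonormal frame\<close>

context
  fixes \<phi> :: "'p \<Rightarrow> complex ^ 's" and p :: 'p
begin

private abbreviation "nab \<equiv> spinor_deriv C \<gamma> E l h S \<phi> p"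
private abbreviation "cl \<equiv> clifford_mult C \<gamma> h S p"

text \<open>Both Dirac operators at once, with \<zeta> = i for D_+ and \<zeta> = -i for D_-.
  \<open>tm a\<close> is one summand written in real vectors: Clifford multiplication by (e -
  \<zeta> Je)/2 after differentiation along (e + \<zeta> Je)/2. The traced map is (v - \<zeta> Jv)
  \<cdot> \<open>nab w\<close>.\<close>

lemma dirac_frame:
  assumes \<zeta>: "\<zeta> * \<zeta> = - 1" and e: "unitary_frame C h (pproj S p) e"
    and tm: "\<And>a. a < m \<Longrightarrow> tm a = (1/2) *\<^sub>R cl ((1/2) *\<^sub>R nab (e a) + (\<zeta> / 2) *s nab (J (pproj S p) (e a))) (e a)
      - (\<zeta> / 2) *s cl ((1/2) *\<^sub>R nab (e a) + (\<zeta> / 2) *s nab (J (pproj S p) (e a))) (J (pproj S p) (e a))"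
  shows "2 *\<^sub>R (\<Sum>a<m. tm a) = (1/2) *\<^sub>R (\<Sum>a<2*m. \<gamma> a *v nab (pframe S p a)
      - \<zeta> *s hermitian_clifford.c (2 * m) \<gamma> (Jmat p a) (nab (pframe S p a)))"
proof -
  let ?x = "pproj S p"
  note el = unitary_levi[OF e]
  define B where "B v w = cl (nab w) v - \<zeta> *s cl (nab w) (J ?x v)" for v w
  have "(\<Sum>a<m. B (e a) (e a) + B (J ?x (e a)) (J ?x (e a))) = (\<Sum>a<2*m. B (pframe S p a) (pframe S p a))"
  proof (rule trace_unitary[where B = B and s = "pframe S p", OF _ _ pframe_levi pframe_orth e])
    show "B (tv_lin a u b v) w = a *\<^sub>R B u w + b *\<^sub>R B v w" if "u \<in> H ?x" "v \<in> H ?x" "w \<in> H ?x" for a b u v w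
      unfolding B_def J_lin[OF that(1,2)] clifford_mult_lin[OF that(1,2)]
        clifford_mult_lin[OF J_levi[OF that(1)] J_levi[OF that(2)]]
      by (simp add: vec_eq_iff scaleR_complex algebra_simps)
    show "B w (tv_lin a u b v) = a *\<^sub>R B w u + b *\<^sub>R B w v" if "u \<in> H ?x" "v \<in> H ?x" "w \<in> H ?x" for a b u v w
      unfolding B_def spinor_deriv_lin[OF that(1,2)]
      by (simp add: linear_add[OF clifford_mult_linear] linear_scale[OF clifford_mult_linear]
          vec_eq_iff scaleR_complex algebra_simps)
  qed
  moreover have "B (e a) (e a) + B (J ?x (e a)) (J ?x (e a)) = 4 *\<^sub>R tm a" if "a < m" for a
  proof -
    note ea = el[OF that]
    have JJe: "cl \<psi> (J ?x (J ?x (e a))) = - cl \<psi> (e a)" for \<psi>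
      unfolding JJ[OF ea] clifford_mult_lin[OF ea ea] by simp
    \<comment> \<open>With \<zeta>^2 = -1 the four terms from e and Je recombine into one product of
      the two halves.\<close>
    have z: "\<zeta> * (\<zeta> * y) = - y" for y using \<zeta> by (simp add: mult.assoc[symmetric])
    show ?thesis
      unfolding tm[OF that] B_def JJe
      by (simp add: linear_add[OF clifford_mult_linear] linear_scale[OF clifford_mult_linear] clifford_mult_smult
          vec_eq_iff scaleR_complex algebra_simps z)
  qed
  moreover have "B (pframe S p a) (pframe S p a) = \<gamma> a *v nab (pframe S p a)
      - \<zeta> *s hermitian_clifford.c (2 * m) \<gamma> (Jmat p a) (nab (pframe S p a))" if "a < 2 * m" for a
    unfolding B_def using clifford_mult_pframe[OF that] by (simp add: clifford_mult_c)
  ultimately have "(\<Sum>a<m. 4 *\<^sub>R tm a) = (\<Sum>a<2*m. \<gamma> a *v nab (pframe S p a)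
      - \<zeta> *s hermitian_clifford.c (2 * m) \<gamma> (Jmat p a) (nab (pframe S p a)))"
    by simp
  from arg_cong[OF this, of "\<lambda>v. (1/2) *\<^sub>R v"]
  show ?thesis by (simp add: scaleR_sum_right[symmetric])
qed

lemma half_tv: "(\<lambda>k. v k / 2) = tv_lin (1/2) v 0 v" "(\<lambda>k. - (v k / 2)) = tv_lin (-1/2) v 0 v" for v :: "'a tvec"
  by (simp_all add: tv_lin_def)

lemma Dplus_frame:
  "Dplus C \<gamma> E l h S \<phi> p = (1/2) *\<^sub>R (\<Sum>a<2*m. \<gamma> a *v nab (pframe S p a)
      - \<i> *s hermitian_clifford.c (2 * m) \<gamma> (Jmat p a) (nab (pframe S p a)))"
  unfolding Dplus_def Let_def
proof (rule dirac_frame[OF _ some_unitary])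
  fix a assume a: "a < m"
  let ?e = "some_unitary_frame C h (pproj S p) a"
  let ?Je = "J (pproj S p) ?e"
  note ea = unitary_levi[OF some_unitary[of "pproj S p"] a]
  show "cext (cl (cext nab (part01 C (pproj S p) ?e)))
        (part10 C (pproj S p) ?e) =
    (1/2) *\<^sub>R cl ((1/2) *\<^sub>R nab ?e +
      (\<i> / 2) *s nab ?Je) ?e
      - (\<i> / 2) *s cl ((1/2) *\<^sub>R nab ?e +
      (\<i> / 2) *s nab ?Je) ?Je"
    unfolding cext_def part01_def part10_def fst_conv snd_conv half_tv
      spinor_deriv_lin[OF ea ea] spinor_deriv_lin[OF J_levi[OF ea] J_levi[OF ea]]
      clifford_mult_lin[OF ea ea] clifford_mult_lin[OF J_levi[OF ea] J_levi[OF ea]]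
    by (simp add: linear_add[OF clifford_mult_linear] linear_scale[OF clifford_mult_linear] clifford_mult_smult
          vec_eq_iff scaleR_complex algebra_simps)
qed simp

lemma Dminus_frame:
  "Dminus C \<gamma> E l h S \<phi> p = (1/2) *\<^sub>R (\<Sum>a<2*m. \<gamma> a *v nab (pframe S p a)
      - (- \<i>) *s hermitian_clifford.c (2 * m) \<gamma> (Jmat p a) (nab (pframe S p a)))"
  unfolding Dminus_def Let_def
proof (rule dirac_frame[OF _ some_unitary])
  fix a assume a: "a < m"
  let ?e = "some_unitary_frame C h (pproj S p) a"
  let ?Je = "J (pproj S p) ?e"
  note ea = unitary_levi[OF some_unitary[of "pproj S p"] a]
  show "cext (cl (cext nab (part10 C (pproj S p) ?e)))
        (part01 C (pproj S p) ?e) =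
    (1/2) *\<^sub>R cl ((1/2) *\<^sub>R nab ?e +
      (- \<i> / 2) *s nab ?Je) ?e
      - (- \<i> / 2) *s cl ((1/2) *\<^sub>R nab ?e +
      (- \<i> / 2) *s nab ?Je) ?Je"
    unfolding cext_def part01_def part10_def fst_conv snd_conv half_tv
      spinor_deriv_lin[OF ea ea] spinor_deriv_lin[OF J_levi[OF ea] J_levi[OF ea]]
      clifford_mult_lin[OF ea ea] clifford_mult_lin[OF J_levi[OF ea] J_levi[OF ea]]
    by (simp add: linear_add[OF clifford_mult_linear] linear_diff[OF clifford_mult_linear] linear_scale[OF clifford_mult_linear] clifford_mult_smult
          vec_eq_iff scaleR_complex algebra_simps)
qed simp

text \<open>The coefficients a and b are 1/(m-l+2) and 1/(m+l+2); the further factor 1/2 comes from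
  the projections of X to the types (0,1) and (1,0).\<close>

lemma twistor_frame:
  assumes X: "X \<in> H (pproj S p)"
  shows "twistor C \<gamma> E l h S \<phi> p X = nab X
    + (1 / (2 * (real m - of_int l + 2))) *\<^sub>R (cl (Dplus C \<gamma> E l h S \<phi> p) X + \<i> *s cl (Dplus C \<gamma> E l h S \<phi> p) (J (pproj S p) X))
    + (1 / (2 * (real m + of_int l + 2))) *\<^sub>R (cl (Dminus C \<gamma> E l h S \<phi> p) X - \<i> *s cl (Dminus C \<gamma> E l h S \<phi> p) (J (pproj S p) X))"
proof -
  have coef: "2 * ((real m - of_int l) / 2 + 1) = real m - of_int l + 2"
    "2 * (real m - (real m - of_int l) / 2 + 1) = real m + of_int l + 2" by (simp_all add: field_simps)
  have half: "r *\<^sub>R ((1/2) *\<^sub>R (v :: complex ^ 's) + \<i> *s ((1/2) *\<^sub>R w)) = (r/2) *\<^sub>R (v + \<i> *s w)"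
    "r *\<^sub>R ((1/2) *\<^sub>R (v :: complex ^ 's) + \<i> *s ((-1/2) *\<^sub>R w)) = (r/2) *\<^sub>R (v - \<i> *s w)" for r v w
    by (simp_all add: vec_eq_iff scaleR_complex algebra_simps)
  show ?thesis
    unfolding twistor_def Let_def cext_def part01_def part10_def fst_conv snd_conv half_tv
      clifford_mult_lin[OF X X] clifford_mult_lin[OF J_levi[OF X] J_levi[OF X]] scaleR_zero_left add_0_right coef half
    by (simp add: mult.commute)
qed

end

end

section \<open>Covariance of the twistor operator\<close>

locale spinc_conformal = density_conformal C E h h' f + P: spinc_pherm C E h \<gamma> l S + Q: spinc_pherm C E h' \<gamma> l S'
  for C :: "('a::{t2_space, second_countable_topology}, 'n::finite) cr_structure" and E :: "('a, 'q) density"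
    and h h' f and \<gamma> :: "nat \<Rightarrow> complex ^ 's ^ 's::finite" and l :: int and S S' :: "('a, 'p, 'q, 's) spinc" +
  fixes \<phi> :: "'p \<Rightarrow> complex ^ 's"
  assumes corr: "corresponding_spinc C E f S S'"
    and field: "spinor_field C \<gamma> S \<phi>"
    and eigen: "Theta_act C \<gamma> h S p (\<phi> p) = of_int l *s \<phi> p"
begin

lemma proj_eq: "pproj S' = pproj S" and act_eq: "pact S' = pact S" and sec_eq: "psec S' = psec S"
  and pframe_eq: "a < 2 * m \<Longrightarrow> pframe S' p a = (\<lambda>k. exp (- f (pproj S p)) * pframe S p a k)"
  and pdet_eq: "\<exists>r>0. \<forall>q. qproj E q = pproj S p \<longrightarrow> pdet S' p q = of_real r * pdet S p q"
  using corr unfolding corresponding_spinc_def by blast+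

lemma frame_eq: "spinor_frame C \<gamma> S' = spinor_frame C \<gamma> S"
  by (simp add: spinor_frame_def[abs_def] proj_eq act_eq sec_eq)

text \<open>The selecting condition is the same for both structures, hence so is the selected
  section; the two spinor derivatives are computed in one and the same frame.\<close>

lemma through_eq: "Q.through p = P.through p"
  by (simp add: P.through_def Q.through_def frame_eq proj_eq)

lemma pframe_tv: "a < 2 * m \<Longrightarrow> pframe S' p a = tv_lin (inverse (u (pproj S p))) (pframe S p a) 0 (pframe S p a)"
  by (simp add: pframe_eq tv_lin_def exp_minus)

text \<open>The correspondence only provides some positive factor; unit length for both norms
  determines it.\<close>

lemma pdet_ratio:
  assumes "qproj E q = pproj S p"
  shows "pdet S' p q = of_real (u (pproj S p) powi (- l)) * pdet S p q" "pdet S p q \<noteq> 0"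
proof -
  obtain r where r: "r > 0" "\<forall>q. qproj E q = pproj S p \<longrightarrow> pdet S' p q = of_real r * pdet S p q"
    using pdet_eq by blast
  have "density_norm C h E l (pdet S p) q = 1" by (rule P.pdet_norm[OF assms])
  moreover have "density_norm C h' E l (pdet S' p) q = 1" by (rule Q.pdet_norm) (simp add: proj_eq assms)
  ultimately show "pdet S' p q = of_real (u (pproj S p) powi (- l)) * pdet S p q" "pdet S p q \<noteq> 0"
    using density_norm_ratio[of l "pdet S p" q "pdet S' p" r] r assms by auto
qed

lemma logder_change:
  assumes "v \<in> H (pproj S p)"
  shows "density_logder C h' E l (\<lambda>y. pdet S' (P.through p y)) (pproj S p) v =
    density_logder C h E l (\<lambda>y. pdet S (P.through p y)) (pproj S p) v
      - \<i> * of_int l * of_real (\<delta> (pproj S p) (J (pproj S p) v))"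
proof -
  let ?x = "pproj S p"
  obtain U where U: "?x \<in> U" "P.through p ?x = p" "spinor_frame C \<gamma> S U (P.through p)" by (rule P.through)
  obtain V where V: "?x \<in> V" "density_section C E V (some_section ?x)" by (rule some_section)
  have W: "open (U \<inter> V)" "?x \<in> U \<inter> V"
    using P.spinor_frame_open[OF U(3)] density_section_open[OF V(2)] U V by auto
  have sU: "spinor_frame C \<gamma> S (U \<inter> V) (P.through p)" by (rule spinor_frame_subset[OF U(3) W(1)]) simp
  have sV: "density_section C E (U \<inter> V) (some_section ?x)" by (rule density_section_subset[OF V(2) W(1)]) simp
  have proj: "qproj E (some_section ?x y) = pproj S (P.through p y)" "pproj S (P.through p y) = y" if "y \<in> U \<inter> V" for y
    using density_section_proj[OF sV that] P.spinor_frame_proj[OF sU that] by auto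
  show ?thesis
  proof (rule density_logder_conformal[OF assms W])
    show "smooth_near \<A> ?x (\<lambda>y. pdet S (P.through p y) (some_section ?x y))"
      by (rule smooth_nearI[OF P.pdet_smooth[OF sU sV] W(2)])
    show "pdet S (P.through p ?x) (some_section ?x ?x) \<noteq> 0"
      by (rule pdet_ratio(2)[OF proj(1)[OF W(2)]])
    show "pdet S' (P.through p y) (some_section ?x y) = of_real (u y powi (- l)) * pdet S (P.through p y) (some_section ?x y)"
      if "y \<in> U \<inter> V" for y
      using pdet_ratio(1)[OF proj(1)[OF that]] proj(2)[OF that] by simp
  qed
qed

text \<open>The new frame is u^(-1) s. The derivative of u^(-1) contributes a multiple of s_a, which
  is orthogonal to s_b because a and b differ; the two factors u^(-1) cancel the u^2 of the
  metric.\<close>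

lemma christoffel_change:
  assumes v: "v \<in> H (pproj S p)" and ab: "a < 2 * m" "b < 2 * m" "a \<noteq> b"
  shows "Q.g (pproj S p) (Q.D (pproj S p) v (\<lambda>y. pframe S' (P.through p y) a)) (pframe S' p b) =
    P.g (pproj S p) (P.D (pproj S p) v (\<lambda>y. pframe S (P.through p y) a)) (pframe S p b)
      + diff_form (pproj S p) v (pframe S p a) (pframe S p b)"
proof -
  let ?x = "pproj S p" and ?Y = "\<lambda>y. pframe S (P.through p y) a"
  note vt = levi_tangent[OF v]
  obtain U where U: "?x \<in> U" "P.through p ?x = p" "spinor_frame C \<gamma> S U (P.through p)" by (rule P.through)
  have Y: "hvf_near C ?x ?Y" by (rule P.pframe_hvf_near[OF ab(1)])
  note pa = P.pframe_levi[OF ab(1), of p] and pb = P.pframe_levi[OF ab(2), of p]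
  have ui: "smooth_near \<A> ?x (\<lambda>y. inverse (u y))" by (rule smooth_near_inverse[OF u_near]) simp
  have "Q.D ?x v (\<lambda>y. pframe S' (P.through p y) a) = Q.D ?x v (\<lambda>y k. inverse (u y) * ?Y y k)"
  proof (rule Q.D_local[symmetric, OF _ vt P.spinor_frame_open[OF U(3)] U(1)])
    show "vf_near \<A> ?x (\<lambda>y k. inverse (u y) * ?Y y k)" by (rule vf_near_scale[OF hvf_near_vf[OF Y] ui])
    show "(\<lambda>k. inverse (u y) * ?Y y k) = pframe S' (P.through p y) a" if "y \<in> U" for y
      using P.spinor_frame_proj[OF U(3) that] by (simp add: pframe_eq[OF ab(1)] exp_minus)
  qed
  also have "\<dots> = tv_lin (v (\<lambda>y. inverse (u y))) (?Y ?x) (inverse (u ?x)) (Q.D ?x v ?Y)"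
    by (rule Q.D_scale[OF hvf_near_vf[OF Y] ui vt])
  finally have D: "Q.D ?x v (\<lambda>y. pframe S' (P.through p y) a) =
      tv_lin (v (\<lambda>y. inverse (u y))) (pframe S p a) (inverse (u ?x)) (Q.D ?x v ?Y)" by (simp add: U(2))
  note QD = Q.D_levi[OF vt Y]
  have "Q.g ?x (Q.D ?x v (\<lambda>y. pframe S' (P.through p y) a)) (pframe S' p b) =
      (u ?x * u ?x) * P.g ?x (tv_lin (v (\<lambda>y. inverse (u y))) (pframe S p a) (inverse (u ?x)) (Q.D ?x v ?Y))
        (tv_lin (inverse (u ?x)) (pframe S p b) 0 (pframe S p b))"
    unfolding D pframe_tv[OF ab(2)] by (rule g'[OF levi_lin[OF pa QD] levi_lin[OF pb pb]])
  also have "\<dots> = P.g ?x (Q.D ?x v ?Y) (pframe S p b)"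
    unfolding P.g_lin_right[OF pb pb levi_lin[OF pa QD]] P.g_lin_left[OF pa QD pb]
    using P.pframe_orth[OF ab(1,2), of p] ab(3) by (simp add: field_simps)
  also have "\<dots> = P.g ?x (P.D ?x v ?Y) (pframe S p b) + diff_form ?x v (?Y ?x) (pframe S p b)"
    by (rule conn_diff[OF v Y pb])
  finally show ?thesis by (simp add: U(2))
qed

text \<open>The frame coefficients g(G, s_a) of the gradient.\<close>

definition grad :: "'p \<Rightarrow> nat \<Rightarrow> real" where "grad p a = \<delta> (pproj S p) (pframe S p a)"

context
  fixes p :: 'p
begin

interpretation hc: hermitian_clifford "2 * m" \<gamma> "P.Jmat p" by (rule P.clifford)

private abbreviation "x \<equiv> pproj S p"
private abbreviation "F \<equiv> grad p"
private abbreviation "nab \<equiv> spinor_deriv C \<gamma> E l h S \<phi> p"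
private abbreviation "nab' \<equiv> spinor_deriv C \<gamma> E l h' S' (\<lambda>p. u (pproj S p) *\<^sub>R \<phi> p) p"

lemma \<delta>_coeff:
  assumes "X \<in> H x"
  shows "\<delta> x X = (\<Sum>a<2*m. P.coeff p X a * F a)"
proof -
  have "X u = (\<Sum>a<2*m. P.coeff p X a * pframe S p a u)"
    using fun_cong[OF P.pframe_expand[OF assms], of u] by (simp add: tv_sum_def)
  then show ?thesis by (simp add: \<delta>_def grad_def sum_divide_distrib)
qed

lemma rot_grad:
  assumes "a < 2 * m"
  shows "hc.rot F a = - \<delta> x (J x (pframe S p a))"
proof -
  have "\<delta> x (J x (pframe S p a)) = hc.dot (P.Jmat p a) F"
    using \<delta>_coeff[OF J_levi[OF P.pframe_levi[OF assms]]] by (simp add: hc.dot_def)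
  then show ?thesis using hc.dot_j_rot[OF assms, of F] by simp
qed

text \<open>Brings the change of the connection into the shape required by
  \<open>conformal_spin_action\<close>. The term \<delta>(X) g(s_a, s_b) drops out for distinct
  indices.\<close>

lemma diff_form_coeff:
  assumes X: "X \<in> H x" and ab: "a < 2 * m" "b < 2 * m" "a \<noteq> b"
  shows "diff_form x X (pframe S p a) (pframe S p b) =
    F a * P.coeff p X b - P.coeff p X a * F b
    + (hc.rot F a * hc.rot (P.coeff p X) b - hc.rot (P.coeff p X) a * hc.rot F b) - \<delta> x (J x X) * P.Jmat p a b"
  unfolding diff_form_def rot_grad[OF ab(1)] rot_grad[OF ab(2)] P.coeff_J[OF X ab(1), symmetric]
    P.coeff_J[OF X ab(2), symmetric]
  using P.pframe_orth[OF ab(1,2), of p] ab(3) by (simp add: grad_def P.coeff_def algebra_simps)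

lemma N_eigen: "hc.N (\<phi> p) = (- 2 * \<i> * of_int l) *s \<phi> p"
proof -
  have "(\<i> / 2) *s hc.N (\<phi> p) = of_int l *s \<phi> p" using eigen[of p] P.Theta_N[of p "\<phi> p"] by simp
  then have "(- 2 * \<i>) *s ((\<i> / 2) *s hc.N (\<phi> p)) = (- 2 * \<i>) *s (of_int l *s \<phi> p)" by simp
  then show ?thesis by (simp add: vector_smult_assoc)
qed

text \<open>The term from the change of the density connection cancels against the one of the eigenvalue
  of \<open>\<Theta>\<close>, because the weight of the structure equals this eigenvalue.\<close>

lemma spinor_deriv_conformal:
  assumes X: "X \<in> H x"
  shows "nab' X =
    u x *\<^sub>R (nab X
      - (1/2) *\<^sub>R (hc.c (P.coeff p X) (hc.c F (\<phi> p)) + hc.c (hc.rot (P.coeff p X)) (hc.c (hc.rot F) (\<phi> p))))"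
proof -
  note Xt = levi_tangent[OF X]
  let ?s = "P.through p"
  obtain U where U: "x \<in> U" "?s x = p" "spinor_frame C \<gamma> S U ?s" by (rule P.through)
  have sm: "smooth_near \<A> x (\<lambda>y. \<phi> (?s y))"
  proof (rule smooth_nearI[OF _ U(1)])
    show "smooth_fun \<A> U (\<lambda>y. \<phi> (?s y))" using field U(3) unfolding spinor_field_def by blast
  qed
  have comp: "smooth_near \<A> x (\<lambda>y. \<phi> (?s y) $ i)" for i
    by (rule smooth_near_linear[OF bounded_linear_vec_nth sm])
  have "vder X (\<lambda>y. u (pproj S (?s y)) *\<^sub>R \<phi> (?s y)) = u x *\<^sub>R vder X (\<lambda>y. \<phi> (?s y)) + X u *\<^sub>R \<phi> (?s x)"
  proof -
    have "cder X (\<lambda>y. (u (pproj S (?s y)) *\<^sub>R \<phi> (?s y)) $ i) = of_real (u x) * cder X (\<lambda>y. \<phi> (?s y) $ i) + of_real (X u) * \<phi> (?s x) $ i" for i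
    proof -
      have "cder X (\<lambda>y. (u (pproj S (?s y)) *\<^sub>R \<phi> (?s y)) $ i) = cder X (\<lambda>y. of_real (u y) * \<phi> (?s y) $ i)"
        by (rule cder_cong_on[OF Xt P.spinor_frame_open[OF U(3)] U(1)])
          (use P.spinor_frame_proj[OF U(3)] in \<open>simp add: scaleR_complex\<close>)
      then show ?thesis using cder_mult_real[OF Xt u_near comp] by simp
    qed
    then show ?thesis by (simp add: vder_def vec_eq_iff scaleR_complex)
  qed
  \<comment> \<open>The summand \<delta>(X) \<phi> comes from differentiating e^f; it meets the
    opposite scalar in the spin action.\<close>
  then have vd: "vder X (\<lambda>y. u (pproj S (?s y)) *\<^sub>R \<phi> (?s y)) = u x *\<^sub>R (vder X (\<lambda>y. \<phi> (?s y)) + \<delta> x X *\<^sub>R \<phi> p)"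
    by (simp add: tv_u[of X x] U(2) scaleR_add_right)
  define B where "B a b = F a * P.coeff p X b - P.coeff p X a * F b
    + (hc.rot F a * hc.rot (P.coeff p X) b - hc.rot (P.coeff p X) a * hc.rot F b) - \<delta> x (J x X) * P.Jmat p a b" for a b
  let ?G = "\<lambda>a b. P.g x (P.D x X (\<lambda>y. pframe S (?s y) a)) (pframe S p b)"
  have "(\<Sum>b<2*m. \<Sum>a<b. Q.g x (Q.D x X (\<lambda>y. pframe S' (?s y) a)) (pframe S' p b) *\<^sub>R ((\<gamma> a ** \<gamma> b) *v (u x *\<^sub>R \<phi> p))) =
      (\<Sum>b<2*m. \<Sum>a<b. u x *\<^sub>R (?G a b *\<^sub>R ((\<gamma> a ** \<gamma> b) *v \<phi> p) + B a b *\<^sub>R ((\<gamma> a ** \<gamma> b) *v \<phi> p)))"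
  proof (intro sum.cong refl)
    fix b a assume "b \<in> {..<2*m}" "a \<in> {..<b}"
    then have ab: "a < 2*m" "b < 2*m" "a \<noteq> b" by auto
    have "(\<gamma> a ** \<gamma> b) *v (u x *\<^sub>R \<phi> p) = u x *\<^sub>R ((\<gamma> a ** \<gamma> b) *v \<phi> p)"
      by (simp add: scaleR_eq_smult vector_scalar_commute)
    then show "Q.g x (Q.D x X (\<lambda>y. pframe S' (?s y) a)) (pframe S' p b) *\<^sub>R ((\<gamma> a ** \<gamma> b) *v (u x *\<^sub>R \<phi> p)) =
        u x *\<^sub>R (?G a b *\<^sub>R ((\<gamma> a ** \<gamma> b) *v \<phi> p) + B a b *\<^sub>R ((\<gamma> a ** \<gamma> b) *v \<phi> p))"
      unfolding christoffel_change[OF X ab] diff_form_coeff[OF X ab] B_def[symmetric]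
      by (simp add: scaleR_left_distrib scaleR_add_right algebra_simps)
  qed
  also have "\<dots> = u x *\<^sub>R ((\<Sum>b<2*m. \<Sum>a<b. ?G a b *\<^sub>R ((\<gamma> a ** \<gamma> b) *v \<phi> p)) +
      (\<Sum>b<2*m. \<Sum>a<b. B a b *\<^sub>R ((\<gamma> a ** \<gamma> b) *v \<phi> p)))"
    by (simp only: scaleR_sum_right[symmetric] sum.distrib)
  also have "(\<Sum>b<2*m. \<Sum>a<b. B a b *\<^sub>R ((\<gamma> a ** \<gamma> b) *v \<phi> p)) =
      - (hc.c (P.coeff p X) (hc.c F (\<phi> p)) + hc.c (hc.rot (P.coeff p X)) (hc.c (hc.rot F) (\<phi> p)))
      - (2 * \<delta> x X) *\<^sub>R \<phi> p - (\<delta> x (J x X) / 2) *\<^sub>R ((- 2 * \<i> * of_int l) *s \<phi> p)"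
    unfolding B_def hc.conformal_spin_action N_eigen using \<delta>_coeff[OF X] by (simp add: hc.dot_def)
  finally have spin: "(\<Sum>b<2*m. \<Sum>a<b. Q.g x (Q.D x X (\<lambda>y. pframe S' (?s y) a)) (pframe S' p b) *\<^sub>R ((\<gamma> a ** \<gamma> b) *v (u x *\<^sub>R \<phi> p))) =
    u x *\<^sub>R ((\<Sum>b<2*m. \<Sum>a<b. ?G a b *\<^sub>R ((\<gamma> a ** \<gamma> b) *v \<phi> p)) +
      (- (hc.c (P.coeff p X) (hc.c F (\<phi> p)) + hc.c (hc.rot (P.coeff p X)) (hc.c (hc.rot F) (\<phi> p)))
      - (2 * \<delta> x X) *\<^sub>R \<phi> p - (\<delta> x (J x X) / 2) *\<^sub>R ((- 2 * \<i> * of_int l) *s \<phi> p)))" .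
  show ?thesis
    unfolding Q.spinor_deriv_eq P.spinor_deriv_eq proj_eq through_eq vd spin logder_change[OF X]
    by (simp add: vec_eq_iff scaleR_complex diff_divide_distrib algebra_simps)
qed

lemma coeff_conformal:
  assumes "X \<in> H x" "a < 2 * m"
  shows "Q.coeff p X a = u x * P.coeff p X a"
proof -
  note pa = P.pframe_levi[OF assms(2), of p]
  show ?thesis
    unfolding Q.coeff_def P.coeff_def proj_eq pframe_tv[OF assms(2)] g'[OF assms(1) levi_lin[OF pa pa]]
      P.g_lin_right[OF pa pa assms(1)] by simp
qed

text \<open>The metric contributes u^2 and each of the two frame vectors u^(-1), so the matrix of J
  is unchanged.\<close>

lemma Jmat_conformal:
  assumes "a < 2 * m" "b < 2 * m"
  shows "Q.Jmat p a b = P.Jmat p a b"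
proof -
  note pa = P.pframe_levi[OF assms(1), of p]
  have "Q.Jmat p a b = u x * P.coeff p (J x (pframe S' p a)) b"
    using coeff_conformal[OF J_levi[OF Q.pframe_levi[OF assms(1), of p, unfolded proj_eq]] assms(2)] by (simp add: proj_eq)
  also have "J x (pframe S' p a) = tv_lin (inverse (u x)) (J x (pframe S p a)) 0 (J x (pframe S p a))"
    unfolding pframe_tv[OF assms(1)] by (rule J_lin[OF pa pa])
  finally show ?thesis
    unfolding P.coeff_lin[OF J_levi[OF pa] J_levi[OF pa] assms(2)] by simp
qed

lemma clifford_mult_conformal:
  assumes "X \<in> H x"
  shows "clifford_mult C \<gamma> h' S' p \<psi> X = u x *\<^sub>R clifford_mult C \<gamma> h S p \<psi> X"
  unfolding Q.clifford_mult_c P.clifford_mult_c hc.c_scale[symmetric]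
  by (rule hc.c_cong) (rule coeff_conformal[OF assms])

text \<open>The factor u in front of the new derivative cancels the u^(-1) of the new frame vectors,
  so the Dirac sums change only by a zeroth order term. It is evaluated with \<nu> = -2il and n =
  2m.\<close>

lemma dirac_conformal:
  "(\<Sum>a<2*m. \<gamma> a *v nab' (pframe S' p a)
      - \<zeta> *s hc.c (Q.Jmat p a) (nab' (pframe S' p a))) =
   (\<Sum>a<2*m. \<gamma> a *v nab (pframe S p a)
      - \<zeta> *s hc.c (P.Jmat p a) (nab (pframe S p a)))
   - (1/2) *\<^sub>R ((\<zeta> * (- 2 * \<i> * of_int l) - of_nat (2 * m) - 4) *s hc.c F (\<phi> p)
      + (- 2 * \<i> * of_int l + 4 * \<zeta> + of_nat (2 * m) * \<zeta>) *s hc.c (hc.rot F) (\<phi> p))"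
proof -
  let ?K = "\<lambda>a. \<gamma> a *v hc.c F (\<phi> p) + hc.c (P.Jmat p a) (hc.c (hc.rot F) (\<phi> p))"
  have nab: "nab' (pframe S' p a) =
      nab (pframe S p a) - (1/2) *\<^sub>R ?K a" if a: "a < 2 * m" for a
  proof -
    note pa = P.pframe_levi[OF a, of p]
    have 1: "hc.c (P.coeff p (pframe S p a)) \<psi> = \<gamma> a *v \<psi>" for \<psi>
      using P.clifford_mult_pframe[OF a, of p \<psi>] by (simp add: P.clifford_mult_c)
    have 2: "hc.c (hc.rot (P.coeff p (pframe S p a))) \<psi> = hc.c (P.Jmat p a) \<psi>" for \<psi>
      by (rule hc.c_cong) (use P.coeff_J[OF pa] in simp)
    show ?thesis
      unfolding pframe_tv[OF a] Q.spinor_deriv_lin[OF pa[folded proj_eq] pa[folded proj_eq]]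
        spinor_deriv_conformal[OF pa] 1 2 by simp
  qed
  have J: "hc.c (Q.Jmat p a) \<psi> = hc.c (P.Jmat p a) \<psi>" if "a < 2 * m" for a \<psi>
    by (rule hc.c_cong) (rule Jmat_conformal[OF that])
  have "(\<Sum>a<2*m. \<gamma> a *v nab' (pframe S' p a)
      - \<zeta> *s hc.c (Q.Jmat p a) (nab' (pframe S' p a))) =
    (\<Sum>a<2*m. (\<gamma> a *v nab (pframe S p a)
      - \<zeta> *s hc.c (P.Jmat p a) (nab (pframe S p a)))
      - (1/2) *\<^sub>R (\<gamma> a *v ?K a - \<zeta> *s hc.c (P.Jmat p a) (?K a)))"
  proof (rule sum.cong[OF refl])
    fix a assume "a \<in> {..<2*m}"
    then have a: "a < 2 * m" by simp
    show "\<gamma> a *v nab' (pframe S' p a)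
      - \<zeta> *s hc.c (Q.Jmat p a) (nab' (pframe S' p a)) =
      (\<gamma> a *v nab (pframe S p a)
      - \<zeta> *s hc.c (P.Jmat p a) (nab (pframe S p a)))
      - (1/2) *\<^sub>R (\<gamma> a *v ?K a - \<zeta> *s hc.c (P.Jmat p a) (?K a))"
      unfolding nab[OF a] J[OF a] linear_diff[OF hc.gamma_linear] linear_diff[OF hc.c_linear]
        linear_scale[OF hc.gamma_linear] linear_scale[OF hc.c_linear]
      by (simp add: vec_eq_iff scaleR_complex algebra_simps)
  qed
  also have "\<dots> = (\<Sum>a<2*m. \<gamma> a *v nab (pframe S p a)
      - \<zeta> *s hc.c (P.Jmat p a) (nab (pframe S p a)))
      - (1/2) *\<^sub>R (\<Sum>a<2*m. \<gamma> a *v ?K a - \<zeta> *s hc.c (P.Jmat p a) (?K a))"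
    by (subst sum_subtractf) (simp only: scaleR_sum_right)
  finally show ?thesis
    unfolding hc.conformal_dirac_action[OF N_eigen] .
qed

lemma twistor_conformal:
  assumes X: "X \<in> H x" and l: "- int m \<le> l" "l \<le> int m"
  shows "twistor C \<gamma> E l h' S' (\<lambda>p. u (pproj S p) *\<^sub>R \<phi> p) p X = u x *\<^sub>R twistor C \<gamma> E l h S \<phi> p X"
proof -
  note X' = X[folded proj_eq]
  define dp where "dp = Dplus C \<gamma> E l h S \<phi> p"
  define dm where "dm = Dminus C \<gamma> E l h S \<phi> p"
  define A where "A = hc.c F (\<phi> p)"
  define A' where "A' = hc.c (hc.rot F) (\<phi> p)"
  \<comment> \<open>The range of l makes both numbers at least 2; they are the denominators in the
    twistor operator.\<close>
  have rp: "real m - of_int l + 2 \<noteq> 0" and rm: "real m + of_int l + 2 \<noteq> 0"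
    using l by linarith+
  \<comment> \<open>For \<zeta> = i the two coefficients are -2 (m-l+2) and 2i (m-l+2). The factors
    -1/2 of the correction and 1/2 of D_+ turn them into 1/2 (m-l+2) (A - iA').\<close>
  have dp': "Dplus C \<gamma> E l h' S' (\<lambda>p. u (pproj S p) *\<^sub>R \<phi> p) p = dp + (1/2) *\<^sub>R ((real m - of_int l + 2) *\<^sub>R (A - \<i> *s A'))"
    unfolding Q.Dplus_frame dirac_conformal dp_def P.Dplus_frame A_def[symmetric] A'_def[symmetric]
    by (simp add: vec_eq_iff scaleR_complex algebra_simps)
  \<comment> \<open>For \<zeta> = -i the coefficients are -2 (m+l+2) and -2i (m+l+2).\<close>
  have dm': "Dminus C \<gamma> E l h' S' (\<lambda>p. u (pproj S p) *\<^sub>R \<phi> p) p = dm + (1/2) *\<^sub>R ((real m + of_int l + 2) *\<^sub>R (A + \<i> *s A'))"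
    unfolding Q.Dminus_frame dirac_conformal dm_def P.Dminus_frame A_def[symmetric] A'_def[symmetric]
    by (simp add: vec_eq_iff scaleR_complex algebra_simps)
  let ?c = "\<lambda>\<psi>. hc.c (P.coeff p X) \<psi>" and ?c' = "\<lambda>\<psi>. hc.c (hc.rot (P.coeff p X)) \<psi>"
  have cl: "clifford_mult C \<gamma> h S p \<psi> X = ?c \<psi>" "clifford_mult C \<gamma> h S p \<psi> (J x X) = ?c' \<psi>" for \<psi>
    unfolding P.clifford_mult_c by (simp, rule hc.c_cong, rule P.coeff_J[OF X])
  have cl': "clifford_mult C \<gamma> h' S' p \<psi> X = u x *\<^sub>R ?c \<psi>" "clifford_mult C \<gamma> h' S' p \<psi> (J x X) = u x *\<^sub>R ?c' \<psi>" for \<psi>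
    unfolding clifford_mult_conformal[OF X] clifford_mult_conformal[OF J_levi[OF X]] cl by simp_all
  have lin: "?c (\<psi> + r *\<^sub>R (s *\<^sub>R (\<xi> + \<i> *s \<omega>))) = ?c \<psi> + r *\<^sub>R (s *\<^sub>R (?c \<xi> + \<i> *s ?c \<omega>))"
    "?c (\<psi> + r *\<^sub>R (s *\<^sub>R (\<xi> - \<i> *s \<omega>))) = ?c \<psi> + r *\<^sub>R (s *\<^sub>R (?c \<xi> - \<i> *s ?c \<omega>))"
    "?c' (\<psi> + r *\<^sub>R (s *\<^sub>R (\<xi> + \<i> *s \<omega>))) = ?c' \<psi> + r *\<^sub>R (s *\<^sub>R (?c' \<xi> + \<i> *s ?c' \<omega>))"
    "?c' (\<psi> + r *\<^sub>R (s *\<^sub>R (\<xi> - \<i> *s \<omega>))) = ?c' \<psi> + r *\<^sub>R (s *\<^sub>R (?c' \<xi> - \<i> *s ?c' \<omega>))" for \<psi> r s \<xi> \<omega>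
    by (simp_all add: linear_add[OF hc.c_linear] linear_diff[OF hc.c_linear] linear_scale[OF hc.c_linear] hc.c_smult)
  \<comment> \<open>The twistor coefficient 1/(2R) meets the factor R/2 of the zeroth order term,
    which leaves 1/4 whatever the weight is.\<close>
  have cancel: "(1 / (2 * R)) *\<^sub>R (r *\<^sub>R (\<psi> + (1/2) *\<^sub>R (R *\<^sub>R \<xi>)) + \<i> *s (r *\<^sub>R (\<omega> + (1/2) *\<^sub>R (R *\<^sub>R \<kappa>)))) =
      r *\<^sub>R ((1 / (2 * R)) *\<^sub>R (\<psi> + \<i> *s \<omega>) + (1/4) *\<^sub>R (\<xi> + \<i> *s \<kappa>))"
    "(1 / (2 * R)) *\<^sub>R (r *\<^sub>R (\<psi> + (1/2) *\<^sub>R (R *\<^sub>R \<xi>)) - \<i> *s (r *\<^sub>R (\<omega> + (1/2) *\<^sub>R (R *\<^sub>R \<kappa>)))) =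
      r *\<^sub>R ((1 / (2 * R)) *\<^sub>R (\<psi> - \<i> *s \<omega>) + (1/4) *\<^sub>R (\<xi> - \<i> *s \<kappa>))"
    if "R \<noteq> 0" for R r :: real and \<psi> \<xi> \<omega> \<kappa> :: "complex ^ 's"
    using that by (simp_all add: vec_eq_iff scaleR_complex field_simps)
  \<comment> \<open>(X + iJX) \<cdot> (A - iA') + (X - iJX) \<cdot> (A + iA') = 2 (X \<cdot> A + JX
    \<cdot> A'), so the two quarters together cancel the term with -1/2 in the spinor
    derivative.\<close>
  show ?thesis
    unfolding Q.twistor_frame[OF X'] P.twistor_frame[OF X] proj_eq cl cl' dp' dm' dp_def[symmetric] dm_def[symmetric]
      spinor_deriv_conformal[OF X] lin cancel[OF rp] cancel[OF rm] A_def[symmetric] A'_def[symmetric]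
    by (simp add: vec_eq_iff scaleR_complex algebra_simps)
qed

end

end

theorem mainTheorem2:
  fixes C :: "('a::{t2_space, second_countable_topology}, 'n::finite) cr_structure"
    and h h' :: "'a pherm"
    and E :: "('a, 'q) density"
    and \<gamma> :: "nat \<Rightarrow> complex ^ 's ^ 's::finite"
    and S S' :: "('a, 'p, 'q, 's) spinc"
    and l :: int
    and f :: "'a \<Rightarrow> real"
    and \<phi> :: "'p \<Rightarrow> complex ^ 's"
  assumes "strictly_pseudoconvex_cr C" and "crdim C \<ge> 1"
    and "l \<in> {int (crdim C) - 2 * int q | q. q \<le> crdim C}"
    and "density_bundle C E" and "spinor_module (crdim C) \<gamma>"
    and "pseudo_hermitian C h" and "spinc_structure C \<gamma> E l h S"
    and "smooth_fun (charts C) UNIV f"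
    and "pseudo_hermitian C h'" and "conformal_change C f h h'"
    and "spinc_structure C \<gamma> E l h' S'" and "corresponding_spinc C E f S S'"
    and "spinor_field C \<gamma> S \<phi>" and "\<forall>p. Theta_act C \<gamma> h S p (\<phi> p) = of_int l *s \<phi> p"
  shows "\<forall>p. \<forall>X\<in>levi C (pproj S p).
    twistor C \<gamma> E l h' S' (\<lambda>p. exp (f (pproj S p)) *\<^sub>R \<phi> p) p X
      = exp (f (pproj S p)) *\<^sub>R twistor C \<gamma> E l h S \<phi> p X"
proof (intro allI ballI)
  fix p X
  assume X: "X \<in> levi C (pproj S p)"
  interpret spinc_conformal C E h h' f \<gamma> l S S' \<phi>
    by unfold_locales (use assms in auto)
  have "- int (crdim C) \<le> l" "l \<le> int (crdim C)"
    using assms(3) by auto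
  with X show "twistor C \<gamma> E l h' S' (\<lambda>p. exp (f (pproj S p)) *\<^sub>R \<phi> p) p X
      = exp (f (pproj S p)) *\<^sub>R twistor C \<gamma> E l h S \<phi> p X"
    by (rule twistor_conformal)
qed

end
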